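(* Let $k$ be a field, $n\ge2$, and let $\Lambda$ be the exterior algebra over $k$ on $n$ generators. Then for all $m\ge 0$, $$\dim_k HH_m(\Lambda)=\begin{cases}2^n\binom{n+m-1}{n-1},&\text{if }\operatorname{char}k=2;\\ 2^{n-1}+1,&\text{if }m=0\text{ and }\operatorname{char}k\ne2;\\ 2^{n-1}\binom{n+m-1}{n-1},&\text{if }m\ge1\text{ and }\operatorname{char}k\neq2.\end{cases}$$
   Context: The exterior algebra is the ungraded associative $k$-algebra $\Lambda=k\langle x_1,\dots,x_n\rangle/(x_i^2\ (1\le i\le n),\ x_ix_j+x_jx_i\ (1\le i<j\le n))$. Hochschild homology is the usual (ungraded, no super signs) one: $HH_m(\Lambda)=\operatorname{Tor}_m^{\Lambda^e}(\Lambda,\Lambda)$ with $\Lambda^e=\Lambda\otimes_k\Lambda^{op}$. *)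

theory Defs
  imports "HOL-Algebra.QuotRing" "Jordan_Normal_Form.Missing_VectorSpace"
begin

section \<open>Conventions\<close>

text \<open>
  All objects are records of type \<open>('r, 'm) module\<close>, which carries a ring structure together with
  a scalar multiplication. An associative \<open>K\<close>-algebra uses all of its fields. For a mere module
  the fields \<open>mult\<close> and \<open>one\<close> are irrelevant. The library locale \<open>module\<close> requires
  a commutative base ring, so left modules over arbitrary rings are introduced here. A right
  \<open>R\<close>-module is a record whose scalar multiplication \<open>r \<odot> x\<close> stands for \<open>x \<cdot> r\<close>.
\<close>

definition characteristic :: "('k, 'z) ring_scheme \<Rightarrow> nat" where
  "characteristic K =
     (if \<exists>p::nat. 0 < p \<and> [p] \<cdot>\<^bsub>K\<^esub> \<one>\<^bsub>K\<^esub> = \<zero>\<^bsub>K\<^esub>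
      then LEAST p::nat. 0 < p \<and> [p] \<cdot>\<^bsub>K\<^esub> \<one>\<^bsub>K\<^esub> = \<zero>\<^bsub>K\<^esub> else 0)"


section \<open>Free modules, monoid algebras and quotients\<close>

definition basis_elt :: "('r, 'z) ring_scheme \<Rightarrow> 's \<Rightarrow> 's \<Rightarrow> 'r" where
  "basis_elt R s = (\<lambda>t. if t = s then \<one>\<^bsub>R\<^esub> else \<zero>\<^bsub>R\<^esub>)"

definition free_module :: "('r, 'z) ring_scheme \<Rightarrow> 's set \<Rightarrow> ('r, 's \<Rightarrow> 'r) module" where
  "free_module R S =
     \<lparr>carrier = {f. (\<forall>s. f s \<in> carrier R) \<and> finite {s. f s \<noteq> \<zero>\<^bsub>R\<^esub>} \<and> {s. f s \<noteq> \<zero>\<^bsub>R\<^esub>} \<subseteq> S},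
      monoid.mult = (\<lambda>_ _ _. \<zero>\<^bsub>R\<^esub>), one = (\<lambda>_. \<zero>\<^bsub>R\<^esub>), zero = (\<lambda>_. \<zero>\<^bsub>R\<^esub>),
      add = (\<lambda>f g s. f s \<oplus>\<^bsub>R\<^esub> g s), smult = (\<lambda>r f s. r \<otimes>\<^bsub>R\<^esub> f s)\<rparr>"

definition monoid_algebra ::
    "('k, 'z) ring_scheme \<Rightarrow> ('g, 'y) monoid_scheme \<Rightarrow> ('k, 'g \<Rightarrow> 'k) module" where
  "monoid_algebra K G = (free_module K (carrier G))
     \<lparr>monoid.mult := (\<lambda>f g x. \<Oplus>\<^bsub>K\<^esub>p\<in>{(u, v). f u \<noteq> \<zero>\<^bsub>K\<^esub> \<and> g v \<noteq> \<zero>\<^bsub>K\<^esub> \<and> u \<otimes>\<^bsub>G\<^esub> v = x}.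
                f (fst p) \<otimes>\<^bsub>K\<^esub> g (snd p)),
      one := basis_elt K \<one>\<^bsub>G\<^esub>\<rparr>"

text \<open>The library construction \<open>M Quot I\<close>, extended by the induced scalar multiplication.\<close>

definition quotient_module :: "('r, 'm) module \<Rightarrow> 'm set \<Rightarrow> ('r, 'm set) module" where
  "quotient_module M I =
     \<lparr>carrier = a_rcosets\<^bsub>M\<^esub> I, monoid.mult = rcoset_mult M I, one = I +>\<^bsub>M\<^esub> \<one>\<^bsub>M\<^esub>,
      zero = I, add = set_add M, smult = (\<lambda>r X. \<Union>x\<in>X. I +>\<^bsub>M\<^esub> (r \<odot>\<^bsub>M\<^esub> x))\<rparr>"


section \<open>The exterior algebra\<close>

definition word_monoid :: "nat \<Rightarrow> nat list monoid" where
  "word_monoid n = \<lparr>carrier = lists {1..n}, monoid.mult = (@), one = []\<rparr>"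

definition free_algebra :: "('k, 'z) ring_scheme \<Rightarrow> nat \<Rightarrow> ('k, nat list \<Rightarrow> 'k) module" where
  "free_algebra K n = monoid_algebra K (word_monoid n)"

abbreviation gen :: "('k, 'z) ring_scheme \<Rightarrow> nat \<Rightarrow> nat list \<Rightarrow> 'k" where
  "gen K i \<equiv> basis_elt K [i]"

definition exterior_relations :: "('k, 'z) ring_scheme \<Rightarrow> nat \<Rightarrow> (nat list \<Rightarrow> 'k) set" where
  "exterior_relations K n =
     {gen K i \<otimes>\<^bsub>free_algebra K n\<^esub> gen K i | i. 1 \<le> i \<and> i \<le> n} \<union>
     {gen K i \<otimes>\<^bsub>free_algebra K n\<^esub> gen K j \<oplus>\<^bsub>free_algebra K n\<^esub> gen K j \<otimes>\<^bsub>free_algebra K n\<^esub> gen K i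
       | i j. 1 \<le> i \<and> i < j \<and> j \<le> n}"

definition exterior_algebra :: "('k, 'z) ring_scheme \<Rightarrow> nat \<Rightarrow> ('k, (nat list \<Rightarrow> 'k) set) module" where
  "exterior_algebra K n =
     quotient_module (free_algebra K n) (Idl\<^bsub>free_algebra K n\<^esub> (exterior_relations K n))"


section \<open>Tensor products\<close>

text \<open>
  Let \<open>K\<close> be a commutative ring, \<open>R\<close> a \<open>K\<close>-algebra, \<open>M\<close> a right and \<open>N\<close> a left \<open>R\<close>-module.
  The \<open>K\<close>-module \<open>M \<otimes>\<^sub>R N\<close> is the quotient of the free \<open>K\<close>-module on the pairs \<open>(x, y)\<close>
  by the span of the relations below. The last family identifies the scalar action of \<open>K\<close> with
  the action through \<open>c \<mapsto> c \<cdot> 1\<^sub>R\<close>.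
\<close>

abbreviation pairs_module ::
    "('k, 'z) ring_scheme \<Rightarrow> ('r, 'm) module \<Rightarrow> ('s, 'n) module \<Rightarrow> ('k, 'm \<times> 'n \<Rightarrow> 'k) module" where
  "pairs_module K M N \<equiv> free_module K (carrier M \<times> carrier N)"

definition tensor_relations ::
    "('k, 'z) ring_scheme \<Rightarrow> ('k, 'r) module \<Rightarrow> ('r, 'm) module \<Rightarrow> ('r, 'n) module \<Rightarrow>
     ('m \<times> 'n \<Rightarrow> 'k) set" where
  "tensor_relations K R M N =
    (let F = pairs_module K M N; \<delta> = (\<lambda>x y. basis_elt K (x, y)) in
     {\<delta> (x \<oplus>\<^bsub>M\<^esub> x') y \<ominus>\<^bsub>F\<^esub> (\<delta> x y \<oplus>\<^bsub>F\<^esub> \<delta> x' y)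
       | x x' y. x \<in> carrier M \<and> x' \<in> carrier M \<and> y \<in> carrier N} \<union>
     {\<delta> x (y \<oplus>\<^bsub>N\<^esub> y') \<ominus>\<^bsub>F\<^esub> (\<delta> x y \<oplus>\<^bsub>F\<^esub> \<delta> x y')
       | x y y'. x \<in> carrier M \<and> y \<in> carrier N \<and> y' \<in> carrier N} \<union>
     {\<delta> (r \<odot>\<^bsub>M\<^esub> x) y \<ominus>\<^bsub>F\<^esub> \<delta> x (r \<odot>\<^bsub>N\<^esub> y)
       | r x y. r \<in> carrier R \<and> x \<in> carrier M \<and> y \<in> carrier N} \<union>
     {c \<odot>\<^bsub>F\<^esub> \<delta> x y \<ominus>\<^bsub>F\<^esub> \<delta> ((c \<odot>\<^bsub>R\<^esub> \<one>\<^bsub>R\<^esub>) \<odot>\<^bsub>M\<^esub> x) y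
       | c x y. c \<in> carrier K \<and> x \<in> carrier M \<and> y \<in> carrier N})"

definition tensor_kernel ::
    "('k, 'z) ring_scheme \<Rightarrow> ('k, 'r) module \<Rightarrow> ('r, 'm) module \<Rightarrow> ('r, 'n) module \<Rightarrow>
     ('m \<times> 'n \<Rightarrow> 'k) set" where
  "tensor_kernel K R M N =
     LinearCombinations.module.span K (pairs_module K M N) (tensor_relations K R M N)"

definition tensor_product ::
    "('k, 'z) ring_scheme \<Rightarrow> ('k, 'r) module \<Rightarrow> ('r, 'm) module \<Rightarrow> ('r, 'n) module \<Rightarrow>
     ('k, ('m \<times> 'n \<Rightarrow> 'k) set) module" where
  "tensor_product K R M N = quotient_module (pairs_module K M N) (tensor_kernel K R M N)"

definition pushforward ::
    "('k, 'z) ring_scheme \<Rightarrow> ('n \<Rightarrow> 'p) \<Rightarrow> ('m \<times> 'n \<Rightarrow> 'k) \<Rightarrow> 'm \<times> 'p \<Rightarrow> 'k" where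
  "pushforward K h g = (\<lambda>(x, z). \<Oplus>\<^bsub>K\<^esub>y\<in>{y. g (x, y) \<noteq> \<zero>\<^bsub>K\<^esub> \<and> h y = z}. g (x, y))"

text \<open>The map \<open>id \<otimes> h\<close> from \<open>M \<otimes>\<^sub>R N\<close> to \<open>M \<otimes>\<^sub>R N'\<close> for an \<open>R\<close>-linear \<open>h\<close> from \<open>N\<close> to \<open>N'\<close>.\<close>

definition tensor_map ::
    "('k, 'z) ring_scheme \<Rightarrow> ('k, 'r) module \<Rightarrow> ('r, 'm) module \<Rightarrow> ('r, 'p) module \<Rightarrow> ('n \<Rightarrow> 'p) \<Rightarrow>
     ('m \<times> 'n \<Rightarrow> 'k) set \<Rightarrow> ('m \<times> 'p \<Rightarrow> 'k) set" where
  "tensor_map K R M N' h X =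
     (\<Union>g\<in>X. tensor_kernel K R M N' +>\<^bsub>pairs_module K M N'\<^esub> pushforward K h g)"

definition self_algebra :: "('k, 'z) ring_scheme \<Rightarrow> ('k, 'k) module" where
  "self_algebra K = \<lparr>carrier = carrier K, monoid.mult = (\<otimes>\<^bsub>K\<^esub>), one = \<one>\<^bsub>K\<^esub>,
     zero = \<zero>\<^bsub>K\<^esub>, add = (\<oplus>\<^bsub>K\<^esub>), smult = (\<otimes>\<^bsub>K\<^esub>)\<rparr>"

text \<open>
  As a \<open>K\<close>-module this is \<open>tensor_product K (self_algebra K) A B\<close>. The multiplication is induced
  by the one of the monoid algebra of \<open>A \<times>\<times> B\<close>, that is \<open>(a \<otimes> b)(a' \<otimes> b') = aa' \<otimes> bb'\<close>.
\<close>

definition tensor_algebra ::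
    "('k, 'z) ring_scheme \<Rightarrow> ('k, 'a) module \<Rightarrow> ('k, 'b) module \<Rightarrow> ('k, ('a \<times> 'b \<Rightarrow> 'k) set) module" where
  "tensor_algebra K A B =
     quotient_module (monoid_algebra K (A \<times>\<times> B)) (tensor_kernel K (self_algebra K) A B)"


section \<open>Projective resolutions and Tor\<close>

locale left_module = R?: ring R + M?: abelian_group M
  for R :: "('r, 'z) ring_scheme" (structure) and M :: "('r, 'm, 'y) module_scheme" (structure) +
  assumes smult_closed: "\<lbrakk>r \<in> carrier R; x \<in> carrier M\<rbrakk> \<Longrightarrow> r \<odot>\<^bsub>M\<^esub> x \<in> carrier M"
    and smult_l_distr: "\<lbrakk>r \<in> carrier R; s \<in> carrier R; x \<in> carrier M\<rbrakk> \<Longrightarrow>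
      (r \<oplus>\<^bsub>R\<^esub> s) \<odot>\<^bsub>M\<^esub> x = r \<odot>\<^bsub>M\<^esub> x \<oplus>\<^bsub>M\<^esub> s \<odot>\<^bsub>M\<^esub> x"
    and smult_r_distr: "\<lbrakk>r \<in> carrier R; x \<in> carrier M; y \<in> carrier M\<rbrakk> \<Longrightarrow>
      r \<odot>\<^bsub>M\<^esub> (x \<oplus>\<^bsub>M\<^esub> y) = r \<odot>\<^bsub>M\<^esub> x \<oplus>\<^bsub>M\<^esub> r \<odot>\<^bsub>M\<^esub> y"
    and smult_assoc: "\<lbrakk>r \<in> carrier R; s \<in> carrier R; x \<in> carrier M\<rbrakk> \<Longrightarrow>
      (r \<otimes>\<^bsub>R\<^esub> s) \<odot>\<^bsub>M\<^esub> x = r \<odot>\<^bsub>M\<^esub> (s \<odot>\<^bsub>M\<^esub> x)"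
    and smult_one: "x \<in> carrier M \<Longrightarrow> \<one>\<^bsub>R\<^esub> \<odot>\<^bsub>M\<^esub> x = x"

text \<open>
  A projective module is a direct summand (a retract) of a free module. It is then a retract of
  the free module on its own carrier, so it is enough to consider bases in the type \<open>'p\<close>.
\<close>

definition projective_module :: "('r, 'z) ring_scheme \<Rightarrow> ('r, 'p) module \<Rightarrow> bool" where
  "projective_module R P \<longleftrightarrow> left_module R P \<and>
     (\<exists>(S :: 'p set) i q. i \<in> module_hom R P (free_module R S) \<and> q \<in> module_hom R (free_module R S) P \<and>
       (\<forall>x\<in>carrier P. q (i x) = x))"

definition projective_resolution ::
    "('r, 'z) ring_scheme \<Rightarrow> ('r, 'n) module \<Rightarrow>
     (nat \<Rightarrow> ('r, 'p) module) \<Rightarrow> (nat \<Rightarrow> 'p \<Rightarrow> 'p) \<Rightarrow> ('p \<Rightarrow> 'n) \<Rightarrow> bool" where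
  "projective_resolution R N P d \<epsilon> \<longleftrightarrow>
     (\<forall>i. projective_module R (P i)) \<and>
     (\<forall>i. d i \<in> module_hom R (P (Suc i)) (P i)) \<and>
     \<epsilon> \<in> module_hom R (P 0) N \<and>
     \<epsilon> ` carrier (P 0) = carrier N \<and>
     d 0 ` carrier (P 1) = {x \<in> carrier (P 0). \<epsilon> x = \<zero>\<^bsub>N\<^esub>} \<and>
     (\<forall>i. d (Suc i) ` carrier (P (Suc (Suc i))) = {x \<in> carrier (P (Suc i)). d i x = \<zero>\<^bsub>P i\<^esub>})"

text \<open>
  Every left \<open>R\<close>-module with elements of type \<open>'n\<close> has a projective resolution with elements of
  type \<open>'r list \<times> 'n \<Rightarrow> 'r\<close>: generating sets of all syzygies embed into \<open>'r list \<times> 'n\<close> by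
  cardinality, so all terms can be taken to be free modules on subsets of that type.
\<close>

definition some_projective_resolution ::
    "('r, 'z) ring_scheme \<Rightarrow> ('r, 'n) module \<Rightarrow>
     (nat \<Rightarrow> ('r, 'r list \<times> 'n \<Rightarrow> 'r) module) \<times>
     (nat \<Rightarrow> ('r list \<times> 'n \<Rightarrow> 'r) \<Rightarrow> ('r list \<times> 'n \<Rightarrow> 'r)) \<times> (('r list \<times> 'n \<Rightarrow> 'r) \<Rightarrow> 'n)" where
  "some_projective_resolution R N = (SOME (P, d, \<epsilon>). projective_resolution R N P d \<epsilon>)"

text \<open>Here \<open>D i\<close> maps \<open>C (Suc i)\<close> to \<open>C i\<close>, and the complex is zero in negative degrees.\<close>

definition cycles :: "(nat \<Rightarrow> ('k, 'c) module) \<Rightarrow> (nat \<Rightarrow> 'c \<Rightarrow> 'c) \<Rightarrow> nat \<Rightarrow> 'c set" where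
  "cycles C D m = (case m of 0 \<Rightarrow> carrier (C 0)
     | Suc i \<Rightarrow> {x \<in> carrier (C (Suc i)). D i x = \<zero>\<^bsub>C i\<^esub>})"

definition boundaries :: "(nat \<Rightarrow> ('k, 'c) module) \<Rightarrow> (nat \<Rightarrow> 'c \<Rightarrow> 'c) \<Rightarrow> nat \<Rightarrow> 'c set" where
  "boundaries C D m = D m ` carrier (C (Suc m))"

definition homology ::
    "(nat \<Rightarrow> ('k, 'c) module) \<Rightarrow> (nat \<Rightarrow> 'c \<Rightarrow> 'c) \<Rightarrow> nat \<Rightarrow> ('k, 'c set) module" where
  "homology C D m = quotient_module ((C m)\<lparr>carrier := cycles C D m\<rparr>) (boundaries C D m)"

definition Tor ::
    "('k, 'z) ring_scheme \<Rightarrow> ('k, 'r) module \<Rightarrow> ('r, 'm) module \<Rightarrow> ('r, 'n) module \<Rightarrow> nat \<Rightarrow>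
     ('k, ('m \<times> ('r list \<times> 'n \<Rightarrow> 'r) \<Rightarrow> 'k) set set) module" where
  "Tor K R M N m =
    (case some_projective_resolution R N of (P, d, _) \<Rightarrow>
       homology (\<lambda>i. tensor_product K R M (P i)) (\<lambda>i. tensor_map K R M (P i) (d i)) m)"


section \<open>Hochschild homology\<close>

definition opposite :: "('k, 'a) module \<Rightarrow> ('k, 'a) module" where
  "opposite A = A\<lparr>monoid.mult := (\<lambda>x y. y \<otimes>\<^bsub>A\<^esub> x)\<rparr>"

definition enveloping_algebra ::
    "('k, 'z) ring_scheme \<Rightarrow> ('k, 'a) module \<Rightarrow> ('k, ('a \<times> 'a \<Rightarrow> 'k) set) module" where
  "enveloping_algebra K A = tensor_algebra K A (opposite A)"

text \<open>
  The actions \<open>(a \<otimes> b) \<cdot> x = a x b\<close> and \<open>x \<cdot> (a \<otimes> b) = b x a\<close> of the enveloping algebra on \<open>A\<close>.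
  An element of the enveloping algebra is a coset \<open>X\<close>, on which the value of the sum is constant.
\<close>

definition left_enveloping_module ::
    "('k, 'z) ring_scheme \<Rightarrow> ('k, 'a) module \<Rightarrow> (('a \<times> 'a \<Rightarrow> 'k) set, 'a) module" where
  "left_enveloping_module K A =
     \<lparr>carrier = carrier A, monoid.mult = (\<otimes>\<^bsub>A\<^esub>), one = \<one>\<^bsub>A\<^esub>, zero = \<zero>\<^bsub>A\<^esub>, add = (\<oplus>\<^bsub>A\<^esub>),
      smult = (\<lambda>X x. the_elem
        ((\<lambda>f. \<Oplus>\<^bsub>A\<^esub>p\<in>{p. f p \<noteq> \<zero>\<^bsub>K\<^esub>}. f p \<odot>\<^bsub>A\<^esub> (fst p \<otimes>\<^bsub>A\<^esub> x \<otimes>\<^bsub>A\<^esub> snd p)) ` X))\<rparr>"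

definition right_enveloping_module ::
    "('k, 'z) ring_scheme \<Rightarrow> ('k, 'a) module \<Rightarrow> (('a \<times> 'a \<Rightarrow> 'k) set, 'a) module" where
  "right_enveloping_module K A =
     \<lparr>carrier = carrier A, monoid.mult = (\<otimes>\<^bsub>A\<^esub>), one = \<one>\<^bsub>A\<^esub>, zero = \<zero>\<^bsub>A\<^esub>, add = (\<oplus>\<^bsub>A\<^esub>),
      smult = (\<lambda>X x. the_elem
        ((\<lambda>f. \<Oplus>\<^bsub>A\<^esub>p\<in>{p. f p \<noteq> \<zero>\<^bsub>K\<^esub>}. f p \<odot>\<^bsub>A\<^esub> (snd p \<otimes>\<^bsub>A\<^esub> x \<otimes>\<^bsub>A\<^esub> fst p)) ` X))\<rparr>"

definition Hochschild_homology where
  "Hochschild_homology K A m =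
     Tor K (enveloping_algebra K A) (right_enveloping_module K A) (left_enveloping_module K A) m"

end

theory Submission
  imports Defs "HOL-Library.Countable"
begin

text \<open>
  The exterior algebra \<open>\<Lambda>\<close> has a basis \<open>e\<^sub>S\<close> indexed by the subsets of \<open>{1..n}\<close>; independence comes from a
  linear map on words that weighs a word by the parity of its inversions. The bimodule \<open>\<Lambda>\<close> has the Koszul
  resolution with terms \<open>\<Lambda>\<^sup>e \<otimes> D\<^sub>m\<close>, where \<open>D\<^sub>m\<close> has a basis \<open>z\<^sub>a\<close> indexed by the multisets \<open>a\<close> of size
  \<open>m\<close>, and \<open>d z\<^sub>a\<close> is the sum of \<open>(x\<^sub>i \<otimes> 1 \<plusminus> 1 \<otimes> x\<^sub>i) z\<^sub>b\<close> over all \<open>a = b + {i}\<close>. It is exact since the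
  variables can be contracted one at a time. Tensoring with \<open>\<Lambda>\<close> gives the complex on \<open>e\<^sub>S \<otimes> z\<^sub>a\<close> whose
  differential vanishes if \<open>card S + size a\<close> is odd and is twice the one-sided Koszul differential
  otherwise. So in characteristic 2 everything survives, and otherwise the odd part and, in degree 0,
  the unit survive, because the same contraction makes the even part exact elsewhere. Projective
  resolutions are unique up to homotopy, so the value of \<open>Tor\<close> does not depend on the chosen one.
\<close>

section \<open>Modules over noncommutative rings\<close>

text \<open>The sign between \<open>x_i \<otimes> 1\<close> and \<open>1 \<otimes> x_i\<close> has
  to alternate with the degree. In the square of the differential, the terms with both generators on
  one side cancel because the generators anticommute and square to zero. The mixed terms commute
  instead, and cancel only when consecutive signs are opposite. The \<open>z_a\<close> form a
  divided power basis, so no multiplicities appear as coefficients and exactness holds in every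
  characteristic.

  The contraction is linear over \<open>K\<close> but not over the enveloping algebra, since
  dividing by a variable does not commute with multiplying by it. This is why exactness is proved
  for families of scalars and then transported to modules.

  The factor two arises as \<open>1 + (-1)^(card S + size a)\<close>: left and right multiplication
  by a generator differ by a sign that depends on the degree of the other factor. The differential
  preserves \<open>card S + size a\<close>, so the complex splits by the parity of this number. Half
  of the subsets have a given parity, which explains \<open>2 ^ (n - 1)\<close>; the binomial
  coefficient counts the multisets.\<close>

lemma left_moduleI:
  assumes "ring R" "abelian_group M"
    "\<And>r x. r \<in> carrier R \<Longrightarrow> x \<in> carrier M \<Longrightarrow> r \<odot>\<^bsub>M\<^esub> x \<in> carrier M"
    "\<And>r s x. r \<in> carrier R \<Longrightarrow> s \<in> carrier R \<Longrightarrow> x \<in> carrier M \<Longrightarrow>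
      (r \<oplus>\<^bsub>R\<^esub> s) \<odot>\<^bsub>M\<^esub> x = r \<odot>\<^bsub>M\<^esub> x \<oplus>\<^bsub>M\<^esub> s \<odot>\<^bsub>M\<^esub> x"
    "\<And>r x y. r \<in> carrier R \<Longrightarrow> x \<in> carrier M \<Longrightarrow> y \<in> carrier M \<Longrightarrow>
      r \<odot>\<^bsub>M\<^esub> (x \<oplus>\<^bsub>M\<^esub> y) = r \<odot>\<^bsub>M\<^esub> x \<oplus>\<^bsub>M\<^esub> r \<odot>\<^bsub>M\<^esub> y"
    "\<And>r s x. r \<in> carrier R \<Longrightarrow> s \<in> carrier R \<Longrightarrow> x \<in> carrier M \<Longrightarrow>
      (r \<otimes>\<^bsub>R\<^esub> s) \<odot>\<^bsub>M\<^esub> x = r \<odot>\<^bsub>M\<^esub> (s \<odot>\<^bsub>M\<^esub> x)"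
    "\<And>x. x \<in> carrier M \<Longrightarrow> \<one>\<^bsub>R\<^esub> \<odot>\<^bsub>M\<^esub> x = x"
  shows "left_module R M"
  unfolding left_module_def left_module_axioms_def using assms by blast

lemma module_homI:
  assumes "\<And>x. x \<in> carrier M \<Longrightarrow> f x \<in> carrier N"
    "\<And>x y. x \<in> carrier M \<Longrightarrow> y \<in> carrier M \<Longrightarrow> f (x \<oplus>\<^bsub>M\<^esub> y) = f x \<oplus>\<^bsub>N\<^esub> f y"
    "\<And>r x. r \<in> carrier R \<Longrightarrow> x \<in> carrier M \<Longrightarrow> f (r \<odot>\<^bsub>M\<^esub> x) = r \<odot>\<^bsub>N\<^esub> f x"
  shows "f \<in> module_hom R M N"
  unfolding module_hom_def using assms by auto

lemma module_hom_in: "f \<in> module_hom R M N \<Longrightarrow> x \<in> carrier M \<Longrightarrow> f x \<in> carrier N"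
  unfolding module_hom_def by auto

lemma module_hom_comp:
  "f \<in> module_hom R M N \<Longrightarrow> g \<in> module_hom R N L \<Longrightarrow> (\<lambda>x. g (f x)) \<in> module_hom R M L"
  by (rule module_homI) (auto simp: module_hom_in module_hom_add module_hom_smult)

text \<open>Membership in \<open>module_hom\<close> constrains a function on the carrier only. The
  module axioms of \<open>M\<close> keep sums and multiples inside the carrier, where
  \<open>f\<close> and \<open>g\<close> agree.\<close>

lemma module_hom_cong:
  assumes "f \<in> module_hom R M N" "\<And>x. x \<in> carrier M \<Longrightarrow> f x = g x" "left_module R M"
  shows "g \<in> module_hom R M N"
proof -
  interpret left_module R M by fact
  show ?thesis
    using assms(1,2) smult_closed unfolding module_hom_def by (fastforce simp: Pi_iff)
qed

text \<open>The ring axioms are equations, apart from the existence of negatives, whose images serve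
  as negatives. So they pass to any surjective image that respects the operations. Quotient algebras
  become rings in this way.\<close>

lemma (in ring) ring_image:
  assumes "p ` carrier R = carrier S"
    "\<And>x y. x \<in> carrier R \<Longrightarrow> y \<in> carrier R \<Longrightarrow> p x \<oplus>\<^bsub>S\<^esub> p y = p (x \<oplus> y)"
    "\<And>x y. x \<in> carrier R \<Longrightarrow> y \<in> carrier R \<Longrightarrow> p x \<otimes>\<^bsub>S\<^esub> p y = p (x \<otimes> y)"
    "\<zero>\<^bsub>S\<^esub> = p \<zero>" "\<one>\<^bsub>S\<^esub> = p \<one>"
  shows "ring S"
proof (rule ringI)
  show "abelian_group S"
  proof (rule abelian_groupI)
    fix x assume "x \<in> carrier S"
    then obtain a where "a \<in> carrier R" "x = p a" using assms(1) by blast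
    then show "\<exists>y\<in>carrier S. y \<oplus>\<^bsub>S\<^esub> x = \<zero>\<^bsub>S\<^esub>"
      using assms by (intro bexI[of _ "p (\<ominus> a)"]) (auto simp: l_neg)
  qed (auto simp: assms(1)[symmetric] assms(2-) a_ac)
  show "monoid S"
    by (rule monoidI) (auto simp: assms(1)[symmetric] assms(2-) m_assoc)
qed (auto simp: assms(1)[symmetric] assms(2-) l_distr r_distr)

context left_module
begin

text \<open>The module analogue of \<open>ring_image\<close>. With \<open>p = id\<close> it also
  moves the axioms between records that differ only in fields irrelevant for modules.\<close>

lemma left_module_image:
  assumes "p ` carrier M = carrier N"
    "\<And>x y. x \<in> carrier M \<Longrightarrow> y \<in> carrier M \<Longrightarrow> p x \<oplus>\<^bsub>N\<^esub> p y = p (x \<oplus>\<^bsub>M\<^esub> y)"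
    "\<And>r x. r \<in> carrier R \<Longrightarrow> x \<in> carrier M \<Longrightarrow> r \<odot>\<^bsub>N\<^esub> p x = p (r \<odot>\<^bsub>M\<^esub> x)"
    "\<zero>\<^bsub>N\<^esub> = p \<zero>\<^bsub>M\<^esub>"
  shows "left_module R N"
proof (rule left_moduleI)
  show "ring R" by (rule R.ring_axioms)
  show "abelian_group N"
  proof (rule abelian_groupI)
    fix x assume "x \<in> carrier N"
    then obtain a where "a \<in> carrier M" "x = p a" using assms(1) by blast
    then show "\<exists>y\<in>carrier N. y \<oplus>\<^bsub>N\<^esub> x = \<zero>\<^bsub>N\<^esub>"
      using assms by (intro bexI[of _ "p (\<ominus>\<^bsub>M\<^esub> a)"]) (auto simp: M.l_neg)
  qed (auto simp: assms(1)[symmetric] assms(2-) M.a_ac)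
qed (auto simp: assms(1)[symmetric] assms(2-) smult_closed smult_l_distr smult_r_distr
    smult_assoc smult_one)

lemma smult_r_null [simp]: "r \<in> carrier R \<Longrightarrow> r \<odot>\<^bsub>M\<^esub> \<zero>\<^bsub>M\<^esub> = \<zero>\<^bsub>M\<^esub>"
  using smult_r_distr[of r "\<zero>\<^bsub>M\<^esub>" "\<zero>\<^bsub>M\<^esub>"] smult_closed[of r "\<zero>\<^bsub>M\<^esub>"]
  by (simp add: M.add.l_cancel_one)

lemma smult_l_null [simp]: "x \<in> carrier M \<Longrightarrow> \<zero> \<odot>\<^bsub>M\<^esub> x = \<zero>\<^bsub>M\<^esub>"
  using smult_l_distr[of "\<zero>" "\<zero>" x] smult_closed[of "\<zero>" x] by (simp add: M.add.l_cancel_one)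

lemma smult_r_minus:
  assumes "r \<in> carrier R" "x \<in> carrier M" shows "r \<odot>\<^bsub>M\<^esub> (\<ominus>\<^bsub>M\<^esub> x) = \<ominus>\<^bsub>M\<^esub> (r \<odot>\<^bsub>M\<^esub> x)"
proof -
  have "r \<odot>\<^bsub>M\<^esub> (\<ominus>\<^bsub>M\<^esub> x) \<oplus>\<^bsub>M\<^esub> r \<odot>\<^bsub>M\<^esub> x = \<zero>\<^bsub>M\<^esub>"
    using assms smult_r_distr[of r "\<ominus>\<^bsub>M\<^esub> x" x] by (simp add: M.l_neg)
  then show ?thesis using assms by (simp add: M.minus_equality smult_closed)
qed

lemma smult_l_minus:
  assumes "r \<in> carrier R" "x \<in> carrier M" shows "(\<ominus> r) \<odot>\<^bsub>M\<^esub> x = \<ominus>\<^bsub>M\<^esub> (r \<odot>\<^bsub>M\<^esub> x)"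
proof -
  have "(\<ominus> r) \<odot>\<^bsub>M\<^esub> x \<oplus>\<^bsub>M\<^esub> r \<odot>\<^bsub>M\<^esub> x = \<zero>\<^bsub>M\<^esub>"
    using assms smult_l_distr[of "\<ominus> r" r x] by (simp add: R.l_neg)
  then show ?thesis using assms by (simp add: M.minus_equality smult_closed)
qed

lemma smult_finsum:
  assumes "r \<in> carrier R" "f \<in> A \<rightarrow> carrier M"
  shows "r \<odot>\<^bsub>M\<^esub> (\<Oplus>\<^bsub>M\<^esub>i\<in>A. f i) = (\<Oplus>\<^bsub>M\<^esub>i\<in>A. r \<odot>\<^bsub>M\<^esub> f i)"
  using assms(2)
proof (induction A rule: infinite_finite_induct)
  case (insert a A)
  then show ?case
    using assms(1) by (simp add: M.finsum_insert smult_r_distr smult_closed Pi_iff)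
qed (use assms(1) in auto)

end

lemma finsum_mono_neutral:
  assumes "abelian_monoid G" "finite B" "A \<subseteq> B" "f \<in> B \<rightarrow> carrier G"
    "\<And>x. x \<in> B \<Longrightarrow> x \<notin> A \<Longrightarrow> f x = \<zero>\<^bsub>G\<^esub>"
  shows "finsum G f A = finsum G f B"
proof -
  interpret abelian_monoid G by fact
  show ?thesis using assms(2-) by (intro add.finprod_mono_neutral_cong_left) auto
qed

lemma finsum_single:
  assumes "abelian_monoid G" "finite A" "a \<in> A" "f a \<in> carrier G"
    "\<And>x. x \<in> A \<Longrightarrow> x \<noteq> a \<Longrightarrow> f x = \<zero>\<^bsub>G\<^esub>"
  shows "finsum G f A = f a"
proof -
  interpret abelian_monoid G by fact
  have "finsum G f {a} = finsum G f A"
    using assms(2-) by (intro finsum_mono_neutral[OF assms(1)]) (auto, metis zero_closed)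
  then show ?thesis using assms(4) by simp
qed

locale left_module_hom = M?: left_module R M + N?: left_module R N
  for R (structure) and M and N + fixes f
  assumes hom: "f \<in> module_hom R M N"
begin

lemma closed [simp, intro]: "x \<in> carrier M \<Longrightarrow> f x \<in> carrier N"
  using hom by (rule module_hom_in)

lemma add: "x \<in> carrier M \<Longrightarrow> y \<in> carrier M \<Longrightarrow> f (x \<oplus>\<^bsub>M\<^esub> y) = f x \<oplus>\<^bsub>N\<^esub> f y"
  using hom by (simp add: module_hom_add)

lemma smult: "r \<in> carrier R \<Longrightarrow> x \<in> carrier M \<Longrightarrow> f (r \<odot>\<^bsub>M\<^esub> x) = r \<odot>\<^bsub>N\<^esub> f x"
  using hom by (simp add: module_hom_smult)

lemma zero [simp]: "f \<zero>\<^bsub>M\<^esub> = \<zero>\<^bsub>N\<^esub>"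
  using add[of "\<zero>\<^bsub>M\<^esub>" "\<zero>\<^bsub>M\<^esub>"] by (simp add: N.M.add.l_cancel_one)

lemma minus: "x \<in> carrier M \<Longrightarrow> f (\<ominus>\<^bsub>M\<^esub> x) = \<ominus>\<^bsub>N\<^esub> f x"
  using add[of "\<ominus>\<^bsub>M\<^esub> x" x] by (simp add: M.M.l_neg N.M.minus_equality)

lemma diff: "x \<in> carrier M \<Longrightarrow> y \<in> carrier M \<Longrightarrow> f (x \<ominus>\<^bsub>M\<^esub> y) = f x \<ominus>\<^bsub>N\<^esub> f y"
  by (simp add: M.M.minus_eq N.M.minus_eq add minus)

lemma finsum: "g \<in> A \<rightarrow> carrier M \<Longrightarrow> f (\<Oplus>\<^bsub>M\<^esub>i\<in>A. g i) = (\<Oplus>\<^bsub>N\<^esub>i\<in>A. f (g i))"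
proof (induction A rule: infinite_finite_induct)
  case (insert a A)
  then show ?case by (simp add: M.M.finsum_insert N.M.finsum_insert add Pi_iff)
qed auto

end

lemma left_module_homI:
  "left_module R M \<Longrightarrow> left_module R N \<Longrightarrow> f \<in> module_hom R M N \<Longrightarrow> left_module_hom R M N f"
  by (simp add: left_module_hom_def left_module_hom_axioms_def)

lemma module_hom_plus:
  assumes "left_module R M" "left_module R N" "f \<in> module_hom R M N" "g \<in> module_hom R M N"
  shows "(\<lambda>x. f x \<oplus>\<^bsub>N\<^esub> g x) \<in> module_hom R M N"
proof -
  interpret f: left_module_hom R M N f using assms by (simp add: left_module_homI)
  interpret g: left_module_hom R M N g using assms by (simp add: left_module_homI)
  show ?thesis
    by (rule module_homI) (auto simp: f.add g.add f.smult g.smult f.N.smult_r_distr f.N.M.a_ac)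
qed

lemma module_hom_diff:
  assumes "left_module R M" "left_module R N" "f \<in> module_hom R M N" "g \<in> module_hom R M N"
  shows "(\<lambda>x. f x \<ominus>\<^bsub>N\<^esub> g x) \<in> module_hom R M N"
proof -
  interpret f: left_module_hom R M N f using assms by (simp add: left_module_homI)
  interpret g: left_module_hom R M N g using assms by (simp add: left_module_homI)
  show ?thesis
    by (rule module_homI) (auto simp: f.N.M.minus_eq f.add g.add f.smult g.smult f.N.smult_r_distr
        f.N.smult_r_minus f.N.M.minus_add f.N.M.a_ac)
qed

section \<open>Free modules\<close>

lemma free_module_simps [simp]:
  "carrier (free_module R S) =
    {f. (\<forall>s. f s \<in> carrier R) \<and> finite {s. f s \<noteq> \<zero>\<^bsub>R\<^esub>} \<and> {s. f s \<noteq> \<zero>\<^bsub>R\<^esub>} \<subseteq> S}"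
  "\<zero>\<^bsub>free_module R S\<^esub> = (\<lambda>_. \<zero>\<^bsub>R\<^esub>)"
  "f \<oplus>\<^bsub>free_module R S\<^esub> g = (\<lambda>s. f s \<oplus>\<^bsub>R\<^esub> g s)"
  "r \<odot>\<^bsub>free_module R S\<^esub> f = (\<lambda>s. r \<otimes>\<^bsub>R\<^esub> f s)"
  by (simp_all add: free_module_def)

lemma (in ring) free_module_left_module: "left_module R (free_module R S)"
proof (rule left_moduleI)
  show "abelian_group (free_module R S)"
  proof (rule abelian_groupI)
    fix f g assume f: "f \<in> carrier (free_module R S)" and g: "g \<in> carrier (free_module R S)"
    have "{s. f s \<oplus> g s \<noteq> \<zero>} \<subseteq> {s. f s \<noteq> \<zero>} \<union> {s. g s \<noteq> \<zero>}" by auto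
    then show "f \<oplus>\<^bsub>free_module R S\<^esub> g \<in> carrier (free_module R S)"
      using f g by (auto intro: finite_subset)
  next
    fix f assume f: "f \<in> carrier (free_module R S)"
    have "{s. \<ominus> f s \<noteq> \<zero>} \<subseteq> {s. f s \<noteq> \<zero>}" by auto
    then show "\<exists>g\<in>carrier (free_module R S). g \<oplus>\<^bsub>free_module R S\<^esub> f = \<zero>\<^bsub>free_module R S\<^esub>"
      using f by (intro bexI[of _ "\<lambda>s. \<ominus> f s"]) (auto simp: l_neg intro: finite_subset)
  qed (auto simp: a_ac)
  fix r f assume r: "r \<in> carrier R" and f: "f \<in> carrier (free_module R S)"
  have "{s. r \<otimes> f s \<noteq> \<zero>} \<subseteq> {s. f s \<noteq> \<zero>}" using r by auto
  then show "r \<odot>\<^bsub>free_module R S\<^esub> f \<in> carrier (free_module R S)"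
    using r f by (auto intro: finite_subset)
qed (auto simp: ring_axioms l_distr r_distr m_assoc)

lemma (in ring) basis_elt_closed [simp, intro]: "s \<in> S \<Longrightarrow> basis_elt R s \<in> carrier (free_module R S)"
  by (auto simp: basis_elt_def)

text \<open>This is the linear extension of \<open>b\<close> from the basis. Summing over the
  support makes it agree, after unfolding, with the sums that define the actions of the enveloping
  algebra.\<close>

definition free_ext :: "('r, 'z) ring_scheme \<Rightarrow> ('r, 'm, 'y) module_scheme \<Rightarrow> ('s \<Rightarrow> 'm) \<Rightarrow> ('s \<Rightarrow> 'r) \<Rightarrow> 'm"
  where "free_ext R M b f = (\<Oplus>\<^bsub>M\<^esub>s\<in>{s. f s \<noteq> \<zero>\<^bsub>R\<^esub>}. f s \<odot>\<^bsub>M\<^esub> b s)"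

context left_module
begin

text \<open>Terms outside the support vanish, so the index set may be enlarged. This allows two
  functions with different supports to be summed over a common set.\<close>

lemma free_ext_sum:
  assumes f: "f \<in> carrier (free_module R S)" and b: "b \<in> S \<rightarrow> carrier M"
    and A: "finite A" "{s. f s \<noteq> \<zero>} \<subseteq> A" "A \<subseteq> S"
  shows "free_ext R M b f = (\<Oplus>\<^bsub>M\<^esub>s\<in>A. f s \<odot>\<^bsub>M\<^esub> b s)"
  unfolding free_ext_def
proof (rule finsum_mono_neutral)
  show "(\<lambda>s. f s \<odot>\<^bsub>M\<^esub> b s) \<in> A \<rightarrow> carrier M"
    using f b A by (auto intro!: smult_closed)
  show "f s \<odot>\<^bsub>M\<^esub> b s = \<zero>\<^bsub>M\<^esub>" if "s \<in> A" "s \<notin> {s. f s \<noteq> \<zero>}" for s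
  proof -
    have "b s \<in> carrier M" using that b A by auto
    then show ?thesis using that by simp
  qed
qed (use A in \<open>auto intro: M.abelian_monoid_axioms\<close>)

lemma free_ext_closed:
  assumes "f \<in> carrier (free_module R S)" "b \<in> S \<rightarrow> carrier M"
  shows "free_ext R M b f \<in> carrier M"
  unfolding free_ext_def using assms by (intro M.finsum_closed) (auto intro!: smult_closed)

lemma free_ext_hom:
  assumes b: "b \<in> S \<rightarrow> carrier M"
  shows "free_ext R M b \<in> module_hom R (free_module R S) M"
proof (rule module_homI)
  interpret F: left_module R "free_module R S" by (rule R.free_module_left_module)
  fix f g assume f: "f \<in> carrier (free_module R S)" and g: "g \<in> carrier (free_module R S)"
  let ?A = "{s. f s \<noteq> \<zero>} \<union> {s. g s \<noteq> \<zero>}"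
  have A: "finite ?A" "?A \<subseteq> S" using f g by auto
  have fg: "f \<oplus>\<^bsub>free_module R S\<^esub> g \<in> carrier (free_module R S)" using f g by (rule F.M.a_closed)
  have "free_ext R M b (f \<oplus>\<^bsub>free_module R S\<^esub> g) = (\<Oplus>\<^bsub>M\<^esub>s\<in>?A. (f s \<oplus> g s) \<odot>\<^bsub>M\<^esub> b s)"
    by (subst free_ext_sum[OF fg b, of ?A]) (use A f g in auto)
  also have "\<dots> = (\<Oplus>\<^bsub>M\<^esub>s\<in>?A. f s \<odot>\<^bsub>M\<^esub> b s \<oplus>\<^bsub>M\<^esub> g s \<odot>\<^bsub>M\<^esub> b s)"
    using f g A b
    by (intro M.finsum_cong') (auto intro!: smult_l_distr smult_closed M.a_closed simp: Pi_iff)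
  also have "\<dots> = (\<Oplus>\<^bsub>M\<^esub>s\<in>?A. f s \<odot>\<^bsub>M\<^esub> b s) \<oplus>\<^bsub>M\<^esub> (\<Oplus>\<^bsub>M\<^esub>s\<in>?A. g s \<odot>\<^bsub>M\<^esub> b s)"
    using f g A b by (intro M.finsum_addf) (auto intro!: smult_closed simp: Pi_iff)
  finally show "free_ext R M b (f \<oplus>\<^bsub>free_module R S\<^esub> g) = free_ext R M b f \<oplus>\<^bsub>M\<^esub> free_ext R M b g"
    using free_ext_sum[OF f b, of ?A] free_ext_sum[OF g b, of ?A] A by auto
next
  interpret F: left_module R "free_module R S" by (rule R.free_module_left_module)
  fix r f assume r: "r \<in> carrier R" and f: "f \<in> carrier (free_module R S)"
  let ?A = "{s. f s \<noteq> \<zero>}"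
  have A: "finite ?A" "?A \<subseteq> S" using f by auto
  have rf: "r \<odot>\<^bsub>free_module R S\<^esub> f \<in> carrier (free_module R S)" using r f by (rule F.smult_closed)
  have "free_ext R M b (r \<odot>\<^bsub>free_module R S\<^esub> f) = (\<Oplus>\<^bsub>M\<^esub>s\<in>?A. (r \<otimes> f s) \<odot>\<^bsub>M\<^esub> b s)"
    by (subst free_ext_sum[OF rf b, of ?A]) (use A f r in auto)
  also have "\<dots> = (\<Oplus>\<^bsub>M\<^esub>s\<in>?A. r \<odot>\<^bsub>M\<^esub> (f s \<odot>\<^bsub>M\<^esub> b s))"
    using f r A b
    by (intro M.finsum_cong') (auto intro!: smult_assoc smult_closed simp: Pi_iff)
  also have "\<dots> = r \<odot>\<^bsub>M\<^esub> free_ext R M b f"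
    unfolding free_ext_def using f r A b
    by (intro smult_finsum[symmetric]) (auto intro!: smult_closed simp: Pi_iff)
  finally show "free_ext R M b (r \<odot>\<^bsub>free_module R S\<^esub> f) = r \<odot>\<^bsub>M\<^esub> free_ext R M b f" .
qed (use free_ext_closed b in auto)

lemma free_ext_basis:
  assumes "b s \<in> carrier M"
  shows "free_ext R M b (basis_elt R s) = b s"
proof -
  have "free_ext R M b (basis_elt R s) = (\<Oplus>\<^bsub>M\<^esub>t\<in>{s}. basis_elt R s t \<odot>\<^bsub>M\<^esub> b t)"
    by (rule free_ext_sum[of _ "{s}"]) (use assms in \<open>auto simp: basis_elt_def\<close>)
  then show ?thesis using assms by (simp add: basis_elt_def smult_one)
qed

end

lemma free_module_finsum:
  assumes "ring R" "f \<in> A \<rightarrow> carrier (free_module R S)"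
  shows "(\<Oplus>\<^bsub>free_module R S\<^esub>i\<in>A. f i) t = (\<Oplus>\<^bsub>R\<^esub>i\<in>A. f i t)"
  using assms(2)
proof (induction A rule: infinite_finite_induct)
  case (insert a A)
  interpret ring R by fact
  interpret F: left_module R "free_module R S" by (rule free_module_left_module)
  show ?case using insert by (subst F.M.finsum_insert) (auto simp: Pi_iff)
next
  case (infinite A)
  interpret ring R by fact
  interpret F: left_module R "free_module R S" by (rule free_module_left_module)
  show ?case using infinite by simp
next
  case empty
  interpret ring R by fact
  interpret F: left_module R "free_module R S" by (rule free_module_left_module)
  show ?case by simp
qed

lemma free_module_expand:
  assumes "ring R" and f: "f \<in> carrier (free_module R S)"
  shows "free_ext R (free_module R S) (basis_elt R) f = f"
proof
  interpret ring R by fact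
  interpret F: left_module R "free_module R S" by (rule free_module_left_module)
  fix t
  \<comment> \<open>Adding \<open>t\<close> to the support makes the sum contain the term at
    \<open>t\<close> even when \<open>f t\<close> is zero.\<close>
  let ?A = "insert t {s. f s \<noteq> \<zero>\<^bsub>R\<^esub>}"
  have "free_ext R (free_module R S) (basis_elt R) f t =
      (\<Oplus>\<^bsub>R\<^esub>s\<in>{s. f s \<noteq> \<zero>\<^bsub>R\<^esub>}. f s \<otimes>\<^bsub>R\<^esub> basis_elt R s t)"
    unfolding free_ext_def
    by (subst free_module_finsum[OF assms(1)])
      (use f in \<open>auto intro!: F.smult_closed simp del: free_module_simps(1),
        auto simp: basis_elt_def\<close>)
  also have "\<dots> = (\<Oplus>\<^bsub>R\<^esub>s\<in>?A. f s \<otimes>\<^bsub>R\<^esub> basis_elt R s t)"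
    by (rule finsum_mono_neutral[OF abelian_monoid_axioms]) (use f in \<open>auto simp: basis_elt_def\<close>)
  also have "\<dots> = f t \<otimes>\<^bsub>R\<^esub> basis_elt R t t"
    by (rule finsum_single[OF abelian_monoid_axioms]) (use f in \<open>auto simp: basis_elt_def\<close>)
  finally show "free_ext R (free_module R S) (basis_elt R) f t = f t"
    using f by (simp add: basis_elt_def)
qed

lemma free_hom_expand:
  assumes "left_module R N" and h: "h \<in> module_hom R (free_module R S) N"
    and f: "f \<in> carrier (free_module R S)"
  shows "h f = free_ext R N (\<lambda>s. h (basis_elt R s)) f"
proof -
  interpret N: left_module R N by fact
  interpret F: left_module R "free_module R S" by (rule N.R.free_module_left_module)
  interpret h: left_module_hom R "free_module R S" N h
    using h by (intro left_module_homI) unfold_locales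
  have "h f = h (free_ext R (free_module R S) (basis_elt R) f)"
    by (simp only: free_module_expand[OF N.R.ring_axioms f])
  also have "\<dots> = free_ext R N (\<lambda>s. h (basis_elt R s)) f"
    unfolding free_ext_def
  proof (subst h.finsum)
    have S: "s \<in> S" "f s \<in> carrier R" if "f s \<noteq> \<zero>\<^bsub>R\<^esub>" for s using f that by auto
    show "(\<lambda>s. f s \<odot>\<^bsub>free_module R S\<^esub> basis_elt R s) \<in>
        {s. f s \<noteq> \<zero>\<^bsub>R\<^esub>} \<rightarrow> carrier (free_module R S)"
      using S by (blast intro: F.smult_closed N.R.basis_elt_closed)
    show "(\<Oplus>\<^bsub>N\<^esub>i\<in>{s. f s \<noteq> \<zero>\<^bsub>R\<^esub>}. h (f i \<odot>\<^bsub>free_module R S\<^esub> basis_elt R i)) =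
        (\<Oplus>\<^bsub>N\<^esub>s\<in>{s. f s \<noteq> \<zero>\<^bsub>R\<^esub>}. f s \<odot>\<^bsub>N\<^esub> h (basis_elt R s))"
      using S by (intro N.M.finsum_cong')
        (blast intro: N.smult_closed N.R.basis_elt_closed h.closed h.smult)+
  qed
  finally show ?thesis .
qed

lemma free_hom_eqI:
  assumes "left_module R N" "h \<in> module_hom R (free_module R S) N"
    "h' \<in> module_hom R (free_module R S) N" "f \<in> carrier (free_module R S)"
    "\<And>s. s \<in> S \<Longrightarrow> h (basis_elt R s) = h' (basis_elt R s)"
  shows "h f = h' f"
proof -
  interpret N: left_module R N by fact
  have S: "s \<in> S" "f s \<in> carrier R" if "f s \<noteq> \<zero>\<^bsub>R\<^esub>" for s using assms(4) that by auto
  have "free_ext R N (\<lambda>s. h (basis_elt R s)) f = free_ext R N (\<lambda>s. h' (basis_elt R s)) f"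
    unfolding free_ext_def
    using S by (intro N.M.finsum_cong')
      (auto simp: assms(5) intro!: N.smult_closed module_hom_in[OF assms(3)] N.R.basis_elt_closed
        simp del: free_module_simps)
  then show ?thesis using free_hom_expand assms by metis
qed

section \<open>Submodules and quotients\<close>

locale left_submodule = left_module R M
  for R :: "('r, 'z) ring_scheme" (structure) and M :: "('r, 'm) module" and I +
  assumes subset: "I \<subseteq> carrier M"
    and zero_in [simp]: "\<zero>\<^bsub>M\<^esub> \<in> I"
    and add_in: "x \<in> I \<Longrightarrow> y \<in> I \<Longrightarrow> x \<oplus>\<^bsub>M\<^esub> y \<in> I"
    and smult_in: "r \<in> carrier R \<Longrightarrow> x \<in> I \<Longrightarrow> r \<odot>\<^bsub>M\<^esub> x \<in> I"

lemma quotient_module_simps [simp]: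
  "carrier (quotient_module M I) = a_rcosets\<^bsub>M\<^esub> I"
  "\<zero>\<^bsub>quotient_module M I\<^esub> = I"
  "\<one>\<^bsub>quotient_module M I\<^esub> = I +>\<^bsub>M\<^esub> \<one>\<^bsub>M\<^esub>"
  "X \<oplus>\<^bsub>quotient_module M I\<^esub> Y = X <+>\<^bsub>M\<^esub> Y"
  "X \<otimes>\<^bsub>quotient_module M I\<^esub> Y = rcoset_mult M I X Y"
  "r \<odot>\<^bsub>quotient_module M I\<^esub> X = (\<Union>x\<in>X. I +>\<^bsub>M\<^esub> (r \<odot>\<^bsub>M\<^esub> x))"
  by (simp_all add: quotient_module_def)

context left_submodule
begin

lemma minus_in: "x \<in> I \<Longrightarrow> \<ominus>\<^bsub>M\<^esub> x \<in> I"
  using smult_in[of "\<ominus> \<one>" x] smult_l_minus[of \<one> x] subset by (auto simp: smult_one subset_iff)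

lemma diff_in: "x \<in> I \<Longrightarrow> y \<in> I \<Longrightarrow> x \<ominus>\<^bsub>M\<^esub> y \<in> I"
  by (simp add: M.minus_eq add_in minus_in)

lemma abelian_subgroup: "abelian_subgroup I M"
proof (rule abelian_subgroupI3)
  show "additive_subgroup I M"
    by (rule additive_subgroupI, rule group.subgroupI)
      (use subset minus_in add_in zero_in in \<open>auto simp: M.a_group a_inv_def simp del: zero_in\<close>)
qed (rule M.abelian_group_axioms)

lemma coset_eq_iff:
  assumes "x \<in> carrier M" "y \<in> carrier M"
  shows "I +>\<^bsub>M\<^esub> x = I +>\<^bsub>M\<^esub> y \<longleftrightarrow> x \<ominus>\<^bsub>M\<^esub> y \<in> I"
proof -
  interpret I: abelian_subgroup I M by (rule abelian_subgroup)
  have "x \<in> I +>\<^bsub>M\<^esub> y \<longleftrightarrow> x \<ominus>\<^bsub>M\<^esub> y \<in> I"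
    using assms I.a_rcos_module[of y x] by (simp add: M.minus_eq)
  then show ?thesis
    using assms I.a_repr_independence' I.a_rcos_self[of x] by metis
qed

lemma coset_self: "x \<in> carrier M \<Longrightarrow> x \<in> I +>\<^bsub>M\<^esub> x"
  using abelian_subgroup by (rule abelian_subgroup.a_rcos_self)

lemma in_coset:
  assumes "x \<in> carrier M" "y \<in> I +>\<^bsub>M\<^esub> x"
  shows "y \<in> carrier M" "y \<ominus>\<^bsub>M\<^esub> x \<in> I" "I +>\<^bsub>M\<^esub> y = I +>\<^bsub>M\<^esub> x"
proof -
  interpret I: abelian_subgroup I M by (rule abelian_subgroup)
  show "y \<in> carrier M" using assms I.a_elemrcos_carrier by blast
  show eq: "I +>\<^bsub>M\<^esub> y = I +>\<^bsub>M\<^esub> x" using assms I.a_repr_independence' by auto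
  show "y \<ominus>\<^bsub>M\<^esub> x \<in> I" using eq coset_eq_iff[OF \<open>y \<in> carrier M\<close> assms(1)] by simp
qed

lemma coset_zero: "I +>\<^bsub>M\<^esub> \<zero>\<^bsub>M\<^esub> = I"
  using subset by (intro M.a_coset_add_zero)

lemma coset_eq_zero_iff: "x \<in> carrier M \<Longrightarrow> I +>\<^bsub>M\<^esub> x = I \<longleftrightarrow> x \<in> I"
  using coset_eq_iff[of x "\<zero>\<^bsub>M\<^esub>"] M.add.inv_one
  by (simp add: coset_zero M.minus_eq a_inv_def)

lemma coset_add:
  "x \<in> carrier M \<Longrightarrow> y \<in> carrier M \<Longrightarrow> (I +>\<^bsub>M\<^esub> x) <+>\<^bsub>M\<^esub> (I +>\<^bsub>M\<^esub> y) = I +>\<^bsub>M\<^esub> (x \<oplus>\<^bsub>M\<^esub> y)"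
  using abelian_subgroup by (rule abelian_subgroup.a_rcos_sum)

lemma coset_smult:
  assumes "r \<in> carrier R" "x \<in> carrier M"
  shows "(\<Union>y\<in>I +>\<^bsub>M\<^esub> x. I +>\<^bsub>M\<^esub> (r \<odot>\<^bsub>M\<^esub> y)) = I +>\<^bsub>M\<^esub> (r \<odot>\<^bsub>M\<^esub> x)"
proof -
  have "I +>\<^bsub>M\<^esub> (r \<odot>\<^bsub>M\<^esub> y) = I +>\<^bsub>M\<^esub> (r \<odot>\<^bsub>M\<^esub> x)" if y: "y \<in> I +>\<^bsub>M\<^esub> x" for y
  proof -
    have "r \<odot>\<^bsub>M\<^esub> (y \<ominus>\<^bsub>M\<^esub> x) \<in> I" using in_coset[OF assms(2) y] assms by (intro smult_in)
    then show ?thesis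
      using in_coset[OF assms(2) y] assms
      by (simp add: coset_eq_iff smult_closed M.minus_eq smult_r_distr smult_r_minus)
  qed
  then show ?thesis using coset_self[OF assms(2)] by blast
qed

lemma carrier_quotient: "carrier (quotient_module M I) = (\<lambda>x. I +>\<^bsub>M\<^esub> x) ` carrier M"
  by (auto simp: A_RCOSETS_def')

lemma quotient_left_module: "left_module R (quotient_module M I)"
  by (rule left_module_image[where p = "\<lambda>x. I +>\<^bsub>M\<^esub> x", OF carrier_quotient[symmetric]])
    (simp_all add: coset_add coset_smult coset_zero del: UN_simps)

lemma coset_hom: "(\<lambda>x. I +>\<^bsub>M\<^esub> x) \<in> module_hom R M (quotient_module M I)"
  by (rule module_homI) (simp_all add: coset_add coset_smult M.a_rcosetsI[OF subset] del: UN_simps)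

text \<open>Two members of a coset differ by an element of \<open>I\<close>, which \<open>f\<close>
  kills. The image being a singleton is what gives \<open>the_elem\<close> a meaning.\<close>

lemma hom_image_coset:
  assumes N: "left_module R N" and f: "f \<in> module_hom R M N" "\<And>x. x \<in> I \<Longrightarrow> f x = \<zero>\<^bsub>N\<^esub>"
    and x: "x \<in> carrier M"
  shows "f ` (I +>\<^bsub>M\<^esub> x) = {f x}"
proof -
  interpret f: left_module_hom R M N f by (rule left_module_homI[OF left_module_axioms N f(1)])
  have "f y = f x" if y: "y \<in> I +>\<^bsub>M\<^esub> x" for y
  proof -
    have "f y \<ominus>\<^bsub>N\<^esub> f x = \<zero>\<^bsub>N\<^esub>"
      using in_coset[OF x y] x f(2) f.diff by metis
    then show ?thesis using in_coset[OF x y] x by simp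
  qed
  then show ?thesis using coset_self[OF x] by blast
qed

text \<open>The universal property of the quotient, with the induced map written through
  \<open>the_elem\<close> as in the definitions of the enveloping actions.\<close>

lemma the_elem_hom:
  assumes N: "left_module R N" and f: "f \<in> module_hom R M N" "\<And>x. x \<in> I \<Longrightarrow> f x = \<zero>\<^bsub>N\<^esub>"
  shows "(\<lambda>X. the_elem (f ` X)) \<in> module_hom R (quotient_module M I) N"
    and "x \<in> carrier M \<Longrightarrow> the_elem (f ` (I +>\<^bsub>M\<^esub> x)) = f x"
proof -
  note im = hom_image_coset[OF N f, simplified]
  interpret f: left_module_hom R M N f by (rule left_module_homI[OF left_module_axioms N f(1)])
  show "(\<lambda>X. the_elem (f ` X)) \<in> module_hom R (quotient_module M I) N"
  proof (rule module_homI)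
    fix X assume "X \<in> carrier (quotient_module M I)"
    then obtain x where x: "X = I +>\<^bsub>M\<^esub> x" "x \<in> carrier M" unfolding carrier_quotient by blast
    then show "the_elem (f ` X) \<in> carrier N" by (simp add: im)
    fix r assume r: "r \<in> carrier R"
    have "r \<odot>\<^bsub>quotient_module M I\<^esub> X = I +>\<^bsub>M\<^esub> (r \<odot>\<^bsub>M\<^esub> x)"
      using coset_smult r x by simp
    then show "the_elem (f ` (r \<odot>\<^bsub>quotient_module M I\<^esub> X)) = r \<odot>\<^bsub>N\<^esub> the_elem (f ` X)"
      using r x im f.smult smult_closed by simp
  next
    fix X Y assume "X \<in> carrier (quotient_module M I)" "Y \<in> carrier (quotient_module M I)"
    then obtain x y where x: "X = I +>\<^bsub>M\<^esub> x" "x \<in> carrier M" "Y = I +>\<^bsub>M\<^esub> y" "y \<in> carrier M"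
      unfolding carrier_quotient by blast
    then show "the_elem (f ` (X \<oplus>\<^bsub>quotient_module M I\<^esub> Y)) =
        the_elem (f ` X) \<oplus>\<^bsub>N\<^esub> the_elem (f ` Y)"
      by (simp add: im coset_add f.add)
  qed
  show "x \<in> carrier M \<Longrightarrow> the_elem (f ` (I +>\<^bsub>M\<^esub> x)) = f x" by (simp add: im)
qed

text \<open>Submodules appear here as carrier updates because \<open>homology\<close> passes to the
  cycles in that way.\<close>

lemma restrict_left_module: "left_module R (M\<lparr>carrier := I\<rparr>)"
proof (rule left_moduleI)
  show "abelian_group (M\<lparr>carrier := I\<rparr>)"
  proof (rule abelian_groupI)
    fix x assume "x \<in> carrier (M\<lparr>carrier := I\<rparr>)"
    then show "\<exists>y\<in>carrier (M\<lparr>carrier := I\<rparr>). y \<oplus>\<^bsub>M\<lparr>carrier := I\<rparr>\<^esub> x = \<zero>\<^bsub>M\<lparr>carrier := I\<rparr>\<^esub>"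
      using subset by (intro bexI[of _ "\<ominus>\<^bsub>M\<^esub> x"]) (auto simp: M.l_neg minus_in)
  qed (use subset in \<open>auto simp: add_in M.a_ac subset_iff\<close>)
qed (use subset in \<open>auto simp: smult_in smult_l_distr smult_r_distr smult_assoc smult_one subset_iff
    R.ring_axioms\<close>)

end

lemma kernel_submodule:
  assumes "left_module R M" "left_module R N" "f \<in> module_hom R M N"
  shows "left_submodule R M {x \<in> carrier M. f x = \<zero>\<^bsub>N\<^esub>}"
proof -
  interpret f: left_module_hom R M N f using assms by (rule left_module_homI)
  show ?thesis
    by unfold_locales (auto simp: f.add f.smult f.M.smult_closed)
qed

lemma image_submodule:
  assumes "left_module R M" "left_module R N" "f \<in> module_hom R M N"
  shows "left_submodule R N (f ` carrier M)"
proof -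
  interpret f: left_module_hom R M N f using assms by (rule left_module_homI)
  show ?thesis
  proof unfold_locales
    show "\<zero>\<^bsub>N\<^esub> \<in> f ` carrier M" using f.zero by (metis f.M.M.zero_closed imageI)
    show "x \<oplus>\<^bsub>N\<^esub> y \<in> f ` carrier M" if "x \<in> f ` carrier M" "y \<in> f ` carrier M" for x y
      using that f.add by (metis (no_types, lifting) f.M.M.a_closed image_iff)
    show "r \<odot>\<^bsub>N\<^esub> y \<in> f ` carrier M" if "r \<in> carrier R" "y \<in> f ` carrier M" for r y
      using that f.smult by (metis (no_types, lifting) f.M.smult_closed image_iff)
  qed auto
qed

text \<open>The bridge to the library locale over a commutative base, through which spans and
  dimensions become available.\<close>

lemma left_module_imp_module:
  assumes "cring K" "left_module K V" shows "module K V"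
proof -
  interpret left_module K V by fact
  show ?thesis
    using assms(1) by (intro moduleI) (auto simp: M.abelian_group_axioms smult_closed smult_l_distr
        smult_r_distr smult_assoc smult_one)
qed

section \<open>Tensor products\<close>

text \<open>Only closure conditions are required. \<open>M\<close> stands for a right module, for
  which \<open>left_module\<close> would assert associativity in the wrong order, and the quotient
  makes sense without further axioms.\<close>

locale tensor = K?: cring K for K :: "('k, 'z) ring_scheme" (structure) +
  fixes R :: "('k, 'r) module" and M :: "('r, 'm) module" and N :: "('r, 'n) module"
  assumes scalar_closed: "c \<in> carrier K \<Longrightarrow> c \<odot>\<^bsub>R\<^esub> \<one>\<^bsub>R\<^esub> \<in> carrier R"
    and M_add_closed: "x \<in> carrier M \<Longrightarrow> x' \<in> carrier M \<Longrightarrow> x \<oplus>\<^bsub>M\<^esub> x' \<in> carrier M"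
    and N_add_closed: "y \<in> carrier N \<Longrightarrow> y' \<in> carrier N \<Longrightarrow> y \<oplus>\<^bsub>N\<^esub> y' \<in> carrier N"
    and M_smult_closed: "r \<in> carrier R \<Longrightarrow> x \<in> carrier M \<Longrightarrow> r \<odot>\<^bsub>M\<^esub> x \<in> carrier M"
    and N_smult_closed: "r \<in> carrier R \<Longrightarrow> y \<in> carrier N \<Longrightarrow> r \<odot>\<^bsub>N\<^esub> y \<in> carrier N"
begin

abbreviation "F \<equiv> pairs_module K M N"
abbreviation "T \<equiv> tensor_product K R M N"
abbreviation "I \<equiv> tensor_kernel K R M N"

definition pure :: "'m \<Rightarrow> 'n \<Rightarrow> ('m \<times> 'n \<Rightarrow> 'k) set" where
  "pure x y = I +>\<^bsub>F\<^esub> basis_elt K (x, y)"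

lemma F_module: "left_module K F"
  by (rule free_module_left_module)

lemma basis_elt_F: "x \<in> carrier M \<Longrightarrow> y \<in> carrier N \<Longrightarrow> basis_elt K (x, y) \<in> carrier F"
  by (rule basis_elt_closed) simp

lemma relations_cases:
  assumes "g \<in> tensor_relations K R M N"
  obtains
    x x' y where "x \<in> carrier M" "x' \<in> carrier M" "y \<in> carrier N"
      "g = basis_elt K (x \<oplus>\<^bsub>M\<^esub> x', y) \<ominus>\<^bsub>F\<^esub> (basis_elt K (x, y) \<oplus>\<^bsub>F\<^esub> basis_elt K (x', y))"
  | x y y' where "x \<in> carrier M" "y \<in> carrier N" "y' \<in> carrier N"
      "g = basis_elt K (x, y \<oplus>\<^bsub>N\<^esub> y') \<ominus>\<^bsub>F\<^esub> (basis_elt K (x, y) \<oplus>\<^bsub>F\<^esub> basis_elt K (x, y'))"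
  | r x y where "r \<in> carrier R" "x \<in> carrier M" "y \<in> carrier N"
      "g = basis_elt K (r \<odot>\<^bsub>M\<^esub> x, y) \<ominus>\<^bsub>F\<^esub> basis_elt K (x, r \<odot>\<^bsub>N\<^esub> y)"
  | c x y where "c \<in> carrier K" "x \<in> carrier M" "y \<in> carrier N"
      "g = c \<odot>\<^bsub>F\<^esub> basis_elt K (x, y) \<ominus>\<^bsub>F\<^esub> basis_elt K ((c \<odot>\<^bsub>R\<^esub> \<one>\<^bsub>R\<^esub>) \<odot>\<^bsub>M\<^esub> x, y)"
  using assms unfolding tensor_relations_def Let_def by blast

lemma relations_intros:
  "x \<in> carrier M \<Longrightarrow> x' \<in> carrier M \<Longrightarrow> y \<in> carrier N \<Longrightarrow>
    basis_elt K (x \<oplus>\<^bsub>M\<^esub> x', y) \<ominus>\<^bsub>F\<^esub> (basis_elt K (x, y) \<oplus>\<^bsub>F\<^esub> basis_elt K (x', y))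
    \<in> tensor_relations K R M N"
  "x \<in> carrier M \<Longrightarrow> y \<in> carrier N \<Longrightarrow> y' \<in> carrier N \<Longrightarrow>
    basis_elt K (x, y \<oplus>\<^bsub>N\<^esub> y') \<ominus>\<^bsub>F\<^esub> (basis_elt K (x, y) \<oplus>\<^bsub>F\<^esub> basis_elt K (x, y'))
    \<in> tensor_relations K R M N"
  "r \<in> carrier R \<Longrightarrow> x \<in> carrier M \<Longrightarrow> y \<in> carrier N \<Longrightarrow>
    basis_elt K (r \<odot>\<^bsub>M\<^esub> x, y) \<ominus>\<^bsub>F\<^esub> basis_elt K (x, r \<odot>\<^bsub>N\<^esub> y) \<in> tensor_relations K R M N"
  "c \<in> carrier K \<Longrightarrow> x \<in> carrier M \<Longrightarrow> y \<in> carrier N \<Longrightarrow>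
    c \<odot>\<^bsub>F\<^esub> basis_elt K (x, y) \<ominus>\<^bsub>F\<^esub> basis_elt K ((c \<odot>\<^bsub>R\<^esub> \<one>\<^bsub>R\<^esub>) \<odot>\<^bsub>M\<^esub> x, y)
    \<in> tensor_relations K R M N"
  unfolding tensor_relations_def Let_def by blast+

lemma relations_subset: "tensor_relations K R M N \<subseteq> carrier F"
proof
  interpret F: left_module K F by (rule F_module)
  fix g assume "g \<in> tensor_relations K R M N"
  then show "g \<in> carrier F"
    by (cases rule: relations_cases)
      (simp_all del: free_module_simps add: F.M.minus_closed F.M.a_closed F.smult_closed
        basis_elt_F M_add_closed N_add_closed M_smult_closed N_smult_closed scalar_closed)
qed

lemma I_submodule: "left_submodule K F I"
proof -
  interpret F: left_module K F by (rule F_module)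
  interpret FM: module K F
    using K.cring_axioms F_module by (rule left_module_imp_module)
  have "submodule K I F"
    unfolding tensor_kernel_def by (rule FM.span_is_submodule[OF relations_subset])
  then show ?thesis
    unfolding submodule_def by unfold_locales auto
qed

lemma relations_in_I: "tensor_relations K R M N \<subseteq> I"
proof -
  interpret FM: module K F
    using K.cring_axioms F_module by (rule left_module_imp_module)
  show ?thesis unfolding tensor_kernel_def by (rule FM.in_own_span[OF relations_subset])
qed

lemma I_least:
  assumes "left_submodule K F J" "tensor_relations K R M N \<subseteq> J"
  shows "I \<subseteq> J"
proof -
  interpret J: left_submodule K F J by fact
  interpret FM: module K F
    using K.cring_axioms F_module by (rule left_module_imp_module)
  have "submodule K J F"
    unfolding submodule_def using J.subset J.zero_in J.add_in J.smult_in FM.module_axioms by auto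
  then show ?thesis unfolding tensor_kernel_def using assms(2) by (intro FM.span_is_subset)
qed

lemma T_module: "left_module K T"
  unfolding tensor_product_def using I_submodule by (rule left_submodule.quotient_left_module)

lemma coset_hom_T: "(\<lambda>g. I +>\<^bsub>F\<^esub> g) \<in> module_hom K F T"
  unfolding tensor_product_def using I_submodule by (rule left_submodule.coset_hom)

lemma carrier_T: "carrier T = (\<lambda>g. I +>\<^bsub>F\<^esub> g) ` carrier F"
  unfolding tensor_product_def using I_submodule by (rule left_submodule.carrier_quotient)

lemma zero_T: "\<zero>\<^bsub>T\<^esub> = I"
  unfolding tensor_product_def by simp

lemma pure_closed: "x \<in> carrier M \<Longrightarrow> y \<in> carrier N \<Longrightarrow> pure x y \<in> carrier T"
  unfolding pure_def by (rule module_hom_in[OF coset_hom_T basis_elt_F])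

lemma pure_relations:
  "x \<in> carrier M \<Longrightarrow> x' \<in> carrier M \<Longrightarrow> y \<in> carrier N \<Longrightarrow>
    pure (x \<oplus>\<^bsub>M\<^esub> x') y = pure x y \<oplus>\<^bsub>T\<^esub> pure x' y"
  "x \<in> carrier M \<Longrightarrow> y \<in> carrier N \<Longrightarrow> y' \<in> carrier N \<Longrightarrow>
    pure x (y \<oplus>\<^bsub>N\<^esub> y') = pure x y \<oplus>\<^bsub>T\<^esub> pure x y'"
  "r \<in> carrier R \<Longrightarrow> x \<in> carrier M \<Longrightarrow> y \<in> carrier N \<Longrightarrow>
    pure (r \<odot>\<^bsub>M\<^esub> x) y = pure x (r \<odot>\<^bsub>N\<^esub> y)"
  "c \<in> carrier K \<Longrightarrow> x \<in> carrier M \<Longrightarrow> y \<in> carrier N \<Longrightarrow>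
    c \<odot>\<^bsub>T\<^esub> pure x y = pure ((c \<odot>\<^bsub>R\<^esub> \<one>\<^bsub>R\<^esub>) \<odot>\<^bsub>M\<^esub> x) y"
proof -
  interpret I: left_submodule K F I by (rule I_submodule)
  interpret h: left_module_hom K F T "\<lambda>g. I +>\<^bsub>F\<^esub> g"
    by (rule left_module_homI[OF F_module T_module coset_hom_T])
  note [simp del] = free_module_simps
  note [simp] = basis_elt_F M_add_closed N_add_closed M_smult_closed N_smult_closed scalar_closed
  note rel = relations_intros[THEN subsetD[OF relations_in_I]]
  show "pure (x \<oplus>\<^bsub>M\<^esub> x') y = pure x y \<oplus>\<^bsub>T\<^esub> pure x' y"
    if "x \<in> carrier M" "x' \<in> carrier M" "y \<in> carrier N" for x x' y
    unfolding pure_def using that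
    by (subst h.add[symmetric], simp, simp, subst I.coset_eq_iff) (simp_all add: rel)
  show "pure x (y \<oplus>\<^bsub>N\<^esub> y') = pure x y \<oplus>\<^bsub>T\<^esub> pure x y'"
    if "x \<in> carrier M" "y \<in> carrier N" "y' \<in> carrier N" for x y y'
    unfolding pure_def using that
    by (subst h.add[symmetric], simp, simp, subst I.coset_eq_iff) (simp_all add: rel)
  show "pure (r \<odot>\<^bsub>M\<^esub> x) y = pure x (r \<odot>\<^bsub>N\<^esub> y)"
    if "r \<in> carrier R" "x \<in> carrier M" "y \<in> carrier N" for r x y
    unfolding pure_def using that
    by (subst I.coset_eq_iff) (simp_all add: rel)
  show "c \<odot>\<^bsub>T\<^esub> pure x y = pure ((c \<odot>\<^bsub>R\<^esub> \<one>\<^bsub>R\<^esub>) \<odot>\<^bsub>M\<^esub> x) y"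
    if "c \<in> carrier K" "x \<in> carrier M" "y \<in> carrier N" for c x y
    unfolding pure_def using that
    by (subst h.smult[symmetric], simp, simp, subst I.coset_eq_iff)
      (simp_all add: rel I.smult_closed)
qed

text \<open>Composing with the quotient map reduces the claim to linear maps on the free module of
  pairs, whose basis elements become the pure tensors.\<close>

lemma hom_eqI:
  assumes "left_module K V" "f \<in> module_hom K T V" "g \<in> module_hom K T V" "t \<in> carrier T"
    "\<And>x y. x \<in> carrier M \<Longrightarrow> y \<in> carrier N \<Longrightarrow> f (pure x y) = g (pure x y)"
  shows "f t = g t"
proof -
  obtain a where a: "a \<in> carrier F" "t = I +>\<^bsub>F\<^esub> a" using assms(4) unfolding carrier_T by blast
  have "f (I +>\<^bsub>F\<^esub> a) = g (I +>\<^bsub>F\<^esub> a)"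
    by (rule free_hom_eqI[OF assms(1) module_hom_comp[OF coset_hom_T assms(2)]
        module_hom_comp[OF coset_hom_T assms(3)] a(1)]) (use assms(5) in \<open>auto simp: pure_def\<close>)
  then show ?thesis using a by simp
qed

text \<open>The kernel of \<open>f\<close> is a submodule that contains the four families of
  relations, hence also their span. The map is arbitrary here, not a \<open>free_ext\<close>, so
  that the lemma also applies to multiplication by a fixed element followed by the quotient
  map.\<close>

lemma kills_kernel:
  assumes V: "left_module K V" and f: "f \<in> module_hom K F V"
    and bal:
    "\<And>x x' y. x \<in> carrier M \<Longrightarrow> x' \<in> carrier M \<Longrightarrow> y \<in> carrier N \<Longrightarrow>
      f (basis_elt K (x \<oplus>\<^bsub>M\<^esub> x', y)) = f (basis_elt K (x, y)) \<oplus>\<^bsub>V\<^esub> f (basis_elt K (x', y))"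
    "\<And>x y y'. x \<in> carrier M \<Longrightarrow> y \<in> carrier N \<Longrightarrow> y' \<in> carrier N \<Longrightarrow>
      f (basis_elt K (x, y \<oplus>\<^bsub>N\<^esub> y')) = f (basis_elt K (x, y)) \<oplus>\<^bsub>V\<^esub> f (basis_elt K (x, y'))"
    "\<And>r x y. r \<in> carrier R \<Longrightarrow> x \<in> carrier M \<Longrightarrow> y \<in> carrier N \<Longrightarrow>
      f (basis_elt K (r \<odot>\<^bsub>M\<^esub> x, y)) = f (basis_elt K (x, r \<odot>\<^bsub>N\<^esub> y))"
    "\<And>c x y. c \<in> carrier K \<Longrightarrow> x \<in> carrier M \<Longrightarrow> y \<in> carrier N \<Longrightarrow>
      c \<odot>\<^bsub>V\<^esub> f (basis_elt K (x, y)) = f (basis_elt K ((c \<odot>\<^bsub>R\<^esub> \<one>\<^bsub>R\<^esub>) \<odot>\<^bsub>M\<^esub> x, y))"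
    and g: "g \<in> I"
  shows "f g = \<zero>\<^bsub>V\<^esub>"
proof -
  interpret f: left_module_hom K F V f by (rule left_module_homI[OF F_module V f])
  note [simp del] = free_module_simps
  note [simp] = basis_elt_F M_add_closed N_add_closed M_smult_closed N_smult_closed scalar_closed
  have "I \<subseteq> {g \<in> carrier F. f g = \<zero>\<^bsub>V\<^esub>}"
  proof (rule I_least)
    show "left_submodule K F {g \<in> carrier F. f g = \<zero>\<^bsub>V\<^esub>}"
      by (rule kernel_submodule[OF F_module V f])
    show "tensor_relations K R M N \<subseteq> {g \<in> carrier F. f g = \<zero>\<^bsub>V\<^esub>}"
    proof
      fix g assume g: "g \<in> tensor_relations K R M N"
      have "f g = \<zero>\<^bsub>V\<^esub>"
        using g by (cases rule: relations_cases)
          (simp_all add: f.diff f.add f.smult f.M.smult_closed bal f.N.M.r_neg f.N.M.minus_eq f.N.smult_closed)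
      then show "g \<in> {g \<in> carrier F. f g = \<zero>\<^bsub>V\<^esub>}" using g relations_subset by blast
    qed
  qed
  then show ?thesis using g by blast
qed

text \<open>The \<open>the_elem\<close> form matches the scalar multiplications of the enveloping
  modules. It has its intended meaning only for balanced \<open>\<phi>\<close>.\<close>

definition lift :: "('k, 'v) module \<Rightarrow> ('m \<Rightarrow> 'n \<Rightarrow> 'v) \<Rightarrow> ('m \<times> 'n \<Rightarrow> 'k) set \<Rightarrow> 'v" where
  "lift V \<phi> X = the_elem (free_ext K V (\<lambda>(x, y). \<phi> x y) ` X)"

text \<open>The third conclusion is kept because \<open>tensor_map\<close> is a union over all
  representatives of a coset and needs the values at each of them.\<close>

lemma lift:
  assumes V: "left_module K V" and \<phi>: "\<And>x y. x \<in> carrier M \<Longrightarrow> y \<in> carrier N \<Longrightarrow> \<phi> x y \<in> carrier V"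
    and bal:
    "\<And>x x' y. x \<in> carrier M \<Longrightarrow> x' \<in> carrier M \<Longrightarrow> y \<in> carrier N \<Longrightarrow> \<phi> (x \<oplus>\<^bsub>M\<^esub> x') y = \<phi> x y \<oplus>\<^bsub>V\<^esub> \<phi> x' y"
    "\<And>x y y'. x \<in> carrier M \<Longrightarrow> y \<in> carrier N \<Longrightarrow> y' \<in> carrier N \<Longrightarrow> \<phi> x (y \<oplus>\<^bsub>N\<^esub> y') = \<phi> x y \<oplus>\<^bsub>V\<^esub> \<phi> x y'"
    "\<And>r x y. r \<in> carrier R \<Longrightarrow> x \<in> carrier M \<Longrightarrow> y \<in> carrier N \<Longrightarrow> \<phi> (r \<odot>\<^bsub>M\<^esub> x) y = \<phi> x (r \<odot>\<^bsub>N\<^esub> y)"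
    "\<And>c x y. c \<in> carrier K \<Longrightarrow> x \<in> carrier M \<Longrightarrow> y \<in> carrier N \<Longrightarrow>
      c \<odot>\<^bsub>V\<^esub> \<phi> x y = \<phi> ((c \<odot>\<^bsub>R\<^esub> \<one>\<^bsub>R\<^esub>) \<odot>\<^bsub>M\<^esub> x) y"
  shows "lift V \<phi> \<in> module_hom K T V"
    and "\<And>x y. x \<in> carrier M \<Longrightarrow> y \<in> carrier N \<Longrightarrow> lift V \<phi> (pure x y) = \<phi> x y"
    and "\<And>g. g \<in> carrier F \<Longrightarrow>
      free_ext K V (\<lambda>(x, y). \<phi> x y) ` (I +>\<^bsub>F\<^esub> g) = {free_ext K V (\<lambda>(x, y). \<phi> x y) g}"
proof -
  interpret V: left_module K V by fact
  interpret I: left_submodule K F I by (rule I_submodule)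
  let ?f = "free_ext K V (\<lambda>(x, y). \<phi> x y)"
  have f: "?f \<in> module_hom K F V" by (rule V.free_ext_hom) (use \<phi> in auto)
  have fb: "?f (basis_elt K (x, y)) = \<phi> x y" if "x \<in> carrier M" "y \<in> carrier N" for x y
    using V.free_ext_basis[of "\<lambda>(x, y). \<phi> x y" "(x, y)"] \<phi> that by simp
  note [simp] = M_add_closed N_add_closed M_smult_closed N_smult_closed scalar_closed
  have ker: "?f g = \<zero>\<^bsub>V\<^esub>" if "g \<in> I" for g
    by (rule kills_kernel[OF V f _ _ _ _ that]) (simp_all add: fb bal)
  show "lift V \<phi> \<in> module_hom K T V"
    unfolding lift_def tensor_product_def using V f ker by (rule I.the_elem_hom(1))
  show "lift V \<phi> (pure x y) = \<phi> x y" if "x \<in> carrier M" "y \<in> carrier N" for x y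
    unfolding lift_def pure_def using I.the_elem_hom(2)[OF V f ker basis_elt_F] that fb by simp
  show "?f ` (I +>\<^bsub>F\<^esub> g) = {?f g}" if "g \<in> carrier F" for g
    using V f ker that by (rule I.hom_image_coset)
qed

end

text \<open>Grouping the linear extension of \<open>(x, y)\<close> to \<open>(x, h y)\<close> by the
  fibres of \<open>h\<close> gives the defining sum. In this form linearity comes from
  \<open>free_ext_hom\<close>.\<close>

lemma pushforward_eq:
  fixes M :: "('r, 'm) module" and N :: "('s, 'n) module" and N' :: "('s, 'p) module"
  assumes "cring K" and g: "g \<in> carrier (pairs_module K M N)"
    and h: "\<And>y. y \<in> carrier N \<Longrightarrow> h y \<in> carrier N'"
  shows "pushforward K h g =
    free_ext K (pairs_module K M N') (\<lambda>(x, y). basis_elt K (x, h y)) g"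
proof
  interpret cring K by fact
  interpret F': left_module K "pairs_module K M N'" by (rule free_module_left_module)
  fix q :: "'m \<times> 'p" obtain u z where q: "q = (u, z)" by (cases q)
  let ?S = "{p. g p \<noteq> \<zero>\<^bsub>K\<^esub>}"
  have S: "finite ?S" "\<And>x y. g (x, y) \<noteq> \<zero>\<^bsub>K\<^esub> \<Longrightarrow> x \<in> carrier M \<and> y \<in> carrier N"
    "\<And>p. g p \<in> carrier K" using g by auto
  let ?c = "\<lambda>p. g p \<otimes>\<^bsub>K\<^esub> (if u = fst p \<and> z = h (snd p) then \<one>\<^bsub>K\<^esub> else \<zero>\<^bsub>K\<^esub>)"
  have "free_ext K (pairs_module K M N') (\<lambda>(x, y). basis_elt K (x, h y)) g q =
      (\<Oplus>\<^bsub>K\<^esub>p\<in>?S. (g p \<odot>\<^bsub>pairs_module K M N'\<^esub> (case p of (x, y) \<Rightarrow> basis_elt K (x, h y))) q)"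
    unfolding free_ext_def
    by (rule free_module_finsum[OF ring_axioms])
      (use S h in \<open>auto intro!: F'.smult_closed basis_elt_closed simp del: free_module_simps\<close>)
  also have "\<dots> = (\<Oplus>\<^bsub>K\<^esub>p\<in>?S. ?c p)"
    by (intro finsum_cong') (use S in \<open>auto simp: basis_elt_def q split: prod.splits\<close>)
  also have "\<dots> = (\<Oplus>\<^bsub>K\<^esub>p\<in>Pair u ` {y. g (u, y) \<noteq> \<zero>\<^bsub>K\<^esub> \<and> h y = z}. ?c p)"
    by (rule finsum_mono_neutral[OF abelian_monoid_axioms, symmetric]) (use S in auto)
  also have "\<dots> = (\<Oplus>\<^bsub>K\<^esub>y\<in>{y. g (u, y) \<noteq> \<zero>\<^bsub>K\<^esub> \<and> h y = z}. ?c (u, y))"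
    by (rule add.finprod_reindex) (use S in \<open>auto simp: inj_on_def\<close>)
  also have "\<dots> = (\<Oplus>\<^bsub>K\<^esub>y\<in>{y. g (u, y) \<noteq> \<zero>\<^bsub>K\<^esub> \<and> h y = z}. g (u, y))"
    by (intro finsum_cong') (use S in auto)
  finally show "pushforward K h g q =
      free_ext K (pairs_module K M N') (\<lambda>(x, y). basis_elt K (x, h y)) g q"
    by (simp add: pushforward_def q)
qed

locale tensor_functor = N: tensor K R M N + N': tensor K R M N'
  for K :: "('k, 'z) ring_scheme" and R :: "('k, 'r) module" and M :: "('r, 'm) module"
    and N :: "('r, 'n) module" and N' :: "('r, 'p) module"
begin

text \<open>By definition \<open>tensor_map\<close> is a union of cosets, one for each
  representative. By \<open>pushforward_eq\<close> each coset is the value of one linear map at that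
  representative. This map vanishes on the tensor kernel, so all the cosets coincide and the union
  is the value of a \<open>lift\<close>.\<close>

lemma tensor_map:
  assumes h: "h \<in> module_hom R N N'"
  shows tensor_map_hom: "tensor_map K R M N' h \<in> module_hom K N.T N'.T"
    and tensor_map_pure: "x \<in> carrier M \<Longrightarrow> y \<in> carrier N \<Longrightarrow>
      tensor_map K R M N' h (N.pure x y) = N'.pure x (h y)"
proof -
  let ?\<phi> = "\<lambda>x y. N'.pure x (h y)"
  note [simp] = module_hom_in[OF h] module_hom_add[OF h] module_hom_smult[OF h] N'.pure_closed
  note [simp] = N.scalar_closed N.M_smult_closed N.N_smult_closed
  interpret T': left_module K N'.T by (rule N'.T_module)
  interpret F': left_module K N'.F by (rule N'.F_module)
  have c: "?\<phi> x y \<in> carrier N'.T" if "x \<in> carrier M" "y \<in> carrier N" for x y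
    using that by simp
  have b: "x \<in> carrier M \<Longrightarrow> x' \<in> carrier M \<Longrightarrow> y \<in> carrier N \<Longrightarrow> ?\<phi> (x \<oplus>\<^bsub>M\<^esub> x') y = ?\<phi> x y \<oplus>\<^bsub>N'.T\<^esub> ?\<phi> x' y"
    "x \<in> carrier M \<Longrightarrow> y \<in> carrier N \<Longrightarrow> y' \<in> carrier N \<Longrightarrow> ?\<phi> x (y \<oplus>\<^bsub>N\<^esub> y') = ?\<phi> x y \<oplus>\<^bsub>N'.T\<^esub> ?\<phi> x y'"
    "r \<in> carrier R \<Longrightarrow> x \<in> carrier M \<Longrightarrow> y \<in> carrier N \<Longrightarrow> ?\<phi> (r \<odot>\<^bsub>M\<^esub> x) y = ?\<phi> x (r \<odot>\<^bsub>N\<^esub> y)"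
    "a \<in> carrier K \<Longrightarrow> x \<in> carrier M \<Longrightarrow> y \<in> carrier N \<Longrightarrow>
      a \<odot>\<^bsub>N'.T\<^esub> ?\<phi> x y = ?\<phi> ((a \<odot>\<^bsub>R\<^esub> \<one>\<^bsub>R\<^esub>) \<odot>\<^bsub>M\<^esub> x) y" for x x' y y' r a
    by (simp_all add: N'.pure_relations)
  have L: "N.lift N'.T ?\<phi> \<in> module_hom K N.T N'.T"
    by (rule N.lift(1)[OF N'.T_module c b])
  have L2: "N.lift N'.T ?\<phi> (N.pure x y) = ?\<phi> x y" if "x \<in> carrier M" "y \<in> carrier N" for x y
    by (rule N.lift(2)[OF N'.T_module c b that])
  have L3: "free_ext K N'.T (\<lambda>(x, y). ?\<phi> x y) ` (N.I +>\<^bsub>N.F\<^esub> g) = {free_ext K N'.T (\<lambda>(x, y). ?\<phi> x y) g}"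
    if "g \<in> carrier N.F" for g
    by (rule N.lift(3)[OF N'.T_module c b that])
  have eq: "tensor_map K R M N' h X = N.lift N'.T ?\<phi> X" if "X \<in> carrier N.T" for X
  proof -
    obtain g where g: "g \<in> carrier N.F" "X = N.I +>\<^bsub>N.F\<^esub> g" using \<open>X \<in> _\<close> N.carrier_T by blast
    let ?c = "\<lambda>g. N'.I +>\<^bsub>N'.F\<^esub> g" and ?f = "free_ext K N'.T (\<lambda>(x, y). ?\<phi> x y)"
    have X: "a \<in> carrier N.F" if "a \<in> X" for a
      using left_submodule.in_coset(1)[OF N.I_submodule g(1)] that g(2) by blast
    have "?c (pushforward K h a) = ?f a" if a: "a \<in> X" for a
    proof -
      have hm: "free_ext K N'.F (\<lambda>(x, y). basis_elt K (x, h y)) \<in> module_hom K N.F N'.F"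
        by (rule F'.free_ext_hom) (use module_hom_in[OF h] in \<open>auto intro!: N'.basis_elt_F simp del: free_module_simps\<close>)
      have b: "free_ext K N'.F (\<lambda>(x, y). basis_elt K (x, h y)) (basis_elt K (x, y)) = basis_elt K (x, h y)"
        if "x \<in> carrier M" "y \<in> carrier N" for x y
        using F'.free_ext_basis[of "\<lambda>(x, y). basis_elt K (x, h y)" "(x, y)"]
          N'.basis_elt_F[of x "h y"] that by (simp del: free_module_simps)
      have b': "?f (basis_elt K (x, y)) = ?\<phi> x y"
        if "x \<in> carrier M" "y \<in> carrier N" for x y
        using T'.free_ext_basis[of "\<lambda>(x, y). ?\<phi> x y" "(x, y)"] that by simp
      have "?c (free_ext K N'.F (\<lambda>(x, y). basis_elt K (x, h y)) a) = ?f a"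
      proof (rule free_hom_eqI[OF N'.T_module module_hom_comp[OF hm N'.coset_hom_T] _ X[OF a]])
        show "?f \<in> module_hom K N.F N'.T" by (rule T'.free_ext_hom) auto
        fix p assume "p \<in> carrier M \<times> carrier N"
        then show "?c (free_ext K N'.F (\<lambda>(x, y). basis_elt K (x, h y)) (basis_elt K p)) = ?f (basis_elt K p)"
          using b b' by (cases p) (auto simp only: N'.pure_def[symmetric])
      qed
      then show ?thesis
        using pushforward_eq[OF N.K.cring_axioms X[OF a], of h N'] by simp
    qed
    then have "tensor_map K R M N' h X = \<Union> (?f ` X)"
      unfolding tensor_map_def by simp
    then show ?thesis
      unfolding N.lift_def g(2) using L3[OF g(1)] by simp
  qed
  show "tensor_map K R M N' h \<in> module_hom K N.T N'.T"
    by (rule module_hom_cong[OF L eq[symmetric] N.T_module])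
  show "x \<in> carrier M \<Longrightarrow> y \<in> carrier N \<Longrightarrow> tensor_map K R M N' h (N.pure x y) = N'.pure x (h y)"
    using eq[of "N.pure x y"] L2 by (simp add: N.pure_closed)
qed

lemma tensor_map_eqI:
  assumes "g \<in> module_hom R N N'" "h \<in> module_hom R N N'" "\<And>y. y \<in> carrier N \<Longrightarrow> g y = h y"
    "t \<in> carrier N.T"
  shows "tensor_map K R M N' g t = tensor_map K R M N' h t"
  by (rule N.hom_eqI[OF N'.T_module tensor_map_hom tensor_map_hom])
    (use assms in \<open>auto simp: tensor_map_pure\<close>)

lemma tensor_map_add:
  assumes "g \<in> module_hom R N N'" "h \<in> module_hom R N N'" "f \<in> module_hom R N N'"
    "\<And>y. y \<in> carrier N \<Longrightarrow> f y = g y \<oplus>\<^bsub>N'\<^esub> h y"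
    "t \<in> carrier N.T"
  shows "tensor_map K R M N' f t = tensor_map K R M N' g t \<oplus>\<^bsub>N'.T\<^esub> tensor_map K R M N' h t"
  by (rule N.hom_eqI[OF N'.T_module tensor_map_hom
        module_hom_plus[OF N.T_module N'.T_module tensor_map_hom tensor_map_hom]])
    (use assms in \<open>auto simp: tensor_map_pure N'.pure_relations module_hom_in\<close>)

end

lemma tensor_map_comp:
  assumes "tensor K R M N" "tensor K R M N'" "tensor K R M N''"
    "f \<in> module_hom R N N'" "g \<in> module_hom R N' N''" "t \<in> carrier (tensor_product K R M N)"
  shows "tensor_map K R M N'' g (tensor_map K R M N' f t) = tensor_map K R M N'' (\<lambda>x. g (f x)) t"
proof -
  interpret A: tensor_functor K R M N N' using assms by (simp add: tensor_functor_def)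
  interpret B: tensor_functor K R M N' N'' using assms by (simp add: tensor_functor_def)
  interpret C: tensor_functor K R M N N'' using assms by (simp add: tensor_functor_def)
  note fg = module_hom_comp[OF assms(4,5)]
  show ?thesis
    by (rule A.N.hom_eqI[OF B.N'.T_module
          module_hom_comp[OF A.tensor_map_hom[OF assms(4)] B.tensor_map_hom[OF assms(5)]]
          C.tensor_map_hom[OF fg] assms(6)])
      (simp add: A.tensor_map_pure[OF assms(4)] B.tensor_map_pure[OF assms(5)]
        C.tensor_map_pure[OF fg] module_hom_in[OF assms(4)])
qed

lemma tensor_map_id:
  assumes "tensor K R M N" "f \<in> module_hom R N N" "\<And>x. x \<in> carrier N \<Longrightarrow> f x = x"
    "t \<in> carrier (tensor_product K R M N)"
  shows "tensor_map K R M N f t = t"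
proof -
  interpret tensor_functor K R M N N using assms by (simp add: tensor_functor_def)
  show ?thesis
    by (rule N.hom_eqI[OF N.T_module tensor_map_hom[OF assms(2)] _ assms(4)])
      (auto simp: tensor_map_pure[OF assms(2)] assms(3) intro!: module_homI)
qed

section \<open>Comparison of projective resolutions\<close>

lemma (in abelian_group) diff_zero: "x \<in> carrier G \<Longrightarrow> x \<ominus> \<zero> = x"
  using add.inv_one by (simp add: minus_eq a_inv_def)

text \<open>Preimages are chosen for the generators of a free module that retracts onto
  \<open>P\<close>, extended linearly and restricted along the section \<open>i\<close>. Asking only
  that \<open>\<alpha>\<close> lands in the image of \<open>\<beta>\<close>, rather than that
  \<open>\<beta>\<close> is onto, lets exactness supply the hypothesis.\<close>

lemma projective_lift:
  assumes P: "projective_module R P" and A: "left_module R A" and B: "left_module R B"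
    and \<alpha>: "\<alpha> \<in> module_hom R P A" and \<beta>: "\<beta> \<in> module_hom R B A"
    and im: "\<And>x. x \<in> carrier P \<Longrightarrow> \<alpha> x \<in> \<beta> ` carrier B"
  shows "\<exists>\<gamma>\<in>module_hom R P B. \<forall>x\<in>carrier P. \<beta> (\<gamma> x) = \<alpha> x"
proof -
  interpret B: left_module R B by fact
  obtain S :: "'c set" and i q where i: "i \<in> module_hom R P (free_module R S)"
    and q: "q \<in> module_hom R (free_module R S) P" and qi: "\<And>x. x \<in> carrier P \<Longrightarrow> q (i x) = x"
    using P unfolding projective_module_def by blast
  have "\<forall>s\<in>S. \<exists>y\<in>carrier B. \<beta> y = \<alpha> (q (basis_elt R s))"
    using im module_hom_in[OF q B.R.basis_elt_closed] by (metis (no_types, lifting) image_iff)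
  then obtain b where b: "\<And>s. s \<in> S \<Longrightarrow> b s \<in> carrier B"
      "\<And>s. s \<in> S \<Longrightarrow> \<beta> (b s) = \<alpha> (q (basis_elt R s))"
    by metis
  have g: "free_ext R B b \<in> module_hom R (free_module R S) B"
    by (rule B.free_ext_hom) (use b in auto)
  have "\<beta> (free_ext R B b (i x)) = \<alpha> x" if x: "x \<in> carrier P" for x
  proof -
    have "\<beta> (free_ext R B b (i x)) = \<alpha> (q (i x))"
      by (rule free_hom_eqI[OF A module_hom_comp[OF g \<beta>] module_hom_comp[OF q \<alpha>] module_hom_in[OF i x]])
        (simp add: b B.free_ext_basis)
    then show ?thesis using qi x by simp
  qed
  then show ?thesis using module_hom_comp[OF i g] by (intro bexI) auto
qed

locale resolution = N: left_module R N for R :: "('r, 'z) ring_scheme" and N :: "('r, 'n) module" +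
  fixes P :: "nat \<Rightarrow> ('r, 'p) module" and d :: "nat \<Rightarrow> 'p \<Rightarrow> 'p" and \<epsilon> :: "'p \<Rightarrow> 'n"
  assumes resolution: "projective_resolution R N P d \<epsilon>"
begin

text \<open>Merging the kernel of the augmentation with the kernels of the differentials makes
  exactness read the same in all degrees, as in \<open>d_image\<close>.\<close>

definition syzygy :: "nat \<Rightarrow> 'p set" where
  "syzygy n = {x \<in> carrier (P n). case n of 0 \<Rightarrow> \<epsilon> x = \<zero>\<^bsub>N\<^esub> | Suc i \<Rightarrow> d i x = \<zero>\<^bsub>P i\<^esub>}"

lemma projective: "projective_module R (P n)"
  using resolution by (simp add: projective_resolution_def)

lemma module: "left_module R (P n)"
  using projective by (simp add: projective_module_def)

lemma d_hom: "d n \<in> module_hom R (P (Suc n)) (P n)"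
  using resolution by (simp add: projective_resolution_def)

lemma \<epsilon>_hom: "\<epsilon> \<in> module_hom R (P 0) N"
  using resolution by (simp add: projective_resolution_def)

lemma \<epsilon>_surj: "\<epsilon> ` carrier (P 0) = carrier N"
  using resolution by (simp add: projective_resolution_def)

lemma d_image: "d n ` carrier (P (Suc n)) = syzygy n"
  using resolution by (cases n) (simp_all add: projective_resolution_def syzygy_def)

lemma d_in_syzygy: "x \<in> carrier (P (Suc n)) \<Longrightarrow> d n x \<in> syzygy n"
  using d_image by blast

lemma syzygy_Suc: "x \<in> syzygy (Suc n) \<longleftrightarrow> x \<in> carrier (P (Suc n)) \<and> d n x = \<zero>\<^bsub>P n\<^esub>"
  by (simp add: syzygy_def)

lemma d_d: "x \<in> carrier (P (Suc (Suc n))) \<Longrightarrow> d n (d (Suc n) x) = \<zero>\<^bsub>P n\<^esub>"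
  using d_in_syzygy[of x "Suc n"] syzygy_Suc by blast

end

locale resolution_pair = P: resolution R N P d \<epsilon> + Q: resolution R N Q d' \<epsilon>'
  for R :: "('r, 'z) ring_scheme" and N :: "('r, 'n) module"
    and P :: "nat \<Rightarrow> ('r, 'p) module" and d \<epsilon>
    and Q :: "nat \<Rightarrow> ('r, 'q) module" and d' \<epsilon>'
begin

definition chain_lift :: "(nat \<Rightarrow> 'p \<Rightarrow> 'q) \<Rightarrow> bool" where
  "chain_lift f \<longleftrightarrow> (\<forall>n. f n \<in> module_hom R (P n) (Q n)) \<and>
    (\<forall>n. \<forall>x\<in>carrier (P (Suc n)). d' n (f (Suc n) x) = f n (d n x)) \<and>
    (\<forall>x\<in>carrier (P 0). \<epsilon>' (f 0 x) = \<epsilon> x)"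

lemma chain_lift_exists: "\<exists>f. chain_lift f"
proof -
  \<comment> \<open>Preservation of syzygies is the part of the invariant that makes the next
    lifting problem solvable: \<open>f (d n x)\<close> is then a syzygy and so lies in the image of
    \<open>d' n\<close>.\<close>
  let ?A = "\<lambda>n f. f \<in> module_hom R (P n) (Q n) \<and> f ` P.syzygy n \<subseteq> Q.syzygy n \<and>
    (n = 0 \<longrightarrow> (\<forall>x\<in>carrier (P 0). \<epsilon>' (f x) = \<epsilon> x))"
  let ?B = "\<lambda>n f g. \<forall>x\<in>carrier (P (Suc n)). d' n (g x) = f (d n x)"
  have "\<exists>f. \<forall>n. ?A n (f n) \<and> ?B n (f n) (f (Suc n))"
  proof (rule dependent_nat_choice)
    obtain f where "f \<in> module_hom R (P 0) (Q 0)" "\<forall>x\<in>carrier (P 0). \<epsilon>' (f x) = \<epsilon> x"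
      using projective_lift[OF P.projective P.N.left_module_axioms Q.module P.\<epsilon>_hom Q.\<epsilon>_hom]
        Q.\<epsilon>_surj module_hom_in[OF P.\<epsilon>_hom] by auto
    then show "\<exists>f. ?A 0 f"
      using module_hom_in[of f] by (intro exI[of _ f]) (fastforce simp: P.syzygy_def Q.syzygy_def)
  next
    fix f n assume f: "?A n f"
    then have fh: "f \<in> module_hom R (P n) (Q n)" by blast
    have "f (d n x) \<in> d' n ` carrier (Q (Suc n))" if "x \<in> carrier (P (Suc n))" for x
      using f P.d_in_syzygy[OF that] Q.d_image by auto
    then obtain g where g: "g \<in> module_hom R (P (Suc n)) (Q (Suc n))"
        "\<forall>x\<in>carrier (P (Suc n)). d' n (g x) = f (d n x)"
      using projective_lift[OF P.projective Q.module Q.module module_hom_comp[OF P.d_hom fh] Q.d_hom]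
      by auto
    have "f \<zero>\<^bsub>P n\<^esub> = \<zero>\<^bsub>Q n\<^esub>"
      using left_module_hom.zero[OF left_module_homI[OF P.module Q.module fh]] .
    then have "g ` P.syzygy (Suc n) \<subseteq> Q.syzygy (Suc n)"
      using g module_hom_in[OF g(1)] by (auto simp: P.syzygy_Suc Q.syzygy_Suc)
    then show "\<exists>g. ?A (Suc n) g \<and> ?B n f g" using g by (intro exI[of _ g]) simp
  qed
  then obtain f where f: "\<forall>n. ?A n (f n) \<and> ?B n (f n) (f (Suc n))" by (rule exE)
  show ?thesis unfolding chain_lift_def using f by (intro exI[of _ f]) simp
qed

definition homotopy :: "(nat \<Rightarrow> 'p \<Rightarrow> 'q) \<Rightarrow> (nat \<Rightarrow> 'p \<Rightarrow> 'q) \<Rightarrow> (nat \<Rightarrow> 'p \<Rightarrow> 'q) \<Rightarrow> bool" where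
  "homotopy f g s \<longleftrightarrow> (\<forall>n. s n \<in> module_hom R (P n) (Q (Suc n))) \<and>
    (\<forall>x\<in>carrier (P 0). f 0 x = g 0 x \<oplus>\<^bsub>Q 0\<^esub> d' 0 (s 0 x)) \<and>
    (\<forall>n. \<forall>x\<in>carrier (P (Suc n)). f (Suc n) x =
      g (Suc n) x \<oplus>\<^bsub>Q (Suc n)\<^esub> (d' (Suc n) (s (Suc n) x) \<oplus>\<^bsub>Q (Suc n)\<^esub> s n (d n x)))"

text \<open>The difference \<open>e\<close> of the two lifts covers the zero map of
  \<open>N\<close>, so it can be lifted step by step through \<open>d'\<close>, each time corrected
  by the part of the homotopy already built.\<close>

lemma homotopy_exists:
  assumes f: "chain_lift f" and g: "chain_lift g"
  shows "\<exists>s. homotopy f g s"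
proof -
  define e where "e n x = f n x \<ominus>\<^bsub>Q n\<^esub> g n x" for n x
  have fh: "f n \<in> module_hom R (P n) (Q n)" and gh: "g n \<in> module_hom R (P n) (Q n)" for n
    using f g by (auto simp: chain_lift_def)
  have eh: "e n \<in> module_hom R (P n) (Q n)" for n
    unfolding e_def by (rule module_hom_diff[OF P.module Q.module fh gh])
  interpret d': left_module_hom R "Q (Suc n)" "Q n" "d' n" for n
    by (rule left_module_homI[OF Q.module Q.module Q.d_hom])
  interpret \<epsilon>': left_module_hom R "Q 0" N "\<epsilon>'"
    by (rule left_module_homI[OF Q.module P.N.left_module_axioms Q.\<epsilon>_hom])
  have d'e: "d' n (e (Suc n) x) = e n (d n x)" if "x \<in> carrier (P (Suc n))" for n x
    unfolding e_def using f g that module_hom_in[OF fh] module_hom_in[OF gh]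
    by (simp add: d'.diff chain_lift_def)
  have \<epsilon>e: "\<epsilon>' (e 0 x) = \<zero>\<^bsub>N\<^esub>" if "x \<in> carrier (P 0)" for x
    unfolding e_def using f g that module_hom_in[OF fh] module_hom_in[OF gh] module_hom_in[OF P.\<epsilon>_hom]
    by (simp add: \<epsilon>'.diff chain_lift_def P.N.M.r_neg P.N.M.minus_eq)
  have fe: "f n x = g n x \<oplus>\<^bsub>Q n\<^esub> e n x" if "x \<in> carrier (P n)" for n x
  proof -
    have "f n x \<in> carrier (Q n)" "g n x \<in> carrier (Q n)" using that fh gh module_hom_in by metis+
    then show ?thesis
      unfolding e_def d'.N.M.minus_eq
      by (metis d'.N.M.a_inv_closed d'.N.M.a_lcomm d'.N.M.r_neg d'.N.M.r_zero)
  qed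
  \<comment> \<open>The equation \<open>d' n (s x) = e n x\<close> is demanded on syzygies only,
    since elsewhere the term with \<open>d\<close> intervenes. This is enough because it is applied
    to elements \<open>d n x\<close>. In degree 0 there is no such term and the equation holds
    everywhere.\<close>
  let ?A = "\<lambda>n s. s \<in> module_hom R (P n) (Q (Suc n)) \<and> (\<forall>x\<in>P.syzygy n. d' n (s x) = e n x) \<and>
    (n = 0 \<longrightarrow> (\<forall>x\<in>carrier (P 0). d' 0 (s x) = e 0 x))"
  let ?B = "\<lambda>n s t. \<forall>x\<in>carrier (P (Suc n)). d' (Suc n) (t x) = e (Suc n) x \<ominus>\<^bsub>Q (Suc n)\<^esub> s (d n x)"
  have "\<exists>s. \<forall>n. ?A n (s n) \<and> ?B n (s n) (s (Suc n))"
  proof (rule dependent_nat_choice)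
    have "e 0 x \<in> d' 0 ` carrier (Q (Suc 0))" if "x \<in> carrier (P 0)" for x
      unfolding Q.d_image using \<epsilon>e[OF that] module_hom_in[OF eh that] by (simp add: Q.syzygy_def)
    then obtain s where "s \<in> module_hom R (P 0) (Q (Suc 0))" "\<forall>x\<in>carrier (P 0). d' 0 (s x) = e 0 x"
      using projective_lift[OF P.projective Q.module Q.module eh Q.d_hom] by blast
    then show "\<exists>s. ?A 0 s" by (auto simp: P.syzygy_def)
  next
    fix s n assume s: "?A n s"
    then have sh: "s \<in> module_hom R (P n) (Q (Suc n))" by blast
    let ?a = "\<lambda>x. e (Suc n) x \<ominus>\<^bsub>Q (Suc n)\<^esub> s (d n x)"
    have ah: "?a \<in> module_hom R (P (Suc n)) (Q (Suc n))"
      by (rule module_hom_diff[OF P.module Q.module eh module_hom_comp[OF P.d_hom sh]])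
    interpret s: left_module_hom R "P n" "Q (Suc n)" s
      by (rule left_module_homI[OF P.module Q.module sh])
    have "?a x \<in> d' (Suc n) ` carrier (Q (Suc (Suc n)))" if x: "x \<in> carrier (P (Suc n))" for x
    proof -
      have dx: "d n x \<in> P.syzygy n" "d n x \<in> carrier (P n)"
        using P.d_in_syzygy[OF x] module_hom_in[OF P.d_hom x] by blast+
      \<comment> \<open>Both terms equal \<open>e n (d n x)\<close>: the first because
        \<open>e\<close> is a chain map, the second by the invariant at the syzygy
        \<open>d n x\<close>.\<close>
      have "d' n (?a x) = e n (d n x) \<ominus>\<^bsub>Q n\<^esub> e n (d n x)"
        using s dx x module_hom_in[OF eh x] by (subst d'.diff) (auto simp: d'e)
      then show ?thesis
        unfolding Q.d_image Q.syzygy_Suc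
        using module_hom_in[OF ah x] module_hom_in[OF eh dx(2)] by (simp add: d'.N.M.r_neg d'.N.M.minus_eq)
    qed
    then obtain t where t: "t \<in> module_hom R (P (Suc n)) (Q (Suc (Suc n)))"
        "\<forall>x\<in>carrier (P (Suc n)). d' (Suc n) (t x) = ?a x"
      using projective_lift[OF P.projective Q.module Q.module ah Q.d_hom] by blast
    have "d' (Suc n) (t x) = e (Suc n) x" if "x \<in> P.syzygy (Suc n)" for x
      using that s t module_hom_in[OF eh] abelian_group.diff_zero[OF left_module.axioms(2)[OF Q.module]]
      by (simp add: P.syzygy_Suc)
    then show "\<exists>t. ?A (Suc n) t \<and> ?B n s t" using t by (intro exI[of _ t]) simp
  qed
  then obtain s where s': "\<forall>n. ?A n (s n) \<and> ?B n (s n) (s (Suc n))" by (rule exE)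
  have s: "?A n (s n)" "?B n (s n) (s (Suc n))" for n
    using spec[OF s', of n] by (rule conjunct1, rule conjunct2)
  have "homotopy f g s"
    unfolding homotopy_def
  proof (intro conjI allI ballI)
    show "s n \<in> module_hom R (P n) (Q (Suc n))" for n using s(1) by blast
    show "f 0 x = g 0 x \<oplus>\<^bsub>Q 0\<^esub> d' 0 (s 0 x)" if "x \<in> carrier (P 0)" for x
      using that s(1)[of 0] fe by simp
    fix n x assume x: "x \<in> carrier (P (Suc n))"
    have sd: "s n (d n x) \<in> carrier (Q (Suc n))"
      using s(1)[of n] module_hom_in[OF P.d_hom x] module_hom_in by metis
    have "d' (Suc n) (s (Suc n) x) \<oplus>\<^bsub>Q (Suc n)\<^esub> s n (d n x) = e (Suc n) x"
      using s(2)[of n] x module_hom_in[OF eh x] sd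
      by (simp add: d'.M.M.minus_eq d'.M.M.a_assoc d'.M.M.l_neg)
    then show "f (Suc n) x = g (Suc n) x \<oplus>\<^bsub>Q (Suc n)\<^esub>
        (d' (Suc n) (s (Suc n) x) \<oplus>\<^bsub>Q (Suc n)\<^esub> s n (d n x))"
      using fe[OF x] by simp
  qed
  then show ?thesis by blast
qed

end

section \<open>Homology and Tor\<close>

text \<open>This says that \<open>\<kappa>\<close> induces an isomorphism from the homology in
  degree \<open>m\<close> onto the free module on \<open>X\<close>. Avoiding the quotient makes it
  easy to pull back along maps of complexes.\<close>

definition homology_coords ::
    "('k, 'z) ring_scheme \<Rightarrow> (nat \<Rightarrow> ('k, 'c) module) \<Rightarrow> (nat \<Rightarrow> 'c \<Rightarrow> 'c) \<Rightarrow> nat \<Rightarrow> 's set \<Rightarrow>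
      ('c \<Rightarrow> 's \<Rightarrow> 'k) \<Rightarrow> bool" where
  "homology_coords K C D m X \<kappa> \<longleftrightarrow> \<kappa> \<in> module_hom K (C m) (free_module K X) \<and>
    (\<forall>x\<in>cycles C D m. \<kappa> x = \<zero>\<^bsub>free_module K X\<^esub> \<longleftrightarrow> x \<in> boundaries C D m) \<and>
    (\<forall>w\<in>carrier (free_module K X). \<exists>x\<in>cycles C D m. \<kappa> x = w)"

text \<open>In the single degree \<open>m\<close>: the second conjunct makes the induced map on
  homology well defined and injective, the third makes it surjective.\<close>

definition quasi_iso ::
    "('k, 'z) ring_scheme \<Rightarrow> (nat \<Rightarrow> ('k, 'c) module) \<Rightarrow> (nat \<Rightarrow> 'c \<Rightarrow> 'c) \<Rightarrow>
      (nat \<Rightarrow> ('k, 'd) module) \<Rightarrow> (nat \<Rightarrow> 'd \<Rightarrow> 'd) \<Rightarrow> nat \<Rightarrow> ('c \<Rightarrow> 'd) \<Rightarrow> bool" where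
  "quasi_iso K C D C' D' m f \<longleftrightarrow> f \<in> module_hom K (C m) (C' m) \<and>
    (\<forall>x\<in>cycles C D m. f x \<in> cycles C' D' m \<and> (f x \<in> boundaries C' D' m \<longleftrightarrow> x \<in> boundaries C D m)) \<and>
    (\<forall>y\<in>cycles C' D' m. \<exists>x\<in>cycles C D m. \<exists>b\<in>boundaries C' D' m. y = f x \<oplus>\<^bsub>C' m\<^esub> b)"

text \<open>Every cycle of the target is hit by \<open>f\<close> up to a boundary, and
  \<open>\<kappa>\<close> does not see boundaries.\<close>

lemma homology_coords_pullback:
  assumes "ring K" and f: "quasi_iso K C D C' D' m f" and \<kappa>: "homology_coords K C' D' m X \<kappa>"
    and sub: "cycles C D m \<subseteq> carrier (C m)" "cycles C' D' m \<subseteq> carrier (C' m)"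
      "boundaries C' D' m \<subseteq> cycles C' D' m"
  shows "homology_coords K C D m X (\<lambda>x. \<kappa> (f x))"
proof -
  interpret ring K by fact
  interpret X: left_module K "free_module K X" by (rule free_module_left_module)
  note [simp del] = free_module_simps
  have fh: "f \<in> module_hom K (C m) (C' m)" and \<kappa>h: "\<kappa> \<in> module_hom K (C' m) (free_module K X)"
    using f \<kappa> by (auto simp: quasi_iso_def homology_coords_def)
  have "\<exists>x\<in>cycles C D m. \<kappa> (f x) = w" if w: "w \<in> carrier (free_module K X)" for w
  proof -
    obtain y where y: "y \<in> cycles C' D' m" "\<kappa> y = w" using \<kappa> w by (auto simp: homology_coords_def)
    obtain x b where x: "x \<in> cycles C D m" "b \<in> boundaries C' D' m" "y = f x \<oplus>\<^bsub>C' m\<^esub> b"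
      using f y(1) unfolding quasi_iso_def by blast
    have "f x \<in> carrier (C' m)" "b \<in> carrier (C' m)" using x sub module_hom_in[OF fh] by blast+
    moreover have "\<kappa> b = \<zero>\<^bsub>free_module K X\<^esub>" using x(2) sub(3) \<kappa> unfolding homology_coords_def by blast
    ultimately have "w = \<kappa> (f x)"
      using y(2) x(3) module_hom_in[OF \<kappa>h] by (simp add: module_hom_add[OF \<kappa>h])
    then show ?thesis using x(1) by blast
  qed
  then show ?thesis
    using f \<kappa> module_hom_comp[OF fh \<kappa>h] unfolding homology_coords_def quasi_iso_def by simp
qed

text \<open>\<open>\<kappa>\<close> descends to a linear bijection \<open>q\<close> from the
  homology onto the free module on \<open>X\<close>, whose basis elements are counted by
  \<open>X\<close>.\<close>

lemma homology_dim:
  assumes "field K" and mods: "left_module K (C m)" "left_module K (C (Suc m))"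
    and D: "D m \<in> module_hom K (C (Suc m)) (C m)"
    and cyc: "left_submodule K (C m) (cycles C D m)"
    and bc: "boundaries C D m \<subseteq> cycles C D m"
    and \<kappa>: "homology_coords K C D m X \<kappa>" and X: "finite X"
  shows "vectorspace K (homology C D m) \<and> vectorspace.fin_dim K (homology C D m) \<and>
    vectorspace.dim K (homology C D m) = card X"
proof -
  interpret K: field K by fact
  let ?X = "free_module K X" and ?H = "homology C D m" and ?Z = "(C m)\<lparr>carrier := cycles C D m\<rparr>"
  interpret X: left_module K ?X by (rule K.free_module_left_module)
  interpret C: left_submodule K "C m" "cycles C D m" by fact
  interpret Z: left_module K ?Z by (rule C.restrict_left_module)
  interpret B0: left_submodule K "C m" "boundaries C D m"
    unfolding boundaries_def by (rule image_submodule[OF mods(2,1) D])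
  interpret B: left_submodule K ?Z "boundaries C D m"
    using bc B0.add_in B0.smult_in by unfold_locales auto
  note [simp del] = free_module_simps quotient_module_simps
  have \<kappa>h: "\<kappa> \<in> module_hom K ?Z ?X"
  proof (rule module_homI)
    have "\<kappa> \<in> module_hom K (C m) ?X" using \<kappa> by (simp add: homology_coords_def)
    note this' = module_hom_in[OF this] module_hom_add[OF this] module_hom_smult[OF this]
    show "\<kappa> x \<in> carrier ?X" if "x \<in> carrier ?Z" for x using that C.subset this'(1) by auto
    show "\<kappa> (x \<oplus>\<^bsub>?Z\<^esub> y) = \<kappa> x \<oplus>\<^bsub>?X\<^esub> \<kappa> y" if "x \<in> carrier ?Z" "y \<in> carrier ?Z" for x y
      using that C.subset this'(2)[of x y] by auto
    show "\<kappa> (r \<odot>\<^bsub>?Z\<^esub> x) = r \<odot>\<^bsub>?X\<^esub> \<kappa> x" if "r \<in> carrier K" "x \<in> carrier ?Z" for r x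
      using that C.subset this'(3)[of r x] by auto
  qed
  have ker: "\<kappa> x = \<zero>\<^bsub>?X\<^esub> \<longleftrightarrow> x \<in> boundaries C D m" if "x \<in> carrier ?Z" for x
    using that \<kappa> by (simp add: homology_coords_def)
  have ker': "\<kappa> x = \<zero>\<^bsub>?X\<^esub>" if "x \<in> boundaries C D m" for x
    using that bc ker by auto
  define q where "q Y = the_elem (\<kappa> ` Y)" for Y
  have qh: "q \<in> module_hom K ?H ?X"
    unfolding q_def homology_def using X.left_module_axioms \<kappa>h ker' by (rule B.the_elem_hom(1))
  have q: "q (boundaries C D m +>\<^bsub>?Z\<^esub> x) = \<kappa> x" if "x \<in> carrier ?Z" for x
    unfolding q_def using X.left_module_axioms \<kappa>h ker' that by (rule B.the_elem_hom(2))
  have H: "left_module K ?H" unfolding homology_def by (rule B.quotient_left_module)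
  have cH: "carrier ?H = (\<lambda>x. boundaries C D m +>\<^bsub>?Z\<^esub> x) ` carrier ?Z"
    unfolding homology_def by (rule B.carrier_quotient)
  interpret q: left_module_hom K ?H ?X q by (rule left_module_homI[OF H X.left_module_axioms qh])
  have vH: "vectorspace K ?H" and vX: "vectorspace K ?X"
    using left_module_imp_module[OF K.cring_axioms] H X.left_module_axioms assms(1)
    by (auto simp: vectorspace_def)
  have inj: "inj_on q (carrier ?H)"
  proof (rule inj_onI)
    fix Y Y' assume Y: "Y \<in> carrier ?H" "Y' \<in> carrier ?H" "q Y = q Y'"
    then obtain x y where x: "x \<in> carrier ?Z" "Y = boundaries C D m +>\<^bsub>?Z\<^esub> x"
      and y: "y \<in> carrier ?Z" "Y' = boundaries C D m +>\<^bsub>?Z\<^esub> y" unfolding cH by blast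
    interpret \<kappa>: left_module_hom K ?Z ?X \<kappa>
      by (rule left_module_homI[OF Z.left_module_axioms X.left_module_axioms \<kappa>h])
    have "\<kappa> (x \<ominus>\<^bsub>?Z\<^esub> y) = \<zero>\<^bsub>?X\<^esub>"
      using Y(3) q x y \<kappa>.diff[OF x(1) y(1)] \<kappa>.closed[OF y(1)] by (simp add: X.M.minus_eq X.M.r_neg)
    then have "x \<ominus>\<^bsub>?Z\<^esub> y \<in> boundaries C D m"
      using ker Z.M.minus_closed[OF x(1) y(1)] by blast
    then show "Y = Y'" using x y B.coset_eq_iff by blast
  qed
  have surj: "q ` carrier ?H = carrier ?X"
  proof
    show "q ` carrier ?H \<subseteq> carrier ?X" by auto
    show "carrier ?X \<subseteq> q ` carrier ?H"
    proof
      fix w assume "w \<in> carrier ?X"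
      then obtain x where "x \<in> cycles C D m" "\<kappa> x = w" using \<kappa> by (auto simp: homology_coords_def)
      then show "w \<in> q ` carrier ?H"
        using q[of x] unfolding cH by (intro image_eqI[of _ _ "boundaries C D m +>\<^bsub>?Z\<^esub> x"]) auto
    qed
  qed
  \<comment> \<open>\<open>surj_fin_dim\<close> and \<open>dim_eq\<close> take finite dimension of
    the domain as a hypothesis, so the inverse is used: its domain is the space with the known
    basis.\<close>
  define p where "p = inv_into (carrier ?H) q"
  have pq: "p (q Y) = Y" if "Y \<in> carrier ?H" for Y
    using that inj by (simp add: p_def)
  have qp: "q (p w) = w" and pc: "p w \<in> carrier ?H" if "w \<in> carrier ?X" for w
    using that surj by (simp_all add: p_def f_inv_into_f inv_into_into)
  have ph: "p \<in> module_hom K ?X ?H"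
  proof (rule module_homI)
    show "p w \<in> carrier ?H" if "w \<in> carrier ?X" for w using pc that .
    show "p (v \<oplus>\<^bsub>?X\<^esub> w) = p v \<oplus>\<^bsub>?H\<^esub> p w" if "v \<in> carrier ?X" "w \<in> carrier ?X" for v w
      using that pq[of "p v \<oplus>\<^bsub>?H\<^esub> p w"] by (simp add: q.add pc qp q.M.M.a_closed)
    show "p (r \<odot>\<^bsub>?X\<^esub> w) = r \<odot>\<^bsub>?H\<^esub> p w" if "r \<in> carrier K" "w \<in> carrier ?X" for r w
      using that pq[of "r \<odot>\<^bsub>?H\<^esub> p w"] by (simp add: q.smult pc qp q.M.smult_closed)
  qed
  interpret H: vectorspace K ?H by (rule vH)
  interpret VX: vectorspace K ?X by (rule vX)
  interpret p: linear_map K ?X ?H p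
    using ph vX vH by (intro linear_map.intro) (auto simp: mod_hom_def mod_hom_axioms_def vectorspace_def)
  let ?b = "basis_elt K ` X"
  have inj_b: "inj_on (basis_elt K) X"
  proof (rule inj_onI)
    fix s t assume "basis_elt K s = basis_elt K t"
    then have "basis_elt K s s = basis_elt K t s" by simp
    then show "s = t" by (simp add: basis_elt_def split: if_splits)
  qed
  have fin: "finite ?b" and bX: "?b \<subseteq> carrier ?X" using X by auto
  \<comment> \<open>The coefficients of a combination are its values. Independence and spanning both
    follow from this formula.\<close>
  have lc: "VX.lincomb a ?b = (\<lambda>s. if s \<in> X then a (basis_elt K s) else \<zero>\<^bsub>K\<^esub>)"
    if a: "a \<in> ?b \<rightarrow> carrier K" for a
  proof
    fix t
    have aK: "a (basis_elt K s) \<in> carrier K" if "s \<in> X" for s using a that by auto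
    have "VX.lincomb a ?b = (\<Oplus>\<^bsub>?X\<^esub>s\<in>X. a (basis_elt K s) \<odot>\<^bsub>?X\<^esub> basis_elt K s)"
      unfolding VX.lincomb_def using inj_b aK
      by (intro X.M.finsum_reindex) (auto intro!: X.smult_closed)
    then have "VX.lincomb a ?b t = (\<Oplus>\<^bsub>K\<^esub>s\<in>X. (a (basis_elt K s) \<odot>\<^bsub>?X\<^esub> basis_elt K s) t)"
      using aK by (simp, subst free_module_finsum[OF K.ring_axioms]) (auto intro!: X.smult_closed)
    also have "\<dots> = (\<Oplus>\<^bsub>K\<^esub>s\<in>X. a (basis_elt K s) \<otimes>\<^bsub>K\<^esub> basis_elt K s t)"
      by (simp add: free_module_simps)
    also have "\<dots> = (if t \<in> X then a (basis_elt K t) else \<zero>\<^bsub>K\<^esub>)"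
    proof (cases "t \<in> X")
      case True
      then show ?thesis
        using X aK by (subst finsum_single[OF K.abelian_monoid_axioms, of _ t]) (auto simp: basis_elt_def)
    next
      case False
      then show ?thesis
        using X aK by (simp, intro K.add.finprod_one_eqI) (auto simp: basis_elt_def)
    qed
    finally show "VX.lincomb a ?b t = (if t \<in> X then a (basis_elt K t) else \<zero>\<^bsub>K\<^esub>)" .
  qed
  have basis: "VX.basis ?b"
    unfolding VX.basis_def
  proof (intro conjI)
    show "\<not> VX.lin_dep ?b"
    proof (rule VX.finite_lin_indpt2[OF fin bX])
      fix a assume a: "a \<in> ?b \<rightarrow> carrier K" "VX.lincomb a ?b = \<zero>\<^bsub>?X\<^esub>"
      then have "(\<lambda>s. if s \<in> X then a (basis_elt K s) else \<zero>\<^bsub>K\<^esub>) = (\<lambda>s. \<zero>\<^bsub>K\<^esub>)"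
        using lc by (simp add: free_module_simps)
      then show "\<forall>v\<in>?b. a v = \<zero>\<^bsub>K\<^esub>" by (auto dest: fun_cong split: if_splits)
    qed
    show "VX.span ?b = carrier ?X"
    proof
      show "VX.span ?b \<subseteq> carrier ?X" by (rule VX.span_is_subset2[OF bX])
      show "carrier ?X \<subseteq> VX.span ?b"
      proof
        fix w assume w: "w \<in> carrier ?X"
        define a where "a v = w (inv_into X (basis_elt K) v)" for v
        have a: "a \<in> ?b \<rightarrow> carrier K" using w by (auto simp: a_def free_module_simps)
        have "w s = \<zero>\<^bsub>K\<^esub>" if "s \<notin> X" for s using w that by (auto simp: free_module_simps)
        then have "VX.lincomb a ?b = w"
          unfolding lc[OF a] by (intro ext) (use inj_b in \<open>auto simp: a_def\<close>)
        then show "w \<in> VX.span ?b" unfolding VX.finite_span[OF fin bX] using a by blast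
      qed
    qed
  qed (rule bX)
  have fdX: "VX.fin_dim" unfolding VX.fin_dim_def using basis fin VX.basis_def bX by blast
  have dX: "VX.dim = card X" using VX.dim_basis[OF fin basis] card_image[OF inj_b] by simp
  have injp: "inj_on p (carrier ?X)" using qp by (metis inj_onI)
  have surjp: "p ` carrier ?X = carrier ?H"
  proof
    show "p ` carrier ?X \<subseteq> carrier ?H" using pc by blast
    show "carrier ?H \<subseteq> p ` carrier ?X"
      using pq[symmetric] q.closed by (blast intro: image_eqI)
  qed
  show ?thesis using vH p.surj_fin_dim[OF fdX surjp] p.dim_eq[OF fdX injp surjp] dX by simp
qed

text \<open>The hypotheses of \<open>tensor\<close> that concern \<open>R\<close> and
  \<open>M\<close> alone, separated because the other factor runs through all terms of a
  resolution.\<close>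

locale tensor_left = K?: cring K for K :: "('k, 'z) ring_scheme" (structure) +
  fixes R :: "('k, 'r) module" and M :: "('r, 'm) module"
  assumes scalar_closed: "c \<in> carrier K \<Longrightarrow> c \<odot>\<^bsub>R\<^esub> \<one>\<^bsub>R\<^esub> \<in> carrier R"
    and M_add_closed: "x \<in> carrier M \<Longrightarrow> x' \<in> carrier M \<Longrightarrow> x \<oplus>\<^bsub>M\<^esub> x' \<in> carrier M"
    and M_smult_closed: "r \<in> carrier R \<Longrightarrow> x \<in> carrier M \<Longrightarrow> r \<odot>\<^bsub>M\<^esub> x \<in> carrier M"
begin

lemma tensor:
  assumes "left_module R N" shows "tensor K R M N"
proof -
  interpret N: left_module R N by fact
  show ?thesis
    by unfold_locales (auto simp: scalar_closed M_add_closed M_smult_closed N.smult_closed)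
qed

end

locale tensor_resolution = tensor_left K R M + resolution R N P d \<epsilon>
  for K :: "('k, 'z) ring_scheme" (structure) and R :: "('k, 'r) module" and M :: "('r, 'm) module"
    and N :: "('r, 'n) module" and P :: "nat \<Rightarrow> ('r, 'p) module" and d \<epsilon>
begin

abbreviation "C \<equiv> \<lambda>i. tensor_product K R M (P i)"
abbreviation "D \<equiv> \<lambda>i. tensor_map K R M (P i) (d i)"

lemma tensor_P: "tensor K R M (P i)"
  by (rule tensor[OF module])

lemma C_module: "left_module K (C i)"
  by (rule tensor.T_module[OF tensor_P])

lemma D_hom: "D i \<in> module_hom K (C (Suc i)) (C i)"
  by (rule tensor_functor.tensor_map_hom[OF _ d_hom]) (simp add: tensor_functor_def tensor_P)

lemma D_D:
  assumes "x \<in> carrier (C (Suc (Suc i)))" shows "D i (D (Suc i) x) = \<zero>\<^bsub>C i\<^esub>"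
proof -
  interpret C: left_module K "C i" by (rule C_module)
  interpret C'': tensor K R M "P (Suc (Suc i))" by (rule tensor_P)
  interpret A: tensor_functor K R M "P (Suc (Suc i))" "P i" by (simp add: tensor_functor_def tensor_P)
  interpret Pi: left_module R "P i" by (rule module)
  note dd = module_hom_comp[OF d_hom[of "Suc i"] d_hom[of i]]
  have p0: "A.N'.pure y \<zero>\<^bsub>P i\<^esub> = \<zero>\<^bsub>C i\<^esub>" if y: "y \<in> carrier M" for y
    using A.N'.pure_relations(2)[OF y Pi.M.zero_closed Pi.M.zero_closed]
      A.N'.pure_closed[OF y Pi.M.zero_closed] by (simp add: C.M.add.l_cancel_one)
  have "tensor_map K R M (P i) (\<lambda>x. d i (d (Suc i) x)) x = (\<lambda>_. \<zero>\<^bsub>C i\<^esub>) x"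
    by (rule C''.hom_eqI[OF C_module A.tensor_map_hom[OF dd] _ assms])
      (auto simp: A.tensor_map_pure[OF dd] d_d p0 intro!: module_homI)
  then show ?thesis
    using tensor_map_comp[OF tensor_P tensor_P tensor_P d_hom d_hom assms] by simp
qed

lemma cycles_submodule: "left_submodule K (C m) (cycles C D m)"
proof (cases m)
  case 0
  interpret left_module K "C 0" by (rule C_module)
  show ?thesis unfolding 0 by unfold_locales (auto simp: cycles_def smult_closed)
next
  case (Suc i)
  show ?thesis
    unfolding Suc cycles_def nat.case by (rule kernel_submodule[OF C_module C_module D_hom])
qed

lemma cycles_subset: "cycles C D m \<subseteq> carrier (C m)"
  by (rule left_submodule.subset[OF cycles_submodule])

lemma D_cycles: "x \<in> carrier (C (Suc m)) \<Longrightarrow> D m x \<in> cycles C D m"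
  using module_hom_in[OF D_hom] D_D by (cases m) (auto simp: cycles_def)

lemma boundaries_subset: "boundaries C D m \<subseteq> cycles C D m"
  using D_cycles by (auto simp: boundaries_def)

end

locale tensor_resolution_pair = A: tensor_resolution K R M N P d \<epsilon> + B: tensor_resolution K R M N Q d' \<epsilon>'
  for K :: "('k, 'z) ring_scheme" and R :: "('k, 'r) module" and M :: "('r, 'm) module"
    and N :: "('r, 'n) module"
    and P :: "nat \<Rightarrow> ('r, 'p) module" and d \<epsilon> and Q :: "nat \<Rightarrow> ('r, 'q) module" and d' \<epsilon>'
begin

lemma resolution_pair: "resolution_pair R N P d \<epsilon> Q d' \<epsilon>'"
  by (simp add: resolution_pair_def A.resolution_axioms B.resolution_axioms)

lemma pair_functor: "tensor_functor K R M (P i) (Q j)"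
  by (simp add: tensor_functor_def A.tensor_P B.tensor_P)

lemma chain_map:
  assumes f: "resolution_pair.chain_lift R P d \<epsilon> Q d' \<epsilon>' f" and x: "x \<in> carrier (A.C (Suc n))"
  shows "B.D n (tensor_map K R M (Q (Suc n)) (f (Suc n)) x) = tensor_map K R M (Q n) (f n) (A.D n x)"
proof -
  have fh: "f n \<in> module_hom R (P n) (Q n)" for n
    using f resolution_pair.chain_lift_def[OF resolution_pair] by metis
  have e: "d' n (f (Suc n) y) = f n (d n y)" if "y \<in> carrier (P (Suc n))" for y
    using f that resolution_pair.chain_lift_def[OF resolution_pair] by metis
  show ?thesis
    unfolding tensor_map_comp[OF A.tensor_P B.tensor_P B.tensor_P fh B.d_hom x]
      tensor_map_comp[OF A.tensor_P A.tensor_P B.tensor_P A.d_hom fh x]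
    by (rule tensor_functor.tensor_map_eqI[OF pair_functor module_hom_comp[OF fh B.d_hom]
          module_hom_comp[OF A.d_hom fh] e x])
qed

text \<open>Both \<open>g f\<close> and the identity lift the identity of \<open>N\<close>, hence
  they are homotopic. After tensoring, the homotopy has two correction terms; on cycles the one that
  starts with the differential vanishes, and in degree 0 it is absent.\<close>

lemma chain_homotopy:
  assumes f: "resolution_pair.chain_lift R P d \<epsilon> Q d' \<epsilon>' f"
    and g: "resolution_pair.chain_lift R Q d' \<epsilon>' P d \<epsilon> g"
  shows "\<exists>S. \<forall>x\<in>cycles A.C A.D m. S x \<in> carrier (A.C (Suc m)) \<and>
    tensor_map K R M (P m) (g m) (tensor_map K R M (Q m) (f m) x) = x \<oplus>\<^bsub>A.C m\<^esub> A.D m (S x)"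
proof -
  interpret PQ: resolution_pair R N P d \<epsilon> Q d' \<epsilon>' by (rule resolution_pair)
  interpret QP: resolution_pair R N Q d' \<epsilon>' P d \<epsilon>
    by (simp add: resolution_pair_def A.resolution_axioms B.resolution_axioms)
  interpret PP: resolution_pair R N P d \<epsilon> P d \<epsilon>
    by (simp add: resolution_pair_def A.resolution_axioms)
  have fh: "f n \<in> module_hom R (P n) (Q n)" and gh: "g n \<in> module_hom R (Q n) (P n)" for n
    using f g by (simp_all add: PQ.chain_lift_def QP.chain_lift_def)
  note gf = module_hom_comp[OF fh gh]
  have idh: "(\<lambda>x. x) \<in> module_hom R (P n) (P n)" for n by (rule module_homI) auto
  have "PP.chain_lift (\<lambda>n x. g n (f n x))" "PP.chain_lift (\<lambda>n x. x)"
    using f g gf idh module_hom_in[OF fh]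
    by (simp_all add: PP.chain_lift_def PQ.chain_lift_def QP.chain_lift_def)
  then obtain s where s: "PP.homotopy (\<lambda>n x. g n (f n x)) (\<lambda>n x. x) s"
    using PP.homotopy_exists by blast
  then have sh: "s n \<in> module_hom R (P n) (P (Suc n))" for n by (simp add: PP.homotopy_def)
  let ?S = "\<lambda>n. tensor_map K R M (P (Suc n)) (s n)"
  have func: "tensor_functor K R M (P i) (P j)" for i j by (simp add: tensor_functor_def A.tensor_P)
  have Sh: "?S n \<in> module_hom K (A.C n) (A.C (Suc n))" for n
    by (rule tensor_functor.tensor_map_hom[OF func sh])
  note tid = tensor_map_id[OF A.tensor_P idh refl]
  note tgf = tensor_map_comp[OF A.tensor_P B.tensor_P A.tensor_P fh gh]
  have "tensor_map K R M (P m) (\<lambda>x. g m (f m x)) x = x \<oplus>\<^bsub>A.C m\<^esub> A.D m (?S m x)"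
    if x: "x \<in> cycles A.C A.D m" for x
  proof (cases m)
    case 0
    have xc: "x \<in> carrier (A.C 0)" using x A.cycles_subset 0 by blast
    have "tensor_map K R M (P 0) (\<lambda>x. g 0 (f 0 x)) x =
        tensor_map K R M (P 0) (\<lambda>x. x) x \<oplus>\<^bsub>A.C 0\<^esub> tensor_map K R M (P 0) (\<lambda>x. d 0 (s 0 x)) x"
      by (rule tensor_functor.tensor_map_add[OF func idh module_hom_comp[OF sh A.d_hom] gf _ xc])
        (use s in \<open>simp add: PP.homotopy_def\<close>)
    then show ?thesis
      using tensor_map_comp[OF A.tensor_P A.tensor_P A.tensor_P sh A.d_hom xc] tid[OF xc] 0 by simp
  next
    case (Suc n)
    have xc: "x \<in> carrier (A.C (Suc n))" using x A.cycles_subset Suc by blast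
    have Dx: "A.D n x = \<zero>\<^bsub>A.C n\<^esub>" using x Suc by (simp add: cycles_def)
    note ds = module_hom_comp[OF sh A.d_hom] and sd = module_hom_comp[OF A.d_hom sh]
    have sum: "(\<lambda>x. d (Suc n) (s (Suc n) x) \<oplus>\<^bsub>P (Suc n)\<^esub> s n (d n x))
        \<in> module_hom R (P (Suc n)) (P (Suc n))"
      by (rule module_hom_plus[OF A.module A.module ds sd])
    have "tensor_map K R M (P (Suc n)) (\<lambda>x. g (Suc n) (f (Suc n) x)) x =
        tensor_map K R M (P (Suc n)) (\<lambda>x. x) x \<oplus>\<^bsub>A.C (Suc n)\<^esub>
        tensor_map K R M (P (Suc n)) (\<lambda>x. d (Suc n) (s (Suc n) x) \<oplus>\<^bsub>P (Suc n)\<^esub> s n (d n x)) x"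
      by (rule tensor_functor.tensor_map_add[OF func idh sum gf _ xc])
        (use s in \<open>simp add: PP.homotopy_def\<close>)
    also have "tensor_map K R M (P (Suc n)) (\<lambda>x. d (Suc n) (s (Suc n) x) \<oplus>\<^bsub>P (Suc n)\<^esub> s n (d n x)) x
      = A.D (Suc n) (?S (Suc n) x) \<oplus>\<^bsub>A.C (Suc n)\<^esub> ?S n (A.D n x)"
      unfolding tensor_map_comp[OF A.tensor_P A.tensor_P A.tensor_P sh A.d_hom xc]
        tensor_map_comp[OF A.tensor_P A.tensor_P A.tensor_P A.d_hom sh xc]
      by (rule tensor_functor.tensor_map_add[OF func ds sd sum refl xc])
    also have "?S n (A.D n x) = \<zero>\<^bsub>A.C (Suc n)\<^esub>"
      unfolding Dx by (rule left_module_hom.zero[OF left_module_homI[OF A.C_module A.C_module Sh]])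
    finally show ?thesis
      using module_hom_in[OF A.D_hom module_hom_in[OF Sh xc]] tid[OF xc] Suc
        abelian_groupE(5)[OF left_module.axioms(2)[OF A.C_module[of "Suc n"]]]
        left_module.axioms(2)[OF A.C_module[of "Suc n"]]
      by (simp add: abelian_monoid.r_zero abelian_group.axioms(1))
  qed
  then show ?thesis
    using module_hom_in[OF Sh] A.cycles_subset[of m] tgf[of _ m] by (intro exI[of _ "?S m"]) auto
qed

end

text \<open>Let \<open>F\<close> and \<open>G\<close> be induced by comparison maps in both
  directions. If \<open>F x\<close> is a boundary, then \<open>x\<close>, which equals
  \<open>G (F x)\<close> up to a boundary, is one too. Every cycle \<open>y\<close> is
  \<open>F (G y)\<close> up to a boundary.\<close>

lemma tor_quasi_iso:
  assumes "tensor_resolution K R M N P d \<epsilon>" "tensor_resolution K R M N Q d' \<epsilon>'"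
  shows "\<exists>f. quasi_iso K (\<lambda>i. tensor_product K R M (P i)) (\<lambda>i. tensor_map K R M (P i) (d i))
    (\<lambda>i. tensor_product K R M (Q i)) (\<lambda>i. tensor_map K R M (Q i) (d' i)) m f"
proof -
  interpret A: tensor_resolution_pair K R M N P d \<epsilon> Q d' \<epsilon>'
    using assms by (simp add: tensor_resolution_pair_def)
  interpret B: tensor_resolution_pair K R M N Q d' \<epsilon>' P d \<epsilon>
    using assms by (simp add: tensor_resolution_pair_def)
  obtain f where f: "resolution_pair.chain_lift R P d \<epsilon> Q d' \<epsilon>' f"
    using resolution_pair.chain_lift_exists[OF A.resolution_pair] by blast
  obtain g where g: "resolution_pair.chain_lift R Q d' \<epsilon>' P d \<epsilon> g"
    using resolution_pair.chain_lift_exists[OF B.resolution_pair] by blast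
  have fh: "f n \<in> module_hom R (P n) (Q n)" and gh: "g n \<in> module_hom R (Q n) (P n)" for n
    using f g resolution_pair.chain_lift_def[OF A.resolution_pair]
      resolution_pair.chain_lift_def[OF B.resolution_pair] by metis+
  let ?F = "\<lambda>n. tensor_map K R M (Q n) (f n)" and ?G = "\<lambda>n. tensor_map K R M (P n) (g n)"
  have Fh: "?F n \<in> module_hom K (A.A.C n) (A.B.C n)" for n
    by (rule tensor_functor.tensor_map_hom[OF A.pair_functor fh])
  have Gh: "?G n \<in> module_hom K (A.B.C n) (A.A.C n)" for n
    by (rule tensor_functor.tensor_map_hom[OF B.pair_functor gh])
  note F0 = left_module_hom.zero[OF left_module_homI[OF A.A.C_module A.B.C_module Fh]]
  note G0 = left_module_hom.zero[OF left_module_homI[OF A.B.C_module A.A.C_module Gh]]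
  obtain S where S': "\<forall>x\<in>cycles A.A.C A.A.D m. S x \<in> carrier (A.A.C (Suc m)) \<and>
      ?G m (?F m x) = x \<oplus>\<^bsub>A.A.C m\<^esub> A.A.D m (S x)"
    using A.chain_homotopy[OF f g, of m] by (rule exE)
  note S = bspec[OF S', THEN conjunct1] bspec[OF S', THEN conjunct2]
  obtain T where T': "\<forall>x\<in>cycles A.B.C A.B.D m. T x \<in> carrier (A.B.C (Suc m)) \<and>
      ?F m (?G m x) = x \<oplus>\<^bsub>A.B.C m\<^esub> A.B.D m (T x)"
    using B.chain_homotopy[OF g f, of m] by (rule exE)
  note T = bspec[OF T', THEN conjunct1] bspec[OF T', THEN conjunct2]
  have Fz: "?F m x \<in> cycles A.B.C A.B.D m" if "x \<in> cycles A.A.C A.A.D m" for x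
    using that module_hom_in[OF Fh] A.chain_map[OF f] F0 by (cases m) (simp_all add: cycles_def)
  have Gz: "?G m x \<in> cycles A.A.C A.A.D m" if "x \<in> cycles A.B.C A.B.D m" for x
    using that module_hom_in[OF Gh] B.chain_map[OF g] G0 by (cases m) (simp_all add: cycles_def)
  have Fb: "?F m x \<in> boundaries A.B.C A.B.D m" if "x \<in> boundaries A.A.C A.A.D m" for x
    using that A.chain_map[OF f] module_hom_in[OF Fh] by (force simp: boundaries_def)
  have Gb: "?G m x \<in> boundaries A.A.C A.A.D m" if "x \<in> boundaries A.B.C A.B.D m" for x
    using that B.chain_map[OF g] module_hom_in[OF Gh] by (force simp: boundaries_def)
  interpret BA: left_submodule K "A.A.C m" "boundaries A.A.C A.A.D m"
    unfolding boundaries_def by (rule image_submodule[OF A.A.C_module A.A.C_module A.A.D_hom])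
  interpret BB: left_submodule K "A.B.C m" "boundaries A.B.C A.B.D m"
    unfolding boundaries_def by (rule image_submodule[OF A.B.C_module A.B.C_module A.B.D_hom])
  have "x \<in> boundaries A.A.C A.A.D m" if x: "x \<in> cycles A.A.C A.A.D m" "?F m x \<in> boundaries A.B.C A.B.D m" for x
  proof -
    have xc: "x \<in> carrier (A.A.C m)" using x A.A.cycles_subset by blast
    have b: "A.A.D m (S x) \<in> boundaries A.A.C A.A.D m" using S x by (auto simp: boundaries_def)
    have "x = ?G m (?F m x) \<ominus>\<^bsub>A.A.C m\<^esub> A.A.D m (S x)"
      using S(2)[OF x(1)] xc b BA.subset by (auto simp: BA.M.minus_eq BA.M.a_assoc BA.M.r_neg subset_iff)
    then show ?thesis using BA.diff_in[OF Gb[OF x(2)] b] by simp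
  qed
  moreover have "\<exists>x\<in>cycles A.A.C A.A.D m. \<exists>b\<in>boundaries A.B.C A.B.D m. y = ?F m x \<oplus>\<^bsub>A.B.C m\<^esub> b"
    if y: "y \<in> cycles A.B.C A.B.D m" for y
  proof (intro bexI)
    have yc: "y \<in> carrier (A.B.C m)" using y A.B.cycles_subset by blast
    have b: "A.B.D m (T y) \<in> boundaries A.B.C A.B.D m" using T y by (auto simp: boundaries_def)
    show "y = ?F m (?G m y) \<oplus>\<^bsub>A.B.C m\<^esub> (\<ominus>\<^bsub>A.B.C m\<^esub> A.B.D m (T y))"
      using T(2)[OF y] yc b BB.subset by (auto simp: BB.M.a_assoc BB.M.r_neg subset_iff)
    show "\<ominus>\<^bsub>A.B.C m\<^esub> A.B.D m (T y) \<in> boundaries A.B.C A.B.D m" using b by (rule BB.minus_in)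
    show "?G m y \<in> cycles A.A.C A.A.D m" using Gz y .
  qed
  ultimately have "quasi_iso K A.A.C A.A.D A.B.C A.B.D m (?F m)"
    unfolding quasi_iso_def using Fh Fz Fb by blast
  then show ?thesis by blast
qed

text \<open>The elements of \<open>P\<close> have exactly the type over which \<open>SOME\<close>
  ranges in \<open>some_projective_resolution\<close>. So \<open>P\<close> witnesses that the chosen
  tuple really is a resolution, and the comparison with it carries over the coordinates.\<close>

lemma Tor_dim:
  fixes R :: "('k, 'r) module" and N :: "('r, 'n) module"
    and P :: "nat \<Rightarrow> ('r, 'r list \<times> 'n \<Rightarrow> 'r) module"
  assumes "field K" and P: "tensor_resolution K R M N P d \<epsilon>"
    and \<kappa>: "homology_coords K (\<lambda>i. tensor_product K R M (P i)) (\<lambda>i. tensor_map K R M (P i) (d i)) m X \<kappa>"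
    and X: "finite X"
  shows "vectorspace K (Tor K R M N m) \<and> vectorspace.fin_dim K (Tor K R M N m) \<and>
    vectorspace.dim K (Tor K R M N m) = card X"
proof -
  interpret K: field K by fact
  interpret P: tensor_resolution K R M N P d \<epsilon> by fact
  obtain Q d' \<epsilon>' where Q: "some_projective_resolution R N = (Q, d', \<epsilon>')"
    by (cases "some_projective_resolution R N") auto
  have "case (P, d, \<epsilon>) of (Q, d', \<epsilon>') \<Rightarrow> projective_resolution R N Q d' \<epsilon>'"
    using P.resolution by simp
  from someI[of "\<lambda>(Q, d', \<epsilon>'). projective_resolution R N Q d' \<epsilon>'", OF this]
  have "projective_resolution R N Q d' \<epsilon>'"
    using Q unfolding some_projective_resolution_def by simp
  then interpret Q: tensor_resolution K R M N Q d' \<epsilon>' by unfold_locales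
  obtain f where f: "quasi_iso K Q.C Q.D P.C P.D m f"
    using tor_quasi_iso[OF Q.tensor_resolution_axioms P] by blast
  have "homology_coords K Q.C Q.D m X (\<lambda>x. \<kappa> (f x))"
    by (rule homology_coords_pullback[OF K.ring_axioms f \<kappa> Q.cycles_subset P.cycles_subset
          P.boundaries_subset])
  moreover have "Tor K R M N m = homology Q.C Q.D m" by (simp add: Tor_def Q)
  ultimately show ?thesis
    using homology_dim[OF assms(1) Q.C_module Q.C_module Q.D_hom Q.cycles_submodule
        Q.boundaries_subset _ X] by simp
qed

section \<open>Algebras over a commutative ring\<close>

lemma zero_hom:
  assumes "left_module R M" "left_module R N" shows "(\<lambda>_. \<zero>\<^bsub>N\<^esub>) \<in> module_hom R M N"
proof -
  interpret M: left_module R M by fact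
  interpret N: left_module R N by fact
  show ?thesis by (rule module_homI) auto
qed

locale k_algebra = K?: cring K + A?: ring A + AM?: left_module K A
  for K :: "('k, 'z) ring_scheme" and A :: "('k, 'a) module" (structure) +
  assumes smult_mult_l: "c \<in> carrier K \<Longrightarrow> x \<in> carrier A \<Longrightarrow> y \<in> carrier A \<Longrightarrow> (c \<odot> x) \<otimes> y = c \<odot> (x \<otimes> y)"
    and smult_mult_r: "c \<in> carrier K \<Longrightarrow> x \<in> carrier A \<Longrightarrow> y \<in> carrier A \<Longrightarrow> x \<otimes> (c \<odot> y) = c \<odot> (x \<otimes> y)"
begin

lemma mult_hom_l: "y \<in> carrier A \<Longrightarrow> (\<lambda>x. x \<otimes> y) \<in> module_hom K A A"
  by (rule module_homI) (auto simp: A.l_distr smult_mult_l)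

lemma mult_hom_r: "x \<in> carrier A \<Longrightarrow> (\<lambda>y. x \<otimes> y) \<in> module_hom K A A"
  by (rule module_homI) (auto simp: A.r_distr smult_mult_r)

lemma opposite_k_algebra: "k_algebra K (opposite A)"
proof -
  have s [simp]: "carrier (opposite A) = carrier A" "\<one>\<^bsub>opposite A\<^esub> = \<one>" "\<zero>\<^bsub>opposite A\<^esub> = \<zero>"
    "x \<oplus>\<^bsub>opposite A\<^esub> y = x \<oplus> y" "x \<otimes>\<^bsub>opposite A\<^esub> y = y \<otimes> x" "c \<odot>\<^bsub>opposite A\<^esub> x = c \<odot> x" for x y c
    by (simp_all add: opposite_def)
  have "abelian_group (opposite A)"
    by (rule abelian_groupI) (auto simp: A.a_ac intro: A.l_neg)
  moreover have "monoid (opposite A)"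
    by (rule monoidI) (auto simp: A.m_assoc)
  ultimately have "ring (opposite A)"
    by (rule ringI) (auto simp: A.l_distr A.r_distr)
  moreover have "left_module K (opposite A)"
    by (rule AM.left_module_image[where p = id]) auto
  ultimately show ?thesis
    by (simp add: k_algebra_def k_algebra_axioms_def K.cring_axioms smult_mult_l smult_mult_r)
qed

text \<open>Scalars act as multiplication by \<open>c \<odot> \<one>\<close>, so ideals absorb
  them.\<close>

lemma ideal_submodule:
  assumes "ideal I A" shows "left_submodule K A I"
proof -
  interpret I: ideal I A by fact
  have "c \<odot> x \<in> I" if "c \<in> carrier K" "x \<in> I" for c x
  proof -
    have "c \<odot> x = (c \<odot> \<one>) \<otimes> x" using that by (simp add: smult_mult_l)
    then show ?thesis using that I.I_l_closed[of x "c \<odot> \<one>"] AM.smult_closed by simp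
  qed
  then show ?thesis by unfold_locales (use I.a_subset in auto)
qed

lemma coset_mult:
  assumes "ideal I A" "x \<in> carrier A" "y \<in> carrier A"
  shows "(I +> x) \<otimes>\<^bsub>quotient_module A I\<^esub> (I +> y) = I +> (x \<otimes> y)"
  using ideal.rcoset_mult_add[OF assms] by simp

lemma quotient_k_algebra:
  assumes I: "ideal I A" shows "k_algebra K (quotient_module A I)"
proof -
  interpret Is: left_submodule K A I by (rule ideal_submodule[OF I])
  note cq = Is.carrier_quotient and cm = coset_mult[OF I]
  have m: "left_module K (quotient_module A I)" by (rule Is.quotient_left_module)
  have r: "ring (quotient_module A I)"
    by (rule A.ring_image[where p = "\<lambda>x. I +> x", OF cq[symmetric]])
      (simp_all add: Is.coset_add cm[simplified] Is.coset_zero)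
  have sm: "c \<odot>\<^bsub>quotient_module A I\<^esub> (I +> x) = I +> (c \<odot> x)"
    if "c \<in> carrier K" "x \<in> carrier A" for c x
    using Is.coset_smult that by simp
  show ?thesis
    unfolding k_algebra_def k_algebra_axioms_def cq
    using K.cring_axioms r m
    by (auto simp del: quotient_module_simps simp: sm cm AM.smult_closed smult_mult_l smult_mult_r)
qed

end

section \<open>Monoid algebras\<close>

lemma monoid_algebra_simps [simp]:
  "carrier (monoid_algebra K G) = carrier (free_module K (carrier G))"
  "\<zero>\<^bsub>monoid_algebra K G\<^esub> = \<zero>\<^bsub>free_module K (carrier G)\<^esub>"
  "\<one>\<^bsub>monoid_algebra K G\<^esub> = basis_elt K \<one>\<^bsub>G\<^esub>"
  "f \<oplus>\<^bsub>monoid_algebra K G\<^esub> g = f \<oplus>\<^bsub>free_module K (carrier G)\<^esub> g"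
  "c \<odot>\<^bsub>monoid_algebra K G\<^esub> f = c \<odot>\<^bsub>free_module K (carrier G)\<^esub> f"
  by (simp_all add: monoid_algebra_def)

lemma module_hom_monoid_algebra:
  "module_hom K (monoid_algebra K G) N = module_hom K (free_module K (carrier G)) N"
  "module_hom K N (monoid_algebra K G) = module_hom K N (free_module K (carrier G))"
  by (simp_all add: module_hom_def)

lemma coset_monoid_algebra: "I +>\<^bsub>monoid_algebra K G\<^esub> f = I +>\<^bsub>free_module K (carrier G)\<^esub> f"
  by (simp add: a_r_coset_def')

text \<open>Linearity in a parameter of the basis values. Commutativity is what moves a scalar past
  the coefficients \<open>f s\<close>.\<close>

lemma (in ring) module_hom_free_ext_param:
  assumes V: "left_module R V" and W: "left_module R W" and R: "cring R"
    and f: "f \<in> carrier (free_module R S)"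
    and b: "\<And>s. s \<in> S \<Longrightarrow> b s \<in> module_hom R W V"
  shows "(\<lambda>g. free_ext R V (\<lambda>s. b s g) f) \<in> module_hom R W V"
proof (rule module_homI)
  interpret R: cring R by fact
  interpret V: left_module R V by fact
  interpret W: left_module R W by fact
  have S: "s \<in> S" "f s \<in> carrier R" if "f s \<noteq> \<zero>" for s using f that by auto
  note c = module_hom_in[OF b[OF S(1)]] and cb = module_hom_in[OF b]
  show "free_ext R V (\<lambda>s. b s g) f \<in> carrier V" if "g \<in> carrier W" for g
    using cb that by (intro V.free_ext_closed[OF f]) auto
  show "free_ext R V (\<lambda>s. b s (g \<oplus>\<^bsub>W\<^esub> h)) f = free_ext R V (\<lambda>s. b s g) f \<oplus>\<^bsub>V\<^esub> free_ext R V (\<lambda>s. b s h) f"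
    if "g \<in> carrier W" "h \<in> carrier W" for g h
    unfolding free_ext_def using S that
    by (subst V.M.finsum_addf[symmetric])
      (auto intro!: V.M.finsum_cong' V.smult_closed V.M.a_closed c simp: module_hom_add[OF b] V.smult_r_distr cb)
  show "free_ext R V (\<lambda>s. b s (r \<odot>\<^bsub>W\<^esub> g)) f = r \<odot>\<^bsub>V\<^esub> free_ext R V (\<lambda>s. b s g) f"
    if "r \<in> carrier R" "g \<in> carrier W" for r g
    unfolding free_ext_def using S that
    by (subst V.smult_finsum)
      (auto intro!: V.M.finsum_cong' V.smult_closed c
        simp: module_hom_smult[OF b] V.smult_assoc[symmetric] cb R.m_comm)
qed

locale monoid_alg = K?: cring K + G?: monoid G
  for K :: "('k, 'z) ring_scheme" and G :: "('g, 'y) monoid_scheme" (structure)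
begin

abbreviation "F \<equiv> free_module K (carrier G)"
abbreviation "MA \<equiv> monoid_algebra K G"

lemma F_module: "left_module K F"
  by (rule K.free_module_left_module)

lemma MA_module: "left_module K MA"
  by (rule left_module.left_module_image[OF F_module, where p = id]) (simp_all del: free_module_simps)

text \<open>Convolution is the bilinear extension of the multiplication of \<open>G\<close>. In this
  form bilinearity is a consequence of the lemmas on \<open>free_ext\<close>.\<close>

lemma mult_eq:
  assumes f: "f \<in> carrier F" and g: "g \<in> carrier F"
  shows "f \<otimes>\<^bsub>MA\<^esub> g = free_ext K F (\<lambda>u. free_ext K F (\<lambda>v. basis_elt K (u \<otimes> v)) g) f"
proof
  interpret F: left_module K F by (rule F_module)
  fix x
  let ?S = "{u. f u \<noteq> \<zero>\<^bsub>K\<^esub>}" and ?T = "{v. g v \<noteq> \<zero>\<^bsub>K\<^esub>}"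
  have S: "finite ?S" "\<And>u. f u \<noteq> \<zero>\<^bsub>K\<^esub> \<Longrightarrow> u \<in> carrier G" "\<And>u. f u \<in> carrier K"
    and T: "finite ?T" "\<And>u. g u \<noteq> \<zero>\<^bsub>K\<^esub> \<Longrightarrow> u \<in> carrier G" "\<And>u. g u \<in> carrier K" using f g by auto
  let ?Tx = "\<lambda>u. {v. g v \<noteq> \<zero>\<^bsub>K\<^esub> \<and> u \<otimes> v = x}"
  have Tx: "finite (?Tx u)" for u using T(1) by (rule finite_subset[rotated]) auto
  have inner: "free_ext K F (\<lambda>v. basis_elt K (u \<otimes> v)) g \<in> carrier F" if "u \<in> carrier G" for u
    by (rule F.free_ext_closed[OF g]) (use that in \<open>auto simp del: free_module_simps\<close>)
  have inner_x: "free_ext K F (\<lambda>v. basis_elt K (u \<otimes> v)) g x = (\<Oplus>\<^bsub>K\<^esub>v\<in>?Tx u. g v)" if u: "u \<in> carrier G" for u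
  proof -
    have "free_ext K F (\<lambda>v. basis_elt K (u \<otimes> v)) g x =
        (\<Oplus>\<^bsub>K\<^esub>v\<in>?T. (g v \<odot>\<^bsub>F\<^esub> basis_elt K (u \<otimes> v)) x)"
      unfolding free_ext_def
      by (rule free_module_finsum[OF K.ring_axioms])
        (use T u in \<open>auto intro!: F.smult_closed simp del: free_module_simps\<close>)
    also have "\<dots> = (\<Oplus>\<^bsub>K\<^esub>v\<in>?Tx u. (g v \<odot>\<^bsub>F\<^esub> basis_elt K (u \<otimes> v)) x)"
      by (rule finsum_mono_neutral[OF K.abelian_monoid_axioms, symmetric])
        (use T in \<open>auto simp: basis_elt_def\<close>)
    also have "\<dots> = (\<Oplus>\<^bsub>K\<^esub>v\<in>?Tx u. g v)"
      by (rule K.finsum_cong') (use T in \<open>auto simp: basis_elt_def\<close>)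
    finally show ?thesis .
  qed
  \<comment> \<open>Slicing the index set of the convolution by the first component turns the sum
    into an iterated one.\<close>
  have "{(u, v). f u \<noteq> \<zero>\<^bsub>K\<^esub> \<and> g v \<noteq> \<zero>\<^bsub>K\<^esub> \<and> u \<otimes> v = x} = (\<Union>u\<in>?S. Pair u ` ?Tx u)" by auto
  then have "(f \<otimes>\<^bsub>MA\<^esub> g) x = (\<Oplus>\<^bsub>K\<^esub>p\<in>(\<Union>u\<in>?S. Pair u ` ?Tx u). f (fst p) \<otimes>\<^bsub>K\<^esub> g (snd p))"
    by (simp add: monoid_algebra_def)
  also have "\<dots> = (\<Oplus>\<^bsub>K\<^esub>u\<in>?S. \<Oplus>\<^bsub>K\<^esub>p\<in>Pair u ` ?Tx u. f (fst p) \<otimes>\<^bsub>K\<^esub> g (snd p))"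
    by (rule K.add.finprod_UN_disjoint) (use S T Tx in \<open>auto simp: pairwise_def disjnt_def\<close>)
  also have "\<dots> = (\<Oplus>\<^bsub>K\<^esub>u\<in>?S. \<Oplus>\<^bsub>K\<^esub>v\<in>?Tx u. f u \<otimes>\<^bsub>K\<^esub> g v)"
    by (intro K.finsum_cong', simp, use S T in \<open>auto intro!: K.finsum_closed\<close>)
      (subst K.finsum_reindex, use S T in \<open>auto simp: inj_on_def\<close>)
  also have "\<dots> = (\<Oplus>\<^bsub>K\<^esub>u\<in>?S. f u \<otimes>\<^bsub>K\<^esub> free_ext K F (\<lambda>v. basis_elt K (u \<otimes> v)) g x)"
    by (intro K.finsum_cong')
      (use S T in \<open>auto simp: inner_x K.finsum_rdistr[OF Tx] intro!: K.m_closed K.finsum_closed\<close>)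
  also have "\<dots> = free_ext K F (\<lambda>u. free_ext K F (\<lambda>v. basis_elt K (u \<otimes> v)) g) f x"
    unfolding free_ext_def[where b = "\<lambda>u. free_ext K F (\<lambda>v. basis_elt K (u \<otimes> v)) g"]
    by (subst free_module_finsum[OF K.ring_axioms])
      (use S inner in \<open>auto intro!: F.smult_closed simp del: free_module_simps, auto\<close>)
  finally show "(f \<otimes>\<^bsub>MA\<^esub> g) x = free_ext K F (\<lambda>u. free_ext K F (\<lambda>v. basis_elt K (u \<otimes> v)) g) f x" .
qed

lemma mult_hom_l: "g \<in> carrier F \<Longrightarrow> (\<lambda>f. f \<otimes>\<^bsub>MA\<^esub> g) \<in> module_hom K F F"
proof -
  assume g: "g \<in> carrier F"
  interpret F: left_module K F by (rule F_module)
  have "free_ext K F (\<lambda>v. basis_elt K (u \<otimes> v)) g \<in> carrier F" if "u \<in> carrier G" for u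
    by (rule F.free_ext_closed[OF g]) (use that in \<open>auto simp del: free_module_simps\<close>)
  then have h: "free_ext K F (\<lambda>u. free_ext K F (\<lambda>v. basis_elt K (u \<otimes> v)) g) \<in> module_hom K F F"
    by (intro F.free_ext_hom) auto
  show ?thesis by (rule module_hom_cong[OF h mult_eq[OF _ g, symmetric] F_module])
qed

lemma mult_hom_r: "f \<in> carrier F \<Longrightarrow> (\<lambda>g. f \<otimes>\<^bsub>MA\<^esub> g) \<in> module_hom K F F"
proof -
  assume f: "f \<in> carrier F"
  interpret F: left_module K F by (rule F_module)
  have h: "(\<lambda>g. free_ext K F (\<lambda>u. free_ext K F (\<lambda>v. basis_elt K (u \<otimes> v)) g) f) \<in> module_hom K F F"
    by (rule K.module_hom_free_ext_param[OF F_module F_module K.cring_axioms f])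
      (rule F.free_ext_hom, auto simp del: free_module_simps)
  show ?thesis by (rule module_hom_cong[OF h mult_eq[OF f, symmetric] F_module])
qed

lemma mult_closed: "f \<in> carrier F \<Longrightarrow> g \<in> carrier F \<Longrightarrow> f \<otimes>\<^bsub>MA\<^esub> g \<in> carrier F"
  using module_hom_in[OF mult_hom_r] .

lemma mult_basis:
  assumes "u \<in> carrier G" "v \<in> carrier G"
  shows "basis_elt K u \<otimes>\<^bsub>MA\<^esub> basis_elt K v = basis_elt K (u \<otimes> v)"
proof -
  interpret F: left_module K F by (rule F_module)
  note b = K.basis_elt_closed[of _ "carrier G"]
  have i: "free_ext K F (\<lambda>v. basis_elt K (u \<otimes> v)) (basis_elt K v) = basis_elt K (u \<otimes> v)"
    using F.free_ext_basis[of "\<lambda>v. basis_elt K (u \<otimes> v)" v] b[of "u \<otimes> v"] assms by simp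
  have "free_ext K F (\<lambda>u. free_ext K F (\<lambda>v. basis_elt K (u \<otimes> v)) (basis_elt K v)) (basis_elt K u) =
      free_ext K F (\<lambda>v. basis_elt K (u \<otimes> v)) (basis_elt K v)"
    using F.free_ext_basis[of "\<lambda>u. free_ext K F (\<lambda>v. basis_elt K (u \<otimes> v)) (basis_elt K v)" u]
      i b[of "u \<otimes> v"] assms by simp
  then show ?thesis using mult_eq[OF b b] assms i by simp
qed

text \<open>All laws are multilinear, so they need checking on basis elements only, where they are
  the laws of \<open>G\<close>. For associativity the reduction is made in one argument after the
  other.\<close>

lemma k_algebra: "k_algebra K MA"
proof -
  interpret F: left_module K F by (rule F_module)
  interpret M: left_module K MA by (rule MA_module)
  note b = K.basis_elt_closed[of _ "carrier G"]
  note [simp del] = free_module_simps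
  note eqI = free_hom_eqI[OF F_module]
  have assoc: "f \<otimes>\<^bsub>MA\<^esub> g \<otimes>\<^bsub>MA\<^esub> h = f \<otimes>\<^bsub>MA\<^esub> (g \<otimes>\<^bsub>MA\<^esub> h)"
    if f: "f \<in> carrier F" and g: "g \<in> carrier F" and h: "h \<in> carrier F" for f g h
  proof (rule eqI[OF module_hom_comp[OF mult_hom_l[OF g] mult_hom_l[OF h]]
        mult_hom_l[OF mult_closed[OF g h]] f])
    fix u assume u: "u \<in> carrier G"
    show "basis_elt K u \<otimes>\<^bsub>MA\<^esub> g \<otimes>\<^bsub>MA\<^esub> h = basis_elt K u \<otimes>\<^bsub>MA\<^esub> (g \<otimes>\<^bsub>MA\<^esub> h)"
    proof (rule eqI[OF module_hom_comp[OF mult_hom_r[OF b[OF u]] mult_hom_l[OF h]]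
          module_hom_comp[OF mult_hom_l[OF h] mult_hom_r[OF b[OF u]]] g])
      fix v assume v: "v \<in> carrier G"
      show "basis_elt K u \<otimes>\<^bsub>MA\<^esub> basis_elt K v \<otimes>\<^bsub>MA\<^esub> h = basis_elt K u \<otimes>\<^bsub>MA\<^esub> (basis_elt K v \<otimes>\<^bsub>MA\<^esub> h)"
        by (rule eqI[OF mult_hom_r[OF mult_closed[OF b[OF u] b[OF v]]]
              module_hom_comp[OF mult_hom_r[OF b[OF v]] mult_hom_r[OF b[OF u]]] h])
          (simp add: mult_basis u v G.m_assoc)
    qed
  qed
  have idh: "(\<lambda>x. x) \<in> module_hom K F F" by (rule module_homI) auto
  have one: "basis_elt K \<one> \<otimes>\<^bsub>MA\<^esub> f = f" "f \<otimes>\<^bsub>MA\<^esub> basis_elt K \<one> = f" if "f \<in> carrier F" for f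
    using eqI[OF mult_hom_r[OF b[OF G.one_closed]] idh that] eqI[OF mult_hom_l[OF b[OF G.one_closed]] idh that]
    by (simp_all add: mult_basis)
  have "monoid MA"
    by (rule monoidI) (auto simp: mult_closed b assoc one)
  then have "ring MA"
    using M.M.abelian_group_axioms
    by (intro ringI) (auto simp: module_hom_add[OF mult_hom_l] module_hom_add[OF mult_hom_r])
  then show ?thesis
    unfolding k_algebra_def k_algebra_axioms_def
    using K.cring_axioms MA_module
    by (auto simp: module_hom_smult[OF mult_hom_l] module_hom_smult[OF mult_hom_r])
qed

end

section \<open>The enveloping algebra\<close>

locale tensor_alg = A: k_algebra K A + B: k_algebra K B
  for K :: "('k, 'z) ring_scheme" and A :: "('k, 'a) module" and B :: "('k, 'b) module"
begin

sublocale T: tensor K "self_algebra K" A B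
  by unfold_locales (auto simp: self_algebra_def A.AM.smult_closed B.AM.smult_closed)

sublocale P: monoid_alg K "A \<times>\<times> B"
  by (intro monoid_alg.intro A.K.cring_axioms DirProd_monoid A.A.monoid_axioms B.A.monoid_axioms)

abbreviation "TA \<equiv> tensor_algebra K A B"

lemma F_eq: "free_module K (carrier (A \<times>\<times> B)) = T.F"
  by (simp add: DirProd_def)

text \<open>Multiplication by a basis element followed by the quotient map respects the tensor
  relations, so it kills the kernel by \<open>kills_kernel\<close>. Linearity in the multiplier then
  extends this from basis elements to arbitrary ones.\<close>

lemma kernel_ideal: "ideal T.I P.MA"
proof -
  interpret MA: k_algebra K P.MA by (rule P.k_algebra)
  interpret I: left_submodule K T.F T.I by (rule T.I_submodule)
  note [simp del] = free_module_simps
  let ?q = "\<lambda>f. T.I +>\<^bsub>T.F\<^esub> f"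
  note hl = P.mult_hom_l[unfolded F_eq] and hr = P.mult_hom_r[unfolded F_eq]
  have b: "basis_elt K (x, y) \<in> carrier T.F" if "x \<in> carrier A" "y \<in> carrier B" for x y
    using that by (rule T.basis_elt_F)
  have bm: "basis_elt K (x, y) \<otimes>\<^bsub>P.MA\<^esub> basis_elt K (x', y') = basis_elt K (x \<otimes>\<^bsub>A\<^esub> x', y \<otimes>\<^bsub>B\<^esub> y')"
    if "x \<in> carrier A" "y \<in> carrier B" "x' \<in> carrier A" "y' \<in> carrier B" for x y x' y'
    using P.mult_basis[of "(x, y)" "(x', y')"] that by (simp add: DirProd_def)
  have q0: "?q f = \<zero>\<^bsub>T.T\<^esub> \<longleftrightarrow> f \<in> T.I" if "f \<in> carrier T.F" for f
    using I.coset_eq_zero_iff[OF that] by (simp add: T.zero_T)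
  have sc [simp]: "carrier (self_algebra K) = carrier K" by (simp add: self_algebra_def)
  have sc' [simp]: "c \<odot>\<^bsub>self_algebra K\<^esub> \<one>\<^bsub>self_algebra K\<^esub> = c" if "c \<in> carrier K" for c
    using that by (simp add: self_algebra_def)
  note pr = T.pure_relations[unfolded T.pure_def]
  have basis_l: "basis_elt K (x, y) \<otimes>\<^bsub>P.MA\<^esub> g \<in> T.I"
    if "x \<in> carrier A" "y \<in> carrier B" "g \<in> T.I" for x y g
  proof -
    have "?q (basis_elt K (x, y) \<otimes>\<^bsub>P.MA\<^esub> g) = \<zero>\<^bsub>T.T\<^esub>"
      by (rule T.kills_kernel[OF T.T_module module_hom_comp[OF hr[OF b] T.coset_hom_T] _ _ _ _ that(3)])
        (use that in \<open>auto simp: bm A.A.r_distr B.A.r_distr A.smult_mult_r B.smult_mult_r pr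
          A.AM.smult_closed B.AM.smult_closed\<close>)
    then show ?thesis using q0 module_hom_in[OF hr[OF b]] that I.subset by blast
  qed
  have basis_r: "g \<otimes>\<^bsub>P.MA\<^esub> basis_elt K (x, y) \<in> T.I"
    if "x \<in> carrier A" "y \<in> carrier B" "g \<in> T.I" for x y g
  proof -
    have "?q (g \<otimes>\<^bsub>P.MA\<^esub> basis_elt K (x, y)) = \<zero>\<^bsub>T.T\<^esub>"
      by (rule T.kills_kernel[OF T.T_module module_hom_comp[OF hl[OF b] T.coset_hom_T] _ _ _ _ that(3)])
        (use that in \<open>auto simp: bm A.A.l_distr B.A.l_distr A.smult_mult_l B.smult_mult_l pr
          A.AM.smult_closed B.AM.smult_closed\<close>)
    then show ?thesis using q0 module_hom_in[OF hl[OF b]] that I.subset by blast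
  qed
  have zh: "(\<lambda>_. \<zero>\<^bsub>T.T\<^esub>) \<in> module_hom K T.F T.T"
    by (rule zero_hom[OF T.F_module T.T_module])
  show ?thesis
  proof (rule idealI)
    show "ring P.MA" by (rule MA.A.ring_axioms)
    show "subgroup T.I (add_monoid P.MA)"
    proof (rule group.subgroupI)
      show "group (add_monoid P.MA)" by (rule MA.A.a_group)
      fix f assume f: "f \<in> T.I"
      \<comment> \<open>The monoid algebra and the module of pairs share their addition but are
        different records, so their negatives have to be identified.\<close>
      have "\<ominus>\<^bsub>P.MA\<^esub> f = \<ominus>\<^bsub>T.F\<^esub> f"
        using I.minus_in[OF f] f I.subset I.M.l_neg
        by (intro MA.A.minus_equality) (auto simp: F_eq subset_iff)
      then show "inv\<^bsub>add_monoid P.MA\<^esub> f \<in> T.I" using I.minus_in[OF f] by (simp add: a_inv_def)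
    qed (use I.subset I.zero_in I.add_in in \<open>auto simp: F_eq simp del: I.zero_in\<close>)
    fix g f assume g: "g \<in> T.I" and f: "f \<in> carrier P.MA"
    have gF: "g \<in> carrier T.F" and fF: "f \<in> carrier T.F" using g f I.subset by (auto simp: F_eq)
    have "?q (f \<otimes>\<^bsub>P.MA\<^esub> g) = (\<lambda>_. \<zero>\<^bsub>T.T\<^esub>) f"
    proof (rule free_hom_eqI[OF T.T_module module_hom_comp[OF hl[OF gF] T.coset_hom_T] zh fF])
      fix s assume "s \<in> carrier A \<times> carrier B"
      then obtain x y where s: "s = (x, y)" "x \<in> carrier A" "y \<in> carrier B" by blast
      show "?q (basis_elt K s \<otimes>\<^bsub>P.MA\<^esub> g) = \<zero>\<^bsub>T.T\<^esub>"
        using basis_l[OF s(2,3) g] q0 I.subset unfolding s(1) by blast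
    qed
    then show "f \<otimes>\<^bsub>P.MA\<^esub> g \<in> T.I" using q0 module_hom_in[OF hl[OF gF] fF] by simp
    have "?q (g \<otimes>\<^bsub>P.MA\<^esub> f) = (\<lambda>_. \<zero>\<^bsub>T.T\<^esub>) f"
    proof (rule free_hom_eqI[OF T.T_module module_hom_comp[OF hr[OF gF] T.coset_hom_T] zh fF])
      fix s assume "s \<in> carrier A \<times> carrier B"
      then obtain x y where s: "s = (x, y)" "x \<in> carrier A" "y \<in> carrier B" by blast
      show "?q (g \<otimes>\<^bsub>P.MA\<^esub> basis_elt K s) = \<zero>\<^bsub>T.T\<^esub>"
        using basis_r[OF s(2,3) g] q0 I.subset unfolding s(1) by blast
    qed
    then show "g \<otimes>\<^bsub>P.MA\<^esub> f \<in> T.I" using q0 module_hom_in[OF hr[OF gF] fF] by simp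
  qed
qed

lemma TA_k_algebra: "k_algebra K TA"
  unfolding tensor_algebra_def by (rule k_algebra.quotient_k_algebra[OF P.k_algebra kernel_ideal])

text \<open>The tensor algebra and the tensor product over \<open>self_algebra K\<close> are
  quotients of different records by the same kernel. Identifying their linear structure makes
  \<open>lift\<close> usable for the algebra.\<close>

lemma TA_simps:
  "carrier TA = carrier T.T" "\<zero>\<^bsub>TA\<^esub> = \<zero>\<^bsub>T.T\<^esub>" "X \<oplus>\<^bsub>TA\<^esub> Y = X \<oplus>\<^bsub>T.T\<^esub> Y" "c \<odot>\<^bsub>TA\<^esub> X = c \<odot>\<^bsub>T.T\<^esub> X"
  by (simp_all add: tensor_algebra_def tensor_product_def A_RCOSETS_def' a_r_coset_def' set_add_def' F_eq
      del: free_module_simps)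

lemma module_hom_TA: "module_hom K TA V = module_hom K T.T V" "module_hom K V TA = module_hom K V T.T"
  by (simp_all only: module_hom_def TA_simps)

lemma TA_one: "\<one>\<^bsub>TA\<^esub> = T.pure \<one>\<^bsub>A\<^esub> \<one>\<^bsub>B\<^esub>"
  by (simp add: tensor_algebra_def T.pure_def coset_monoid_algebra F_eq DirProd_def del: free_module_simps)

lemma pure_mult:
  assumes "x \<in> carrier A" "y \<in> carrier B" "x' \<in> carrier A" "y' \<in> carrier B"
  shows "T.pure x y \<otimes>\<^bsub>TA\<^esub> T.pure x' y' = T.pure (x \<otimes>\<^bsub>A\<^esub> x') (y \<otimes>\<^bsub>B\<^esub> y')"
proof -
  have "basis_elt K (x, y) \<in> carrier P.MA" "basis_elt K (x', y') \<in> carrier P.MA"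
    using T.basis_elt_F assms by (simp_all add: F_eq del: free_module_simps)
  from k_algebra.coset_mult[OF P.k_algebra kernel_ideal this] show ?thesis
    using P.mult_basis[of "(x, y)" "(x', y')"] assms
    unfolding T.pure_def tensor_algebra_def coset_monoid_algebra F_eq by (simp add: DirProd_def)
qed

end

section \<open>The enveloping algebra and its two actions on the algebra\<close>

locale enveloping = k_algebra K A
  for K :: "('k, 'z) ring_scheme" and A :: "('k, 'a) module" (structure)

sublocale enveloping \<subseteq> E: tensor_alg K A "opposite A"
  by (intro tensor_alg.intro k_algebra_axioms opposite_k_algebra)

context enveloping
begin

abbreviation "Ae \<equiv> enveloping_algebra K A"
abbreviation "Ar \<equiv> right_enveloping_module K A"
abbreviation "Al \<equiv> left_enveloping_module K A"
abbreviation "pure \<equiv> E.T.pure"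

lemma opposite_simps [simp]:
  "carrier (opposite A) = carrier A" "\<one>\<^bsub>opposite A\<^esub> = \<one>" "\<zero>\<^bsub>opposite A\<^esub> = \<zero>"
  "x \<oplus>\<^bsub>opposite A\<^esub> y = x \<oplus> y" "x \<otimes>\<^bsub>opposite A\<^esub> y = y \<otimes> x" "c \<odot>\<^bsub>opposite A\<^esub> x = c \<odot> x"
  by (simp_all add: opposite_def)

lemma Ae_k_algebra: "k_algebra K Ae"
  unfolding enveloping_algebra_def by (rule E.TA_k_algebra)

lemma Ae_pure_closed: "x \<in> carrier A \<Longrightarrow> y \<in> carrier A \<Longrightarrow> pure x y \<in> carrier Ae"
  unfolding enveloping_algebra_def E.TA_simps by (rule E.T.pure_closed) simp_all

lemma Ae_one: "\<one>\<^bsub>Ae\<^esub> = pure \<one> \<one>"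
  unfolding enveloping_algebra_def E.TA_one by simp

lemma Ae_mult:
  "x \<in> carrier A \<Longrightarrow> y \<in> carrier A \<Longrightarrow> x' \<in> carrier A \<Longrightarrow> y' \<in> carrier A \<Longrightarrow>
    pure x y \<otimes>\<^bsub>Ae\<^esub> pure x' y' = pure (x \<otimes> x') (y' \<otimes> y)"
  unfolding enveloping_algebra_def using E.pure_mult[of x y x' y'] by simp

lemma Ae_hom_eqI:
  assumes "left_module K V" "f \<in> module_hom K Ae V" "g \<in> module_hom K Ae V" "X \<in> carrier Ae"
    "\<And>x y. x \<in> carrier A \<Longrightarrow> y \<in> carrier A \<Longrightarrow> f (pure x y) = g (pure x y)"
  shows "f X = g X"
  using E.T.hom_eqI[of V f g X] assms
  unfolding enveloping_algebra_def E.module_hom_TA E.TA_simps by simp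

lemma self_algebra_simps [simp]:
  "carrier (self_algebra K) = carrier K" "c \<odot>\<^bsub>self_algebra K\<^esub> d = c \<otimes>\<^bsub>K\<^esub> d" "\<one>\<^bsub>self_algebra K\<^esub> = \<one>\<^bsub>K\<^esub>"
  by (simp_all add: self_algebra_def)

text \<open>Over \<open>self_algebra K\<close> a balanced map is the same as a bilinear one, so
  linearity in each argument replaces the four tensor relations.\<close>

lemma Ae_lift:
  assumes V: "left_module K V"
    and c: "\<And>x y. x \<in> carrier A \<Longrightarrow> y \<in> carrier A \<Longrightarrow> \<phi> x y \<in> carrier V"
    and l: "\<And>y. y \<in> carrier A \<Longrightarrow> (\<lambda>x. \<phi> x y) \<in> module_hom K A V"
    and r: "\<And>x. x \<in> carrier A \<Longrightarrow> (\<lambda>y. \<phi> x y) \<in> module_hom K A V"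
  shows "E.T.lift V \<phi> \<in> module_hom K Ae V"
    and "\<And>x y. x \<in> carrier A \<Longrightarrow> y \<in> carrier A \<Longrightarrow> E.T.lift V \<phi> (pure x y) = \<phi> x y"
proof -
  note hs = c module_hom_add[OF l] module_hom_smult[OF l] module_hom_add[OF r] module_hom_smult[OF r]
    AM.smult_closed
  show "E.T.lift V \<phi> \<in> module_hom K Ae V"
    unfolding enveloping_algebra_def E.module_hom_TA
    by (rule E.T.lift(1)[OF V]) (simp_all add: hs)
  show "E.T.lift V \<phi> (pure x y) = \<phi> x y" if "x \<in> carrier A" "y \<in> carrier A" for x y
    by (rule E.T.lift(2)[OF V]) (simp_all add: hs that)
qed

text \<open>The last equation recognises the action as a \<open>lift\<close>, which replaces
  arguments about cosets. Later proofs remove it from the simpset to keep actions folded.\<close>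

lemma Al_simps [simp]:
  "carrier Al = carrier A" "\<zero>\<^bsub>Al\<^esub> = \<zero>" "x \<oplus>\<^bsub>Al\<^esub> y = x \<oplus> y"
  "X \<odot>\<^bsub>Al\<^esub> x = E.T.lift A (\<lambda>a b. a \<otimes> x \<otimes> b) X"
  by (simp_all add: left_enveloping_module_def E.T.lift_def free_ext_def case_prod_beta)

lemma Ar_simps [simp]:
  "carrier Ar = carrier A" "\<zero>\<^bsub>Ar\<^esub> = \<zero>" "x \<oplus>\<^bsub>Ar\<^esub> y = x \<oplus> y"
  "X \<odot>\<^bsub>Ar\<^esub> x = E.T.lift A (\<lambda>a b. b \<otimes> x \<otimes> a) X"
  by (simp_all add: right_enveloping_module_def E.T.lift_def free_ext_def case_prod_beta)

lemma act:
  assumes x: "x \<in> carrier A"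
  shows Al_hom: "(\<lambda>X. X \<odot>\<^bsub>Al\<^esub> x) \<in> module_hom K Ae A"
    and Al_pure: "a \<in> carrier A \<Longrightarrow> b \<in> carrier A \<Longrightarrow> pure a b \<odot>\<^bsub>Al\<^esub> x = a \<otimes> x \<otimes> b"
    and Ar_hom: "(\<lambda>X. X \<odot>\<^bsub>Ar\<^esub> x) \<in> module_hom K Ae A"
    and Ar_pure: "a \<in> carrier A \<Longrightarrow> b \<in> carrier A \<Longrightarrow> pure a b \<odot>\<^bsub>Ar\<^esub> x = b \<otimes> x \<otimes> a"
proof -
  note hs = x A.l_distr A.r_distr smult_mult_l smult_mult_r AM.smult_closed
  have h: "(\<lambda>a. a \<otimes> x \<otimes> b) \<in> module_hom K A A" "(\<lambda>a. b \<otimes> x \<otimes> a) \<in> module_hom K A A"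
    if "b \<in> carrier A" for b
    using that by (auto intro!: module_homI simp: hs)
  have c: "a \<otimes> x \<otimes> b \<in> carrier A" if "a \<in> carrier A" "b \<in> carrier A" for a b using that x by simp
  note L = Ae_lift[OF AM.left_module_axioms]
  show "(\<lambda>X. X \<odot>\<^bsub>Al\<^esub> x) \<in> module_hom K Ae A"
    unfolding Al_simps by (rule L(1)[OF c h(1) h(2)])
  show "a \<in> carrier A \<Longrightarrow> b \<in> carrier A \<Longrightarrow> pure a b \<odot>\<^bsub>Al\<^esub> x = a \<otimes> x \<otimes> b"
    unfolding Al_simps by (rule L(2)[OF c h(1) h(2)])
  show "(\<lambda>X. X \<odot>\<^bsub>Ar\<^esub> x) \<in> module_hom K Ae A"
    unfolding Ar_simps by (rule L(1)[OF c h(2) h(1)])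
  show "a \<in> carrier A \<Longrightarrow> b \<in> carrier A \<Longrightarrow> pure a b \<odot>\<^bsub>Ar\<^esub> x = b \<otimes> x \<otimes> a"
    unfolding Ar_simps by (rule L(2)[OF c h(2) h(1)])
qed

lemma act_r:
  assumes X: "X \<in> carrier Ae"
  shows Al_hom_r: "(\<lambda>x. X \<odot>\<^bsub>Al\<^esub> x) \<in> module_hom K A A"
    and Ar_hom_r: "(\<lambda>x. X \<odot>\<^bsub>Ar\<^esub> x) \<in> module_hom K A A"
proof -
  note [simp del] = Al_simps(4) Ar_simps(4)
  note cl = module_hom_in[OF Al_hom] module_hom_in[OF Ar_hom]
  have sh: "(\<lambda>x. c \<odot> x) \<in> module_hom K A A" if "c \<in> carrier K" for c
    using that by (intro module_homI)
      (auto simp: AM.smult_closed AM.smult_r_distr AM.smult_assoc[symmetric] K.m_comm)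
  show "(\<lambda>x. X \<odot>\<^bsub>Al\<^esub> x) \<in> module_hom K A A"
  proof (rule module_homI)
    show "X \<odot>\<^bsub>Al\<^esub> (x \<oplus> y) = X \<odot>\<^bsub>Al\<^esub> x \<oplus> X \<odot>\<^bsub>Al\<^esub> y" if x: "x \<in> carrier A" "y \<in> carrier A" for x y
      by (rule Ae_hom_eqI[OF AM.left_module_axioms Al_hom
            module_hom_plus[OF k_algebra.axioms(3)[OF Ae_k_algebra] AM.left_module_axioms Al_hom Al_hom] X])
        (use x in \<open>auto simp: Al_pure A.l_distr A.r_distr\<close>)
    show "X \<odot>\<^bsub>Al\<^esub> (c \<odot> x) = c \<odot> (X \<odot>\<^bsub>Al\<^esub> x)" if x: "c \<in> carrier K" "x \<in> carrier A" for c x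
      by (rule Ae_hom_eqI[OF AM.left_module_axioms Al_hom module_hom_comp[OF Al_hom sh] X])
        (use x in \<open>auto simp: Al_pure smult_mult_l smult_mult_r AM.smult_closed\<close>)
  qed (use cl X in auto)
  show "(\<lambda>x. X \<odot>\<^bsub>Ar\<^esub> x) \<in> module_hom K A A"
  proof (rule module_homI)
    show "X \<odot>\<^bsub>Ar\<^esub> (x \<oplus> y) = X \<odot>\<^bsub>Ar\<^esub> x \<oplus> X \<odot>\<^bsub>Ar\<^esub> y" if x: "x \<in> carrier A" "y \<in> carrier A" for x y
      by (rule Ae_hom_eqI[OF AM.left_module_axioms Ar_hom
            module_hom_plus[OF k_algebra.axioms(3)[OF Ae_k_algebra] AM.left_module_axioms Ar_hom Ar_hom] X])
        (use x in \<open>auto simp: Ar_pure A.l_distr A.r_distr\<close>)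
    show "X \<odot>\<^bsub>Ar\<^esub> (c \<odot> x) = c \<odot> (X \<odot>\<^bsub>Ar\<^esub> x)" if x: "c \<in> carrier K" "x \<in> carrier A" for c x
      by (rule Ae_hom_eqI[OF AM.left_module_axioms Ar_hom module_hom_comp[OF Ar_hom sh] X])
        (use x in \<open>auto simp: Ar_pure smult_mult_l smult_mult_r AM.smult_closed\<close>)
  qed (use cl X in auto)
qed

text \<open>All terms are linear in \<open>X\<close> and in \<open>Y\<close>, so pure tensors
  suffice. The reversed order for \<open>Ar\<close> is the right module law in the convention that
  writes scalars on the left.\<close>

lemma act_mult:
  assumes X: "X \<in> carrier Ae" and Y: "Y \<in> carrier Ae" and x: "x \<in> carrier A"
  shows Al_mult: "(X \<otimes>\<^bsub>Ae\<^esub> Y) \<odot>\<^bsub>Al\<^esub> x = X \<odot>\<^bsub>Al\<^esub> (Y \<odot>\<^bsub>Al\<^esub> x)"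
    and Ar_mult: "(X \<otimes>\<^bsub>Ae\<^esub> Y) \<odot>\<^bsub>Ar\<^esub> x = Y \<odot>\<^bsub>Ar\<^esub> (X \<odot>\<^bsub>Ar\<^esub> x)"
proof -
  interpret Ae: k_algebra K Ae by (rule Ae_k_algebra)
  note [simp del] = Al_simps(4) Ar_simps(4)
  note cl = module_hom_in[OF Al_hom] module_hom_in[OF Ar_hom]
  note eqI = Ae_hom_eqI[OF AM.left_module_axioms]
  show "(X \<otimes>\<^bsub>Ae\<^esub> Y) \<odot>\<^bsub>Al\<^esub> x = X \<odot>\<^bsub>Al\<^esub> (Y \<odot>\<^bsub>Al\<^esub> x)"
  proof (rule eqI[OF module_hom_comp[OF Ae.mult_hom_l[OF Y] Al_hom[OF x]] Al_hom[OF cl(1)[OF x Y]] X])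
    fix a b assume ab: "a \<in> carrier A" "b \<in> carrier A"
    note p = Ae_pure_closed[OF ab]
    show "(pure a b \<otimes>\<^bsub>Ae\<^esub> Y) \<odot>\<^bsub>Al\<^esub> x = pure a b \<odot>\<^bsub>Al\<^esub> (Y \<odot>\<^bsub>Al\<^esub> x)"
      by (rule eqI[OF module_hom_comp[OF Ae.mult_hom_r[OF p] Al_hom[OF x]]
            module_hom_comp[OF Al_hom[OF x] Al_hom_r[OF p]] Y])
        (simp add: Ae_mult Al_pure ab x A.m_assoc)
  qed
  show "(X \<otimes>\<^bsub>Ae\<^esub> Y) \<odot>\<^bsub>Ar\<^esub> x = Y \<odot>\<^bsub>Ar\<^esub> (X \<odot>\<^bsub>Ar\<^esub> x)"
  proof (rule eqI[OF module_hom_comp[OF Ae.mult_hom_l[OF Y] Ar_hom[OF x]]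
          module_hom_comp[OF Ar_hom[OF x] Ar_hom_r[OF Y]] X])
    fix a b assume ab: "a \<in> carrier A" "b \<in> carrier A"
    note p = Ae_pure_closed[OF ab]
    show "(pure a b \<otimes>\<^bsub>Ae\<^esub> Y) \<odot>\<^bsub>Ar\<^esub> x = Y \<odot>\<^bsub>Ar\<^esub> (pure a b \<odot>\<^bsub>Ar\<^esub> x)"
      by (rule eqI[OF module_hom_comp[OF Ae.mult_hom_r[OF p] Ar_hom[OF x]] Ar_hom[OF cl(2)[OF x p]] Y])
        (simp add: Ae_mult Ar_pure ab x A.m_assoc)
  qed
qed

lemma Al_left_module: "left_module Ae Al"
proof -
  interpret Ae: k_algebra K Ae by (rule Ae_k_algebra)
  note [simp del] = Al_simps(4) Ar_simps(4)
  have "abelian_group Al"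
    by (rule abelian_groupI) (auto simp: A.a_ac intro: A.l_neg)
  then show ?thesis
    using module_hom_in[OF Al_hom] module_hom_add[OF Al_hom] module_hom_add[OF Al_hom_r]
    by (intro left_moduleI) (auto simp: Ae.A.ring_axioms Al_mult Ae_one Al_pure)
qed

lemma Ar_tensor_left: "tensor_left K Ae Ar"
proof -
  interpret Ae: k_algebra K Ae by (rule Ae_k_algebra)
  show ?thesis
    using module_hom_in[OF Ar_hom] by unfold_locales (auto simp: Ae.AM.smult_closed simp del: Ar_simps(4))
qed

end

section \<open>Signs and inversions\<close>

(* The simplifier would otherwise turn {1..n} into {Suc 0..n}. *)
declare One_nat_def [simp del]

definition sign :: "('k, 'z) ring_scheme \<Rightarrow> nat \<Rightarrow> 'k" where
  "sign K k = (if even k then \<one>\<^bsub>K\<^esub> else \<ominus>\<^bsub>K\<^esub> \<one>\<^bsub>K\<^esub>)"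

context ring
begin

lemma sign_closed [simp, intro]: "sign R k \<in> carrier R"
  by (simp add: sign_def)

lemma sign_0 [simp]: "sign R 0 = \<one>"
  by (simp add: sign_def)

lemma sign_Suc: "sign R (Suc k) = \<ominus> sign R k"
  by (simp add: sign_def)

lemma sign_add: "sign R (k + l) = sign R k \<otimes> sign R l"
  by (simp add: sign_def l_minus r_minus)

end

fun inversions :: "nat list \<Rightarrow> nat" where
  "inversions [] = 0"
| "inversions (x # w) = card {y \<in> set w. y < x} + inversions w"

lemma inversions_sorted: "sorted w \<Longrightarrow> inversions w = 0"
  by (induction w) auto

lemma inversions_snoc:
  "sorted w \<Longrightarrow> distinct w \<Longrightarrow> i \<notin> set w \<Longrightarrow> inversions (w @ [i]) = card {y \<in> set w. i < y}"
proof (induction w)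
  case (Cons y w)
  have "{z. (z = i \<or> z \<in> set w) \<and> z < y} = (if i < y then {i} else {})"
    using Cons.prems by auto
  moreover have "{z. (z = y \<or> z \<in> set w) \<and> i < z} = {z \<in> set w. i < z} \<union> (if i < y then {y} else {})"
    by auto
  ultimately show ?case
    using Cons by (cases "i < y") auto
qed simp

text \<open>Only the pair of \<open>i\<close> and \<open>j\<close> changes its status. Every letter
  of \<open>u\<close> has the same set of letters to its right, and \<open>v\<close> is
  untouched.\<close>

lemma inversions_swap:
  assumes "i < j" "distinct (u @ i # j # v)"
  shows "inversions (u @ j # i # v) = Suc (inversions (u @ i # j # v))"
  using assms
proof (induction u)
  case Nil
  have "{y. (y = i \<or> y \<in> set v) \<and> y < j} = insert i {y \<in> set v. y < j}"
    "{y. (y = j \<or> y \<in> set v) \<and> y < i} = {y \<in> set v. y < i}" using Nil by auto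
  then show ?case using Nil by simp
next
  case (Cons x u)
  have "set (u @ j # i # v) = set (u @ i # j # v)" by auto
  then show ?case using Cons by (simp del: set_append)
qed

section \<open>The exterior algebra\<close>

locale exterior = K?: field K for K :: "('k, 'z) ring_scheme" (structure) +
  fixes n :: nat
begin

abbreviation "FA \<equiv> free_algebra K n"
abbreviation "Ie \<equiv> Idl\<^bsub>FA\<^esub> (exterior_relations K n)"
abbreviation "\<Lambda> \<equiv> exterior_algebra K n"
abbreviation "V \<equiv> free_module K (Pow {1..n})"

sublocale W: monoid_alg K "word_monoid n"
  by (intro monoid_alg.intro K.cring_axioms monoidI) (auto simp: word_monoid_def)

lemma FA_eq: "FA = W.MA"
  by (simp add: free_algebra_def)

lemma FA_k_algebra: "k_algebra K FA"
  unfolding FA_eq by (rule W.k_algebra)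

lemma carrier_word_monoid [simp]: "carrier (word_monoid n) = lists {1..n}"
  by (simp add: word_monoid_def)

lemma carrier_FA: "carrier FA = carrier W.F"
  by (simp add: FA_eq)

lemma FA_hom: "module_hom K FA N = module_hom K W.F N" "module_hom K N FA = module_hom K N W.F"
  unfolding FA_eq by (rule module_hom_monoid_algebra)+

lemma basis_FA: "w \<in> lists {1..n} \<Longrightarrow> basis_elt K w \<in> carrier FA"
  unfolding carrier_FA by (rule K.basis_elt_closed) simp

lemma basis_mult:
  "u \<in> lists {1..n} \<Longrightarrow> v \<in> lists {1..n} \<Longrightarrow> basis_elt K u \<otimes>\<^bsub>FA\<^esub> basis_elt K v = basis_elt K (u @ v)"
  unfolding FA_eq using W.mult_basis[of u v] by (simp add: word_monoid_def)

lemma relations_FA: "exterior_relations K n \<subseteq> carrier FA"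
proof -
  interpret FA: k_algebra K FA by (rule FA_k_algebra)
  show ?thesis unfolding exterior_relations_def by (auto intro!: FA.A.a_closed FA.A.m_closed basis_FA)
qed

lemma Ie_ideal: "ideal Ie FA"
proof -
  interpret FA: k_algebra K FA by (rule FA_k_algebra)
  show ?thesis by (rule FA.A.genideal_ideal[OF relations_FA])
qed

lemma relations_Ie: "exterior_relations K n \<subseteq> Ie"
proof -
  interpret FA: k_algebra K FA by (rule FA_k_algebra)
  show ?thesis by (rule FA.A.genideal_self[OF relations_FA])
qed

lemma \<Lambda>_k_algebra: "k_algebra K \<Lambda>"
  unfolding exterior_algebra_def by (rule k_algebra.quotient_k_algebra[OF FA_k_algebra Ie_ideal])

end

sublocale exterior \<subseteq> L: enveloping K "exterior_algebra K n"
  by (intro enveloping.intro \<Lambda>_k_algebra)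

context exterior
begin

definition word :: "nat list \<Rightarrow> (nat list \<Rightarrow> 'k) set" where
  "word w = Ie +>\<^bsub>FA\<^esub> basis_elt K w"

definition e :: "nat set \<Rightarrow> (nat list \<Rightarrow> 'k) set" where
  "e S = word (sorted_list_of_set S)"

lemma Ie_submodule: "left_submodule K FA Ie"
  by (rule k_algebra.ideal_submodule[OF FA_k_algebra Ie_ideal])

lemma coset_\<Lambda>_hom: "(\<lambda>f. Ie +>\<^bsub>FA\<^esub> f) \<in> module_hom K FA \<Lambda>"
  unfolding exterior_algebra_def by (rule left_submodule.coset_hom[OF Ie_submodule])

lemma carrier_\<Lambda>: "carrier \<Lambda> = (\<lambda>f. Ie +>\<^bsub>FA\<^esub> f) ` carrier FA"
  unfolding exterior_algebra_def by (rule left_submodule.carrier_quotient[OF Ie_submodule])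

lemma zero_\<Lambda>: "\<zero>\<^bsub>\<Lambda>\<^esub> = Ie"
  by (simp add: exterior_algebra_def)

lemma word_closed [simp]: "w \<in> lists {1..n} \<Longrightarrow> word w \<in> carrier \<Lambda>"
  unfolding word_def by (rule module_hom_in[OF coset_\<Lambda>_hom basis_FA])

lemma word_mult:
  "u \<in> lists {1..n} \<Longrightarrow> v \<in> lists {1..n} \<Longrightarrow> word u \<otimes>\<^bsub>\<Lambda>\<^esub> word v = word (u @ v)"
  unfolding word_def exterior_algebra_def
  using k_algebra.coset_mult[OF FA_k_algebra Ie_ideal basis_FA basis_FA] by (simp add: basis_mult)

lemma word_Nil: "word [] = \<one>\<^bsub>\<Lambda>\<^esub>"
  by (simp add: word_def exterior_algebra_def free_algebra_def word_monoid_def)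

lemma word_sq: "i \<in> {1..n} \<Longrightarrow> word [i, i] = \<zero>\<^bsub>\<Lambda>\<^esub>"
proof -
  assume i: "i \<in> {1..n}"
  have "gen K i \<otimes>\<^bsub>FA\<^esub> gen K i \<in> Ie"
    using relations_Ie i unfolding exterior_relations_def by auto
  then have "basis_elt K [i, i] \<in> Ie" using basis_mult[of "[i]" "[i]"] i by simp
  then show ?thesis
    unfolding word_def zero_\<Lambda> using left_submodule.coset_eq_zero_iff[OF Ie_submodule basis_FA] i by simp
qed

lemma word_swap_less:
  assumes "i \<in> {1..n}" "j \<in> {1..n}" "i < j" shows "word [i, j] \<oplus>\<^bsub>\<Lambda>\<^esub> word [j, i] = \<zero>\<^bsub>\<Lambda>\<^esub>"
proof -
  have b: "basis_elt K [i, j] \<in> carrier FA" "basis_elt K [j, i] \<in> carrier FA"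
    using assms by (auto intro!: basis_FA)
  have "gen K i \<otimes>\<^bsub>FA\<^esub> gen K j \<oplus>\<^bsub>FA\<^esub> gen K j \<otimes>\<^bsub>FA\<^esub> gen K i \<in> exterior_relations K n"
    unfolding exterior_relations_def using assms by auto
  then have "basis_elt K [i, j] \<oplus>\<^bsub>FA\<^esub> basis_elt K [j, i] \<in> Ie"
    using relations_Ie basis_mult[of "[i]" "[j]"] basis_mult[of "[j]" "[i]"] assms by auto
  then show ?thesis
    unfolding word_def module_hom_add[OF coset_\<Lambda>_hom b, symmetric] zero_\<Lambda>
    using left_submodule.coset_eq_zero_iff[OF Ie_submodule] left_submodule.subset[OF Ie_submodule] by blast
qed

lemma word_swap:
  assumes "i \<in> {1..n}" "j \<in> {1..n}" "i \<noteq> j" shows "word [i, j] = \<ominus>\<^bsub>\<Lambda>\<^esub> word [j, i]"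
proof -
  have "word [i, j] \<oplus>\<^bsub>\<Lambda>\<^esub> word [j, i] = \<zero>\<^bsub>\<Lambda>\<^esub>"
    using word_swap_less[of i j] word_swap_less[of j i] assms L.A.a_comm[of "word [i, j]" "word [j, i]"]
    by (cases "i < j") auto
  then show ?thesis using assms by (intro L.A.minus_equality[symmetric]) auto
qed

text \<open>The letter \<open>i\<close> travels to the right. Each smaller letter it passes costs a
  sign, an equal letter annihilates the word, and a larger letter stops it.\<close>

lemma word_insort:
  assumes "i \<in> {1..n}" "w \<in> lists {1..n}" "sorted w" "distinct w"
  shows "word (i # w) = (if i \<in> set w then \<zero>\<^bsub>\<Lambda>\<^esub>
    else sign K (card {y \<in> set w. y < i}) \<odot>\<^bsub>\<Lambda>\<^esub> word (insort i w))"
  using assms(2-)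
proof (induction w rule: list.induct)
  case Nil
  then show ?case using assms(1) by (simp add: L.AM.smult_one)
next
  case (Cons y w)
  have y: "y \<in> {1..n}" and w: "w \<in> lists {1..n}" using Cons.prems by auto
  have yw: "y < z" if "z \<in> set w" for z using Cons.prems that by (cases "y = z") auto
  have split: "word (i # y # w) = word [i, y] \<otimes>\<^bsub>\<Lambda>\<^esub> word w"
    using word_mult[of "[i, y]" w] assms(1) y w by simp
  consider "i < y" | "i = y" | "y < i" by linarith
  then show ?case
  proof cases
    case 1
    then have i: "i \<notin> set (y # w)" and c: "{z \<in> set (y # w). z < i} = {}" using yw by force+
    show ?thesis unfolding c if_not_P[OF i] using 1 assms(1) y w by (simp add: L.AM.smult_one)
  next
    case 2
    then show ?thesis using split word_sq[OF assms(1)] w by simp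
  next
    case 3
    have iw: "i # w \<in> lists {1..n}" "insort i w \<in> lists {1..n}"
      using assms(1) w set_insort_key[of "\<lambda>x. x" i w] by auto
    have "word (i # y # w) = \<ominus>\<^bsub>\<Lambda>\<^esub> (word [y] \<otimes>\<^bsub>\<Lambda>\<^esub> word (i # w))"
      using split word_swap[OF assms(1) y] 3 word_mult[of "[y, i]" w] word_mult[of "[y]" "i # w"]
        assms(1) y w by (simp add: L.A.l_minus)
    also have "\<dots> = (if i \<in> set (y # w) then \<zero>\<^bsub>\<Lambda>\<^esub>
        else sign K (card {z \<in> set (y # w). z < i}) \<odot>\<^bsub>\<Lambda>\<^esub> word (insort i (y # w)))"
    proof (cases "i \<in> set w")
      case True
      then show ?thesis using Cons y by (simp add: L.A.minus_zero)
    next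
      case False
      have "{z \<in> set (y # w). z < i} = insert y {z \<in> set w. z < i}" using 3 by auto
      then have c: "card {z \<in> set (y # w). z < i} = Suc (card {z \<in> set w. z < i})"
        using Cons.prems by simp
      have "word [y] \<otimes>\<^bsub>\<Lambda>\<^esub> word (i # w) =
          sign K (card {z \<in> set w. z < i}) \<odot>\<^bsub>\<Lambda>\<^esub> word (y # insort i w)"
        using Cons False y iw word_mult[of "[y]" "insort i w"] by (simp add: L.smult_mult_r)
      then show ?thesis
        using False 3 y iw unfolding c by (simp add: K.sign_Suc L.AM.smult_l_minus del: set_simps, simp)
    qed
    finally show ?thesis .
  qed
qed

text \<open>Insertion sort from the right: by \<open>word_insort\<close> the head costs one sign for
  each smaller letter behind it, which is the summand it contributes to
  \<open>inversions\<close>.\<close>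

lemma word_eq:
  assumes "w \<in> lists {1..n}"
  shows "word w = (if distinct w then sign K (inversions w) \<odot>\<^bsub>\<Lambda>\<^esub> e (set w) else \<zero>\<^bsub>\<Lambda>\<^esub>)"
  using assms
proof (induction w rule: list.induct)
  case Nil
  then show ?case by (simp add: e_def L.AM.smult_one)
next
  case (Cons x w)
  let ?s = "sorted_list_of_set (set w)"
  have x: "x \<in> {1..n}" and w: "w \<in> lists {1..n}" and s: "?s \<in> lists {1..n}" using Cons.prems by auto
  have "word (x # w) = word [x] \<otimes>\<^bsub>\<Lambda>\<^esub> word w" using word_mult[of "[x]" w] x w by simp
  also have "\<dots> = (if distinct w then sign K (inversions w) \<odot>\<^bsub>\<Lambda>\<^esub> word (x # ?s) else \<zero>\<^bsub>\<Lambda>\<^esub>)"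
    using Cons.IH w x s word_mult[of "[x]" ?s] by (simp add: e_def L.smult_mult_r)
  also have "\<dots> = (if distinct (x # w) then sign K (inversions (x # w)) \<odot>\<^bsub>\<Lambda>\<^esub> e (set (x # w)) else \<zero>\<^bsub>\<Lambda>\<^esub>)"
  proof (cases "distinct (x # w)")
    case True
    let ?c = "card {y \<in> set w. y < x}" and ?t = "word (insort x ?s)"
    have key: "e (set (x # w)) = ?t" using True by (simp add: e_def)
    have "insort x ?s \<in> lists {1..n}" using x s set_insort_key[of "\<lambda>x. x" x ?s] by auto
    then have t: "?t \<in> carrier \<Lambda>" by (rule word_closed)
    have wx: "word (x # ?s) = sign K ?c \<odot>\<^bsub>\<Lambda>\<^esub> ?t"
      using True word_insort[OF x s] by simp
    have "inversions (x # w) = inversions w + ?c" by simp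
    then have A: "sign K (inversions (x # w)) \<odot>\<^bsub>\<Lambda>\<^esub> ?t = sign K (inversions w) \<odot>\<^bsub>\<Lambda>\<^esub> (sign K ?c \<odot>\<^bsub>\<Lambda>\<^esub> ?t)"
      using L.AM.smult_assoc[OF K.sign_closed K.sign_closed t] by (simp only: K.sign_add)
    have d: "distinct w" using True by simp
    show ?thesis unfolding key wx A if_P[OF True] if_P[OF d] ..
  next
    case False
    then show ?thesis using word_insort[OF x s] by auto
  qed
  finally show ?case .
qed

section \<open>Coordinates on the exterior algebra and independence of the
  \<open>e S\<close>\<close>

definition word_coord :: "nat list \<Rightarrow> nat set \<Rightarrow> 'k" where
  "word_coord w = (if distinct w then sign K (inversions w) \<odot>\<^bsub>V\<^esub> basis_elt K (set w) else \<zero>\<^bsub>V\<^esub>)"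

lemma V_module: "left_module K V"
  by (rule K.free_module_left_module)

lemma word_coord_closed: "w \<in> lists {1..n} \<Longrightarrow> word_coord w \<in> carrier V"
proof -
  interpret V: left_module K V by (rule V_module)
  assume "w \<in> lists {1..n}"
  then have "basis_elt K (set w) \<in> carrier V" by (intro K.basis_elt_closed) auto
  then show ?thesis
    unfolding word_coord_def using V.smult_closed V.M.zero_closed
    by (simp del: free_module_simps)
qed

lemma word_coord_hom: "free_ext K V word_coord \<in> module_hom K FA V"
  unfolding FA_hom
  by (rule left_module.free_ext_hom[OF V_module]) (use word_coord_closed in \<open>auto simp del: free_module_simps\<close>)

lemma word_coord_basis: "w \<in> lists {1..n} \<Longrightarrow> free_ext K V word_coord (basis_elt K w) = word_coord w"
  by (rule left_module.free_ext_basis[OF V_module]) (rule word_coord_closed)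

lemma word_coord_square: "word_coord (u @ i # i # v) = \<zero>\<^bsub>V\<^esub>"
  by (simp add: word_coord_def)

text \<open>If some letter repeats, both terms vanish. Otherwise the inversion numbers differ by one
  and the signs are opposite.\<close>

lemma word_coord_swap:
  assumes "i < j" "u @ i # j # v \<in> lists {1..n}"
  shows "word_coord (u @ i # j # v) \<oplus>\<^bsub>V\<^esub> word_coord (u @ j # i # v) = \<zero>\<^bsub>V\<^esub>"
proof -
  interpret V: left_module K V by (rule V_module)
  have set_eq: "set (u @ j # i # v) = set (u @ i # j # v)" by auto
  have d: "distinct (u @ j # i # v) = distinct (u @ i # j # v)" by auto
  have "basis_elt K (set (u @ i # j # v)) \<in> carrier V"
    using assms(2) by (intro K.basis_elt_closed) auto
  then show ?thesis
    using inversions_swap[OF assms(1)]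
    by (auto simp: word_coord_def set_eq d K.sign_Suc V.smult_l_minus V.M.r_neg V.smult_closed
        simp del: free_module_simps set_append distinct_append)
qed

text \<open>This carries the independence of the \<open>e S\<close>. A relation multiplied by words
  on both sides becomes a word with a repeated letter or a sum of two words that differ by a
  transposition of neighbours, and \<open>word_coord\<close> kills both.\<close>

lemma word_coord_ideal:
  assumes "f \<in> Ie" shows "free_ext K V word_coord f = \<zero>\<^bsub>V\<^esub>"
proof -
  interpret FA: k_algebra K FA by (rule FA_k_algebra)
  interpret V: left_module K V by (rule V_module)
  let ?\<phi> = "free_ext K V word_coord" and ?W = "lists {1..n}" and ?b = "basis_elt K"
  interpret \<phi>: left_module_hom K FA V ?\<phi>
    by (rule left_module_homI[OF FA.AM.left_module_axioms V_module word_coord_hom])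
  note [simp del] = free_module_simps
  \<comment> \<open>The kernel of \<open>\<phi>\<close> is not visibly an ideal, so pass to the largest ideal inside it.\<close>
  let ?J = "{f \<in> carrier FA. \<forall>u\<in>?W. \<forall>v\<in>?W. ?\<phi> (?b u \<otimes>\<^bsub>FA\<^esub> f \<otimes>\<^bsub>FA\<^esub> ?b v) = \<zero>\<^bsub>V\<^esub>}"
  note [simp] = basis_FA
  have zh: "(\<lambda>_. \<zero>\<^bsub>V\<^esub>) \<in> module_hom K W.F V" by (rule zero_hom[OF W.F_module V_module])
  have J: "ideal ?J FA"
  proof (rule idealI)
    show "ring FA" by (rule FA.A.ring_axioms)
    show "subgroup ?J (add_monoid FA)"
    proof (rule group.subgroupI)
      show "group (add_monoid FA)" by (rule FA.A.a_group)
      have "\<zero>\<^bsub>FA\<^esub> \<in> ?J" by simp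
      then show "?J \<noteq> {}" by blast
      show "inv\<^bsub>add_monoid FA\<^esub> f \<in> ?J" if "f \<in> ?J" for f
        using that by (auto simp: a_inv_def[symmetric] FA.A.l_minus FA.A.r_minus \<phi>.minus)
      show "f \<otimes>\<^bsub>add_monoid FA\<^esub> g \<in> ?J" if "f \<in> ?J" "g \<in> ?J" for f g
        using that by (auto simp: FA.A.l_distr FA.A.r_distr \<phi>.add)
    qed auto
    fix f h assume f: "f \<in> ?J" and h: "h \<in> carrier FA"
    have fc: "f \<in> carrier FA" using f by blast
    have hF: "h \<in> carrier W.F" using h by (simp add: carrier_FA)
    note ml = FA.mult_hom_l and mr = FA.mult_hom_r
    have "?\<phi> (?b u \<otimes>\<^bsub>FA\<^esub> (h \<otimes>\<^bsub>FA\<^esub> f) \<otimes>\<^bsub>FA\<^esub> ?b v) = \<zero>\<^bsub>V\<^esub>" if uv: "u \<in> ?W" "v \<in> ?W" for u v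
    proof (rule free_hom_eqI[OF V_module _ zh hF])
      show "(\<lambda>h. ?\<phi> (?b u \<otimes>\<^bsub>FA\<^esub> (h \<otimes>\<^bsub>FA\<^esub> f) \<otimes>\<^bsub>FA\<^esub> ?b v)) \<in> module_hom K W.F V"
        using module_hom_comp[OF module_hom_comp[OF module_hom_comp[OF ml[OF fc] mr[OF basis_FA[OF uv(1)]]]
              ml[OF basis_FA[OF uv(2)]]] word_coord_hom] by (simp add: FA_hom)
      fix w assume "w \<in> carrier (word_monoid n)"
      then have w: "w \<in> ?W" by simp
      have "?b u \<otimes>\<^bsub>FA\<^esub> (?b w \<otimes>\<^bsub>FA\<^esub> f) = ?b (u @ w) \<otimes>\<^bsub>FA\<^esub> f"
        using uv w fc by (simp add: FA.A.m_assoc[symmetric] basis_mult)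
      then show "?\<phi> (?b u \<otimes>\<^bsub>FA\<^esub> (?b w \<otimes>\<^bsub>FA\<^esub> f) \<otimes>\<^bsub>FA\<^esub> ?b v) = \<zero>\<^bsub>V\<^esub>"
        using f uv w by (simp del: append_in_lists_conv add: append_in_lists_conv)
    qed
    then show "h \<otimes>\<^bsub>FA\<^esub> f \<in> ?J" using fc h by simp
    have "?\<phi> (?b u \<otimes>\<^bsub>FA\<^esub> (f \<otimes>\<^bsub>FA\<^esub> h) \<otimes>\<^bsub>FA\<^esub> ?b v) = \<zero>\<^bsub>V\<^esub>" if uv: "u \<in> ?W" "v \<in> ?W" for u v
    proof (rule free_hom_eqI[OF V_module _ zh hF])
      show "(\<lambda>h. ?\<phi> (?b u \<otimes>\<^bsub>FA\<^esub> (f \<otimes>\<^bsub>FA\<^esub> h) \<otimes>\<^bsub>FA\<^esub> ?b v)) \<in> module_hom K W.F V"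
        using module_hom_comp[OF module_hom_comp[OF module_hom_comp[OF mr[OF fc] mr[OF basis_FA[OF uv(1)]]]
              ml[OF basis_FA[OF uv(2)]]] word_coord_hom] by (simp add: FA_hom)
      fix w assume "w \<in> carrier (word_monoid n)"
      then have w: "w \<in> ?W" by simp
      have "?b u \<otimes>\<^bsub>FA\<^esub> (f \<otimes>\<^bsub>FA\<^esub> ?b w) \<otimes>\<^bsub>FA\<^esub> ?b v = ?b u \<otimes>\<^bsub>FA\<^esub> f \<otimes>\<^bsub>FA\<^esub> ?b (w @ v)"
        using uv w fc by (simp add: FA.A.m_assoc basis_mult)
      then show "?\<phi> (?b u \<otimes>\<^bsub>FA\<^esub> (f \<otimes>\<^bsub>FA\<^esub> ?b w) \<otimes>\<^bsub>FA\<^esub> ?b v) = \<zero>\<^bsub>V\<^esub>"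
        using f uv w by simp
    qed
    then show "f \<otimes>\<^bsub>FA\<^esub> h \<in> ?J" using fc h by simp
  qed
  have "exterior_relations K n \<subseteq> ?J"
  proof
    fix r assume "r \<in> exterior_relations K n"
    then consider i where "r = gen K i \<otimes>\<^bsub>FA\<^esub> gen K i" "i \<in> {1..n}"
      | i j where "r = gen K i \<otimes>\<^bsub>FA\<^esub> gen K j \<oplus>\<^bsub>FA\<^esub> gen K j \<otimes>\<^bsub>FA\<^esub> gen K i" "i \<in> {1..n}" "j \<in> {1..n}" "i < j"
      unfolding exterior_relations_def by force
    then show "r \<in> ?J"
    proof cases
      case (1 i)
      then show ?thesis by (auto simp: basis_mult word_coord_basis word_coord_square)
    next
      case (2 i j)
      then show ?thesis
        by (auto simp: basis_mult word_coord_basis word_coord_swap FA.A.l_distr FA.A.r_distr \<phi>.add)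
    qed
  qed
  then have "Ie \<subseteq> ?J" by (rule FA.A.genideal_minimal[OF J])
  \<comment> \<open>Empty words on both sides recover the value at \<open>f\<close> itself.\<close>
  then have "?\<phi> (?b [] \<otimes>\<^bsub>FA\<^esub> f \<otimes>\<^bsub>FA\<^esub> ?b []) = \<zero>\<^bsub>V\<^esub>" and "f \<in> carrier FA" using assms by auto
  moreover have "?b [] = \<one>\<^bsub>FA\<^esub>" by (simp add: FA_eq word_monoid_def)
  ultimately show ?thesis by simp
qed

definition coord :: "(nat list \<Rightarrow> 'k) set \<Rightarrow> nat set \<Rightarrow> 'k" where
  "coord X = the_elem (free_ext K V word_coord ` X)"

lemma coord_hom: "coord \<in> module_hom K \<Lambda> V"
  using left_submodule.the_elem_hom(1)[OF Ie_submodule V_module word_coord_hom word_coord_ideal]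
  unfolding exterior_algebra_def coord_def[abs_def] .

lemma coord_word: "w \<in> lists {1..n} \<Longrightarrow> coord (word w) = word_coord w"
  unfolding coord_def word_def
  using left_submodule.the_elem_hom(2)[OF Ie_submodule V_module word_coord_hom word_coord_ideal basis_FA]
  by (simp add: word_coord_basis del: free_module_simps)

lemma sorted_list_in_lists: "S \<subseteq> {1..n} \<Longrightarrow> sorted_list_of_set S \<in> lists {1..n}"
  by (metis finite_atLeastAtMost in_listsI rev_finite_subset set_sorted_list_of_set subsetD)

lemma e_closed [simp]: "S \<subseteq> {1..n} \<Longrightarrow> e S \<in> carrier \<Lambda>"
  unfolding e_def by (rule word_closed[OF sorted_list_in_lists])

lemma e_empty: "e {} = \<one>\<^bsub>\<Lambda>\<^esub>"
  by (simp add: e_def word_Nil)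

lemma coord_e: "S \<subseteq> {1..n} \<Longrightarrow> coord (e S) = basis_elt K S"
proof -
  assume S: "S \<subseteq> {1..n}"
  then have "finite S" by (rule finite_subset) simp
  moreover have "(\<lambda>s. basis_elt K S s) = basis_elt K S" ..
  ultimately show ?thesis
    using S by (simp add: e_def coord_word sorted_list_in_lists word_coord_def inversions_sorted)
      (auto simp: basis_elt_def)
qed

text \<open>With \<open>coord_e\<close> this makes the \<open>e S\<close> a basis. They span because
  \<open>word_eq\<close> turns every word into zero or a signed \<open>e S\<close>.\<close>

lemma expand:
  assumes "x \<in> carrier \<Lambda>" shows "free_ext K \<Lambda> e (coord x) = x"
proof -
  obtain f where f: "f \<in> carrier FA" "x = Ie +>\<^bsub>FA\<^esub> f" using assms unfolding carrier_\<Lambda> by blast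
  have eh: "free_ext K \<Lambda> e \<in> module_hom K V \<Lambda>" by (rule L.AM.free_ext_hom) auto
  note ch = coset_\<Lambda>_hom[unfolded FA_hom]
  have eb: "free_ext K \<Lambda> e (basis_elt K S) = e S" if "S \<subseteq> {1..n}" for S
    using that by (intro L.AM.free_ext_basis) simp
  have bV: "basis_elt K S \<in> carrier V" if "S \<subseteq> {1..n}" for S
    using that by (intro K.basis_elt_closed) simp
  have "free_ext K \<Lambda> e (coord (Ie +>\<^bsub>FA\<^esub> f)) = Ie +>\<^bsub>FA\<^esub> f"
  proof (rule free_hom_eqI[OF L.AM.left_module_axioms module_hom_comp[OF module_hom_comp[OF ch coord_hom] eh] ch])
    show "f \<in> carrier W.F" using f by (simp add: carrier_FA)
    fix w assume "w \<in> carrier (word_monoid n)"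
    then have w: "w \<in> lists {1..n}" and sw: "set w \<subseteq> {1..n}" by auto
    have "free_ext K \<Lambda> e (word_coord w) = word w"
      unfolding word_coord_def word_eq[OF w]
      using eb[OF sw] bV[OF sw] left_module_hom.zero[OF left_module_homI[OF V_module L.AM.left_module_axioms eh]]
      by (auto simp: module_hom_smult[OF eh] simp del: free_module_simps)
    then show "free_ext K \<Lambda> e (coord (Ie +>\<^bsub>FA\<^esub> basis_elt K w)) = Ie +>\<^bsub>FA\<^esub> basis_elt K w"
      using coord_word[OF w] unfolding word_def by simp
  qed
  then show ?thesis using f by simp
qed

lemma \<Lambda>_hom_eqI:
  assumes N: "left_module K N" and f: "f \<in> module_hom K \<Lambda> N" and g: "g \<in> module_hom K \<Lambda> N"
    and x: "x \<in> carrier \<Lambda>" and eq: "\<And>S. S \<subseteq> {1..n} \<Longrightarrow> f (e S) = g (e S)"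
  shows "f x = g x"
proof -
  have eh: "free_ext K \<Lambda> e \<in> module_hom K V \<Lambda>" by (rule L.AM.free_ext_hom) auto
  have "f (free_ext K \<Lambda> e (coord x)) = g (free_ext K \<Lambda> e (coord x))"
    by (rule free_hom_eqI[OF N module_hom_comp[OF eh f] module_hom_comp[OF eh g] module_hom_in[OF coord_hom x]])
      (use eq in \<open>simp add: L.AM.free_ext_basis\<close>)
  then show ?thesis using expand[OF x] by simp
qed

lemma e_mult_r:
  assumes "S \<subseteq> {1..n}" "i \<in> {1..n}"
  shows "e S \<otimes>\<^bsub>\<Lambda>\<^esub> word [i] = (if i \<in> S then \<zero>\<^bsub>\<Lambda>\<^esub> else sign K (card {s \<in> S. i < s}) \<odot>\<^bsub>\<Lambda>\<^esub> e (insert i S))"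
proof -
  have S: "finite S" using assms(1) by (rule finite_subset) simp
  note l = sorted_list_in_lists[OF assms(1)]
  have "e S \<otimes>\<^bsub>\<Lambda>\<^esub> word [i] = word (sorted_list_of_set S @ [i])"
    unfolding e_def using assms(2) l by (intro word_mult) auto
  also have "\<dots> = (if i \<in> S then \<zero>\<^bsub>\<Lambda>\<^esub> else sign K (card {s \<in> S. i < s}) \<odot>\<^bsub>\<Lambda>\<^esub> e (insert i S))"
    using assms(2) l S by (subst word_eq) (auto simp: inversions_snoc)
  finally show ?thesis .
qed

lemma e_mult_l:
  assumes "S \<subseteq> {1..n}" "i \<in> {1..n}"
  shows "word [i] \<otimes>\<^bsub>\<Lambda>\<^esub> e S = (if i \<in> S then \<zero>\<^bsub>\<Lambda>\<^esub> else sign K (card {s \<in> S. s < i}) \<odot>\<^bsub>\<Lambda>\<^esub> e (insert i S))"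
proof -
  have S: "finite S" using assms(1) by (rule finite_subset) simp
  note l = sorted_list_in_lists[OF assms(1)]
  have "word [i] \<otimes>\<^bsub>\<Lambda>\<^esub> e S = word (i # sorted_list_of_set S)"
    unfolding e_def using assms(2) l word_mult[of "[i]"] by simp
  then show ?thesis
    using assms(2) S word_insort[OF assms(2) l] by (simp add: e_def sorted_list_of_set.fold_insort_key.insert)
qed

end

text \<open>Multiplication by a generator has this shape in coordinates: where \<open>Q\<close>
  holds, the coefficient at \<open>p\<close> is a sign times the old coefficient at
  \<open>\<pi> p\<close>, and elsewhere it is zero.\<close>

lemma (in cring) reindex_hom:
  assumes P: "finite P" and k: "\<And>p. Q p \<Longrightarrow> k p \<in> carrier R"
    and \<pi>: "\<And>p. Q p \<Longrightarrow> \<pi> p \<in> P' \<Longrightarrow> p \<in> P"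
  shows "(\<lambda>f p. if Q p then k p \<otimes> f (\<pi> p) else \<zero>) \<in> module_hom R (free_module R P') (free_module R P)"
proof (rule module_homI)
  fix f assume f: "f \<in> carrier (free_module R P')"
  have "{p. (if Q p then k p \<otimes> f (\<pi> p) else \<zero>) \<noteq> \<zero>} \<subseteq> P"
  proof
    fix p assume "p \<in> {p. (if Q p then k p \<otimes> f (\<pi> p) else \<zero>) \<noteq> \<zero>}"
    then have "Q p" "k p \<otimes> f (\<pi> p) \<noteq> \<zero>" by (auto split: if_splits)
    then have "f (\<pi> p) \<noteq> \<zero>" using k[of p] by auto
    then show "p \<in> P" using f \<pi>[OF \<open>Q p\<close>] by auto
  qed
  then show "(\<lambda>p. if Q p then k p \<otimes> f (\<pi> p) else \<zero>) \<in> carrier (free_module R P)"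
    unfolding free_module_simps mem_Collect_eq
    using f k by (intro conjI allI finite_subset[OF _ P]) auto
qed (use k in \<open>auto simp: r_distr m_ac\<close>)

context exterior
begin

text \<open>Dual to \<open>e_mult_r\<close>: multiplication adds \<open>i\<close> to a basis set, so
  the coefficient at \<open>S\<close> is taken from \<open>S - {i}\<close>.\<close>

lemma coord_mult_r:
  assumes "i \<in> {1..n}" "x \<in> carrier \<Lambda>"
  shows "coord (x \<otimes>\<^bsub>\<Lambda>\<^esub> word [i]) S = (if i \<in> S then sign K (card {s \<in> S. i < s}) \<otimes> coord x (S - {i}) else \<zero>)"
proof -
  let ?o = "\<lambda>f S. if i \<in> S then sign K (card {s \<in> S. i < s}) \<otimes> f (S - {i}) else \<zero>"
  have oh: "?o \<in> module_hom K V V" by (rule K.reindex_hom) (use assms in auto)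
  have wi: "word [i] \<in> carrier \<Lambda>" using assms by simp
  have "coord (x \<otimes>\<^bsub>\<Lambda>\<^esub> word [i]) = ?o (coord x)"
  proof (rule \<Lambda>_hom_eqI[OF V_module module_hom_comp[OF L.mult_hom_l[OF wi] coord_hom]
        module_hom_comp[OF coord_hom oh] assms(2)])
    fix T assume T: "T \<subseteq> {1..n}"
    have z: "coord \<zero>\<^bsub>\<Lambda>\<^esub> = \<zero>\<^bsub>V\<^esub>"
      by (rule left_module_hom.zero[OF left_module_homI[OF L.AM.left_module_axioms V_module coord_hom]])
    have iT: "insert i T \<subseteq> {1..n}" using T assms by simp
    \<comment> \<open>The sign may be counted in \<open>T\<close> or in \<open>insert i T\<close>,
      because \<open>i\<close> is not above itself.\<close>
    have c: "{s. (s = i \<or> s \<in> T) \<and> i < s} = {s \<in> T. i < s}" by auto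
    show "coord (e T \<otimes>\<^bsub>\<Lambda>\<^esub> word [i]) = ?o (coord (e T))"
      unfolding e_mult_r[OF T assms(1)] coord_e[OF T]
      using T iT z by (auto simp: module_hom_smult[OF coord_hom] coord_e basis_elt_def fun_eq_iff c)
  qed
  then show ?thesis by simp
qed

lemma coord_mult_l:
  assumes "i \<in> {1..n}" "x \<in> carrier \<Lambda>"
  shows "coord (word [i] \<otimes>\<^bsub>\<Lambda>\<^esub> x) S = (if i \<in> S then sign K (card {s \<in> S. s < i}) \<otimes> coord x (S - {i}) else \<zero>)"
proof -
  let ?o = "\<lambda>f S. if i \<in> S then sign K (card {s \<in> S. s < i}) \<otimes> f (S - {i}) else \<zero>"
  have oh: "?o \<in> module_hom K V V" by (rule K.reindex_hom) (use assms in auto)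
  have wi: "word [i] \<in> carrier \<Lambda>" using assms by simp
  have "coord (word [i] \<otimes>\<^bsub>\<Lambda>\<^esub> x) = ?o (coord x)"
  proof (rule \<Lambda>_hom_eqI[OF V_module module_hom_comp[OF L.mult_hom_r[OF wi] coord_hom]
        module_hom_comp[OF coord_hom oh] assms(2)])
    fix T assume T: "T \<subseteq> {1..n}"
    have z: "coord \<zero>\<^bsub>\<Lambda>\<^esub> = \<zero>\<^bsub>V\<^esub>"
      by (rule left_module_hom.zero[OF left_module_homI[OF L.AM.left_module_axioms V_module coord_hom]])
    have iT: "insert i T \<subseteq> {1..n}" using T assms by simp
    have c: "{s. (s = i \<or> s \<in> T) \<and> s < i} = {s \<in> T. s < i}" by auto
    show "coord (word [i] \<otimes>\<^bsub>\<Lambda>\<^esub> e T) = ?o (coord (e T))"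
      unfolding e_mult_l[OF T assms(1)] coord_e[OF T]
      using T iT z by (auto simp: module_hom_smult[OF coord_hom] coord_e basis_elt_def fun_eq_iff c)
  qed
  then show ?thesis by simp
qed

end

section \<open>The Koszul complex in coordinates\<close>

text \<open>The off-diagonal terms cancel in pairs. No division by two is involved, so the argument
  covers characteristic 2.\<close>

lemma (in abelian_group) finsum_antisym:
  assumes "finite S" "\<And>i k. i \<in> S \<Longrightarrow> k \<in> S \<Longrightarrow> g i k \<in> carrier G"
    "\<And>i k. i \<in> S \<Longrightarrow> k \<in> S \<Longrightarrow> i \<noteq> k \<Longrightarrow> g i k \<oplus> g k i = \<zero>"
  shows "(\<Oplus>i\<in>S. \<Oplus>k\<in>S - {i}. g i k) = \<zero>"
  using assms
proof (induction S)
  case (insert x S)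
  have c: "g i k \<in> carrier G" if "i = x \<or> i \<in> S" "k = x \<or> k \<in> S" for i k using insert.prems(1) that by blast
  have "(\<Oplus>i\<in>S. \<Oplus>k\<in>insert x S - {i}. g i k) = (\<Oplus>i\<in>S. g i x \<oplus> (\<Oplus>k\<in>S - {i}. g i k))"
  proof (intro finsum_cong')
    fix i assume i: "i \<in> S"
    then have "insert x S - {i} = insert x (S - {i})" using insert.hyps by auto
    then show "(\<Oplus>k\<in>insert x S - {i}. g i k) = g i x \<oplus> (\<Oplus>k\<in>S - {i}. g i k)"
      using insert.hyps c i by (simp add: finsum_insert Pi_iff)
  qed (use c in auto)
  also have "\<dots> = (\<Oplus>i\<in>S. g i x) \<oplus> (\<Oplus>i\<in>S. \<Oplus>k\<in>S - {i}. g i k)"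
    by (rule finsum_addf) (use c in auto)
  also have "(\<Oplus>i\<in>S. \<Oplus>k\<in>S - {i}. g i k) = \<zero>" using insert by simp
  finally have 1: "(\<Oplus>i\<in>S. \<Oplus>k\<in>insert x S - {i}. g i k) = (\<Oplus>i\<in>S. g i x)"
    using c by (simp add: Pi_iff)
  have "(\<Oplus>i\<in>insert x S. \<Oplus>k\<in>insert x S - {i}. g i k) = (\<Oplus>k\<in>S. g x k) \<oplus> (\<Oplus>i\<in>S. \<Oplus>k\<in>insert x S - {i}. g i k)"
    using insert.hyps c by (subst finsum_insert) auto
  also have "\<dots> = (\<Oplus>k\<in>S. g x k \<oplus> g k x)"
    unfolding 1 by (rule finsum_addf[symmetric]) (use c in auto)
  also have "\<dots> = \<zero>"
    using insert by (intro add.finprod_one_eqI) auto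
  finally show ?case .
qed simp

lemma (in abelian_monoid) finsum_swap:
  assumes "finite S" "\<And>i k. i \<in> S \<Longrightarrow> k \<in> T \<Longrightarrow> g i k \<in> carrier G"
  shows "(\<Oplus>i\<in>S. \<Oplus>k\<in>T. g i k) = (\<Oplus>k\<in>T. \<Oplus>i\<in>S. g i k)"
  using assms
proof (induction S)
  case (insert x S)
  have "(\<Oplus>k\<in>T. \<Oplus>i\<in>insert x S. g i k) = (\<Oplus>k\<in>T. g x k \<oplus> (\<Oplus>i\<in>S. g i k))"
    using insert by (intro finsum_cong') (auto simp: finsum_insert Pi_iff)
  then show ?case using insert by (simp add: finsum_insert finsum_addf Pi_iff)
qed simp

section \<open>Signs of multiplication and the differential on families of scalars\<close>

context cring
begin

definition \<sigma> :: "nat set \<Rightarrow> nat \<Rightarrow> 'a" where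
  "\<sigma> S i = sign R (card {s \<in> S. i < s})"

definition \<tau>L :: "nat set \<Rightarrow> nat \<Rightarrow> 'a" where
  "\<tau>L S i = sign R (card {s \<in> S. s < i})"

lemma \<sigma>_closed [simp]: "\<sigma> S i \<in> carrier R" and \<tau>L_closed [simp]: "\<tau>L S i \<in> carrier R"
  by (simp_all add: \<sigma>_def \<tau>L_def)

lemma sign_remove:
  assumes "finite S" "i \<in> S" "k \<in> S" "i < k"
  shows "\<sigma> S i = \<ominus> \<sigma> (S - {k}) i" "\<sigma> S k = \<sigma> (S - {i}) k"
    "\<tau>L S k = \<ominus> \<tau>L (S - {i}) k" "\<tau>L S i = \<tau>L (S - {k}) i"
proof -
  have "{s \<in> S. i < s} = insert k {s \<in> S - {k}. i < s}" "{s \<in> S. s < k} = insert i {s \<in> S - {i}. s < k}"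
    "{s \<in> S. k < s} = {s \<in> S - {i}. k < s}" "{s \<in> S. s < i} = {s \<in> S - {k}. s < i}"
    using assms by auto
  then show "\<sigma> S i = \<ominus> \<sigma> (S - {k}) i" "\<sigma> S k = \<sigma> (S - {i}) k"
    "\<tau>L S k = \<ominus> \<tau>L (S - {i}) k" "\<tau>L S i = \<tau>L (S - {k}) i"
    using assms by (simp_all add: \<sigma>_def \<tau>L_def sign_Suc)
qed

text \<open>The coordinate form of anticommuting generators. Of the two removals, exactly one
  changes the number of larger elements that the other sign counts.\<close>

lemma \<sigma>_anticommute:
  assumes "finite S" "i \<in> S" "k \<in> S" "i \<noteq> k"
  shows "\<sigma> S i \<otimes> \<sigma> (S - {i}) k \<oplus> \<sigma> S k \<otimes> \<sigma> (S - {k}) i = \<zero>"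
proof (cases "i < k")
  case True
  show ?thesis
    using sign_remove[OF assms(1-3) True] by (simp add: l_minus r_minus m_comm l_neg)
next
  case False
  then have "k < i" using assms by simp
  then show ?thesis
    using sign_remove[OF assms(1,3,2)] by (simp add: l_minus r_minus m_comm r_neg)
qed

lemma \<tau>L_anticommute:
  assumes "finite S" "i \<in> S" "k \<in> S" "i \<noteq> k"
  shows "\<tau>L S i \<otimes> \<tau>L (S - {i}) k \<oplus> \<tau>L S k \<otimes> \<tau>L (S - {k}) i = \<zero>"
proof (cases "i < k")
  case True
  show ?thesis
    using sign_remove[OF assms(1-3) True] by (simp add: l_minus r_minus m_comm r_neg)
next
  case False
  then have "k < i" using assms by simp
  then show ?thesis
    using sign_remove[OF assms(1,3,2)] by (simp add: l_minus r_minus m_comm l_neg)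
qed

text \<open>The elements other than \<open>i\<close> lie above or below it, and there are
  \<open>card S - 1\<close> of them. This is how the cardinality of \<open>S\<close> enters the
  Hochschild differential.\<close>

lemma \<tau>L_eq_\<sigma>:
  assumes "finite S" "i \<in> S" shows "\<tau>L S i = \<sigma> S i \<otimes> sign R (card S - 1)"
proof -
  have "S - {i} = {s \<in> S. i < s} \<union> {s \<in> S. s < i}" using assms by auto
  then have "card S - 1 = card {s \<in> S. i < s} + card {s \<in> S. s < i}"
    using assms by (simp add: card_Diff_singleton[symmetric] card_Un_disjoint disjoint_iff)
  moreover have "sign R k \<otimes> sign R k = \<one>" for k
    by (simp add: sign_def l_minus r_minus)
  ultimately show ?thesis
    by (simp add: \<tau>L_def \<sigma>_def sign_add m_assoc[symmetric])
qed

text \<open>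
  Here \<open>f S a T\<close> is the coefficient of \<open>e\<^sub>S \<otimes> z\<^sub>a \<otimes> e\<^sub>T\<close>, and \<open>\<sigma>\<close>, \<open>\<tau>L\<close> are the signs of right and left
  multiplication by \<open>x\<^sub>i\<close>. The signs \<open>\<tau>\<close> are left open because \<open>\<tau> = 0\<close> gives the one-sided Koszul complex.
\<close>

definition kd :: "(nat set \<Rightarrow> nat \<Rightarrow> 'a) \<Rightarrow> (nat set \<Rightarrow> nat multiset \<Rightarrow> nat set \<Rightarrow> 'a) \<Rightarrow>
    nat set \<Rightarrow> nat multiset \<Rightarrow> nat set \<Rightarrow> 'a" where
  "kd \<tau> f S a T = (\<Oplus>i\<in>S. \<sigma> S i \<otimes> f (S - {i}) (add_mset i a) T) \<oplus>
    sign R (Suc (size a)) \<otimes> (\<Oplus>i\<in>T. \<tau> T i \<otimes> f S (add_mset i a) (T - {i}))"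

text \<open>Chains of degree \<open>m\<close> that involve only the first \<open>j\<close> variables
  in the left factor and in the multiset, while the right factor may use all \<open>n\<close>. The
  parameter \<open>j\<close> is the induction variable of the contraction; for \<open>j = 0\<close>
  only \<open>S = {}\<close> and \<open>a = {#}\<close> remain, which forces
  \<open>m = 0\<close>.\<close>

definition kspace :: "nat \<Rightarrow> nat \<Rightarrow> nat \<Rightarrow> (nat set \<Rightarrow> nat multiset \<Rightarrow> nat set \<Rightarrow> 'a) \<Rightarrow> bool" where
  "kspace n j m f \<longleftrightarrow> (\<forall>S a T. f S a T \<in> carrier R) \<and>
    (\<forall>S a T. f S a T \<noteq> \<zero> \<longrightarrow> S \<subseteq> {1..j} \<and> set_mset a \<subseteq> {1..j} \<and> size a = m \<and> T \<subseteq> {1..n})"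

lemma kspace_closed: "kspace n j m f \<Longrightarrow> f S a T \<in> carrier R"
  by (simp add: kspace_def)

lemma kspace_zero:
  "kspace n j m f \<Longrightarrow> \<not> (S \<subseteq> {1..j} \<and> set_mset a \<subseteq> {1..j} \<and> size a = m \<and> T \<subseteq> {1..n}) \<Longrightarrow> f S a T = \<zero>"
  unfolding kspace_def by blast

lemma kspace_supp:
  "kspace n j m f \<Longrightarrow> f S a T \<noteq> \<zero> \<Longrightarrow> S \<subseteq> {1..j} \<and> set_mset a \<subseteq> {1..j} \<and> size a = m \<and> T \<subseteq> {1..n}"
  unfolding kspace_def by blast

lemma kspace_mono: "kspace n j m f \<Longrightarrow> j \<le> k \<Longrightarrow> kspace n k m f"
  unfolding kspace_def by fastforce

context
  fixes n :: nat and \<tau> :: "nat set \<Rightarrow> nat \<Rightarrow> 'a"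
  assumes \<tau>: "\<And>T i. \<tau> T i \<in> carrier R"
begin

lemma kd_closed: "(\<And>S a T. f S a T \<in> carrier R) \<Longrightarrow> kd \<tau> f S a T \<in> carrier R"
  unfolding kd_def using \<tau> by (intro a_closed m_closed finsum_closed) auto

text \<open>Linearity is recorded for differences because the exactness proof subtracts
  boundaries.\<close>

lemma kd_diff:
  assumes "\<And>S a T. f S a T \<in> carrier R" "\<And>S a T. g S a T \<in> carrier R"
  shows "kd \<tau> (\<lambda>S a T. f S a T \<ominus> g S a T) S a T = kd \<tau> f S a T \<ominus> kd \<tau> g S a T"
proof -
  have sd: "(\<Oplus>i\<in>I. u i \<otimes> (p i \<ominus> q i)) = (\<Oplus>i\<in>I. u i \<otimes> p i) \<ominus> (\<Oplus>i\<in>I. u i \<otimes> q i)"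
    if "\<And>i. u i \<in> carrier R" "\<And>i. p i \<in> carrier R" "\<And>i. q i \<in> carrier R" for u p q and I :: "nat set"
  proof -
    have "(\<Oplus>i\<in>I. u i \<otimes> (p i \<ominus> q i)) \<oplus> (\<Oplus>i\<in>I. u i \<otimes> q i) = (\<Oplus>i\<in>I. u i \<otimes> (p i \<ominus> q i) \<oplus> u i \<otimes> q i)"
      using that by (intro finsum_addf[symmetric]) auto
    also have "\<dots> = (\<Oplus>i\<in>I. u i \<otimes> p i)"
      using that by (intro finsum_cong') (auto simp: r_distr[symmetric] minus_eq a_assoc l_neg)
    finally have "(\<Oplus>i\<in>I. u i \<otimes> p i) = (\<Oplus>i\<in>I. u i \<otimes> (p i \<ominus> q i)) \<oplus> (\<Oplus>i\<in>I. u i \<otimes> q i)" ..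
    then show ?thesis using that by (simp add: minus_eq a_assoc r_neg Pi_iff)
  qed
  have c: "(\<Oplus>i\<in>I. u i \<otimes> p i) \<in> carrier R"
    if "\<And>i. u i \<in> carrier R" "\<And>i. p i \<in> carrier R" for u p and I :: "nat set"
    using that by (intro finsum_closed) auto
  note cs = c[OF \<sigma>_closed assms(1)] c[OF \<sigma>_closed assms(2)] c[OF \<tau> assms(1)] c[OF \<tau> assms(2)]
  have alg: "(p \<ominus> q) \<oplus> s \<otimes> (p' \<ominus> q') = (p \<oplus> s \<otimes> p') \<ominus> (q \<oplus> s \<otimes> q')"
    if "p \<in> carrier R" "q \<in> carrier R" "p' \<in> carrier R" "q' \<in> carrier R" "s \<in> carrier R" for p q p' q' s
    using that by (simp add: minus_eq r_distr r_minus minus_add a_ac)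
  have "kd \<tau> (\<lambda>S a T. f S a T \<ominus> g S a T) S a T =
      ((\<Oplus>i\<in>S. \<sigma> S i \<otimes> f (S - {i}) (add_mset i a) T) \<ominus> (\<Oplus>i\<in>S. \<sigma> S i \<otimes> g (S - {i}) (add_mset i a) T)) \<oplus>
      sign R (Suc (size a)) \<otimes> ((\<Oplus>i\<in>T. \<tau> T i \<otimes> f S (add_mset i a) (T - {i})) \<ominus>
        (\<Oplus>i\<in>T. \<tau> T i \<otimes> g S (add_mset i a) (T - {i})))"
    unfolding kd_def
    using sd[of "\<sigma> S" "\<lambda>i. f (S - {i}) (add_mset i a) T" "\<lambda>i. g (S - {i}) (add_mset i a) T" S]
      sd[of "\<tau> T" "\<lambda>i. f S (add_mset i a) (T - {i})" "\<lambda>i. g S (add_mset i a) (T - {i})" T] assms \<tau>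
    by simp
  then show ?thesis
    unfolding kd_def using assms \<tau> by (simp add: alg Pi_iff)
qed

lemma finsum_scaled_zero:
  assumes "\<And>i. i \<in> I \<Longrightarrow> u i \<in> carrier R" "\<And>i. i \<in> I \<Longrightarrow> p i = \<zero>"
  shows "(\<Oplus>i\<in>I. u i \<otimes> p i) = \<zero>"
  using assms by (intro add.finprod_one_eqI[folded finsum_def, simplified]) auto

lemma kd_kspace:
  assumes f: "kspace n j (Suc m) f" and j: "j \<le> n" shows "kspace n j m (kd \<tau> f)"
proof -
  note fc = kspace_closed[OF f]
  have "kd \<tau> f S a T = \<zero>"
    if no: "\<not> (S \<subseteq> {1..j} \<and> set_mset a \<subseteq> {1..j} \<and> size a = m \<and> T \<subseteq> {1..n})" for S a T
  proof -
    have "(\<Oplus>i\<in>S. \<sigma> S i \<otimes> f (S - {i}) (add_mset i a) T) = \<zero>"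
      by (rule finsum_scaled_zero) (use no in \<open>auto intro!: kspace_zero[OF f]\<close>)
    moreover have "(\<Oplus>i\<in>T. \<tau> T i \<otimes> f S (add_mset i a) (T - {i})) = \<zero>"
    proof (rule finsum_scaled_zero)
      fix i assume i: "i \<in> T"
      show "f S (add_mset i a) (T - {i}) = \<zero>"
      proof (rule kspace_zero[OF f], rule notI)
        assume h: "S \<subseteq> {1..j} \<and> set_mset (add_mset i a) \<subseteq> {1..j} \<and> size (add_mset i a) = Suc m \<and> T - {i} \<subseteq> {1..n}"
        \<comment> \<open>The index \<open>i\<close> also occurs in the multiset, hence is at most
          \<open>j\<close>. This is where \<open>j \<le> n\<close> keeps the support of the right
          factor inside \<open>{1..n}\<close>.\<close>
        then have "i \<in> {1..n}" using j by auto
        then have "T \<subseteq> {1..n}" using h by blast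
        then show False using no h by auto
      qed
    qed (rule \<tau>)
    ultimately show ?thesis by (simp add: kd_def)
  qed
  then have sup: "S \<subseteq> {1..j} \<and> set_mset a \<subseteq> {1..j} \<and> size a = m \<and> T \<subseteq> {1..n}"
    if "kd \<tau> f S a T \<noteq> \<zero>" for S a T
    using that by blast
  show ?thesis
    unfolding kspace_def by (intro conjI allI impI kd_closed fc) (use sup in blast)+
qed

lemma kd_bottom:
  assumes f: "kspace n j 0 f" shows "kd \<tau> f S a T = \<zero>"
proof -
  have "f S' (add_mset i a) T' = \<zero>" for S' i T' by (rule kspace_zero[OF f]) simp
  then show ?thesis using \<tau> by (simp add: kd_def)
qed

text \<open>Removing two elements on the left cancels by \<open>\<sigma>_anticommute\<close>, two on
  the right by \<open>anti\<close>. The mixed sums agree after an exchange of summations and enter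
  with opposite signs.\<close>

lemma kd_kd:
  assumes f: "kspace n j (Suc (Suc m)) f" and j: "j \<le> n"
    and anti: "\<And>T i k. finite T \<Longrightarrow> i \<in> T \<Longrightarrow> k \<in> T \<Longrightarrow> i \<noteq> k \<Longrightarrow>
      \<tau> T i \<otimes> \<tau> (T - {i}) k \<oplus> \<tau> T k \<otimes> \<tau> (T - {k}) i = \<zero>"
  shows "kd \<tau> (kd \<tau> f) S a T = \<zero>"
proof (cases "finite S \<and> finite T")
  case False
  \<comment> \<open>Infinite index sets lie outside the support, so only finite sums need an
    argument.\<close>
  then have "\<not> (S \<subseteq> {1..j} \<and> T \<subseteq> {1..n})" by (meson finite_atLeastAtMost finite_subset)
  then show ?thesis using kspace_zero[OF kd_kspace[OF kd_kspace[OF f j] j]] by blast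
next
  case True
  then have S: "finite S" and T: "finite T" by auto
  note fc [simp] = kspace_closed[OF f]
  note [simp] = \<tau>
  let ?s = "sign R (Suc (size a))"
  let ?A = "\<lambda>i. \<Oplus>k\<in>S - {i}. \<sigma> (S - {i}) k \<otimes> f (S - {i} - {k}) (add_mset k (add_mset i a)) T"
  let ?B = "\<lambda>i. \<Oplus>k\<in>T. \<tau> T k \<otimes> f (S - {i}) (add_mset k (add_mset i a)) (T - {k})"
  let ?C = "\<lambda>k. \<Oplus>i\<in>S. \<sigma> S i \<otimes> f (S - {i}) (add_mset i (add_mset k a)) (T - {k})"
  let ?D = "\<lambda>k. \<Oplus>l\<in>T - {k}. \<tau> (T - {k}) l \<otimes> f S (add_mset l (add_mset k a)) (T - {k} - {l})"
  have cl [simp]: "?A i \<in> carrier R" "?B i \<in> carrier R" "?C i \<in> carrier R" "?D i \<in> carrier R" for i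
    by (auto intro!: finsum_closed)
  have split: "(\<Oplus>i\<in>I. u i \<otimes> (p i \<oplus> c \<otimes> q i)) = (\<Oplus>i\<in>I. u i \<otimes> p i) \<oplus> c \<otimes> (\<Oplus>i\<in>I. u i \<otimes> q i)"
    if "finite I" "\<And>i. u i \<in> carrier R" "\<And>i. p i \<in> carrier R" "\<And>i. q i \<in> carrier R" "c \<in> carrier R"
    for u p q c and I :: "nat set"
  proof -
    have "(\<Oplus>i\<in>I. u i \<otimes> (p i \<oplus> c \<otimes> q i)) = (\<Oplus>i\<in>I. u i \<otimes> p i \<oplus> c \<otimes> (u i \<otimes> q i))"
      using that by (intro finsum_cong') (auto simp: r_distr m_lcomm)
    then show ?thesis using that by (simp add: finsum_addf finsum_rdistr Pi_iff)
  qed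
  have X: "(\<Oplus>i\<in>S. \<sigma> S i \<otimes> ?A i) = \<zero>"
  proof -
    have "(\<Oplus>i\<in>S. \<sigma> S i \<otimes> ?A i) = (\<Oplus>i\<in>S. \<Oplus>k\<in>S - {i}. \<sigma> S i \<otimes>
        (\<sigma> (S - {i}) k \<otimes> f (S - {i} - {k}) (add_mset k (add_mset i a)) T))"
      using S by (intro finsum_cong') (auto intro!: finsum_rdistr finsum_closed)
    also have "\<dots> = \<zero>"
    proof (rule finsum_antisym[OF S])
      fix i k assume ik: "i \<in> S" "k \<in> S" "i \<noteq> k"
      have "S - {k} - {i} = S - {i} - {k}" by auto
      then show "\<sigma> S i \<otimes> (\<sigma> (S - {i}) k \<otimes> f (S - {i} - {k}) (add_mset k (add_mset i a)) T) \<oplus>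
          \<sigma> S k \<otimes> (\<sigma> (S - {k}) i \<otimes> f (S - {k} - {i}) (add_mset i (add_mset k a)) T) = \<zero>"
        using \<sigma>_anticommute[OF S ik] l_distr[of "\<sigma> S i \<otimes> \<sigma> (S - {i}) k" "\<sigma> S k \<otimes> \<sigma> (S - {k}) i"
            "f (S - {i} - {k}) (add_mset k (add_mset i a)) T"]
        by (simp add: m_assoc add_mset_commute)
    qed auto
    finally show ?thesis .
  qed
  have Z: "(\<Oplus>k\<in>T. \<tau> T k \<otimes> ?D k) = \<zero>"
  proof -
    have "(\<Oplus>i\<in>T. \<tau> T i \<otimes> ?D i) = (\<Oplus>i\<in>T. \<Oplus>k\<in>T - {i}. \<tau> T i \<otimes>
        (\<tau> (T - {i}) k \<otimes> f S (add_mset k (add_mset i a)) (T - {i} - {k})))"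
      using T by (intro finsum_cong') (auto intro!: finsum_rdistr finsum_closed)
    also have "\<dots> = \<zero>"
    proof (rule finsum_antisym[OF T])
      fix i k assume ik: "i \<in> T" "k \<in> T" "i \<noteq> k"
      have "T - {k} - {i} = T - {i} - {k}" by auto
      then show "\<tau> T i \<otimes> (\<tau> (T - {i}) k \<otimes> f S (add_mset k (add_mset i a)) (T - {i} - {k})) \<oplus>
          \<tau> T k \<otimes> (\<tau> (T - {k}) i \<otimes> f S (add_mset i (add_mset k a)) (T - {k} - {i})) = \<zero>"
        using anti[OF T ik] l_distr[of "\<tau> T i \<otimes> \<tau> (T - {i}) k" "\<tau> T k \<otimes> \<tau> (T - {k}) i"
            "f S (add_mset k (add_mset i a)) (T - {i} - {k})"]
        by (simp add: m_assoc add_mset_commute)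
    qed auto
    finally show ?thesis .
  qed
  have Y: "(\<Oplus>i\<in>S. \<sigma> S i \<otimes> ?B i) = (\<Oplus>k\<in>T. \<tau> T k \<otimes> ?C k)"
  proof -
    have "(\<Oplus>i\<in>S. \<sigma> S i \<otimes> ?B i) = (\<Oplus>i\<in>S. \<Oplus>k\<in>T. \<sigma> S i \<otimes>
        (\<tau> T k \<otimes> f (S - {i}) (add_mset k (add_mset i a)) (T - {k})))"
      using T by (intro finsum_cong') (auto intro!: finsum_rdistr finsum_closed)
    also have "\<dots> = (\<Oplus>k\<in>T. \<Oplus>i\<in>S. \<sigma> S i \<otimes>
        (\<tau> T k \<otimes> f (S - {i}) (add_mset k (add_mset i a)) (T - {k})))"
      by (rule finsum_swap[OF S]) auto
    also have "\<dots> = (\<Oplus>k\<in>T. \<tau> T k \<otimes> ?C k)"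
      using S by (intro finsum_cong')
        (auto intro!: finsum_closed simp: finsum_rdistr m_lcomm add_mset_commute)
    finally show ?thesis .
  qed
  \<comment> \<open>The inner differential is taken at a multiset with one more element, so its sign
    is the opposite of the outer one. This is what cancels the mixed sums.\<close>
  have s: "sign R (Suc (Suc (size a))) = \<ominus> ?s" by (simp add: sign_Suc)
  have "kd \<tau> (kd \<tau> f) S a T =
      (\<Oplus>i\<in>S. \<sigma> S i \<otimes> (?A i \<oplus> (\<ominus> ?s) \<otimes> ?B i)) \<oplus> ?s \<otimes> (\<Oplus>k\<in>T. \<tau> T k \<otimes> (?C k \<oplus> (\<ominus> ?s) \<otimes> ?D k))"
    unfolding kd_def size_add_mset s ..
  also have "\<dots> = ((\<Oplus>i\<in>S. \<sigma> S i \<otimes> ?A i) \<oplus> (\<ominus> ?s) \<otimes> (\<Oplus>i\<in>S. \<sigma> S i \<otimes> ?B i)) \<oplus>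
      ?s \<otimes> ((\<Oplus>k\<in>T. \<tau> T k \<otimes> ?C k) \<oplus> (\<ominus> ?s) \<otimes> (\<Oplus>k\<in>T. \<tau> T k \<otimes> ?D k))"
    using split[OF S, of "\<sigma> S" ?A ?B "\<ominus> ?s"] split[OF T, of "\<tau> T" ?C ?D "\<ominus> ?s"] by simp
  also have "\<dots> = \<zero>"
    unfolding X Z Y by (simp add: l_minus l_neg Pi_iff)
  finally show ?thesis .
qed

text \<open>
  The contracting homotopy for the last variable. It divides by \<open>x\<^sub>j\<close> on the left factor, so
  \<open>1 - (d h + h d)\<close> lands in the subcomplex that does not involve \<open>x\<^sub>j\<close> in the first two factors.
\<close>

definition contract :: "nat \<Rightarrow> (nat set \<Rightarrow> nat multiset \<Rightarrow> nat set \<Rightarrow> 'a) \<Rightarrow>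
    nat set \<Rightarrow> nat multiset \<Rightarrow> nat set \<Rightarrow> 'a" where
  "contract j f S a T = (if j \<notin> S \<and> j \<in># a then f (insert j S) (a - {#j#}) T else \<zero>)"

lemma contract_kspace:
  assumes f: "kspace n j m f" shows "kspace n j (Suc m) (contract j f)"
proof -
  have "S \<subseteq> {1..j} \<and> set_mset a \<subseteq> {1..j} \<and> size a = Suc m \<and> T \<subseteq> {1..n}"
    if "contract j f S a T \<noteq> \<zero>" for S a T
  proof -
    from that have ja: "j \<in># a" and nz: "f (insert j S) (a - {#j#}) T \<noteq> \<zero>"
      by (auto simp: contract_def split: if_splits)
    from nz have h: "insert j S \<subseteq> {1..j}" "set_mset (a - {#j#}) \<subseteq> {1..j}" "size (a - {#j#}) = m" "T \<subseteq> {1..n}"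
      using kspace_supp[OF f nz] by blast+
    have "set_mset a = insert j (set_mset (a - {#j#}))" "size a = Suc (size (a - {#j#}))"
      using ja by (metis insert_DiffM set_mset_add_mset_insert, metis insert_DiffM size_add_mset)
    then show ?thesis using h by auto
  qed
  then show ?thesis
    using f unfolding kspace_def contract_def by auto
qed

text \<open>If \<open>j\<close> is in \<open>S\<close>, only the summand that removes
  \<open>j\<close> survives. Otherwise the cycle condition is read one step further, at
  \<open>insert j S\<close> and \<open>a - {#j#}\<close>: its \<open>j\<close>-summand is
  \<open>f S a T\<close>, and the remaining ones are those of the contracted chain with opposite
  sign.\<close>

lemma contract_homotopy:
  assumes f: "kspace n j m f" and j: "j \<le> n" and cyc: "\<And>S a T. kd \<tau> f S a T = \<zero>"
    and S: "S \<subseteq> {1..j}" and T: "T \<subseteq> {1..n}" and jSa: "j \<in> S \<or> j \<in># a"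
  shows "kd \<tau> (contract j f) S a T = f S a T"
proof -
  note fc [simp] = kspace_closed[OF f]
  note [simp] = \<tau>
  have fin: "finite S" using S by (rule finite_subset) simp
  have cc [simp]: "contract j f S a T \<in> carrier R" for S a T by (simp add: contract_def)
  show ?thesis
  proof (cases "j \<in> S")
    case True
    \<comment> \<open>As the largest element, \<open>j\<close> is appended on the right without a
      sign. This is the reason for contracting the last variable first.\<close>
    have "{s \<in> S. j < s} = {}" using S by auto
    then have sj: "\<sigma> S j = \<one>" unfolding \<sigma>_def by (simp only: card.empty sign_0)
    have "(\<Oplus>i\<in>S. \<sigma> S i \<otimes> contract j f (S - {i}) (add_mset i a) T) =
        \<sigma> S j \<otimes> contract j f (S - {j}) (add_mset j a) T"
      by (rule finsum_single[OF abelian_monoid_axioms fin True]) (use True in \<open>auto simp: contract_def\<close>)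
    also have "\<dots> = f S a T" using True by (simp add: sj contract_def insert_absorb)
    finally show ?thesis using True by (simp add: kd_def contract_def)
  next
    case False
    then have ja: "j \<in># a" using jSa by blast
    have notin: "{s \<in> insert j S. j < s} = {}" using S by auto
    then have sj: "\<sigma> (insert j S) j = \<one>" unfolding \<sigma>_def by (simp only: card.empty sign_0)
    let ?A = "\<Oplus>i\<in>S. \<sigma> S i \<otimes> f (insert j (S - {i})) (add_mset i (a - {#j#})) T"
    let ?B = "\<Oplus>i\<in>T. \<tau> T i \<otimes> f (insert j S) (add_mset i (a - {#j#})) (T - {i})"
    have AB: "?A \<in> carrier R" "?B \<in> carrier R" by (auto intro!: finsum_closed)
    have sa: "size a = Suc (size (a - {#j#}))" using ja by (metis insert_DiffM size_add_mset)
    have d: "add_mset i a - {#j#} = add_mset i (a - {#j#})" for i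
      using ja by (metis add_mset_add_single diff_union_swap2 insert_DiffM)
    \<comment> \<open>The left part of the cycle condition at the shifted index. Every sign except
      the one at \<open>j\<close> flips, since \<open>j\<close> now lies above each
      \<open>i\<close>.\<close>
    have "(\<Oplus>i\<in>insert j S. \<sigma> (insert j S) i \<otimes> f (insert j S - {i}) (add_mset i (a - {#j#})) T) =
        f S a T \<oplus> (\<Oplus>i\<in>S. \<sigma> (insert j S) i \<otimes> f (insert j S - {i}) (add_mset i (a - {#j#})) T)"
      using fin False ja by (simp add: finsum_insert Pi_iff sj)
    also have "(\<Oplus>i\<in>S. \<sigma> (insert j S) i \<otimes> f (insert j S - {i}) (add_mset i (a - {#j#})) T) =
        (\<Oplus>i\<in>S. \<ominus> \<one> \<otimes> (\<sigma> S i \<otimes> f (insert j (S - {i})) (add_mset i (a - {#j#})) T))"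
    proof (intro finsum_cong')
      fix i assume i: "i \<in> S"
      then have ij: "i < j" using S False by (metis atLeastAtMost_iff le_neq_implies_less subsetD)
      have e: "insert j S - {i} = insert j (S - {i})" "insert j S - {j} = S" using ij False by auto
      have "\<sigma> (insert j S) i = \<ominus> \<sigma> S i"
        using sign_remove(1)[of "insert j S" i j] fin i ij e by simp
      then show "\<sigma> (insert j S) i \<otimes> f (insert j S - {i}) (add_mset i (a - {#j#})) T =
          \<ominus> \<one> \<otimes> (\<sigma> S i \<otimes> f (insert j (S - {i})) (add_mset i (a - {#j#})) T)"
        by (simp add: e l_minus)
    qed auto
    also have "\<dots> = \<ominus> ?A"
      using fin AB by (subst finsum_rdistr[symmetric]) (auto simp: l_minus)
    finally have kdf: "kd \<tau> f (insert j S) (a - {#j#}) T = (f S a T \<oplus> \<ominus> ?A) \<oplus> sign R (size a) \<otimes> ?B"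
      by (simp add: kd_def sa)
    have eq: "(f S a T \<oplus> \<ominus> ?A) \<oplus> sign R (size a) \<otimes> ?B = \<zero>"
      by (rule trans[OF kdf[symmetric] cyc])
    have "kd \<tau> (contract j f) S a T = ?A \<oplus> sign R (Suc (size a)) \<otimes> ?B"
      unfolding kd_def using False ja by (simp add: contract_def d)
    also have "\<dots> = ?A \<oplus> \<ominus> (sign R (size a) \<otimes> ?B)" using AB by (simp add: sign_Suc l_minus)
    \<comment> \<open>Adding the cycle condition, which is zero, leaves exactly
      \<open>f S a T\<close>.\<close>
    also have "\<dots> = ((f S a T \<oplus> \<ominus> ?A) \<oplus> sign R (size a) \<otimes> ?B) \<oplus> (?A \<oplus> \<ominus> (sign R (size a) \<otimes> ?B))"
      unfolding eq using AB by simp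
    also have "\<dots> = f S a T"
    proof -
      have "((p \<oplus> \<ominus> q) \<oplus> r) \<oplus> (q \<oplus> \<ominus> r) = p" if "p \<in> carrier R" "q \<in> carrier R" "r \<in> carrier R" for p q r
      proof -
        have "((p \<oplus> \<ominus> q) \<oplus> r) \<oplus> (q \<oplus> \<ominus> r) = p \<oplus> ((\<ominus> q \<oplus> q) \<oplus> (r \<oplus> \<ominus> r))"
          using that by (simp only: a_ac a_closed a_inv_closed)
        then show ?thesis using that by (simp add: l_neg r_neg)
      qed
      then show ?thesis using AB by simp
    qed
    finally show ?thesis .
  qed
qed

text \<open>Subtracting the boundary of the contraction removes the last variable from the left
  factor and from the multiset, and what is left is again a cycle because \<open>d\<close> squares
  to zero. After all steps the remainder lives in the right factor alone, so it is zero in positive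
  degree.\<close>

lemma koszul_exact:
  assumes f: "kspace n j m f" and j: "j \<le> n" and cyc: "\<And>S a T. kd \<tau> f S a T = \<zero>"
    and anti: "\<And>T i k. finite T \<Longrightarrow> i \<in> T \<Longrightarrow> k \<in> T \<Longrightarrow> i \<noteq> k \<Longrightarrow>
      \<tau> T i \<otimes> \<tau> (T - {i}) k \<oplus> \<tau> T k \<otimes> \<tau> (T - {k}) i = \<zero>"
  shows "\<exists>y. kspace n j (Suc m) y \<and> kspace n 0 m (\<lambda>S a T. f S a T \<ominus> kd \<tau> y S a T)"
  using f j cyc
proof (induction j arbitrary: f)
  case 0
  have z: "kspace n 0 (Suc m) (\<lambda>_ _ _. \<zero>)" by (simp add: kspace_def)
  have "kd \<tau> (\<lambda>_ _ _. \<zero>) S a T = \<zero>" for S a T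
    using \<tau> by (simp add: kd_def)
  then show ?case
    using 0 z kspace_closed[OF 0(1)] by (intro exI[of _ "\<lambda>_ _ _. \<zero>"]) (simp add: diff_zero)
next
  case (Suc j)
  let ?h = "contract (Suc j) f"
  have hk: "kspace n (Suc j) (Suc m) ?h" by (rule contract_kspace[OF Suc.prems(1)])
  have dhk: "kspace n (Suc j) m (kd \<tau> ?h)" by (rule kd_kspace[OF hk Suc.prems(2)])
  note c [simp] = kspace_closed[OF Suc.prems(1)] kspace_closed[OF hk] kspace_closed[OF dhk]
  let ?g = "\<lambda>S a T. f S a T \<ominus> kd \<tau> ?h S a T"
  have gz: "?g S a T = \<zero>" if "f S a T = kd \<tau> ?h S a T" for S a T
    unfolding that by (simp add: minus_eq r_neg)
  have g: "kspace n j m ?g"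
    unfolding kspace_def
  proof (intro conjI allI impI)
    show "?g S a T \<in> carrier R" for S a T by simp
    fix S a T assume nz: "?g S a T \<noteq> \<zero>"
    have out: "S \<subseteq> {1..Suc j} \<and> set_mset a \<subseteq> {1..Suc j} \<and> size a = m \<and> T \<subseteq> {1..n}"
      using nz gz kspace_zero[OF Suc.prems(1)] kspace_zero[OF dhk] by metis
    moreover have "\<not> (Suc j \<in> S \<or> Suc j \<in># a)"
      using nz gz contract_homotopy[OF Suc.prems] out by metis
    ultimately show "S \<subseteq> {1..j}" "set_mset a \<subseteq> {1..j}" "size a = m" "T \<subseteq> {1..n}"
      by (auto simp: le_Suc_eq)
  qed
  have dd: "kd \<tau> (kd \<tau> ?h) S a T = \<zero>" for S a T
  proof (cases m)
    case 0
    then show ?thesis using kd_bottom dhk by simp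
  next
    case (Suc m')
    show ?thesis by (rule kd_kd[OF hk[unfolded Suc] Suc.prems(2)]) (rule anti)
  qed
  have "kd \<tau> ?g S a T = \<zero>" for S a T
    using kd_diff[of f "kd \<tau> ?h" S a T] Suc.prems(3) dd
    by (simp add: minus_eq)
  then obtain y where y: "kspace n j (Suc m) y" "kspace n 0 m (\<lambda>S a T. ?g S a T \<ominus> kd \<tau> y S a T)"
    using Suc.IH[OF g] Suc.prems(2) by auto
  have y': "kspace n (Suc j) (Suc m) y" by (rule kspace_mono[OF y(1)]) simp
  note yc [simp] = kspace_closed[OF y']
  have ydc: "kd \<tau> y S a T \<in> carrier R" for S a T by (rule kd_closed) simp
  \<comment> \<open>The sum of the two primitives is written as a difference so that
    \<open>kd_diff\<close> computes its boundary.\<close>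
  let ?y = "\<lambda>S a T. ?h S a T \<ominus> (\<ominus> y S a T)"
  have m0: "\<zero> \<ominus> \<ominus> \<zero> = \<zero>" by (simp add: minus_eq)
  have "kspace n (Suc j) (Suc m) ?y"
    unfolding kspace_def
  proof (intro conjI allI impI)
    fix S a T assume "?y S a T \<noteq> \<zero>"
    then have "?h S a T \<noteq> \<zero> \<or> y S a T \<noteq> \<zero>" using m0 by auto
    then show "S \<subseteq> {1..Suc j}" "set_mset a \<subseteq> {1..Suc j}" "size a = Suc m" "T \<subseteq> {1..n}"
      using kspace_zero[OF hk] kspace_zero[OF y'] by metis+
  qed simp
  moreover have "kd \<tau> ?y S a T = kd \<tau> ?h S a T \<oplus> kd \<tau> y S a T" for S a T
  proof -
    have z: "kd \<tau> (\<lambda>_ _ _. \<zero>) S a T = \<zero>" using \<tau> by (simp add: kd_def)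
    have "kd \<tau> (\<lambda>S a T. \<ominus> y S a T) S a T = \<ominus> kd \<tau> y S a T"
      using kd_diff[of "\<lambda>_ _ _. \<zero>" y S a T] ydc z by (simp add: minus_eq)
    then show ?thesis
      using kd_diff[of ?h "\<lambda>S a T. \<ominus> y S a T" S a T] ydc by (simp add: minus_eq)
  qed
  then have "f S a T \<ominus> kd \<tau> ?y S a T = ?g S a T \<ominus> kd \<tau> y S a T" for S a T
    using ydc by (simp add: minus_eq minus_add a_assoc)
  ultimately show ?case using y(2) by (intro exI[of _ ?y]) simp
qed

end

end

section \<open>The Koszul resolution\<close>

lemma (in enveloping) pure_hom_l: "y \<in> carrier A \<Longrightarrow> (\<lambda>x. pure x y) \<in> module_hom K A Ae"
  unfolding enveloping_algebra_def E.module_hom_TA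
  by (rule module_homI)
    (auto simp: E.T.pure_closed E.T.pure_relations(1,4) AM.smult_closed)

lemma (in enveloping) pure_hom_r: "x \<in> carrier A \<Longrightarrow> (\<lambda>y. pure x y) \<in> module_hom K A Ae"
  unfolding enveloping_algebra_def E.module_hom_TA
proof (rule module_homI)
  assume x: "x \<in> carrier A"
  show "pure x (c \<odot> y) = c \<odot>\<^bsub>E.T.T\<^esub> pure x y" if "c \<in> carrier K" "y \<in> carrier A" for c y
    using E.T.pure_relations(3)[of c x y] E.T.pure_relations(4)[of c x y] that x by simp
  show "pure x (y \<oplus> y') = pure x y \<oplus>\<^bsub>E.T.T\<^esub> pure x y'" if "y \<in> carrier A" "y' \<in> carrier A" for y y'
    using E.T.pure_relations(2)[of x y y'] that x by simp
qed (auto simp: E.T.pure_closed)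

sublocale exterior \<subseteq> Ae: k_algebra K "enveloping_algebra K (exterior_algebra K n)"
  by (rule L.Ae_k_algebra)

lemma (in abelian_monoid) finsum_zeroI: "(\<And>i. i \<in> A \<Longrightarrow> f i = \<zero>) \<Longrightarrow> finsum G f A = \<zero>"
  by (induction A rule: infinite_finite_induct) (auto simp: finsum_insert Pi_iff)

lemma (in abelian_group) diff_eq_zeroD:
  assumes "x \<in> carrier G" "y \<in> carrier G" "x \<ominus> y = \<zero>" shows "x = y"
proof -
  have "x = (x \<ominus> y) \<oplus> y" using assms(1,2) by (simp add: minus_eq a_assoc l_neg)
  then show ?thesis using assms by simp
qed

text \<open>\<open>projective_module\<close> wants a basis in the element type of the module itself,
  where \<open>S\<close> does not live. The free module on the carrier is taken instead, and each
  basis vector is sent to the generator indexed by it.\<close>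

lemma free_module_projective:
  assumes "ring R" shows "projective_module R (free_module R S)"
proof -
  interpret ring R by fact
  let ?F = "free_module R S"
  interpret F: left_module R ?F by (rule free_module_left_module)
  interpret FF: left_module R "free_module R (carrier ?F)" by (rule free_module_left_module)
  note [simp del] = free_module_simps
  let ?q = "free_ext R ?F (\<lambda>x. x)"
  let ?i = "free_ext R (free_module R (carrier ?F)) (\<lambda>s. basis_elt R (basis_elt R s))"
  have q: "?q \<in> module_hom R (free_module R (carrier ?F)) ?F" by (rule F.free_ext_hom) auto
  have i: "?i \<in> module_hom R ?F (free_module R (carrier ?F))" by (rule FF.free_ext_hom) auto
  have "?q (?i x) = x" if x: "x \<in> carrier ?F" for x
  proof (rule free_hom_eqI[OF F.left_module_axioms module_hom_comp[OF i q] _ x])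
    show "(\<lambda>x. x) \<in> module_hom R ?F ?F" by (rule module_homI) simp_all
    fix s assume s: "s \<in> S"
    have "?i (basis_elt R s) = basis_elt R (basis_elt R s)"
      by (rule FF.free_ext_basis) (use s in auto)
    then show "?q (?i (basis_elt R s)) = basis_elt R s"
      using F.free_ext_basis[of "\<lambda>x. x" "basis_elt R s"] s by auto
  qed
  then show ?thesis unfolding projective_module_def using F.left_module_axioms i q by blast
qed

text \<open>The element types of \<Lambda> and of its enveloping algebra, and the index type of the
  bases that \<open>some_projective_resolution\<close> prescribes.\<close>

type_synonym 'k ext = "(nat list \<Rightarrow> 'k) set"
type_synonym 'k env = "('k ext \<times> 'k ext \<Rightarrow> 'k) set"
type_synonym 'k res = "'k env list \<times> 'k ext"

lemma free_module_closed: "f \<in> carrier (free_module R S) \<Longrightarrow> f s \<in> carrier R"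
  by (simp del: split_paired_All)

lemma free_module_outside: "f \<in> carrier (free_module R S) \<Longrightarrow> s \<notin> S \<Longrightarrow> f s = \<zero>\<^bsub>R\<^esub>"
  by (auto simp del: split_paired_All)

lemma free_module_finiteI:
  "finite S \<Longrightarrow> (\<And>s. f s \<in> carrier R) \<Longrightarrow> (\<And>s. s \<notin> S \<Longrightarrow> f s = \<zero>\<^bsub>R\<^esub>) \<Longrightarrow> f \<in> carrier (free_module R S)"
  unfolding free_module_simps mem_Collect_eq by (intro conjI allI; (blast intro: finite_subset)?)

text \<open>
  The definition of \<open>Tor\<close> only considers resolutions whose elements have type \<open>'r list \<times> 'n \<Rightarrow> 'r\<close>. The
  length of a list over an arbitrary type has room for the countably many multisets.
\<close>

definition enc :: "nat multiset \<Rightarrow> 'b list \<times> 'c" where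
  "enc a = (replicate (to_nat (sorted_list_of_multiset a)) undefined, undefined)"

definition dec :: "'b list \<times> 'c \<Rightarrow> nat multiset" where
  "dec = inv_into UNIV enc"

lemma dec_enc [simp]: "dec (enc a) = a"
proof -
  have "inj (enc :: nat multiset \<Rightarrow> 'a list \<times> 'b)"
  proof (rule injI)
    fix a b :: "nat multiset" assume "(enc a :: 'a list \<times> 'b) = enc b"
    then have "sorted_list_of_multiset a = sorted_list_of_multiset b"
      unfolding enc_def by (metis Pair_inject inj_to_nat injD length_replicate)
    then show "a = b" by (metis mset_sorted_list_of_multiset)
  qed
  then show ?thesis unfolding dec_def by (rule inv_f_f)
qed

context exterior
begin

section \<open>Coordinates on the enveloping algebra\<close>

abbreviation "V2 \<equiv> free_module K (Pow {1..n} \<times> Pow {1..n})"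
abbreviation "MI \<equiv> multisets_of_size {1..n}"

lemma V2_module: "left_module K V2"
  by (rule K.free_module_left_module)

lemma coord_closed [simp]: "x \<in> carrier \<Lambda> \<Longrightarrow> coord x S \<in> carrier K"
  using module_hom_in[OF coord_hom] by simp

lemma coord_outside: "x \<in> carrier \<Lambda> \<Longrightarrow> \<not> S \<subseteq> {1..n} \<Longrightarrow> coord x S = \<zero>"
  using module_hom_in[OF coord_hom, of x] by auto

lemma coord_add: "x \<in> carrier \<Lambda> \<Longrightarrow> y \<in> carrier \<Lambda> \<Longrightarrow> coord (x \<oplus>\<^bsub>\<Lambda>\<^esub> y) S = coord x S \<oplus> coord y S"
  by (simp add: module_hom_add[OF coord_hom])

lemma coord_smult: "c \<in> carrier K \<Longrightarrow> x \<in> carrier \<Lambda> \<Longrightarrow> coord (c \<odot>\<^bsub>\<Lambda>\<^esub> x) S = c \<otimes> coord x S"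
  by (simp add: module_hom_smult[OF coord_hom])

text \<open>These are the coordinates in the basis \<open>e S \<otimes> e T\<close>, obtained as the
  tensor product of the coordinate maps of the two factors.\<close>

definition rho :: "'k env \<Rightarrow> nat set \<times> nat set \<Rightarrow> 'k" where
  "rho = L.E.T.lift V2 (\<lambda>u v p. coord u (fst p) \<otimes> coord v (snd p))"

lemma rho:
  shows rho_hom: "rho \<in> module_hom K L.Ae V2"
    and rho_pure: "u \<in> carrier \<Lambda> \<Longrightarrow> v \<in> carrier \<Lambda> \<Longrightarrow> rho (L.pure u v) (S, T) = coord u S \<otimes> coord v T"
proof -
  have c: "(\<lambda>p. coord u (fst p) \<otimes> coord v (snd p)) \<in> carrier V2"
    if "u \<in> carrier \<Lambda>" "v \<in> carrier \<Lambda>" for u v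
  proof (rule free_module_finiteI)
    fix p assume "p \<notin> Pow {1..n} \<times> Pow {1..n}"
    then have "coord u (fst p) = \<zero> \<or> coord v (snd p) = \<zero>"
      using coord_outside that by (cases p) auto
    then show "coord u (fst p) \<otimes> coord v (snd p) = \<zero>" using that by auto
  qed (use that in auto)
  have l: "(\<lambda>u p. coord u (fst p) \<otimes> coord v (snd p)) \<in> module_hom K \<Lambda> V2" if "v \<in> carrier \<Lambda>" for v
    by (rule module_homI) (use c that in \<open>auto simp: coord_add coord_smult K.l_distr K.m_assoc\<close>)
  have r: "(\<lambda>v p. coord u (fst p) \<otimes> coord v (snd p)) \<in> module_hom K \<Lambda> V2" if "u \<in> carrier \<Lambda>" for u
    by (rule module_homI) (use c that in \<open>auto simp: coord_add coord_smult K.r_distr K.m_lcomm\<close>)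
  show "rho \<in> module_hom K L.Ae V2"
    unfolding rho_def by (rule L.Ae_lift(1)[OF V2_module c l r])
  show "rho (L.pure u v) (S, T) = coord u S \<otimes> coord v T" if "u \<in> carrier \<Lambda>" "v \<in> carrier \<Lambda>"
  proof -
    have "rho (L.pure u v) = (\<lambda>p. coord u (fst p) \<otimes> coord v (snd p))"
      unfolding rho_def by (rule L.Ae_lift(2)[OF V2_module c l r that])
    then show ?thesis by simp
  qed
qed

lemma Ae_basis_eqI:
  assumes N: "left_module K N" and f: "f \<in> module_hom K L.Ae N" and g: "g \<in> module_hom K L.Ae N"
    and X: "X \<in> carrier L.Ae"
    and eq: "\<And>S T. S \<subseteq> {1..n} \<Longrightarrow> T \<subseteq> {1..n} \<Longrightarrow> f (L.pure (e S) (e T)) = g (L.pure (e S) (e T))"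
  shows "f X = g X"
proof (rule L.Ae_hom_eqI[OF N f g X])
  fix u v assume u: "u \<in> carrier \<Lambda>" and v: "v \<in> carrier \<Lambda>"
  show "f (L.pure u v) = g (L.pure u v)"
  proof (rule \<Lambda>_hom_eqI[OF N module_hom_comp[OF L.pure_hom_l[OF v] f] module_hom_comp[OF L.pure_hom_l[OF v] g] u])
    fix S assume S: "S \<subseteq> {1..n}"
    note eS = e_closed[OF S]
    show "f (L.pure (e S) v) = g (L.pure (e S) v)"
      by (rule \<Lambda>_hom_eqI[OF N module_hom_comp[OF L.pure_hom_r[OF eS] f] module_hom_comp[OF L.pure_hom_r[OF eS] g] v])
        (rule eq[OF S])
  qed
qed

abbreviation "ee \<equiv> \<lambda>(S, T). L.pure (e S) (e T)"

lemma ee_closed: "ee \<in> Pow {1..n} \<times> Pow {1..n} \<rightarrow> carrier L.Ae"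
  by (auto intro!: L.Ae_pure_closed)

lemma rho_ee: "S \<subseteq> {1..n} \<Longrightarrow> T \<subseteq> {1..n} \<Longrightarrow> rho (L.pure (e S) (e T)) = basis_elt K (S, T)"
proof
  fix p assume ST: "S \<subseteq> {1..n}" "T \<subseteq> {1..n}"
  show "rho (L.pure (e S) (e T)) p = basis_elt K (S, T) p"
    using ST by (cases p) (simp add: rho_pure coord_e, auto simp: basis_elt_def)
qed

lemma ee_hom: "free_ext K L.Ae ee \<in> module_hom K V2 L.Ae"
  by (rule Ae.AM.free_ext_hom[OF ee_closed])

lemma ee_basis: "S \<subseteq> {1..n} \<Longrightarrow> T \<subseteq> {1..n} \<Longrightarrow> free_ext K L.Ae ee (basis_elt K (S, T)) = L.pure (e S) (e T)"
  by (subst Ae.AM.free_ext_basis) (auto intro!: L.Ae_pure_closed)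

text \<open>With \<open>rho_surj\<close> this makes \<open>rho\<close> and the expansion in the
  basis \<open>ee\<close> mutually inverse.\<close>

lemma rho_expand: "X \<in> carrier L.Ae \<Longrightarrow> free_ext K L.Ae ee (rho X) = X"
  by (rule Ae_basis_eqI[OF Ae.AM.left_module_axioms module_hom_comp[OF rho_hom ee_hom]])
    (auto simp: rho_ee ee_basis intro!: module_homI)

lemma rho_surj: "f \<in> carrier V2 \<Longrightarrow> rho (free_ext K L.Ae ee f) = f"
proof (rule free_hom_eqI[OF V2_module module_hom_comp[OF ee_hom rho_hom]])
  show "(\<lambda>x. x) \<in> module_hom K V2 V2" by (rule module_homI) auto
qed (auto simp: ee_basis rho_ee)

lemma rho_closed [simp]: "X \<in> carrier L.Ae \<Longrightarrow> rho X p \<in> carrier K"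
  by (rule free_module_closed[OF module_hom_in[OF rho_hom]])

lemma rho_outside: "X \<in> carrier L.Ae \<Longrightarrow> \<not> (S \<subseteq> {1..n} \<and> T \<subseteq> {1..n}) \<Longrightarrow> rho X (S, T) = \<zero>"
  using free_module_outside[OF module_hom_in[OF rho_hom], of X "(S, T)"] by auto

section \<open>The Koszul differential over the enveloping algebra\<close>

definition Xg :: "nat \<Rightarrow> 'k env" where
  "Xg i = L.pure (word [i]) \<one>\<^bsub>\<Lambda>\<^esub>"

definition Yg :: "nat \<Rightarrow> 'k env" where
  "Yg i = L.pure \<one>\<^bsub>\<Lambda>\<^esub> (word [i])"

lemma XY_closed [simp]: "i \<in> {1..n} \<Longrightarrow> Xg i \<in> carrier L.Ae" "i \<in> {1..n} \<Longrightarrow> Yg i \<in> carrier L.Ae"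
  by (simp_all add: Xg_def Yg_def L.Ae_pure_closed)

text \<open>The second factor carries the opposite multiplication. So \<open>Yg i\<close> on the
  right places \<open>word [i]\<close> to the left of the second component, which accounts for the
  sign \<open>\<tau>L\<close>.\<close>

lemma rho_mult:
  assumes i: "i \<in> {1..n}" and X: "X \<in> carrier L.Ae"
  shows rho_X: "rho (X \<otimes>\<^bsub>L.Ae\<^esub> Xg i) (S, T) = (if i \<in> S then K.\<sigma> S i \<otimes> rho X (S - {i}, T) else \<zero>)"
    and rho_Y: "rho (X \<otimes>\<^bsub>L.Ae\<^esub> Yg i) (S, T) = (if i \<in> T then K.\<tau>L T i \<otimes> rho X (S, T - {i}) else \<zero>)"
proof -
  note w = word_closed[of "[i]"]
  let ?o = "\<lambda>f p. if i \<in> fst p then K.\<sigma> (fst p) i \<otimes> f (fst p - {i}, snd p) else \<zero>"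
  have oh: "?o \<in> module_hom K V2 V2" by (rule K.reindex_hom) (use i in auto)
  have "rho (X \<otimes>\<^bsub>L.Ae\<^esub> Xg i) = ?o (rho X)"
  proof (rule L.Ae_hom_eqI[OF V2_module module_hom_comp[OF Ae.mult_hom_l[OF XY_closed(1)[OF i]] rho_hom]
        module_hom_comp[OF rho_hom oh] X])
    fix u v assume uv: "u \<in> carrier \<Lambda>" "v \<in> carrier \<Lambda>"
    show "rho (L.pure u v \<otimes>\<^bsub>L.Ae\<^esub> Xg i) = ?o (rho (L.pure u v))"
    proof
      fix p :: "nat set \<times> nat set" obtain S T where p: "p = (S, T)" by (cases p)
      show "rho (L.pure u v \<otimes>\<^bsub>L.Ae\<^esub> Xg i) p = ?o (rho (L.pure u v)) p"
        using uv i w unfolding Xg_def p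
        by (simp add: L.Ae_mult rho_pure coord_mult_r K.m_assoc K.\<sigma>_def)
    qed
  qed
  then show "rho (X \<otimes>\<^bsub>L.Ae\<^esub> Xg i) (S, T) = (if i \<in> S then K.\<sigma> S i \<otimes> rho X (S - {i}, T) else \<zero>)" by simp
  let ?o = "\<lambda>f p. if i \<in> snd p then K.\<tau>L (snd p) i \<otimes> f (fst p, snd p - {i}) else \<zero>"
  have oh: "?o \<in> module_hom K V2 V2" by (rule K.reindex_hom) (use i in auto)
  have "rho (X \<otimes>\<^bsub>L.Ae\<^esub> Yg i) = ?o (rho X)"
  proof (rule L.Ae_hom_eqI[OF V2_module module_hom_comp[OF Ae.mult_hom_l[OF XY_closed(2)[OF i]] rho_hom]
        module_hom_comp[OF rho_hom oh] X])
    fix u v assume uv: "u \<in> carrier \<Lambda>" "v \<in> carrier \<Lambda>"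
    show "rho (L.pure u v \<otimes>\<^bsub>L.Ae\<^esub> Yg i) = ?o (rho (L.pure u v))"
    proof
      fix p :: "nat set \<times> nat set" obtain S T where p: "p = (S, T)" by (cases p)
      show "rho (L.pure u v \<otimes>\<^bsub>L.Ae\<^esub> Yg i) p = ?o (rho (L.pure u v)) p"
        using uv i w unfolding Yg_def p
        by (simp add: L.Ae_mult rho_pure coord_mult_l K.m_lcomm K.\<tau>L_def)
    qed
  qed
  then show "rho (X \<otimes>\<^bsub>L.Ae\<^esub> Yg i) (S, T) = (if i \<in> T then K.\<tau>L T i \<otimes> rho X (S, T - {i}) else \<zero>)" by simp
qed

text \<open>The coefficient of the differential from degree \<open>Suc m\<close> to degree
  \<open>m\<close>. For \<open>m = 0\<close> it is \<open>x_i \<otimes> 1 - 1 \<otimes> x_i\<close>,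
  which multiplication kills; the sign alternates with \<open>m\<close> to make the differential
  square to zero.\<close>

definition Zg :: "nat \<Rightarrow> nat \<Rightarrow> 'k env" where
  "Zg m i = Xg i \<oplus>\<^bsub>L.Ae\<^esub> sign K (Suc m) \<odot>\<^bsub>L.Ae\<^esub> Yg i"

lemma Zg_closed [simp]: "i \<in> {1..n} \<Longrightarrow> Zg m i \<in> carrier L.Ae"
  unfolding Zg_def by (intro Ae.A.a_closed Ae.AM.smult_closed XY_closed) auto

lemma mult_Zg: "i \<in> {1..n} \<Longrightarrow> X \<in> carrier L.Ae \<Longrightarrow>
    X \<otimes>\<^bsub>L.Ae\<^esub> Zg m i = X \<otimes>\<^bsub>L.Ae\<^esub> Xg i \<oplus>\<^bsub>L.Ae\<^esub> sign K (Suc m) \<odot>\<^bsub>L.Ae\<^esub> (X \<otimes>\<^bsub>L.Ae\<^esub> Yg i)"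
  unfolding Zg_def by (simp add: Ae.A.r_distr Ae.AM.smult_closed Ae.smult_mult_r)

abbreviation "Q \<equiv> \<lambda>m. free_module L.Ae (enc ` MI m :: 'k res set)"

text \<open>Dual to the formula on basis elements: the coefficient at a multiset collects
  contributions from all multisets with one more element. Multiplying by \<open>Zg\<close> on the
  right keeps the map linear for the left action.\<close>

definition kz :: "nat \<Rightarrow> ('k res \<Rightarrow> 'k env) \<Rightarrow> 'k res \<Rightarrow> 'k env" where
  "kz m g t = (if t \<in> enc ` MI m
    then \<Oplus>\<^bsub>L.Ae\<^esub>i\<in>{1..n}. g (enc (add_mset i (dec t))) \<otimes>\<^bsub>L.Ae\<^esub> Zg m i else \<zero>\<^bsub>L.Ae\<^esub>)"

lemma Q_module: "left_module L.Ae (Q m)"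
  by (rule Ae.A.free_module_left_module)

lemma Q_closed [simp]: "g \<in> carrier (Q m) \<Longrightarrow> g t \<in> carrier L.Ae"
  by (rule free_module_closed)

lemma Q_projective: "projective_module L.Ae (Q m)"
  by (rule free_module_projective[OF Ae.A.ring_axioms])

lemma finite_MI [simp]: "finite (MI m)"
  by blast

lemma kz_hom: "kz m \<in> module_hom L.Ae (Q (Suc m)) (Q m)"
proof (rule module_homI)
  fix g assume g: "g \<in> carrier (Q (Suc m))"
  note gc = Q_closed[OF g]
  have gz: "g t \<otimes>\<^bsub>L.Ae\<^esub> Zg m i \<in> carrier L.Ae" if "i \<in> {1..n}" for t i
    using that by (intro Ae.A.m_closed gc Zg_closed)
  have "kz m g t \<in> carrier L.Ae" for t
    unfolding kz_def
    by (split if_split) (intro conjI impI Ae.A.finsum_closed Ae.A.zero_closed Pi_I gz, assumption)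
  then show "kz m g \<in> carrier (Q m)"
    by (intro free_module_finiteI) (auto simp: kz_def)
  fix r assume r: "r \<in> carrier L.Ae"
  show "kz m (r \<odot>\<^bsub>Q (Suc m)\<^esub> g) = r \<odot>\<^bsub>Q m\<^esub> kz m g"
  proof
    fix t :: "'k res"
    have "(\<Oplus>\<^bsub>L.Ae\<^esub>i\<in>{1..n}. r \<otimes>\<^bsub>L.Ae\<^esub> g (enc (add_mset i (dec t))) \<otimes>\<^bsub>L.Ae\<^esub> Zg m i) =
        (\<Oplus>\<^bsub>L.Ae\<^esub>i\<in>{1..n}. r \<otimes>\<^bsub>L.Ae\<^esub> (g (enc (add_mset i (dec t))) \<otimes>\<^bsub>L.Ae\<^esub> Zg m i))"
      by (rule Ae.A.finsum_cong'[OF refl])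
        (intro Pi_I Ae.A.m_closed r gc Zg_closed, assumption, rule Ae.A.m_assoc[OF r gc Zg_closed])
    also have "\<dots> = r \<otimes>\<^bsub>L.Ae\<^esub> (\<Oplus>\<^bsub>L.Ae\<^esub>i\<in>{1..n}. g (enc (add_mset i (dec t))) \<otimes>\<^bsub>L.Ae\<^esub> Zg m i)"
      by (rule Ae.A.finsum_rdistr[symmetric]) (simp, rule r, intro Pi_I gz)
    finally show "kz m (r \<odot>\<^bsub>Q (Suc m)\<^esub> g) t = (r \<odot>\<^bsub>Q m\<^esub> kz m g) t"
      using r by (simp add: kz_def)
  qed
next
  fix g h assume g: "g \<in> carrier (Q (Suc m))" and h: "h \<in> carrier (Q (Suc m))"
  note gc = Q_closed[OF g] Q_closed[OF h]
  have gz: "g t \<otimes>\<^bsub>L.Ae\<^esub> Zg m i \<in> carrier L.Ae" "h t \<otimes>\<^bsub>L.Ae\<^esub> Zg m i \<in> carrier L.Ae" if "i \<in> {1..n}" for t i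
    using that by (intro Ae.A.m_closed gc Zg_closed, assumption)+
  show "kz m (g \<oplus>\<^bsub>Q (Suc m)\<^esub> h) = kz m g \<oplus>\<^bsub>Q m\<^esub> kz m h"
  proof
    fix t :: "'k res"
    have "(\<Oplus>\<^bsub>L.Ae\<^esub>i\<in>{1..n}. (g (enc (add_mset i (dec t))) \<oplus>\<^bsub>L.Ae\<^esub> h (enc (add_mset i (dec t)))) \<otimes>\<^bsub>L.Ae\<^esub> Zg m i) =
        (\<Oplus>\<^bsub>L.Ae\<^esub>i\<in>{1..n}. g (enc (add_mset i (dec t))) \<otimes>\<^bsub>L.Ae\<^esub> Zg m i \<oplus>\<^bsub>L.Ae\<^esub> h (enc (add_mset i (dec t))) \<otimes>\<^bsub>L.Ae\<^esub> Zg m i)"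
      by (rule Ae.A.finsum_cong'[OF refl])
        (intro Pi_I Ae.A.a_closed gz, assumption, assumption, rule Ae.A.l_distr[OF gc Zg_closed])
    also have "\<dots> = (\<Oplus>\<^bsub>L.Ae\<^esub>i\<in>{1..n}. g (enc (add_mset i (dec t))) \<otimes>\<^bsub>L.Ae\<^esub> Zg m i) \<oplus>\<^bsub>L.Ae\<^esub>
        (\<Oplus>\<^bsub>L.Ae\<^esub>i\<in>{1..n}. h (enc (add_mset i (dec t))) \<otimes>\<^bsub>L.Ae\<^esub> Zg m i)"
      by (rule Ae.A.finsum_addf) (intro Pi_I gz, assumption)+
    finally show "kz m (g \<oplus>\<^bsub>Q (Suc m)\<^esub> h) t = (kz m g \<oplus>\<^bsub>Q m\<^esub> kz m h) t"
      by (simp add: kz_def)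
  qed
qed

text \<open>Reads a chain as a family of scalars. By \<open>theta_inj\<close> and
  \<open>theta_surj\<close> nothing is lost, so exactness can be settled in
  \<open>kspace\<close>.\<close>

definition theta :: "nat \<Rightarrow> ('k res \<Rightarrow> 'k env) \<Rightarrow> nat set \<Rightarrow> nat multiset \<Rightarrow> nat set \<Rightarrow> 'k" where
  "theta m g S a T = (if a \<in> MI m then rho (g (enc a)) (S, T) else \<zero>)"

lemma theta_kspace:
  assumes g: "g \<in> carrier (Q m)" shows "K.kspace n n m (theta m g)"
proof -
  have "S \<subseteq> {1..n} \<and> set_mset a \<subseteq> {1..n} \<and> size a = m \<and> T \<subseteq> {1..n}"
    if nz: "theta m g S a T \<noteq> \<zero>" for S a T
  proof -
    have "a \<in> MI m" "rho (g (enc a)) (S, T) \<noteq> \<zero>" using nz by (auto simp: theta_def split: if_splits)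
    moreover from this have "S \<subseteq> {1..n} \<and> T \<subseteq> {1..n}"
      using rho_outside[OF Q_closed[OF g, of "enc a"], of S T] by blast
    ultimately show ?thesis by (simp add: multisets_of_size_def)
  qed
  moreover have "theta m g S a T \<in> carrier K" for S a T
    unfolding theta_def by (split if_split) (intro conjI impI rho_closed[OF Q_closed[OF g]] K.zero_closed)
  ultimately show ?thesis unfolding K.kspace_def by blast
qed

lemma theta_diff:
  assumes "g \<in> carrier (Q m)" "h \<in> carrier (Q m)"
  shows "theta m (g \<ominus>\<^bsub>Q m\<^esub> h) S a T = theta m g S a T \<ominus> theta m h S a T"
proof -
  interpret Qm: left_module L.Ae "Q m" by (rule Q_module)
  interpret r: left_module_hom K L.Ae V2 rho
    by (rule left_module_homI[OF Ae.AM.left_module_axioms V2_module rho_hom])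
  let ?d = "g \<ominus>\<^bsub>Q m\<^esub> h"
  have d: "?d \<in> carrier (Q m)" by (rule Qm.M.minus_closed[OF assms])
  \<comment> \<open>Addition in a free module is pointwise by definition, subtraction is not. The
    identity is therefore proved for \<open>g\<close> as the sum of the difference and
    \<open>h\<close>.\<close>
  have "g = ?d \<oplus>\<^bsub>Q m\<^esub> h"
    using assms by (simp add: Qm.M.minus_eq Qm.M.a_assoc Qm.M.l_neg del: free_module_simps)
  then have "g t = (?d \<oplus>\<^bsub>Q m\<^esub> h) t" for t by (rule fun_cong)
  then have gd: "g t = ?d t \<oplus>\<^bsub>L.Ae\<^esub> h t" for t by (simp only: free_module_simps(3))
  have rg: "rho (g t) p = rho (?d t) p \<oplus> rho (h t) p" for t p
    unfolding gd[of t] r.add[OF Q_closed[OF d] Q_closed[OF assms(2)]] by (simp only: free_module_simps)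
  have alg: "p = (p \<oplus> q) \<ominus> q" if "p \<in> carrier K" "q \<in> carrier K" for p q
    using that by (simp add: K.minus_eq K.a_assoc K.r_neg)
  show ?thesis
  proof (cases "a \<in> MI m")
    case True
    show ?thesis
      unfolding theta_def if_P[OF True] rg[of "enc a" "(S, T)"]
      by (rule alg[OF rho_closed[OF Q_closed[OF d]] rho_closed[OF Q_closed[OF assms(2)]]])
  next
    case False
    show ?thesis unfolding theta_def if_not_P[OF False] by (simp add: K.minus_eq)
  qed
qed

lemma theta_inj:
  assumes g: "g \<in> carrier (Q m)" and z: "\<And>S a T. theta m g S a T = \<zero>"
  shows "g = \<zero>\<^bsub>Q m\<^esub>"
proof -
  have "g t = \<zero>\<^bsub>L.Ae\<^esub>" for t
  proof (cases "t \<in> enc ` MI m")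
    case True
    then obtain a where a: "t = enc a" "a \<in> MI m" by blast
    have "rho (g t) p = \<zero>" for p using z[of "fst p" a "snd p"] a by (simp add: theta_def)
    then have "rho (g t) = \<zero>\<^bsub>V2\<^esub>" unfolding free_module_simps by (rule ext)
    then have "g t = free_ext K L.Ae ee \<zero>\<^bsub>V2\<^esub>"
      using rho_expand[OF Q_closed[OF g], of t] by simp
    then show ?thesis
      using left_module_hom.zero[OF left_module_homI[OF V2_module Ae.AM.left_module_axioms ee_hom]] by simp
  next
    case False
    then show ?thesis by (rule free_module_outside[OF g])
  qed
  then show ?thesis unfolding free_module_simps by (rule ext)
qed

lemma theta_surj:
  assumes f: "K.kspace n n m f"
  obtains g where "g \<in> carrier (Q m)" "theta m g = f"
proof
  define g :: "'k res \<Rightarrow>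
      'k env"
    where "g t = (if t \<in> enc ` MI m then free_ext K L.Ae ee (\<lambda>(S, T). f S (dec t) T) else \<zero>\<^bsub>L.Ae\<^esub>)" for t
  have fV: "(\<lambda>(S, T). f S a T) \<in> carrier V2" for a
  proof (rule free_module_finiteI)
    fix p :: "nat set \<times> nat set" obtain S T where p: "p = (S, T)" by (cases p)
    show "(case p of (S, T) \<Rightarrow> f S a T) \<in> carrier K" by (simp add: p K.kspace_closed[OF f])
    assume "p \<notin> Pow {1..n} \<times> Pow {1..n}"
    then have "f S a T = \<zero>" unfolding p by (intro K.kspace_zero[OF f]) blast
    then show "(case p of (S, T) \<Rightarrow> f S a T) = \<zero>" by (simp add: p)
  qed simp
  have "g t \<in> carrier L.Ae" for t
    unfolding g_def using module_hom_in[OF ee_hom fV] by auto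
  then show "g \<in> carrier (Q m)"
    by (intro free_module_finiteI) (auto simp: g_def)
  show "theta m g = f"
  proof (intro ext)
    fix S a T
    show "theta m g S a T = f S a T"
    proof (cases "a \<in> MI m")
      case True
      then show ?thesis by (simp add: theta_def g_def rho_surj[OF fV])
    next
      case False
      have "f S a T = \<zero>"
        by (rule K.kspace_zero[OF f]) (use False in \<open>auto simp: multisets_of_size_def\<close>)
      then show ?thesis using False by (simp add: theta_def)
    qed
  qed
qed

text \<open>By \<open>rho_X\<close> and \<open>rho_Y\<close>, a summand over \<open>{1..n}\<close>
  contributes only for \<open>i\<close> in \<open>S\<close> or in \<open>T\<close>. These are the
  two sums of \<open>kd\<close>.\<close>

lemma theta_kz:
  assumes g: "g \<in> carrier (Q (Suc m))"
  shows "theta m (kz m g) S a T = K.kd K.\<tau>L (theta (Suc m) g) S a T"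
proof (cases "a \<in> MI m \<and> S \<subseteq> {1..n} \<and> T \<subseteq> {1..n}")
  case False
  \<comment> \<open>Outside the index range both sides vanish, each by its own support
    condition.\<close>
  then have no: "\<not> (S \<subseteq> {1..n} \<and> set_mset a \<subseteq> {1..n} \<and> size a = m \<and> T \<subseteq> {1..n})"
    by (simp add: multisets_of_size_def)
  show ?thesis
    using K.kspace_zero[OF theta_kspace[OF module_hom_in[OF kz_hom g]] no]
      K.kspace_zero[OF K.kd_kspace[OF K.\<tau>L_closed theta_kspace[OF g] le_refl] no] by simp
next
  case True
  then have a: "a \<in> MI m" and S: "S \<subseteq> {1..n}" and T: "T \<subseteq> {1..n}" by auto
  have ai: "add_mset i a \<in> MI (Suc m)" if "i \<in> {1..n}" for i
    using a that by (auto simp: multisets_of_size_def)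
  have sa: "size a = m" using a by (simp add: multisets_of_size_def)
  let ?g = "\<lambda>i. g (enc (add_mset i a))" and ?s = "sign K (Suc m)"
  have gc [simp]: "?g i \<in> carrier L.Ae" for i by (rule Q_closed[OF g])
  interpret r: left_module_hom K L.Ae V2 rho
    by (rule left_module_homI[OF Ae.AM.left_module_axioms V2_module rho_hom])
  let ?A = "\<lambda>i. if i \<in> S then K.\<sigma> S i \<otimes> rho (?g i) (S - {i}, T) else \<zero>"
  let ?B = "\<lambda>i. if i \<in> T then K.\<tau>L T i \<otimes> rho (?g i) (S, T - {i}) else \<zero>"
  have AB: "?A i \<in> carrier K" "?B i \<in> carrier K" for i by auto
  have gZ: "?g i \<otimes>\<^bsub>L.Ae\<^esub> Zg m i \<in> carrier L.Ae" if "i \<in> {1..n}" for i using that by (intro Ae.A.m_closed) auto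
  have "theta m (kz m g) S a T = rho (\<Oplus>\<^bsub>L.Ae\<^esub>i\<in>{1..n}. ?g i \<otimes>\<^bsub>L.Ae\<^esub> Zg m i) (S, T)"
    using a by (simp add: theta_def kz_def)
  also have "\<dots> = (\<Oplus>i\<in>{1..n}. rho (?g i \<otimes>\<^bsub>L.Ae\<^esub> Zg m i) (S, T))"
    using gZ by (subst r.finsum, blast, subst free_module_finsum[OF K.ring_axioms])
      (auto intro!: module_hom_in[OF rho_hom] simp del: free_module_simps)
  also have "\<dots> = (\<Oplus>i\<in>{1..n}. ?A i \<oplus> ?s \<otimes> ?B i)"
  proof (intro K.finsum_cong')
    fix i assume i: "i \<in> {1..n}"
    have "rho (?g i \<otimes>\<^bsub>L.Ae\<^esub> Zg m i) =
        rho (?g i \<otimes>\<^bsub>L.Ae\<^esub> Xg i) \<oplus>\<^bsub>V2\<^esub> ?s \<odot>\<^bsub>V2\<^esub> rho (?g i \<otimes>\<^bsub>L.Ae\<^esub> Yg i)"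
      unfolding mult_Zg[OF i gc[of i]]
      using i by (subst r.add) (auto simp: r.smult intro!: Ae.A.m_closed Ae.AM.smult_closed XY_closed simp del: free_module_simps)
    then show "rho (?g i \<otimes>\<^bsub>L.Ae\<^esub> Zg m i) (S, T) = ?A i \<oplus> ?s \<otimes> ?B i"
      using rho_X[OF i gc[of i], of S T] rho_Y[OF i gc[of i], of S T] by simp
  qed auto
  also have "\<dots> = (\<Oplus>i\<in>{1..n}. ?A i) \<oplus> ?s \<otimes> (\<Oplus>i\<in>{1..n}. ?B i)"
    using AB by (simp add: K.finsum_addf K.finsum_rdistr Pi_iff)
  also have "(\<Oplus>i\<in>{1..n}. ?A i) = (\<Oplus>i\<in>S. ?A i)"
    by (rule finsum_mono_neutral[OF K.abelian_monoid_axioms, symmetric]) (use S in auto)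
  also have "(\<Oplus>i\<in>S. ?A i) = (\<Oplus>i\<in>S. K.\<sigma> S i \<otimes> theta (Suc m) g (S - {i}) (add_mset i a) T)"
    using S ai by (intro K.finsum_cong') (auto simp: theta_def)
  also have "(\<Oplus>i\<in>{1..n}. ?B i) = (\<Oplus>i\<in>T. ?B i)"
    by (rule finsum_mono_neutral[OF K.abelian_monoid_axioms, symmetric]) (use T in auto)
  also have "(\<Oplus>i\<in>T. ?B i) = (\<Oplus>i\<in>T. K.\<tau>L T i \<otimes> theta (Suc m) g S (add_mset i a) (T - {i}))"
    using T ai by (intro K.finsum_cong') (auto simp: theta_def)
  finally show ?thesis by (simp add: K.kd_def sa)
qed

section \<open>The augmentation and exactness of the resolution\<close>

definition aug :: "('k res \<Rightarrow> 'k env) \<Rightarrow> 'k ext" where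
  "aug g = g (enc {#}) \<odot>\<^bsub>L.Al\<^esub> \<one>\<^bsub>\<Lambda>\<^esub>"

lemma MI_0: "MI 0 = {{#}}"
  by (auto simp: multisets_of_size_def)

lemma aug_hom: "aug \<in> module_hom L.Ae (Q 0) L.Al"
proof (rule module_homI)
  note [simp del] = L.Al_simps(4)
  show "aug g \<in> carrier L.Al" if "g \<in> carrier (Q 0)" for g
    using module_hom_in[OF L.Al_hom Q_closed[OF that]] by (simp add: aug_def)
  show "aug (g \<oplus>\<^bsub>Q 0\<^esub> h) = aug g \<oplus>\<^bsub>L.Al\<^esub> aug h" if "g \<in> carrier (Q 0)" "h \<in> carrier (Q 0)" for g h
    using module_hom_add[OF L.Al_hom Q_closed[OF that(1)] Q_closed[OF that(2)]] by (simp add: aug_def)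
  show "aug (r \<odot>\<^bsub>Q 0\<^esub> g) = r \<odot>\<^bsub>L.Al\<^esub> aug g" if "r \<in> carrier L.Ae" "g \<in> carrier (Q 0)" for r g
    using L.Al_mult[OF that(1) Q_closed[OF that(2)]] by (simp add: aug_def)
qed

lemma aug_surj: "aug ` carrier (Q 0) = carrier L.Al"
proof
  show "aug ` carrier (Q 0) \<subseteq> carrier L.Al" using module_hom_in[OF aug_hom] by blast
  show "carrier L.Al \<subseteq> aug ` carrier (Q 0)"
  proof
    fix x assume "x \<in> carrier L.Al"
    then have x: "x \<in> carrier \<Lambda>" by simp
    let ?p = "L.pure x \<one>\<^bsub>\<Lambda>\<^esub>"
    have p: "?p \<in> carrier L.Ae" using x by (intro L.Ae_pure_closed) auto
    let ?g = "\<lambda>t. if t = enc {#} then ?p else \<zero>\<^bsub>L.Ae\<^esub>"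
    have gQ: "?g \<in> carrier (Q 0)"
      by (rule free_module_finiteI) (use p in \<open>simp_all add: MI_0\<close>)
    have ag: "aug ?g = x"
      using x L.Al_pure[of "\<one>\<^bsub>\<Lambda>\<^esub>" x "\<one>\<^bsub>\<Lambda>\<^esub>"] by (simp add: aug_def del: L.Al_simps(4))
    show "x \<in> aug ` carrier (Q 0)" using imageI[OF gQ, of aug] unfolding ag .
  qed
qed

text \<open>In degree 0 the sign in \<open>Zg\<close> is minus and both generators act on the unit
  as \<open>x_i\<close>, so \<open>Zg 0 i\<close> annihilates it.\<close>

lemma aug_kz:
  assumes g: "g \<in> carrier (Q 1)" shows "aug (kz 0 g) = \<zero>\<^bsub>\<Lambda>\<^esub>"
proof -
  note [simp del] = L.Al_simps(4)
  let ?g = "\<lambda>i. g (enc (add_mset i {#}))"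
  have gc [simp]: "?g i \<in> carrier L.Ae" for i by (rule Q_closed[OF g])
  interpret l: left_module_hom K L.Ae \<Lambda> "\<lambda>X. X \<odot>\<^bsub>L.Al\<^esub> \<one>\<^bsub>\<Lambda>\<^esub>"
    by (rule left_module_homI[OF Ae.AM.left_module_axioms L.AM.left_module_axioms L.Al_hom]) simp
  have gZ: "?g i \<otimes>\<^bsub>L.Ae\<^esub> Zg 0 i \<in> carrier L.Ae" if "i \<in> {1..n}" for i using that by (intro Ae.A.m_closed) auto
  have "Zg 0 i \<odot>\<^bsub>L.Al\<^esub> \<one>\<^bsub>\<Lambda>\<^esub> = \<zero>\<^bsub>\<Lambda>\<^esub>" if i: "i \<in> {1..n}" for i
  proof -
    have w: "word [i] \<in> carrier \<Lambda>" using i by simp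
    have "Zg 0 i \<odot>\<^bsub>L.Al\<^esub> \<one>\<^bsub>\<Lambda>\<^esub> = Xg i \<odot>\<^bsub>L.Al\<^esub> \<one>\<^bsub>\<Lambda>\<^esub> \<oplus>\<^bsub>\<Lambda>\<^esub> sign K (Suc 0) \<odot>\<^bsub>\<Lambda>\<^esub> (Yg i \<odot>\<^bsub>L.Al\<^esub> \<one>\<^bsub>\<Lambda>\<^esub>)"
      unfolding Zg_def using i by (subst l.add) (auto simp: l.smult intro!: Ae.AM.smult_closed XY_closed)
    moreover have "Xg i \<odot>\<^bsub>L.Al\<^esub> \<one>\<^bsub>\<Lambda>\<^esub> = word [i]" "Yg i \<odot>\<^bsub>L.Al\<^esub> \<one>\<^bsub>\<Lambda>\<^esub> = word [i]"
      unfolding Xg_def Yg_def using w by (simp_all add: L.Al_pure)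
    ultimately show ?thesis
      using w by (simp add: K.sign_Suc L.AM.smult_l_minus L.AM.smult_one L.A.r_neg)
  qed
  then have "(?g i \<otimes>\<^bsub>L.Ae\<^esub> Zg 0 i) \<odot>\<^bsub>L.Al\<^esub> \<one>\<^bsub>\<Lambda>\<^esub> = \<zero>\<^bsub>\<Lambda>\<^esub>" if "i \<in> {1..n}" for i
    using that L.Al_mult[OF gc Zg_closed[OF that], of "\<one>\<^bsub>\<Lambda>\<^esub>"]
      left_module.smult_r_null[OF L.Al_left_module gc] by simp
  then have "(\<Oplus>\<^bsub>\<Lambda>\<^esub>i\<in>{1..n}. (?g i \<otimes>\<^bsub>L.Ae\<^esub> Zg 0 i) \<odot>\<^bsub>L.Al\<^esub> \<one>\<^bsub>\<Lambda>\<^esub>) = \<zero>\<^bsub>\<Lambda>\<^esub>"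
    by (rule L.A.finsum_zeroI)
  then show ?thesis
    using gZ by (simp add: aug_def kz_def MI_0 l.finsum Pi_iff)
qed

text \<open>An element supported on \<open>S = {}\<close> is a combination of the
  \<open>1 \<otimes> e T\<close>, and it acts on the unit as the same combination of the
  \<open>e T\<close>. Hence the augmentation loses nothing on such elements.\<close>

lemma coord_act_one:
  assumes X: "X \<in> carrier L.Ae" and sup: "\<And>S T. S \<noteq> {} \<Longrightarrow> rho X (S, T) = \<zero>" and T: "T \<subseteq> {1..n}"
  shows "coord (X \<odot>\<^bsub>L.Al\<^esub> \<one>\<^bsub>\<Lambda>\<^esub>) T = rho X ({}, T)"
proof -
  note [simp del] = L.Al_simps(4)
  note lh = L.Al_hom[OF L.A.one_closed]
  interpret V: left_module K V by (rule V_module)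
  let ?p = "\<lambda>(S, T). coord (e S \<otimes>\<^bsub>\<Lambda>\<^esub> e T)"
  have pc: "?p \<in> Pow {1..n} \<times> Pow {1..n} \<rightarrow> carrier V"
    by (auto intro!: module_hom_in[OF coord_hom] simp del: free_module_simps)
  have "coord (X \<odot>\<^bsub>L.Al\<^esub> \<one>\<^bsub>\<Lambda>\<^esub>) = free_ext K V ?p (rho X)"
  proof (rule Ae_basis_eqI[OF V_module module_hom_comp[OF lh coord_hom]
        module_hom_comp[OF rho_hom V.free_ext_hom[OF pc]] X])
    fix S T assume ST: "S \<subseteq> {1..n}" "T \<subseteq> {1..n}"
    then show "coord (L.pure (e S) (e T) \<odot>\<^bsub>L.Al\<^esub> \<one>\<^bsub>\<Lambda>\<^esub>) = free_ext K V ?p (rho (L.pure (e S) (e T)))"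
      using V.free_ext_basis[of ?p "(S, T)"] pc
      by (simp add: rho_ee L.Al_pure Pi_iff del: free_module_simps)
  qed
  then have "coord (X \<odot>\<^bsub>L.Al\<^esub> \<one>\<^bsub>\<Lambda>\<^esub>) T = free_ext K V ?p (rho X) T" by (rule fun_cong)
  also have "\<dots> = (\<Oplus>p\<in>{p. rho X p \<noteq> \<zero>}. (rho X p \<odot>\<^bsub>V\<^esub> ?p p) T)"
    unfolding free_ext_def
  proof (rule free_module_finsum[OF K.ring_axioms])
    show "(\<lambda>p. rho X p \<odot>\<^bsub>V\<^esub> ?p p) \<in> {p. rho X p \<noteq> \<zero>} \<rightarrow> carrier V"
    proof
      fix p assume "p \<in> {p. rho X p \<noteq> \<zero>}"
      then have "p \<in> Pow {1..n} \<times> Pow {1..n}" using module_hom_in[OF rho_hom X] by auto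
      then show "rho X p \<odot>\<^bsub>V\<^esub> ?p p \<in> carrier V"
        using pc X by (intro V.smult_closed rho_closed) blast+
    qed
  qed
  also have "\<dots> = (\<Oplus>p\<in>Pair {} ` Pow {1..n}. rho X p \<otimes> basis_elt K (snd p) T)"
  proof (rule trans[OF K.finsum_cong'[OF refl] finsum_mono_neutral[OF K.abelian_monoid_axioms]])
    have sub: "p \<in> Pair {} ` Pow {1..n}" if "rho X p \<noteq> \<zero>" for p
    proof -
      obtain S T where p: "p = (S, T)" by (cases p)
      have "S = {}" using that sup unfolding p by blast
      moreover have "T \<subseteq> {1..n}" using that rho_outside[OF X, of S T] unfolding p by blast
      ultimately show ?thesis unfolding p by blast
    qed
    then show "{p. rho X p \<noteq> \<zero>} \<subseteq> Pair {} ` Pow {1..n}" by blast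
    show "(rho X p \<odot>\<^bsub>V\<^esub> ?p p) T = rho X p \<otimes> basis_elt K (snd p) T" if "p \<in> {p. rho X p \<noteq> \<zero>}" for p
      using sub[of p] that by (auto simp: e_empty coord_e)
  qed (use X in \<open>auto simp: basis_elt_def\<close>)
  also have "\<dots> = rho X ({}, T) \<otimes> basis_elt K (snd ({} :: nat set, T)) T"
    by (rule finsum_single[OF K.abelian_monoid_axioms]) (use X T in \<open>auto simp: basis_elt_def\<close>)
  finally show ?thesis using X by (simp add: basis_elt_def)
qed

text \<open>The remainder is supported on \<open>S = {}\<close> and \<open>a = {#}\<close>. In
  positive degree it is therefore zero, and in degree 0 it is detected by the augmentation.\<close>

lemma koszul_exact_Q:
  assumes g: "g \<in> carrier (Q m)" and cyc: "\<And>S a T. K.kd K.\<tau>L (theta m g) S a T = \<zero>"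
  obtains h where "h \<in> carrier (Q (Suc m))" "K.kspace n 0 m (theta m (g \<ominus>\<^bsub>Q m\<^esub> kz m h))"
proof -
  obtain y where y: "K.kspace n n (Suc m) y" "K.kspace n 0 m (\<lambda>S a T. theta m g S a T \<ominus> K.kd K.\<tau>L y S a T)"
    using K.koszul_exact[OF K.\<tau>L_closed theta_kspace[OF g] le_refl cyc] K.\<tau>L_anticommute by blast
  obtain h where h: "h \<in> carrier (Q (Suc m))" "theta (Suc m) h = y" by (rule theta_surj[OF y(1)])
  have "theta m (g \<ominus>\<^bsub>Q m\<^esub> kz m h) = (\<lambda>S a T. theta m g S a T \<ominus> K.kd K.\<tau>L y S a T)"
    by (intro ext) (simp add: theta_diff[OF g module_hom_in[OF kz_hom h(1)]] theta_kz[OF h(1)] h(2))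
  then have "K.kspace n 0 m (theta m (g \<ominus>\<^bsub>Q m\<^esub> kz m h))" using y(2) by (simp only:)
  then show ?thesis by (rule that[OF h(1)])
qed

lemma Q_diff_zero: "g \<in> carrier (Q m) \<Longrightarrow> h \<in> carrier (Q m) \<Longrightarrow> g \<ominus>\<^bsub>Q m\<^esub> h = \<zero>\<^bsub>Q m\<^esub> \<Longrightarrow> g = h"
  by (rule abelian_group.diff_eq_zeroD[OF left_module.axioms(2)[OF Q_module]])

lemma kz_exact: "kz (Suc m) ` carrier (Q (Suc (Suc m))) = {x \<in> carrier (Q (Suc m)). kz m x = \<zero>\<^bsub>Q m\<^esub>}"
proof (intro equalityI subsetI)
  fix x assume "x \<in> kz (Suc m) ` carrier (Q (Suc (Suc m)))"
  then obtain g where g: "g \<in> carrier (Q (Suc (Suc m)))" "x = kz (Suc m) g" by blast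
  have x: "x \<in> carrier (Q (Suc m))" using g module_hom_in[OF kz_hom] by blast
  have tx: "theta (Suc m) x = K.kd K.\<tau>L (theta (Suc (Suc m)) g)"
    by (intro ext) (simp add: g(2) theta_kz[OF g(1)])
  have "theta m (kz m x) S a T = \<zero>" for S a T
    unfolding theta_kz[OF x] tx
    by (rule K.kd_kd[OF K.\<tau>L_closed theta_kspace[OF g(1)] le_refl K.\<tau>L_anticommute])
  then show "x \<in> {x \<in> carrier (Q (Suc m)). kz m x = \<zero>\<^bsub>Q m\<^esub>}"
    using theta_inj[OF module_hom_in[OF kz_hom x]] x by blast
next
  fix x assume "x \<in> {x \<in> carrier (Q (Suc m)). kz m x = \<zero>\<^bsub>Q m\<^esub>}"
  then have x: "x \<in> carrier (Q (Suc m))" and kx: "kz m x = \<zero>\<^bsub>Q m\<^esub>"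
    by (simp_all only: mem_Collect_eq)
  have "rho \<zero>\<^bsub>L.Ae\<^esub> = \<zero>\<^bsub>V2\<^esub>"
    by (rule left_module_hom.zero[OF left_module_homI[OF Ae.AM.left_module_axioms V2_module rho_hom]])
  then have "K.kd K.\<tau>L (theta (Suc m) x) S a T = \<zero>" for S a T
    unfolding theta_kz[OF x, symmetric] kx by (simp add: theta_def)
  then obtain h where h: "h \<in> carrier (Q (Suc (Suc m)))"
      "K.kspace n 0 (Suc m) (theta (Suc m) (x \<ominus>\<^bsub>Q (Suc m)\<^esub> kz (Suc m) h))"
    using koszul_exact_Q[OF x] by metis
  note kh = module_hom_in[OF kz_hom h(1)]
  \<comment> \<open>The support forces \<open>a = {#}\<close>, which contradicts the size
    \<open>Suc m\<close>.\<close>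
  have "theta (Suc m) (x \<ominus>\<^bsub>Q (Suc m)\<^esub> kz (Suc m) h) S a T = \<zero>" for S a T
    using K.kspace_supp[OF h(2), of S a T] by (cases "a = {#}") auto
  then have "x \<ominus>\<^bsub>Q (Suc m)\<^esub> kz (Suc m) h = \<zero>\<^bsub>Q (Suc m)\<^esub>"
    by (rule theta_inj[OF abelian_group.minus_closed[OF left_module.axioms(2)[OF Q_module] x kh]])
  then have "x = kz (Suc m) h" by (rule Q_diff_zero[OF x kh])
  then show "x \<in> kz (Suc m) ` carrier (Q (Suc (Suc m)))" using h(1) by blast
qed

lemma aug_exact: "kz 0 ` carrier (Q 1) = {x \<in> carrier (Q 0). aug x = \<zero>\<^bsub>L.Al\<^esub>}"
proof (intro equalityI subsetI)
  fix x assume "x \<in> kz 0 ` carrier (Q 1)"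
  then obtain g where g: "g \<in> carrier (Q 1)" "x = kz 0 g" by blast
  then show "x \<in> {x \<in> carrier (Q 0). aug x = \<zero>\<^bsub>L.Al\<^esub>}"
    using module_hom_in[OF kz_hom[of 0]] aug_kz[OF g(1)] by (simp add: One_nat_def del: free_module_simps)
next
  fix x assume "x \<in> {x \<in> carrier (Q 0). aug x = \<zero>\<^bsub>L.Al\<^esub>}"
  then have x: "x \<in> carrier (Q 0)" and ax: "aug x = \<zero>\<^bsub>L.Al\<^esub>"
    by (simp_all only: mem_Collect_eq)
  \<comment> \<open>The coordinate differential is zero below the bottom, so each chain of degree 0
    is a cycle for it. The augmentation enters only afterwards, to kill the remainder.\<close>
  have "K.kd K.\<tau>L (theta 0 x) S a T = \<zero>" for S a T
    by (rule K.kd_bottom[OF K.\<tau>L_closed theta_kspace[OF x]])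
  then obtain h where h: "h \<in> carrier (Q (Suc 0))" "K.kspace n 0 0 (theta 0 (x \<ominus>\<^bsub>Q 0\<^esub> kz 0 h))"
    using koszul_exact_Q[OF x] by metis
  note kh = module_hom_in[OF kz_hom h(1)]
  let ?d = "x \<ominus>\<^bsub>Q 0\<^esub> kz 0 h"
  have d: "?d \<in> carrier (Q 0)"
    by (rule abelian_group.minus_closed[OF left_module.axioms(2)[OF Q_module] x kh])
  interpret a: left_module_hom L.Ae "Q 0" L.Al aug
    by (rule left_module_homI[OF Q_module L.Al_left_module aug_hom])
  have "aug ?d = \<zero>\<^bsub>\<Lambda>\<^esub>"
    using a.diff[OF x kh] ax aug_kz[of h] h(1) abelian_group.diff_zero[OF a.N.M.abelian_group_axioms a.N.M.zero_closed]
    by (simp add: One_nat_def del: free_module_simps)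
  moreover have sup: "rho (?d (enc {#})) (S, T) = \<zero>" if "S \<noteq> {}" for S T
    using K.kspace_supp[OF h(2), of S "{#}" T] that by (auto simp: theta_def MI_0)
  ultimately have "rho (?d (enc {#})) ({}, T) = \<zero>" for T
  proof (cases "T \<subseteq> {1..n}")
    case True
    have "coord \<zero>\<^bsub>\<Lambda>\<^esub> = \<zero>\<^bsub>V\<^esub>"
      by (rule left_module_hom.zero[OF left_module_homI[OF L.AM.left_module_axioms V_module coord_hom]])
    then show ?thesis
      using coord_act_one[OF Q_closed[OF d] sup True] \<open>aug ?d = \<zero>\<^bsub>\<Lambda>\<^esub>\<close> by (simp add: aug_def)
  qed (use rho_outside[OF Q_closed[OF d]] in simp)
  then have "theta 0 ?d S a T = \<zero>" for S a T
    using sup by (cases "S = {}") (auto simp: theta_def MI_0)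
  then have "?d = \<zero>\<^bsub>Q 0\<^esub>" by (rule theta_inj[OF d])
  then have "x = kz 0 h" by (rule Q_diff_zero[OF x kh])
  then have "x \<in> kz 0 ` carrier (Q (Suc 0))" using h(1) by (rule image_eqI)
  then show "x \<in> kz 0 ` carrier (Q 1)" by (simp only: One_nat_def)
qed

lemma koszul_resolution: "tensor_resolution K L.Ae L.Ar L.Al Q kz aug"
proof -
  have "projective_resolution L.Ae L.Al Q kz aug"
    unfolding projective_resolution_def
    by (intro conjI allI Q_projective kz_hom aug_hom aug_surj aug_exact kz_exact)
  then show ?thesis
    using L.Ar_tensor_left L.Al_left_module
    by (simp add: tensor_resolution_def resolution_def resolution_axioms_def)
qed

end

section \<open>The Hochschild complex\<close>

text \<open>For maps on a free module that are not linear over its base ring, such as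
  \<open>phi m x\<close> with values in a \<open>K\<close>-space, \<open>free_hom_eqI\<close> does
  not apply and additivity has to be used directly.\<close>

lemma free_module_induct:
  assumes "ring R" and f: "f \<in> carrier (free_module R S)"
    and "P \<zero>\<^bsub>free_module R S\<^esub>"
    and "\<And>r s. r \<in> carrier R \<Longrightarrow> s \<in> S \<Longrightarrow> P (r \<odot>\<^bsub>free_module R S\<^esub> basis_elt R s)"
    and "\<And>f g. f \<in> carrier (free_module R S) \<Longrightarrow> g \<in> carrier (free_module R S) \<Longrightarrow> P f \<Longrightarrow> P g \<Longrightarrow>
      P (f \<oplus>\<^bsub>free_module R S\<^esub> g)"
  shows "P f"
proof -
  interpret ring R by fact
  let ?F = "free_module R S" and ?A = "{s. f s \<noteq> \<zero>\<^bsub>R\<^esub>}"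
  interpret F: left_module R ?F by (rule free_module_left_module)
  have A: "finite ?A" "?A \<subseteq> S" "\<And>s. f s \<in> carrier R" using f by auto
  note [simp del] = free_module_simps
  have c: "f s \<odot>\<^bsub>?F\<^esub> basis_elt R s \<in> carrier ?F" if "s \<in> S" for s
    using that A(3) by (intro F.smult_closed) auto
  have "P (\<Oplus>\<^bsub>?F\<^esub>s\<in>B. f s \<odot>\<^bsub>?F\<^esub> basis_elt R s)" if "B \<subseteq> ?A" for B
    using finite_subset[OF that A(1)] that
  proof (induction B)
    case (insert s B)
    have "s \<in> S" "B \<subseteq> S" using insert.prems A(2) by auto
    then have "(\<Oplus>\<^bsub>?F\<^esub>s\<in>B. f s \<odot>\<^bsub>?F\<^esub> basis_elt R s) \<in> carrier ?F"
      using c by (intro F.M.finsum_closed) auto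
    then show ?case
      using insert \<open>s \<in> S\<close> \<open>B \<subseteq> S\<close> c A(3)
      by (subst F.M.finsum_insert) (auto intro!: assms(4,5))
  qed (simp add: assms(3))
  then have "P (free_ext R ?F (basis_elt R) f)" unfolding free_ext_def by blast
  then show ?thesis by (simp only: free_module_expand[OF assms(1) f])
qed

sublocale exterior \<subseteq> TR: tensor_resolution K "enveloping_algebra K (exterior_algebra K n)"
    "right_enveloping_module K (exterior_algebra K n)" "left_enveloping_module K (exterior_algebra K n)"
    "\<lambda>m. free_module (enveloping_algebra K (exterior_algebra K n)) (enc ` multisets_of_size {1..n} m)" kz aug
  by (rule koszul_resolution)

context exterior
begin

section \<open>Identification of the tensored resolution with a complex on pairs of a subset and a
  multiset\<close>

abbreviation "W \<equiv> \<lambda>m. free_module K (Pow {1..n} \<times> MI m)"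

text \<open>Tensoring the free module with \<Lambda> leaves one copy of \<Lambda> for each multiset:
  the coefficient of \<open>g\<close> at \<open>a\<close> is moved across the tensor sign and acts
  on \<open>x\<close> from the right.\<close>

definition phi :: "nat \<Rightarrow> 'k ext \<Rightarrow> ('k res \<Rightarrow> 'k env) \<Rightarrow> nat set \<times> nat multiset \<Rightarrow> 'k" where
  "phi m x g = (\<lambda>(S, a). if a \<in> MI m then coord (g (enc a) \<odot>\<^bsub>L.Ar\<^esub> x) S else \<zero>)"

text \<open>The action of \<open>Zg m i\<close> on \<open>x\<close> is
  \<open>x x_i + (-1)^(m+1) x_i x\<close>. The two multiplications remove \<open>i\<close> from the
  same set, so their signs merge into one coefficient.\<close>

definition dW :: "nat \<Rightarrow> (nat set \<times> nat multiset \<Rightarrow> 'k) \<Rightarrow> nat set \<times> nat multiset \<Rightarrow> 'k" where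
  "dW m w = (\<lambda>(S, a). if a \<in> MI m
    then \<Oplus>i\<in>S. (K.\<sigma> S i \<oplus> sign K (Suc m) \<otimes> K.\<tau>L S i) \<otimes> w (S - {i}, add_mset i a) else \<zero>)"

lemma W_module: "left_module K (W m)"
  by (rule K.free_module_left_module)

lemma finite_W_index: "finite (Pow {1..n} \<times> MI m)"
  by simp

lemma Ar_closed: "X \<in> carrier L.Ae \<Longrightarrow> x \<in> carrier \<Lambda> \<Longrightarrow> X \<odot>\<^bsub>L.Ar\<^esub> x \<in> carrier \<Lambda>"
  by (rule module_hom_in[OF L.Ar_hom])

lemma phi_closed:
  assumes "x \<in> carrier \<Lambda>" "g \<in> carrier (Q m)" shows "phi m x g \<in> carrier (W m)"
proof (rule free_module_finiteI[OF finite_W_index])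
  fix p :: "nat set \<times> nat multiset" obtain S a where p: "p = (S, a)" by (cases p)
  note c = Ar_closed[OF Q_closed[OF assms(2)] assms(1), of "enc a"]
  show "phi m x g p \<in> carrier K"
    unfolding phi_def p prod.case by (split if_split) (intro conjI impI coord_closed c K.zero_closed)
  show "phi m x g p = \<zero>" if "p \<notin> Pow {1..n} \<times> MI m"
    using that coord_outside[OF c, of S] unfolding phi_def p prod.case
    by (split if_split) blast
qed

lemma phi_add_l:
  assumes "x \<in> carrier \<Lambda>" "x' \<in> carrier \<Lambda>" "g \<in> carrier (Q m)"
  shows "phi m (x \<oplus>\<^bsub>\<Lambda>\<^esub> x') g = phi m x g \<oplus>\<^bsub>W m\<^esub> phi m x' g"
proof
  fix p :: "nat set \<times> nat multiset" obtain S a where p: "p = (S, a)" by (cases p)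
  note gc = Q_closed[OF assms(3), of "enc a"]
  show "phi m (x \<oplus>\<^bsub>\<Lambda>\<^esub> x') g p = (phi m x g \<oplus>\<^bsub>W m\<^esub> phi m x' g) p"
    using module_hom_add[OF L.Ar_hom_r[OF gc] assms(1,2)] Ar_closed[OF gc] assms(1,2)
    by (simp add: phi_def p coord_add del: L.Ar_simps(4))
qed

lemma phi_smult_l:
  assumes "c \<in> carrier K" "x \<in> carrier \<Lambda>" "g \<in> carrier (Q m)"
  shows "phi m (c \<odot>\<^bsub>\<Lambda>\<^esub> x) g = c \<odot>\<^bsub>W m\<^esub> phi m x g"
proof
  fix p :: "nat set \<times> nat multiset" obtain S a where p: "p = (S, a)" by (cases p)
  note gc = Q_closed[OF assms(3), of "enc a"]
  show "phi m (c \<odot>\<^bsub>\<Lambda>\<^esub> x) g p = (c \<odot>\<^bsub>W m\<^esub> phi m x g) p"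
    using module_hom_smult[OF L.Ar_hom_r[OF gc] assms(1,2)] Ar_closed[OF gc assms(2)] assms(1,2)
    by (simp add: phi_def p coord_smult del: L.Ar_simps(4))
qed

lemma phi_add_r:
  assumes "x \<in> carrier \<Lambda>" "g \<in> carrier (Q m)" "h \<in> carrier (Q m)"
  shows "phi m x (g \<oplus>\<^bsub>Q m\<^esub> h) = phi m x g \<oplus>\<^bsub>W m\<^esub> phi m x h"
proof
  fix p :: "nat set \<times> nat multiset" obtain S a where p: "p = (S, a)" by (cases p)
  note gc = Q_closed[OF assms(2), of "enc a"] and hc = Q_closed[OF assms(3), of "enc a"]
  show "phi m x (g \<oplus>\<^bsub>Q m\<^esub> h) p = (phi m x g \<oplus>\<^bsub>W m\<^esub> phi m x h) p"
    using module_hom_add[OF L.Ar_hom[OF assms(1)] gc hc] Ar_closed[OF gc assms(1)] Ar_closed[OF hc assms(1)]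
    by (simp add: phi_def p coord_add del: L.Ar_simps(4))
qed

lemma phi_balanced:
  assumes "r \<in> carrier L.Ae" "x \<in> carrier \<Lambda>" "g \<in> carrier (Q m)"
  shows "phi m (r \<odot>\<^bsub>L.Ar\<^esub> x) g = phi m x (r \<odot>\<^bsub>Q m\<^esub> g)"
proof
  fix p :: "nat set \<times> nat multiset" obtain S a where p: "p = (S, a)" by (cases p)
  show "phi m (r \<odot>\<^bsub>L.Ar\<^esub> x) g p = phi m x (r \<odot>\<^bsub>Q m\<^esub> g) p"
    using L.Ar_mult[OF assms(1) Q_closed[OF assms(3), of "enc a"] assms(2)]
    by (simp add: phi_def p del: L.Ar_simps(4))
qed

lemma Ar_scalar:
  assumes "c \<in> carrier K" "x \<in> carrier \<Lambda>"
  shows "(c \<odot>\<^bsub>L.Ae\<^esub> \<one>\<^bsub>L.Ae\<^esub>) \<odot>\<^bsub>L.Ar\<^esub> x = c \<odot>\<^bsub>\<Lambda>\<^esub> x"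
proof -
  have "\<one>\<^bsub>L.Ae\<^esub> \<odot>\<^bsub>L.Ar\<^esub> x = x"
    unfolding L.Ae_one using assms L.Ar_pure[OF assms(2) L.A.one_closed L.A.one_closed]
    by (simp del: L.Ar_simps(4))
  then show ?thesis
    using module_hom_smult[OF L.Ar_hom[OF assms(2)] assms(1) Ae.A.one_closed] by (simp only:)
qed

abbreviation "pureQ \<equiv> \<lambda>m. tensor.pure K L.Ae L.Ar (Q m)"

lemma Phi_exists:
  "\<exists>\<Phi>\<in>module_hom K (TR.C m) (W m). \<forall>x\<in>carrier \<Lambda>. \<forall>g\<in>carrier (Q m). \<Phi> (pureQ m x g) = phi m x g"
proof -
  interpret Tm: tensor K L.Ae L.Ar "Q m" by (rule TR.tensor_P)
  have "Tm.lift (W m) (phi m) \<in> module_hom K Tm.T (W m)"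
    by (rule Tm.lift(1)[OF W_module])
      (simp_all only: L.Ar_simps(1,3) phi_closed phi_add_l phi_add_r phi_balanced Ar_scalar phi_smult_l)
  moreover have "Tm.lift (W m) (phi m) (pureQ m x g) = phi m x g" if "x \<in> carrier \<Lambda>" "g \<in> carrier (Q m)" for x g
    by (rule Tm.lift(2)[OF W_module])
      (simp_all only: L.Ar_simps(1,3) phi_closed phi_add_l phi_add_r phi_balanced Ar_scalar phi_smult_l that)
  ultimately show ?thesis by (intro bexI ballI)
qed

text \<open>Chosen rather than written as a lift, because only linearity and the values on pure
  tensors are used.\<close>

definition Phi where
  "Phi m = (SOME \<Phi>. \<Phi> \<in> module_hom K (TR.C m) (W m) \<and>
    (\<forall>x\<in>carrier \<Lambda>. \<forall>g\<in>carrier (Q m). \<Phi> (pureQ m x g) = phi m x g))"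

lemma Phi:
  shows Phi_hom: "Phi m \<in> module_hom K (TR.C m) (W m)"
    and Phi_pure: "x \<in> carrier \<Lambda> \<Longrightarrow> g \<in> carrier (Q m) \<Longrightarrow> Phi m (pureQ m x g) = phi m x g"
proof -
  have "Phi m \<in> module_hom K (TR.C m) (W m) \<and>
      (\<forall>x\<in>carrier \<Lambda>. \<forall>g\<in>carrier (Q m). Phi m (pureQ m x g) = phi m x g)"
    using someI_ex[OF Phi_exists[of m, unfolded Bex_def]] unfolding Phi_def .
  then show "Phi m \<in> module_hom K (TR.C m) (W m)"
    "x \<in> carrier \<Lambda> \<Longrightarrow> g \<in> carrier (Q m) \<Longrightarrow> Phi m (pureQ m x g) = phi m x g"
    by (rule conjunct1, simp only:)
qed

lemma phi_basis:
  assumes "S \<subseteq> {1..n}" "a \<in> MI m"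
  shows "phi m (e S) (basis_elt L.Ae (enc a)) = basis_elt K (S, a)"
proof
  fix p :: "nat set \<times> nat multiset" obtain T b where p: "p = (T, b)" by (cases p)
  have eS: "e S \<in> carrier \<Lambda>" using assms by simp
  have one: "\<one>\<^bsub>L.Ae\<^esub> \<odot>\<^bsub>L.Ar\<^esub> e S = e S"
    using Ar_scalar[OF K.one_closed eS] by (simp add: Ae.AM.smult_one L.AM.smult_one eS del: L.Ar_simps(4))
  have zero: "\<zero>\<^bsub>L.Ae\<^esub> \<odot>\<^bsub>L.Ar\<^esub> e S = \<zero>\<^bsub>\<Lambda>\<^esub>"
    by (rule left_module_hom.zero[OF left_module_homI[OF Ae.AM.left_module_axioms L.AM.left_module_axioms L.Ar_hom[OF eS]]])
  have c0: "coord \<zero>\<^bsub>\<Lambda>\<^esub> = \<zero>\<^bsub>V\<^esub>"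
    by (rule left_module_hom.zero[OF left_module_homI[OF L.AM.left_module_axioms V_module coord_hom]])
  have enc_eq: "(enc b :: 'k res) = enc a \<longleftrightarrow> b = a" using dec_enc by metis
  show "phi m (e S) (basis_elt L.Ae (enc a)) p = basis_elt K (S, a) p"
  proof (cases "b = a")
    case True
    have "basis_elt L.Ae (enc a) (enc b :: 'k res) = \<one>\<^bsub>L.Ae\<^esub>" using True by (simp add: basis_elt_def)
    then have "phi m (e S) (basis_elt L.Ae (enc a)) p = coord (e S) T"
      using True assms(2) by (simp only: phi_def p prod.case one if_True)
    then show ?thesis
      using True assms(1) by (simp add: coord_e p) (auto simp: basis_elt_def)
  next
    case False
    have "basis_elt L.Ae (enc a) (enc b :: 'k res) = \<zero>\<^bsub>L.Ae\<^esub>"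
      using False enc_eq by (simp add: basis_elt_def)
    then have "phi m (e S) (basis_elt L.Ae (enc a)) p = \<zero>"
      by (simp only: phi_def p prod.case zero c0 free_module_simps if_cancel)
    then show ?thesis using False by (simp add: basis_elt_def p)
  qed
qed

definition Psi where
  "Psi m = free_ext K (TR.C m) (\<lambda>(S, a). pureQ m (e S) (basis_elt L.Ae (enc a)))"

lemma basis_Q: "a \<in> MI m \<Longrightarrow> basis_elt L.Ae (enc a :: 'k res) \<in> carrier (Q m)"
  by (rule Ae.A.basis_elt_closed) (rule imageI)

lemma Psi_hom: "Psi m \<in> module_hom K (W m) (TR.C m)"
proof -
  interpret Tm: tensor K L.Ae L.Ar "Q m" by (rule TR.tensor_P)
  show ?thesis
    unfolding Psi_def
  proof (rule left_module.free_ext_hom[OF TR.C_module], rule Pi_I)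
    fix p :: "nat set \<times> nat multiset" assume "p \<in> Pow {1..n} \<times> MI m"
    then obtain S a where "p = (S, a)" "S \<subseteq> {1..n}" "a \<in> MI m" by blast
    then show "(case p of (S, a) \<Rightarrow> pureQ m (e S) (basis_elt L.Ae (enc a))) \<in> carrier (TR.C m)"
      using Tm.pure_closed[of "e S", OF _ basis_Q] by simp
  qed
qed

lemma Psi_basis:
  assumes "S \<subseteq> {1..n}" "a \<in> MI m"
  shows "Psi m (basis_elt K (S, a)) = pureQ m (e S) (basis_elt L.Ae (enc a))"
proof -
  interpret Tm: tensor K L.Ae L.Ar "Q m" by (rule TR.tensor_P)
  show ?thesis
    unfolding Psi_def
    using left_module.free_ext_basis[OF TR.C_module, of "\<lambda>(S, a). pureQ m (e S) (basis_elt L.Ae (enc a))" "(S, a)" m]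
      Tm.pure_closed[of "e S", OF _ basis_Q[OF assms(2)]] assms(1) by simp
qed

lemma Phi_Psi: "w \<in> carrier (W m) \<Longrightarrow> Phi m (Psi m w) = w"
proof (rule free_hom_eqI[OF W_module module_hom_comp[OF Psi_hom Phi_hom]])
  show "(\<lambda>x. x) \<in> module_hom K (W m) (W m)" by (rule module_homI) simp_all
  fix p :: "nat set \<times> nat multiset" assume "p \<in> Pow {1..n} \<times> MI m"
  then obtain S a where p: "p = (S, a)" "S \<subseteq> {1..n}" "a \<in> MI m" by blast
  show "Phi m (Psi m (basis_elt K p)) = basis_elt K p"
    unfolding p(1) Psi_basis[OF p(2,3)] Phi_pure[OF e_closed[OF p(2)] basis_Q[OF p(3)]] phi_basis[OF p(2,3)] ..
qed

text \<open>A coefficient \<open>r\<close> of a basis element is moved onto \<open>x\<close> by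
  balancedness, on the side of \<open>phi\<close> as well as in the tensor product. What remains is
  linear in \<open>x\<close> and is checked on the \<open>e S\<close> by
  \<open>phi_basis\<close>.\<close>

lemma Psi_phi:
  assumes g: "g \<in> carrier (Q m)" and x: "x \<in> carrier \<Lambda>"
  shows "Psi m (phi m x g) = pureQ m x g"
proof -
  interpret Tm: tensor K L.Ae L.Ar "Q m" by (rule TR.tensor_P)
  interpret Qm: left_module L.Ae "Q m" by (rule Q_module)
  interpret C: left_module K "TR.C m" by (rule TR.C_module)
  interpret Psi: left_module_hom K "W m" "TR.C m" "Psi m"
    by (rule left_module_homI[OF W_module TR.C_module Psi_hom])
  note [simp del] = free_module_simps
  have "\<forall>x\<in>carrier \<Lambda>. Psi m (phi m x g) = pureQ m x g"
  proof (rule free_module_induct[OF Ae.A.ring_axioms g])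
    have "phi m x \<zero>\<^bsub>Q m\<^esub> = \<zero>\<^bsub>W m\<^esub>" "pureQ m x \<zero>\<^bsub>Q m\<^esub> = \<zero>\<^bsub>TR.C m\<^esub>" if x: "x \<in> carrier \<Lambda>" for x
    proof -
      show "phi m x \<zero>\<^bsub>Q m\<^esub> = \<zero>\<^bsub>W m\<^esub>"
        using phi_add_r[OF x Qm.M.zero_closed Qm.M.zero_closed] phi_closed[OF x Qm.M.zero_closed]
        by (simp add: Psi.M.M.add.l_cancel_one)
      show "pureQ m x \<zero>\<^bsub>Q m\<^esub> = \<zero>\<^bsub>TR.C m\<^esub>"
        using Tm.pure_relations(2)[of x, OF _ Qm.M.zero_closed Qm.M.zero_closed]
          Tm.pure_closed[of x, OF _ Qm.M.zero_closed] x by (simp add: C.M.add.l_cancel_one)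
    qed
    then show "\<forall>x\<in>carrier \<Lambda>. Psi m (phi m x \<zero>\<^bsub>Q m\<^esub>) = pureQ m x \<zero>\<^bsub>Q m\<^esub>" by simp
  next
    fix r and s :: "'k res" assume r: "r \<in> carrier L.Ae" and "s \<in> enc ` MI m"
    then obtain a where s: "s = enc a" and a: "a \<in> MI m" by blast
    note b = basis_Q[OF a]
    have base: "Psi m (phi m x (basis_elt L.Ae (enc a))) = pureQ m x (basis_elt L.Ae (enc a))"
      if x: "x \<in> carrier \<Lambda>" for x
    proof (rule \<Lambda>_hom_eqI[OF TR.C_module _ _ x])
      show "(\<lambda>x. Psi m (phi m x (basis_elt L.Ae (enc a)))) \<in> module_hom K \<Lambda> (TR.C m)"
        by (rule module_homI)
          (simp_all add: phi_add_l phi_smult_l b phi_closed Psi.add Psi.smult)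
      show "(\<lambda>x. pureQ m x (basis_elt L.Ae (enc a))) \<in> module_hom K \<Lambda> (TR.C m)"
      proof (rule module_homI)
        fix c x assume "c \<in> carrier K" "x \<in> carrier \<Lambda>"
        then show "pureQ m (c \<odot>\<^bsub>\<Lambda>\<^esub> x) (basis_elt L.Ae (enc a)) = c \<odot>\<^bsub>TR.C m\<^esub> pureQ m x (basis_elt L.Ae (enc a))"
          using Tm.pure_relations(4)[of c x, OF _ _ b] Ar_scalar by (simp del: L.Ar_simps(4))
      next
        fix x y assume "x \<in> carrier \<Lambda>" "y \<in> carrier \<Lambda>"
        then show "pureQ m (x \<oplus>\<^bsub>\<Lambda>\<^esub> y) (basis_elt L.Ae (enc a)) =
            pureQ m x (basis_elt L.Ae (enc a)) \<oplus>\<^bsub>TR.C m\<^esub> pureQ m y (basis_elt L.Ae (enc a))"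
          using Tm.pure_relations(1)[of x y, OF _ _ b] by simp
      qed (use Tm.pure_closed[OF _ b] in simp)
      fix S assume S: "S \<subseteq> {1..n}"
      show "Psi m (phi m (e S) (basis_elt L.Ae (enc a))) = pureQ m (e S) (basis_elt L.Ae (enc a))"
        unfolding phi_basis[OF S a] Psi_basis[OF S a] ..
    qed
    show "\<forall>x\<in>carrier \<Lambda>. Psi m (phi m x (r \<odot>\<^bsub>Q m\<^esub> basis_elt L.Ae s)) = pureQ m x (r \<odot>\<^bsub>Q m\<^esub> basis_elt L.Ae s)"
    proof
      fix x assume x: "x \<in> carrier \<Lambda>"
      then have x': "x \<in> carrier L.Ar" by simp
      show "Psi m (phi m x (r \<odot>\<^bsub>Q m\<^esub> basis_elt L.Ae s)) = pureQ m x (r \<odot>\<^bsub>Q m\<^esub> basis_elt L.Ae s)"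
        unfolding s phi_balanced[OF r x b, symmetric] Tm.pure_relations(3)[OF r x' b, symmetric]
        by (rule base[OF Ar_closed[OF r x]])
    qed
  next
    fix f g assume f: "f \<in> carrier (Q m)" and g: "g \<in> carrier (Q m)"
      and "\<forall>x\<in>carrier \<Lambda>. Psi m (phi m x f) = pureQ m x f" "\<forall>x\<in>carrier \<Lambda>. Psi m (phi m x g) = pureQ m x g"
    then show "\<forall>x\<in>carrier \<Lambda>. Psi m (phi m x (f \<oplus>\<^bsub>Q m\<^esub> g)) = pureQ m x (f \<oplus>\<^bsub>Q m\<^esub> g)"
      by (simp add: phi_add_r phi_closed Psi.add Tm.pure_relations(2))
  qed
  then show ?thesis using x by blast
qed

lemma Psi_Phi: "t \<in> carrier (TR.C m) \<Longrightarrow> Psi m (Phi m t) = t"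
proof -
  interpret Tm: tensor K L.Ae L.Ar "Q m" by (rule TR.tensor_P)
  assume t: "t \<in> carrier (TR.C m)"
  show ?thesis
  proof (rule Tm.hom_eqI[OF TR.C_module module_hom_comp[OF Phi_hom Psi_hom] _ t])
    show "(\<lambda>x. x) \<in> module_hom K (TR.C m) (TR.C m)" by (rule module_homI) simp_all
    show "Psi m (Phi m (pureQ m x g)) = pureQ m x g" if "x \<in> carrier L.Ar" "g \<in> carrier (Q m)" for x g
      using that by (simp only: L.Ar_simps(1) Phi_pure Psi_phi)
  qed
qed

lemma W_closed: "w \<in> carrier (W m) \<Longrightarrow> w p \<in> carrier K"
  by (rule free_module_closed)

lemma coeff_closed [simp]: "K.\<sigma> S i \<oplus> sign K (Suc m) \<otimes> K.\<tau>L S i \<in> carrier K"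
  by simp

lemma dW_hom: "dW m \<in> module_hom K (W (Suc m)) (W m)"
proof (rule module_homI)
  fix w assume w: "w \<in> carrier (W (Suc m))"
  note wc [simp] = W_closed[OF w]
  show "dW m w \<in> carrier (W m)"
  proof (rule free_module_finiteI[OF finite_W_index])
    fix p :: "nat set \<times> nat multiset" obtain S a where p: "p = (S, a)" by (cases p)
    show "dW m w p \<in> carrier K"
      unfolding dW_def p prod.case
      by (split if_split) (intro conjI impI K.finsum_closed Pi_I K.m_closed coeff_closed wc K.zero_closed)
    show "dW m w p = \<zero>" if "p \<notin> Pow {1..n} \<times> MI m"
    proof (cases "a \<in> MI m")
      case True
      then have S: "\<not> S \<subseteq> {1..n}" using that p by blast
      have "(\<Oplus>i\<in>S. (K.\<sigma> S i \<oplus> sign K (Suc m) \<otimes> K.\<tau>L S i) \<otimes> w (S - {i}, add_mset i a)) = \<zero>"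
      proof (rule K.finsum_scaled_zero)
        fix i assume "i \<in> S"
        then have "(S - {i}, add_mset i a) \<notin> Pow {1..n} \<times> MI (Suc m)"
          using S by (auto simp: multisets_of_size_def)
        then show "w (S - {i}, add_mset i a) = \<zero>" by (rule free_module_outside[OF w])
      qed (auto simp: K.\<tau>L_closed)
      then show ?thesis by (simp add: dW_def p)
    qed (simp add: dW_def p)
  qed
  fix c assume c: "c \<in> carrier K"
  show "dW m (c \<odot>\<^bsub>W (Suc m)\<^esub> w) = c \<odot>\<^bsub>W m\<^esub> dW m w"
  proof
    fix p :: "nat set \<times> nat multiset" obtain S a where p: "p = (S, a)" by (cases p)
    let ?u = "\<lambda>i. K.\<sigma> S i \<oplus> sign K (Suc m) \<otimes> K.\<tau>L S i"
    have "(\<Oplus>i\<in>S. ?u i \<otimes> (c \<otimes> w (S - {i}, add_mset i a))) = (\<Oplus>i\<in>S. c \<otimes> (?u i \<otimes> w (S - {i}, add_mset i a)))"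
      using c by (intro K.finsum_cong'[OF refl]) (auto simp: K.m_lcomm simp del: K.r_distr K.l_distr)
    also have "\<dots> = c \<otimes> (\<Oplus>i\<in>S. ?u i \<otimes> w (S - {i}, add_mset i a))"
      using c by (cases "finite S") (auto intro!: K.finsum_rdistr[symmetric])
    finally show "dW m (c \<odot>\<^bsub>W (Suc m)\<^esub> w) p = (c \<odot>\<^bsub>W m\<^esub> dW m w) p"
      using c by (simp add: dW_def p)
  qed
next
  fix v w assume v: "v \<in> carrier (W (Suc m))" and w: "w \<in> carrier (W (Suc m))"
  note [simp] = W_closed[OF w] W_closed[OF v]
  show "dW m (v \<oplus>\<^bsub>W (Suc m)\<^esub> w) = dW m v \<oplus>\<^bsub>W m\<^esub> dW m w"
  proof
    fix p :: "nat set \<times> nat multiset" obtain S a where p: "p = (S, a)" by (cases p)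
    let ?u = "\<lambda>i. K.\<sigma> S i \<oplus> sign K (Suc m) \<otimes> K.\<tau>L S i" and ?q = "\<lambda>i. (S - {i}, add_mset i a)"
    have "(\<Oplus>i\<in>S. ?u i \<otimes> (v (?q i) \<oplus> w (?q i))) = (\<Oplus>i\<in>S. ?u i \<otimes> v (?q i) \<oplus> ?u i \<otimes> w (?q i))"
      by (rule K.finsum_cong'[OF refl]) (auto intro!: K.r_distr)
    also have "\<dots> = (\<Oplus>i\<in>S. ?u i \<otimes> v (?q i)) \<oplus> (\<Oplus>i\<in>S. ?u i \<otimes> w (?q i))"
      by (rule K.finsum_addf) auto
    finally show "dW m (v \<oplus>\<^bsub>W (Suc m)\<^esub> w) p = (dW m v \<oplus>\<^bsub>W m\<^esub> dW m w) p"
      by (simp add: dW_def p)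
  qed
qed

text \<open>By the right module law the product with \<open>Zg m i\<close> acts as
  \<open>Zg m i\<close> after the coefficient of \<open>g\<close>. Of its two parts,
  \<open>Xg i\<close> multiplies by \<open>x_i\<close> on the right and \<open>Yg i\<close> on the
  left.\<close>

lemma phi_kz:
  assumes g: "g \<in> carrier (Q (Suc m))" and x: "x \<in> carrier \<Lambda>"
  shows "phi m x (kz m g) = dW m (phi (Suc m) x g)"
proof
  note [simp del] = L.Ar_simps(4)
  fix p :: "nat set \<times> nat multiset" obtain S a where p: "p = (S, a)" by (cases p)
  have kg: "kz m g \<in> carrier (Q m)" by (rule module_hom_in[OF kz_hom g])
  note pc = phi_closed[OF x g]
  show "phi m x (kz m g) p = dW m (phi (Suc m) x g) p"
  proof (cases "p \<in> Pow {1..n} \<times> MI m")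
    case False
    show ?thesis
      using free_module_outside[OF phi_closed[OF x kg] False]
        free_module_outside[OF module_hom_in[OF dW_hom pc] False] by (simp only:)
  next
    case True
    then have S: "S \<subseteq> {1..n}" and a: "a \<in> MI m" by (auto simp: p)
    have ai: "add_mset i a \<in> MI (Suc m)" if "i \<in> {1..n}" for i
      using a that by (auto simp: multisets_of_size_def)
    let ?g = "\<lambda>i. g (enc (add_mset i a))" and ?s = "sign K (Suc m)"
    note gc = Q_closed[OF g]
    let ?y = "\<lambda>i. ?g i \<odot>\<^bsub>L.Ar\<^esub> x"
    have y: "?y i \<in> carrier \<Lambda>" for i by (rule Ar_closed[OF gc x])
    interpret h: left_module_hom K L.Ae \<Lambda> "\<lambda>X. X \<odot>\<^bsub>L.Ar\<^esub> x"
      by (rule left_module_homI[OF Ae.AM.left_module_axioms L.AM.left_module_axioms L.Ar_hom[OF x]])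
    interpret c: left_module_hom K \<Lambda> V coord
      by (rule left_module_homI[OF L.AM.left_module_axioms V_module coord_hom])
    have gZ: "?g i \<otimes>\<^bsub>L.Ae\<^esub> Zg m i \<in> carrier L.Ae" if "i \<in> {1..n}" for i
      using that by (intro Ae.A.m_closed gc Zg_closed)
    have tm: "coord ((?g i \<otimes>\<^bsub>L.Ae\<^esub> Zg m i) \<odot>\<^bsub>L.Ar\<^esub> x) S =
        (if i \<in> S then (K.\<sigma> S i \<oplus> ?s \<otimes> K.\<tau>L S i) \<otimes> coord (?y i) (S - {i}) else \<zero>)" if i: "i \<in> {1..n}" for i
    proof -
      note w = word_closed[of "[i]"]
      have wi: "word [i] \<in> carrier \<Lambda>" using i by (intro w) simp
      interpret hy: left_module_hom K L.Ae \<Lambda> "\<lambda>X. X \<odot>\<^bsub>L.Ar\<^esub> ?y i"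
        by (rule left_module_homI[OF Ae.AM.left_module_axioms L.AM.left_module_axioms L.Ar_hom[OF y]])
      have "(?g i \<otimes>\<^bsub>L.Ae\<^esub> Zg m i) \<odot>\<^bsub>L.Ar\<^esub> x = Zg m i \<odot>\<^bsub>L.Ar\<^esub> ?y i"
        by (rule L.Ar_mult[OF gc Zg_closed[OF i] x])
      also have "\<dots> = Xg i \<odot>\<^bsub>L.Ar\<^esub> ?y i \<oplus>\<^bsub>\<Lambda>\<^esub> ?s \<odot>\<^bsub>\<Lambda>\<^esub> (Yg i \<odot>\<^bsub>L.Ar\<^esub> ?y i)"
        unfolding Zg_def
        using hy.add[OF XY_closed(1)[OF i] Ae.AM.smult_closed[OF K.sign_closed XY_closed(2)[OF i]]]
          hy.smult[OF K.sign_closed XY_closed(2)[OF i]] by (simp only:)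
      also have "Xg i \<odot>\<^bsub>L.Ar\<^esub> ?y i = ?y i \<otimes>\<^bsub>\<Lambda>\<^esub> word [i]"
        unfolding Xg_def L.Ar_pure[OF y wi L.A.one_closed] L.A.l_one[OF y] ..
      also have "Yg i \<odot>\<^bsub>L.Ar\<^esub> ?y i = word [i] \<otimes>\<^bsub>\<Lambda>\<^esub> ?y i"
        unfolding Yg_def L.Ar_pure[OF y L.A.one_closed wi] L.A.r_one[OF L.A.m_closed[OF wi y]] ..
      finally have eq: "(?g i \<otimes>\<^bsub>L.Ae\<^esub> Zg m i) \<odot>\<^bsub>L.Ar\<^esub> x =
          ?y i \<otimes>\<^bsub>\<Lambda>\<^esub> word [i] \<oplus>\<^bsub>\<Lambda>\<^esub> ?s \<odot>\<^bsub>\<Lambda>\<^esub> (word [i] \<otimes>\<^bsub>\<Lambda>\<^esub> ?y i)" .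
      have cl: "?y i \<otimes>\<^bsub>\<Lambda>\<^esub> word [i] \<in> carrier \<Lambda>" "word [i] \<otimes>\<^bsub>\<Lambda>\<^esub> ?y i \<in> carrier \<Lambda>"
        by (rule L.A.m_closed[OF y wi], rule L.A.m_closed[OF wi y])
      have st: "coord ((?g i \<otimes>\<^bsub>L.Ae\<^esub> Zg m i) \<odot>\<^bsub>L.Ar\<^esub> x) S =
          coord (?y i \<otimes>\<^bsub>\<Lambda>\<^esub> word [i]) S \<oplus> ?s \<otimes> coord (word [i] \<otimes>\<^bsub>\<Lambda>\<^esub> ?y i) S"
        unfolding eq using coord_add[OF cl(1) L.AM.smult_closed[OF K.sign_closed cl(2)]]
          coord_smult[OF K.sign_closed cl(2)] by (simp only:)
      show ?thesis
      proof -
        have alg: "(if i \<in> S then s \<otimes> z else \<zero>) \<oplus> c \<otimes> (if i \<in> S then t \<otimes> z else \<zero>) =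
            (if i \<in> S then (s \<oplus> c \<otimes> t) \<otimes> z else \<zero>)"
          if "s \<in> carrier K" "t \<in> carrier K" "c \<in> carrier K" "z \<in> carrier K" for s t c z
          using that by (simp add: K.l_distr K.m_assoc)
        show ?thesis
          unfolding st coord_mult_r[OF i y] coord_mult_l[OF i y] K.\<sigma>_def[symmetric] K.\<tau>L_def[symmetric]
          by (rule alg[OF K.\<sigma>_closed K.\<tau>L_closed K.sign_closed coord_closed[OF y]])
      qed
    qed
    have "phi m x (kz m g) p = coord ((\<Oplus>\<^bsub>L.Ae\<^esub>i\<in>{1..n}. ?g i \<otimes>\<^bsub>L.Ae\<^esub> Zg m i) \<odot>\<^bsub>L.Ar\<^esub> x) S"
      using a by (simp add: phi_def p kz_def)
    also have "\<dots> = coord (\<Oplus>\<^bsub>\<Lambda>\<^esub>i\<in>{1..n}. (?g i \<otimes>\<^bsub>L.Ae\<^esub> Zg m i) \<odot>\<^bsub>L.Ar\<^esub> x) S"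
      by (subst h.finsum) (rule Pi_I, rule gZ, assumption, rule refl)
    also have "\<dots> = (\<Oplus>\<^bsub>V\<^esub>i\<in>{1..n}. coord ((?g i \<otimes>\<^bsub>L.Ae\<^esub> Zg m i) \<odot>\<^bsub>L.Ar\<^esub> x)) S"
      by (subst c.finsum) (rule Pi_I, rule Ar_closed[OF gZ x], assumption, rule refl)
    also have "\<dots> = (\<Oplus>i\<in>{1..n}. coord ((?g i \<otimes>\<^bsub>L.Ae\<^esub> Zg m i) \<odot>\<^bsub>L.Ar\<^esub> x) S)"
      by (rule free_module_finsum[OF K.ring_axioms]) (rule Pi_I, rule c.closed, rule Ar_closed[OF gZ x])
    also have "\<dots> = (\<Oplus>i\<in>{1..n}. if i \<in> S then (K.\<sigma> S i \<oplus> ?s \<otimes> K.\<tau>L S i) \<otimes> coord (?y i) (S - {i}) else \<zero>)"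
      by (rule K.finsum_cong'[OF refl _ tm]) (auto simp: y)
    also have "\<dots> = (\<Oplus>i\<in>S. if i \<in> S then (K.\<sigma> S i \<oplus> ?s \<otimes> K.\<tau>L S i) \<otimes> coord (?y i) (S - {i}) else \<zero>)"
      by (rule finsum_mono_neutral[OF K.abelian_monoid_axioms, symmetric]) (use S in \<open>auto simp: y\<close>)
    also have "\<dots> = (\<Oplus>i\<in>S. (K.\<sigma> S i \<oplus> ?s \<otimes> K.\<tau>L S i) \<otimes> phi (Suc m) x g (S - {i}, add_mset i a))"
      using S ai by (intro K.finsum_cong'[OF refl]) (auto simp: phi_def y)
    finally show ?thesis using a by (simp only: dW_def p prod.case if_True)
  qed
qed

lemma Phi_D: 
  assumes t: "t \<in> carrier (TR.C (Suc m))" shows "Phi m (TR.D m t) = dW m (Phi (Suc m) t)"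
proof -
  interpret Tm: tensor_functor K L.Ae L.Ar "Q (Suc m)" "Q m"
    by (simp only: tensor_functor_def TR.tensor_P)
  show ?thesis
  proof (rule Tm.N.hom_eqI[OF W_module module_hom_comp[OF TR.D_hom Phi_hom] module_hom_comp[OF Phi_hom dW_hom] t])
    fix x g assume x1: "x \<in> carrier L.Ar" and g: "g \<in> carrier (Q (Suc m))"
    have x: "x \<in> carrier L.Ar" "x \<in> carrier \<Lambda>" using x1 by (simp_all only: L.Ar_simps(1))
    show "Phi m (TR.D m (pureQ (Suc m) x g)) = dW m (Phi (Suc m) (pureQ (Suc m) x g))"
      unfolding Tm.tensor_map_pure[OF kz_hom x(1) g] Phi_pure[OF x(2) g]
        Phi_pure[OF x(2) module_hom_in[OF kz_hom g]] by (rule phi_kz[OF g x(2)])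
  qed
qed

end

section \<open>Dimensions\<close>

text \<open>The element 1 serves as a parity bit: a subset of \<open>{2..n}\<close> has exactly one
  extension of the required parity.\<close>

lemma card_parity:
  assumes "1 \<le> n"
  shows "card {S \<in> Pow {1..n}. odd (card S + m)} = 2 ^ (n - 1)"
proof -
  let ?E = "{S \<in> Pow {1..n}. odd (card S + m)}" and ?P = "Pow {2..n}"
  let ?g = "\<lambda>T. if odd (card T + m) then T else insert 1 T"
  have fin: "finite T" if "T \<subseteq> {2..n}" for T using that by (rule finite_subset) simp
  have "bij_betw (\<lambda>S. S - {1}) ?E ?P"
  proof (rule bij_betw_byWitness[where f' = ?g])
    show "\<forall>S\<in>?E. ?g (S - {1}) = S"
    proof
      fix S assume S: "S \<in> ?E"
      have "finite S" by (rule finite_subset[of S "{1..n}"]) (use S in simp_all)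
      show "?g (S - {1}) = S"
      proof (cases "1 \<in> S")
        case True
        then have "card S = Suc (card (S - {1}))" using \<open>finite S\<close> by (intro card.remove)
        then have "\<not> odd (card (S - {1}) + m)" using S by simp
        then show ?thesis using True by (simp only: if_False insert_Diff)
      next
        case False
        then have "S - {1} = S" by simp
        then show ?thesis using S by simp
      qed
    qed
    show "\<forall>T\<in>?P. ?g T - {1} = T" by auto
    show "(\<lambda>S. S - {1}) ` ?E \<subseteq> ?P"
    proof
      fix T assume "T \<in> (\<lambda>S. S - {1}) ` ?E"
      then obtain S where S: "S \<subseteq> {1..n}" "T = S - {1}" by blast
      have "x \<in> {2..n}" if "x \<in> T" for x
        using that S by (auto simp: subset_iff)
      then show "T \<in> ?P" by blast
    qed
    show "?g ` ?P \<subseteq> ?E"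
    proof
      fix S assume "S \<in> ?g ` ?P"
      then obtain T where T: "T \<subseteq> {2..n}" "S = ?g T" by blast
      have "T \<subseteq> {1..n}" using T(1) by force
      moreover have "1 \<notin> T" using T(1) by auto
      ultimately show "S \<in> ?E" using T fin assms by auto
    qed
  qed
  then have "card ?E = card ?P" by (rule bij_betw_same_card)
  then show ?thesis by (simp add: card_Pow)
qed

text \<open>The least positive annihilator of the unit is 2 as soon as 2 annihilates it, because
  \<open>\<one> \<noteq> \<zero>\<close> excludes 1.\<close>

lemma (in field) characteristic_eq_2: "characteristic R = 2 \<longleftrightarrow> \<one> \<oplus> \<one> = \<zero>"
proof -
  have two: "[(2::nat)] \<cdot> \<one> = \<one> \<oplus> \<one>" by (simp add: numeral_2_eq_2)
  let ?P = "\<lambda>p::nat. 0 < p \<and> [p] \<cdot> \<one> = \<zero>"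
  show ?thesis
  proof
    assume c: "characteristic R = 2"
    then have ex: "\<exists>p. ?P p" by (auto simp: characteristic_def split: if_splits)
    then have "characteristic R = (LEAST p. ?P p)" by (simp add: characteristic_def)
    then have "?P 2" using LeastI_ex[OF ex] c by simp
    then show "\<one> \<oplus> \<one> = \<zero>" using two by simp
  next
    assume h: "\<one> \<oplus> \<one> = \<zero>"
    have "(LEAST p. ?P p) = 2"
    proof (rule Least_equality)
      show "?P 2" using h two by simp
      fix y assume y: "?P y"
      have "[(1::nat)] \<cdot> \<one> = \<one>" by (simp add: One_nat_def)
      then have "y \<noteq> 1" using y one_not_zero by metis
      then show "2 \<le> y" using y by linarith
    qed
    moreover have "\<exists>p. ?P p" using h two by (intro exI[of _ 2]) simp
    ultimately show "characteristic R = 2" by (simp add: characteristic_def)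
  qed
qed

context exterior
begin

text \<open>The basis elements that survive in homology.\<close>

definition HX :: "nat \<Rightarrow> (nat set \<times> nat multiset) set" where
  "HX m = {(S, a) \<in> Pow {1..n} \<times> MI m. \<one> \<oplus> \<one> = \<zero> \<or> odd (card S + m) \<or> (S = {} \<and> m = 0)}"

text \<open>By \<open>\<tau>L_eq_\<sigma>\<close> the coefficient is \<open>\<sigma> S i\<close>
  times \<open>1 + (-1)^(card S + m)\<close>. The whole computation rests on this dichotomy between
  two and zero.\<close>

lemma coeff_eq:
  assumes "finite S" "i \<in> S"
  shows "K.\<sigma> S i \<oplus> sign K (Suc m) \<otimes> K.\<tau>L S i = (if even (card S + m) then K.\<sigma> S i \<otimes> (\<one> \<oplus> \<one>) else \<zero>)"
proof -
  have "card S \<noteq> 0" using assms by auto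
  \<comment> \<open>The shift in the degree and the missing element \<open>i\<close> compensate. The
    truncated subtraction is exact because \<open>S\<close> is nonempty.\<close>
  then have s: "Suc m + (card S - 1) = card S + m" by simp
  have "sign K (Suc m) \<otimes> K.\<tau>L S i = K.\<sigma> S i \<otimes> sign K (card S + m)"
    unfolding K.\<tau>L_eq_\<sigma>[OF assms] s[symmetric] K.sign_add by (simp add: K.m_lcomm)
  then show ?thesis
    by (simp add: sign_def K.r_distr K.r_minus K.r_neg)
qed

text \<open>Boundaries have no component in \<open>HX\<close>: the coefficients vanish in
  characteristic 2 and for odd weight, and for \<open>S = {}\<close> the sum is empty.\<close>

lemma dW_HX_zero:
  assumes y: "y \<in> carrier (W (Suc m))" and p: "p \<in> HX m" shows "dW m y p = \<zero>"
proof -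
  obtain S a where Sa: "p = (S, a)" by (cases p)
  have S: "S \<subseteq> {1..n}" and a: "a \<in> MI m" using p by (auto simp: Sa HX_def)
  have fin: "finite S" using S by (rule finite_subset) simp
  have "(\<Oplus>i\<in>S. (K.\<sigma> S i \<oplus> sign K (Suc m) \<otimes> K.\<tau>L S i) \<otimes> y (S - {i}, add_mset i a)) = \<zero>"
  proof (rule K.finsum_zeroI)
    fix i assume i: "i \<in> S"
    then have "K.\<sigma> S i \<oplus> sign K (Suc m) \<otimes> K.\<tau>L S i = \<zero>"
      unfolding coeff_eq[OF fin i] using p by (auto simp: HX_def Sa)
    then show "(K.\<sigma> S i \<oplus> sign K (Suc m) \<otimes> K.\<tau>L S i) \<otimes> y (S - {i}, add_mset i a) = \<zero>"
      using W_closed[OF y] by simp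
  qed
  then show ?thesis by (simp add: dW_def Sa)
qed

text \<open>A nonzero coefficient at \<open>(S, a)\<close> requires \<open>card S + m\<close> to be
  even and two to be nonzero. Its source \<open>(S - {i}, add_mset i a)\<close> has the same weight
  and thus lies outside \<open>HX (Suc m)\<close>.\<close>

lemma HX_cycle:
  assumes w: "w \<in> carrier (W (Suc m))" and sup: "\<And>p. p \<notin> HX (Suc m) \<Longrightarrow> w p = \<zero>"
  shows "dW m w = \<zero>\<^bsub>W m\<^esub>"
proof -
  have "dW m w p = \<zero>" for p
  proof (cases "p \<in> Pow {1..n} \<times> MI m")
    case False
    then show ?thesis by (rule free_module_outside[OF module_hom_in[OF dW_hom w]])
  next
    case True
    then obtain S a where Sa: "p = (S, a)" "S \<subseteq> {1..n}" "a \<in> MI m" by blast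
    have fin: "finite S" using Sa(2) by (rule finite_subset) simp
    have "(\<Oplus>i\<in>S. (K.\<sigma> S i \<oplus> sign K (Suc m) \<otimes> K.\<tau>L S i) \<otimes> w (S - {i}, add_mset i a)) = \<zero>"
    proof (rule K.finsum_zeroI)
      fix i assume i: "i \<in> S"
      show "(K.\<sigma> S i \<oplus> sign K (Suc m) \<otimes> K.\<tau>L S i) \<otimes> w (S - {i}, add_mset i a) = \<zero>"
      proof (cases "even (card S + m) \<and> \<one> \<oplus> \<one> \<noteq> \<zero>")
        case True
        have "card S = Suc (card (S - {i}))" using i fin by (metis card.remove)
        then have "(S - {i}, add_mset i a) \<notin> HX (Suc m)" using True by (auto simp: HX_def)
        then have "w (S - {i}, add_mset i a) = \<zero>" by (rule sup)
        then show ?thesis by simp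
      next
        case False
        then have "K.\<sigma> S i \<oplus> sign K (Suc m) \<otimes> K.\<tau>L S i = \<zero>" unfolding coeff_eq[OF fin i] by auto
        then show ?thesis using W_closed[OF w] by simp
      qed
    qed
    then show ?thesis by (simp add: dW_def Sa)
  qed
  then show ?thesis unfolding free_module_simps by (rule ext)
qed

text \<open>When two is invertible, a cycle without component in \<open>HX\<close> is also a cycle
  for the one-sided Koszul differential. The remainder of \<open>koszul_exact\<close> is excluded by
  \<open>HX 0\<close>, and halving a primitive compensates the factor two. When two is zero,
  \<open>HX\<close> is the whole index set and \<open>w\<close> vanishes.\<close>

lemma HX_exact:
  assumes w: "w \<in> carrier (W m)" and sup: "\<And>p. p \<in> HX m \<Longrightarrow> w p = \<zero>"
    and cyc: "\<And>m'. m = Suc m' \<Longrightarrow> dW m' w = \<zero>\<^bsub>W m'\<^esub>"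
  obtains y where "y \<in> carrier (W (Suc m))" "dW m y = w"
proof (cases "\<one> \<oplus> \<one> = \<zero>")
  case True
  have "w p = \<zero>" for p
  proof (cases "p \<in> Pow {1..n} \<times> MI m")
    case True
    then show ?thesis using \<open>\<one> \<oplus> \<one> = \<zero>\<close> by (intro sup) (auto simp: HX_def)
  next
    case False
    then show ?thesis by (rule free_module_outside[OF w])
  qed
  then have "w = \<zero>\<^bsub>W m\<^esub>" unfolding free_module_simps by (rule ext)
  moreover have "dW m \<zero>\<^bsub>W (Suc m)\<^esub> = \<zero>\<^bsub>W m\<^esub>"
    by (rule left_module_hom.zero[OF left_module_homI[OF W_module W_module dW_hom]])
  moreover have "\<zero>\<^bsub>W (Suc m)\<^esub> \<in> carrier (W (Suc m))" by simp
  ultimately show ?thesis using that by metis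
next
  case False
  note two = False
  define h where "h = inv (\<one> \<oplus> \<one>)"
  have h: "h \<in> carrier K" "(\<one> \<oplus> \<one>) \<otimes> h = \<one>"
    using two K.field_Units K.Units_inv_closed K.Units_r_inv unfolding h_def by auto
  note wc [simp] = W_closed[OF w]
  \<comment> \<open>The right factor is a dummy concentrated at \<open>T = {}\<close>; with
    \<open>\<tau> = 0\<close> only the one-sided differential remains of \<open>kd\<close>.\<close>
  define f where "f S a T = (if T = {} then w (S, a) else \<zero>)" for S :: "nat set" and a and T :: "nat set"
  let ?\<tau> = "\<lambda>_ _. \<zero>" and ?c = "\<one> \<oplus> \<one>"
  have f: "K.kspace n n m f"
    unfolding K.kspace_def
  proof (intro conjI allI impI)
    fix S a T assume nz: "f S a T \<noteq> \<zero>"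
    then have "T = {}" "w (S, a) \<noteq> \<zero>" by (auto simp: f_def split: if_splits)
    then have "(S, a) \<in> Pow {1..n} \<times> MI m" using free_module_outside[OF w] by blast
    then show "S \<subseteq> {1..n}" "set_mset a \<subseteq> {1..n}" "size a = m" "T \<subseteq> {1..n}"
      using \<open>T = {}\<close> by (auto simp: multisets_of_size_def)
  qed (simp add: f_def)
  have kd: "K.kd ?\<tau> g S a T = (\<Oplus>i\<in>S. K.\<sigma> S i \<otimes> g (S - {i}) (add_mset i a) T)"
    if "\<And>S a T. g S a T \<in> carrier K" for g :: "nat set \<Rightarrow> nat multiset \<Rightarrow> nat set \<Rightarrow> 'k" and S a T
    using that by (simp add: K.kd_def K.finsum_closed Pi_iff)
  have fc: "f S a T \<in> carrier K" for S a T by (rule K.kspace_closed[OF f])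
  have kdf: "K.kd ?\<tau> f S a T = \<zero>" for S a T
  proof (cases m)
    case 0
    show ?thesis by (rule K.kd_bottom[OF _ f[unfolded 0]]) simp
  next
    case (Suc m')
    show ?thesis
    proof (cases "S \<subseteq> {1..n} \<and> set_mset a \<subseteq> {1..n} \<and> size a = m' \<and> T = {}")
      case False
      then consider "T \<noteq> {}" | "\<not> (S \<subseteq> {1..n} \<and> set_mset a \<subseteq> {1..n} \<and> size a = m' \<and> T \<subseteq> {1..n})" by blast
      then show ?thesis
      proof cases
        case 1
        then show ?thesis unfolding kd[of f, OF fc] by (intro K.finsum_zeroI) (simp add: f_def)
      next
        case 2
        have "K.kspace n n m' (K.kd ?\<tau> f)" by (rule K.kd_kspace[OF _ f[unfolded Suc] le_refl]) simp
        then show ?thesis using 2 by (rule K.kspace_zero)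
      qed
    next
      case True
      then have S: "S \<subseteq> {1..n}" and a: "a \<in> MI m'" and T: "T = {}" by (auto simp: multisets_of_size_def)
      have fin: "finite S" using S by (rule finite_subset) simp
      show ?thesis
      proof (cases "even (card S + m')")
        case True
        \<comment> \<open>For even weight \<open>dW\<close> is twice the one-sided differential, and
          two can be cancelled in a field.\<close>
        have "dW m' w (S, a) = \<zero>" using cyc[OF Suc] by simp
        then have "\<zero> = (\<Oplus>i\<in>S. (K.\<sigma> S i \<oplus> sign K (Suc m') \<otimes> K.\<tau>L S i) \<otimes> w (S - {i}, add_mset i a))"
          using a by (simp add: dW_def)
        also have "\<dots> = (\<Oplus>i\<in>S. ?c \<otimes> (K.\<sigma> S i \<otimes> f (S - {i}) (add_mset i a) T))"
        proof (rule K.finsum_cong'[OF refl])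
          show "(K.\<sigma> S i \<oplus> sign K (Suc m') \<otimes> K.\<tau>L S i) \<otimes> w (S - {i}, add_mset i a) =
              ?c \<otimes> (K.\<sigma> S i \<otimes> f (S - {i}) (add_mset i a) T)" if "i \<in> S" for i
            unfolding coeff_eq[OF fin that] using True
            by (simp add: f_def T K.m_assoc K.m_lcomm del: K.r_distr K.l_distr)
        qed (simp add: fc)
        also have "\<dots> = ?c \<otimes> K.kd ?\<tau> f S a T"
          unfolding kd[of f, OF fc] using fin by (intro K.finsum_rdistr[symmetric]) (auto simp: fc)
        finally have "?c \<otimes> K.kd ?\<tau> f S a T = \<zero>" ..
        then show ?thesis
          using two K.integral[of ?c] K.kd_closed[of ?\<tau> f] fc by auto
      next
        case False
        show ?thesis
          unfolding kd[of f, OF fc]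
        proof (rule K.finsum_zeroI)
          fix i assume i: "i \<in> S"
          have "card S = Suc (card (S - {i}))" using i fin by (metis card.remove)
          \<comment> \<open>For odd weight every summand reads \<open>w\<close> at an index in
            \<open>HX m\<close>, where it is zero by assumption.\<close>
          then have "(S - {i}, add_mset i a) \<in> HX m"
            using False S i a Suc by (auto simp: HX_def multisets_of_size_def)
          then show "K.\<sigma> S i \<otimes> f (S - {i}) (add_mset i a) T = \<zero>" using sup by (simp add: f_def)
        qed
      qed
    qed
  qed
  obtain y where y: "K.kspace n n (Suc m) y" "K.kspace n 0 m (\<lambda>S a T. f S a T \<ominus> K.kd ?\<tau> y S a T)"
    using K.koszul_exact[of ?\<tau> n n m f] f kdf by auto
  note yc = K.kspace_closed[OF y(1)]
  have kdyc: "K.kd ?\<tau> y S a T \<in> carrier K" for S a T by (rule K.kd_closed) (simp_all add: yc)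
  have fy: "w (S, a) = K.kd ?\<tau> y S a {}" for S a
  proof (rule ccontr)
    assume ne: "w (S, a) \<noteq> K.kd ?\<tau> y S a {}"
    have "f S a {} \<ominus> K.kd ?\<tau> y S a {} \<noteq> \<zero>"
      using ne K.diff_eq_zeroD[OF fc kdyc, of S a "{}" S a "{}"] by (auto simp: f_def)
    \<comment> \<open>The only place where the remainder could survive is the unit in degree 0. It
      belongs to \<open>HX 0\<close>, so \<open>w\<close> is zero there, and the differential is an
      empty sum.\<close>
    from K.kspace_supp[OF y(2) this] have z: "S = {}" "a = {#}" "m = 0" by auto
    have "w (S, a) = \<zero>" using z by (intro sup) (simp add: HX_def MI_0)
    moreover have "K.kd ?\<tau> y S a {} = \<zero>" unfolding kd[of y, OF yc] z by simp
    ultimately show False using ne by simp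
  qed
  \<comment> \<open>The factor \<open>h\<close> halves the primitive. The multiset at this stage has
    size \<open>Suc m\<close>, so an odd \<open>card S + m\<close> selects the even total
    weight.\<close>
  define v where "v = (\<lambda>(S, a). if odd (card S + m) then h \<otimes> y S a {} else \<zero>)"
  have vW: "v \<in> carrier (W (Suc m))"
  proof (rule free_module_finiteI[OF finite_W_index])
    fix p :: "nat set \<times> nat multiset" obtain S a where p: "p = (S, a)" by (cases p)
    show "v p \<in> carrier K" using h yc by (simp add: v_def p)
    assume "p \<notin> Pow {1..n} \<times> MI (Suc m)"
    then have "y S a {} = \<zero>" unfolding p by (intro K.kspace_zero[OF y(1)]) (auto simp: multisets_of_size_def)
    then show "v p = \<zero>" using h by (simp add: v_def p)
  qed
  have "dW m v = w"
  proof
    fix p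
    show "dW m v p = w p"
    proof (cases "p \<in> Pow {1..n} \<times> MI m")
      case False
      show ?thesis
        unfolding free_module_outside[OF module_hom_in[OF dW_hom vW] False] free_module_outside[OF w False] ..
    next
      case True
      then obtain S a where p: "p = (S, a)" "S \<subseteq> {1..n}" "a \<in> MI m" by blast
      have fin: "finite S" using p(2) by (rule finite_subset) simp
      show ?thesis
      proof (cases "even (card S + m)")
        case True
        have "dW m v p = (\<Oplus>i\<in>S. (K.\<sigma> S i \<oplus> sign K (Suc m) \<otimes> K.\<tau>L S i) \<otimes> v (S - {i}, add_mset i a))"
          using p by (simp add: dW_def)
        also have "\<dots> = (\<Oplus>i\<in>S. K.\<sigma> S i \<otimes> y (S - {i}) (add_mset i a) {})"
        proof (rule K.finsum_cong'[OF refl])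
          fix i assume i: "i \<in> S"
          have "card S = Suc (card (S - {i}))" using i fin by (metis card.remove)
          then have "v (S - {i}, add_mset i a) = h \<otimes> y (S - {i}) (add_mset i a) {}"
            using True by (simp add: v_def)
          moreover have "(s \<otimes> ?c) \<otimes> (h \<otimes> z) = s \<otimes> z" if "s \<in> carrier K" "z \<in> carrier K" for s z
          proof -
            have "(s \<otimes> ?c) \<otimes> (h \<otimes> z) = s \<otimes> ((?c \<otimes> h) \<otimes> z)"
              using that h(1) by (simp only: K.m_assoc K.m_closed K.a_closed K.one_closed)
            then show ?thesis using that h(2) by simp
          qed
          ultimately show "(K.\<sigma> S i \<oplus> sign K (Suc m) \<otimes> K.\<tau>L S i) \<otimes> v (S - {i}, add_mset i a) =
              K.\<sigma> S i \<otimes> y (S - {i}) (add_mset i a) {}"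
            unfolding coeff_eq[OF fin i] if_P[OF True] using yc by simp
        qed (simp add: yc)
        also have "\<dots> = w p" unfolding p(1) fy kd[of y, OF yc] ..
        finally show ?thesis .
      next
        case False
        then have "p \<in> HX m" using p by (simp add: HX_def)
        then show ?thesis using dW_HX_zero[OF vW] sup by simp
      qed
    qed
  qed
  with vW show ?thesis by (rule that)
qed

section \<open>Homology coordinates and the count of surviving basis elements\<close>

definition kappa where
  "kappa m t = (\<lambda>p. if p \<in> HX m then Phi m t p else \<zero>)"

lemma HX_subset: "HX m \<subseteq> Pow {1..n} \<times> MI m"
  by (auto simp: HX_def)

lemma finite_HX: "finite (HX m)"
  by (rule finite_subset[OF HX_subset finite_W_index])

lemma kappa_hom: "kappa m \<in> module_hom K (TR.C m) (free_module K (HX m))"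
proof (rule module_homI)
  fix t assume t: "t \<in> carrier (TR.C m)"
  note Pc = W_closed[OF module_hom_in[OF Phi_hom t]]
  show "kappa m t \<in> carrier (free_module K (HX m))"
    by (rule free_module_finiteI[OF finite_HX]) (simp_all add: kappa_def Pc)
  show "kappa m (c \<odot>\<^bsub>TR.C m\<^esub> t) = c \<odot>\<^bsub>free_module K (HX m)\<^esub> kappa m t" if "c \<in> carrier K" for c
    using that by (auto simp: kappa_def module_hom_smult[OF Phi_hom that t] fun_eq_iff)
  show "kappa m (t \<oplus>\<^bsub>TR.C m\<^esub> u) = kappa m t \<oplus>\<^bsub>free_module K (HX m)\<^esub> kappa m u" if "u \<in> carrier (TR.C m)" for u
    by (auto simp: kappa_def module_hom_add[OF Phi_hom t that] fun_eq_iff)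
qed

lemma Phi_inj: "t \<in> carrier (TR.C m) \<Longrightarrow> u \<in> carrier (TR.C m) \<Longrightarrow> Phi m t = Phi m u \<Longrightarrow> t = u"
  using Psi_Phi by metis

lemma Phi_zero: "Phi m \<zero>\<^bsub>TR.C m\<^esub> = \<zero>\<^bsub>W m\<^esub>"
  by (rule left_module_hom.zero[OF left_module_homI[OF TR.C_module W_module Phi_hom]])

text \<open>Transported along \<open>Phi\<close>, the three requirements are
  \<open>dW_HX_zero\<close> for boundaries, \<open>HX_exact\<close> for cycles without component in
  \<open>HX\<close>, and \<open>HX_cycle\<close> for the fact that every vector on \<open>HX\<close>
  is itself a cycle.\<close>

lemma homology_coords_kappa: "homology_coords K TR.C TR.D m (HX m) (kappa m)"
  unfolding homology_coords_def
proof (intro conjI ballI kappa_hom)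
  fix t assume t: "t \<in> cycles TR.C TR.D m"
  then have tc: "t \<in> carrier (TR.C m)" using TR.cycles_subset by blast
  show "kappa m t = \<zero>\<^bsub>free_module K (HX m)\<^esub> \<longleftrightarrow> t \<in> boundaries TR.C TR.D m"
  proof
    assume k: "kappa m t = \<zero>\<^bsub>free_module K (HX m)\<^esub>"
    have sup: "Phi m t p = \<zero>" if "p \<in> HX m" for p
      using fun_cong[OF k, of p] that by (simp add: kappa_def)
    have cyc: "dW m' (Phi m t) = \<zero>\<^bsub>W m'\<^esub>" if m: "m = Suc m'" for m'
    proof -
      have "TR.D m' t = \<zero>\<^bsub>TR.C m'\<^esub>" using t by (simp add: m cycles_def)
      then show ?thesis using Phi_D[of t m'] tc Phi_zero by (simp only: m)
    qed
    obtain y where y: "y \<in> carrier (W (Suc m))" "dW m y = Phi m t"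
      by (rule HX_exact[OF module_hom_in[OF Phi_hom tc] sup cyc])
    note Py = module_hom_in[OF Psi_hom y(1)]
    have "Phi m (TR.D m (Psi (Suc m) y)) = Phi m t"
      unfolding Phi_D[OF Py] Phi_Psi[OF y(1)] y(2) ..
    then have "TR.D m (Psi (Suc m) y) = t"
      by (rule Phi_inj[OF module_hom_in[OF TR.D_hom Py] tc])
    then show "t \<in> boundaries TR.C TR.D m" unfolding boundaries_def using Py by blast
  next
    assume "t \<in> boundaries TR.C TR.D m"
    then obtain u where u: "u \<in> carrier (TR.C (Suc m))" "t = TR.D m u" unfolding boundaries_def by blast
    have "Phi m t p = \<zero>" if "p \<in> HX m" for p
      unfolding u(2) Phi_D[OF u(1)] by (rule dW_HX_zero[OF module_hom_in[OF Phi_hom u(1)] that])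
    then show "kappa m t = \<zero>\<^bsub>free_module K (HX m)\<^esub>" by (auto simp: kappa_def)
  qed
next
  fix w assume w: "w \<in> carrier (free_module K (HX m))"
  have out: "w p = \<zero>" if "p \<notin> HX m" for p by (rule free_module_outside[OF w that])
  have wW: "w \<in> carrier (W m)"
    by (rule free_module_finiteI[OF finite_W_index])
      (use HX_subset free_module_closed[OF w] in \<open>blast intro: out\<close>)+
  note Pw = module_hom_in[OF Psi_hom wW]
  have "Psi m w \<in> cycles TR.C TR.D m"
  proof (cases m)
    case 0
    then show ?thesis using Pw by (simp add: cycles_def)
  next
    case (Suc m')
    have "Phi m' (TR.D m' (Psi m w)) = dW m' w"
      using Phi_D[of "Psi m w" m'] Pw Phi_Psi[OF wW] by (simp only: Suc)
    also have "\<dots> = Phi m' \<zero>\<^bsub>TR.C m'\<^esub>"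
      unfolding Phi_zero by (rule HX_cycle[OF wW[unfolded Suc] out[unfolded Suc]])
    finally have "TR.D m' (Psi m w) = \<zero>\<^bsub>TR.C m'\<^esub>"
      using Pw module_hom_in[OF TR.D_hom, of "Psi m w" m'] left_module.axioms(2)[OF TR.C_module[of m']]
      by (intro Phi_inj) (auto simp: Suc abelian_group_def abelian_monoid.zero_closed)
    then show ?thesis using Pw by (simp add: cycles_def Suc)
  qed
  moreover have "kappa m (Psi m w) = w"
    using out by (auto simp: kappa_def Phi_Psi[OF wW])
  ultimately show "\<exists>t\<in>cycles TR.C TR.D m. kappa m t = w" by blast
qed

lemma card_HX:
  assumes "1 \<le> n"
  shows "card (HX m) = (if characteristic K = 2 then 2 ^ n * ((n + m - 1) choose (n - 1))
    else if m = 0 then 2 ^ (n - 1) + 1 else 2 ^ (n - 1) * ((n + m - 1) choose (n - 1)))"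
proof -
  \<comment> \<open>Multisets are counted by a binomial coefficient with lower entry
    \<open>m\<close>; these two facts justify its reflection to \<open>n - 1\<close>.\<close>
  have "n + m - 1 - m = n - 1" "m \<le> n + m - 1" using assms by auto
  then have MI: "card (MI m) = (n + m - 1) choose (n - 1)"
    using card_multisets_of_size[of "{1..n}" m] binomial_symmetric[of m "n + m - 1"] by simp
  let ?O = "{S \<in> Pow {1..n}. odd (card S + m)}"
  consider "characteristic K = 2" | "characteristic K \<noteq> 2" "m = 0" | "characteristic K \<noteq> 2" "m \<noteq> 0" by blast
  then show ?thesis
  proof cases
    case 1
    then have "HX m = Pow {1..n} \<times> MI m" using K.characteristic_eq_2 by (auto simp: HX_def)
    then show ?thesis using 1 MI by (simp add: card_cartesian_product card_Pow)
  next
    case 2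
    \<comment> \<open>In degree 0 the unit has even weight and is not among the odd subsets, which
      produces the additional 1.\<close>
    then have "HX m = insert ({}, {#}) (?O \<times> {{#}})" using K.characteristic_eq_2 by (auto simp: HX_def MI_0)
    moreover have "({}, {#}) \<notin> ?O \<times> {{#} :: nat multiset}" using 2 by auto
    moreover have "finite (?O \<times> {{#} :: nat multiset})" by simp
    ultimately show ?thesis
      using 2 card_parity[OF assms, of m] by (simp add: card_cartesian_product)
  next
    case 3
    then have "HX m = ?O \<times> MI m" using K.characteristic_eq_2 by (auto simp: HX_def)
    then show ?thesis using 3 MI card_parity[OF assms, of m] by (simp add: card_cartesian_product)
  qed
qed

end

theorem theorem2:
  fixes K :: "('k, 'z) ring_scheme" and n m :: nat
  assumes "field K" and "n \<ge> 2"
  shows "vectorspace K (Hochschild_homology K (exterior_algebra K n) m) \<and>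
    vectorspace.fin_dim K (Hochschild_homology K (exterior_algebra K n) m) \<and>
    vectorspace.dim K (Hochschild_homology K (exterior_algebra K n) m) =
      (if characteristic K = 2 then 2 ^ n * ((n + m - 1) choose (n - 1))
       else if m = 0 then 2 ^ (n - 1) + 1
       else 2 ^ (n - 1) * ((n + m - 1) choose (n - 1)))"
proof -
  interpret exterior K n using assms(1) by (rule exterior.intro)
  have "1 \<le> n" using assms(2) by simp
  then show ?thesis
    using Tor_dim[OF assms(1) koszul_resolution homology_coords_kappa finite_HX] card_HX
    unfolding Hochschild_homology_def by simp
qed

end
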